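(* Let $b$ be a fixed, arbitrary, real number and let $t\in(0,1/2]$ be a fixed level. Let $\hat\varphi_t^{S}$ be the $S$-value multiple testing procedure at level $t$ with horseshoe parameter chosen as the marginal maximum likelihood estimator $\hat\tau$ (all defined in the context). Then, as $n,s_n\to\infty$ with $s_n/n\to0$, \[ \mathrm{FDR}(\theta_0,\hat\varphi_t^{S})\to t,\qquad \mathrm{FNR}(\theta_0,\hat\varphi_t^{S})\to\bar\Phi(b), \] where the convergence is uniform over $\theta_0\in\mathcal{L}_{0,=}[s_n;b]$.
   Context: Model: one observes $X=(X_1,\dots,X_n)$ with $X_i=\theta_i+\varepsilon_i$, $\varepsilon_i$ i.i.d. $\mathcal N(0,1)$, $\theta\in\mathbb R^n$; $P_\theta$ and $E_\theta$ denote the law of $X$ and its expectation. $\phi$ is the standard normal density and $\bar\Phi(u)=P[\mathcal N(0,1)>u]$. Sparse classes: $1\le s_n\le n$ are integers; $\ell_0[s_n]=\{\theta\in\mathbb R^n: |\{i:\theta_i\ne0\}|\le s_n\}$; $S_\theta=\{i:\theta_i\neq0\}$; $\mathcal{L}_{0,=}[s_n;b]=\{\theta\in\ell_0[s_n]: |\theta_i|=\sqrt{2\log(n/s_n)}+b \text{ for all } i\in S_\theta,\ |S_\theta|=s_n\}$. Horseshoe prior with parameter $\tau>0$: $\Pi_\tau$ is the law of $\theta_1$ when $\theta_1\mid\lambda\sim\mathcal N(0,\lambda^2\tau^2)$ and $\lambda\sim C^+(0,1)$ (standard half-Cauchy, density $\frac{2}{\pi(1+\lambda^2)}$ on $(0,\infty)$);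 $h_\tau$ is its Lebesgue density. Conditional probabilities $\Pi_\tau(\cdot\mid X_1\ge x)$, $\Pi_\tau(\cdot\mid X_1\le x)$ are computed in the Bayesian model $\theta_1\sim\Pi_\tau$, $X_1\mid\theta_1\sim\mathcal N(\theta_1,1)$. $S$-value: $S(x;\tau)=2\min\left(\Pi_\tau(\theta_1<0\mid X_1\ge x),\ \Pi_\tau(\theta_1>0\mid X_1\le x)\right)$. Marginal maximum likelihood estimator: $\hat\tau=\hat\tau(X)=\operatorname{argmax}_{\tau\in[1/n,1]}\prod_{i=1}^n\int\phi(X_i-\theta)h_\tau(\theta)\,d\theta$. Procedure: $\hat\varphi^S_t(X)=(\mathbf 1\{S(X_i;\hat\tau)<t\})_{1\le i\le n}\in\{0,1\}^n$. Errors: for a procedure $\varphi=\varphi(X)\in\{0,1\}^n$, \[\mathrm{FDR}(\theta,\varphi)=E_\theta\left[\frac{\sum_{i=1}^n\mathbf 1\{\theta_i=0,\varphi_i=1\}}{\max(1,\sum_{i=1}^n\mathbf 1\{\varphi_i=1\})}\right],\qquad \mathrm{FNR}(\theta,\varphi)=E_\theta\left[\frac{\sum_{i=1}^n\mathbf 1\{\theta_i\ne0\}(1-\varphi_i(X))}{\max(1,\sum_{i=1}^n\mathbf 1\{\theta_i\neq0\})}\right].\] *)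

theory Defs
  imports "HOL-Probability.Probability"
begin

section \<open>Gaussian sequence model\<close>

text \<open>Vectors of \<open>\<real>\<^sup>n\<close> are extensional functions on \<open>{..<n}\<close>, so coordinates are numbered from \<open>0\<close>.\<close>

abbreviation Rn :: "nat \<Rightarrow> (nat \<Rightarrow> real) set" where
  "Rn n \<equiv> {..<n} \<rightarrow>\<^sub>E UNIV"

abbreviation borel_Rn :: "nat \<Rightarrow> (nat \<Rightarrow> real) measure" where
  "borel_Rn n \<equiv> Pi\<^sub>M {..<n} (\<lambda>_. borel)"

text \<open>The second parameter is the standard deviation. For \<open>s = 0\<close> the measure is null, not a
  Dirac measure.\<close>

definition normal_law :: "real \<Rightarrow> real \<Rightarrow> real measure" where
  "normal_law m s = density lborel (normal_density m s)"

text \<open>\<open>P\<^sub>\<theta>\<close>, the law of \<open>X = \<theta> + \<epsilon>\<close> with independent standard normal coordinates \<open>\<epsilon>\<^sub>i\<close>.\<close>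

definition data_law :: "nat \<Rightarrow> (nat \<Rightarrow> real) \<Rightarrow> (nat \<Rightarrow> real) measure" where
  "data_law n \<theta> =
     distr (Pi\<^sub>M {..<n} (\<lambda>_. normal_law 0 1)) (borel_Rn n) (\<lambda>\<epsilon>. \<lambda>i\<in>{..<n}. \<theta> i + \<epsilon> i)"

definition normal_tail :: "real \<Rightarrow> real" where
  "normal_tail u = measure (normal_law 0 1) {u<..}"

definition support_set :: "nat \<Rightarrow> (nat \<Rightarrow> real) \<Rightarrow> nat set" where
  "support_set n \<theta> = {i\<in>{..<n}. \<theta> i \<noteq> 0}"

definition sparse_class :: "nat \<Rightarrow> nat \<Rightarrow> (nat \<Rightarrow> real) set" where
  "sparse_class n s = {\<theta> \<in> Rn n. card (support_set n \<theta>) \<le> s}"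

definition sparse_class_eq :: "nat \<Rightarrow> nat \<Rightarrow> real \<Rightarrow> (nat \<Rightarrow> real) set" where
  "sparse_class_eq n s b =
     {\<theta> \<in> sparse_class n s.
        (\<forall>i\<in>support_set n \<theta>. \<bar>\<theta> i\<bar> = sqrt (2 * ln (real n / real s)) + b) \<and>
        card (support_set n \<theta>) = s}"

section \<open>Horseshoe prior\<close>

definition half_cauchy_density :: "real \<Rightarrow> real" where
  "half_cauchy_density l = indicator {0<..} l * (2 / (pi * (1 + l\<^sup>2)))"

definition half_cauchy :: "real measure" where
  "half_cauchy = density lborel half_cauchy_density"

definition horseshoe :: "real \<Rightarrow> real measure" where
  "horseshoe \<tau> = half_cauchy \<bind> (\<lambda>l. normal_law 0 (l * \<tau>))"

text \<open>The Lebesgue density of the prior for \<open>\<tau> > 0\<close> (see \<open>horseshoe_eq_density\<close> below). It has a pole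
  at \<open>0\<close>, where the integral takes the dummy value \<open>0\<close>.\<close>

definition horseshoe_density :: "real \<Rightarrow> real \<Rightarrow> real" where
  "horseshoe_density \<tau> \<theta> = (\<integral>l. half_cauchy_density l * normal_density 0 (l * \<tau>) \<theta> \<partial>lborel)"

text \<open>The joint law of \<open>(\<theta>\<^sub>1, X\<^sub>1)\<close> in the Bayesian model.\<close>

definition bayes_law :: "real \<Rightarrow> (real \<times> real) measure" where
  "bayes_law \<tau> =
     horseshoe \<tau> \<bind> (\<lambda>\<theta>. normal_law \<theta> 1 \<bind> (\<lambda>x. return (borel \<Otimes>\<^sub>M borel) (\<theta>, x)))"

section \<open>The S-value procedure\<close>

definition S_value :: "real \<Rightarrow> real \<Rightarrow> real" where
  "S_value x \<tau> = 2 * min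
     (\<P>((\<theta>, y) in bayes_law \<tau>. \<theta> < 0 \<bar> y \<ge> x))
     (\<P>((\<theta>, y) in bayes_law \<tau>. \<theta> > 0 \<bar> y \<le> x))"

definition marginal_likelihood :: "nat \<Rightarrow> (nat \<Rightarrow> real) \<Rightarrow> real \<Rightarrow> real" where
  "marginal_likelihood n X \<tau> =
     (\<Prod>i<n. \<integral>\<theta>. std_normal_density (X i - \<theta>) * horseshoe_density \<tau> \<theta> \<partial>lborel)"

text \<open>Nothing guarantees that the maximizer is unique, so an estimator is any measurable selection
  of maximizers.\<close>

definition is_mmle :: "nat \<Rightarrow> ((nat \<Rightarrow> real) \<Rightarrow> real) \<Rightarrow> bool" where
  "is_mmle n T \<longleftrightarrow> T \<in> borel_measurable (borel_Rn n) \<and>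
     (\<forall>X\<in>Rn n. is_arg_max (marginal_likelihood n X) (\<lambda>\<tau>. \<tau> \<in> {1 / real n..1}) (T X))"

definition S_procedure ::
  "((nat \<Rightarrow> real) \<Rightarrow> real) \<Rightarrow> real \<Rightarrow> (nat \<Rightarrow> real) \<Rightarrow> nat \<Rightarrow> nat" where
  "S_procedure T t X i = of_bool (S_value (X i) (T X) < t)"

section \<open>False discovery and false negative rates\<close>

definition FDR :: "nat \<Rightarrow> (nat \<Rightarrow> real) \<Rightarrow> ((nat \<Rightarrow> real) \<Rightarrow> nat \<Rightarrow> nat) \<Rightarrow> real" where
  "FDR n \<theta> \<phi> = (\<integral>X. (\<Sum>i<n. of_bool (\<theta> i = 0 \<and> \<phi> X i = 1)) /
     max 1 (\<Sum>i<n. of_bool (\<phi> X i = 1)) \<partial>data_law n \<theta>)"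

definition FNR :: "nat \<Rightarrow> (nat \<Rightarrow> real) \<Rightarrow> ((nat \<Rightarrow> real) \<Rightarrow> nat \<Rightarrow> nat) \<Rightarrow> real" where
  "FNR n \<theta> \<phi> = (\<integral>X. (\<Sum>i<n. of_bool (\<theta> i \<noteq> 0) * (1 - real (\<phi> X i))) /
     max 1 (\<Sum>i<n. of_bool (\<theta> i \<noteq> 0)) \<partial>data_law n \<theta>)"

section \<open>Well-formedness of the model\<close>

lemma sets_normal_law [simp, measurable_cong]: "sets (normal_law m s) = sets borel"
  by (simp add: normal_law_def)

lemma space_normal_law [simp]: "space (normal_law m s) = UNIV"
  by (simp add: normal_law_def)

lemma prob_space_normal_law: "s \<noteq> 0 \<Longrightarrow> prob_space (normal_law m s)"
proof -
  assume "s \<noteq> 0"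
  then have "prob_space (density lborel (normal_density m \<bar>s\<bar>))"
    by (intro prob_space_normal_density) auto
  then show ?thesis
    by (simp add: normal_law_def normal_density_def)
qed

lemma subprob_space_normal_law: "subprob_space (normal_law m s)"
proof (cases "s = 0")
  case True
  then have "normal_law m s = density lborel (\<lambda>_. 0)"
    by (simp add: normal_law_def normal_density_def)
  then show ?thesis
    by (intro subprob_spaceI) (simp_all add: emeasure_density)
qed (simp add: prob_space_normal_law prob_space_imp_subprob_space)

lemma measurable_normal_law [measurable]:
  assumes [measurable]: "f \<in> borel_measurable M" "g \<in> borel_measurable M"
  shows "(\<lambda>x. normal_law (f x) (g x)) \<in> measurable M (subprob_algebra borel)"
proof (rule measurable_subprob_algebra)
  fix A :: "real set" assume [measurable]: "A \<in> sets borel"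
  have "(\<lambda>x. \<integral>\<^sup>+y. ennreal (normal_density (f x) (g x) y) * indicator A y \<partial>lborel)
      \<in> borel_measurable M"
    unfolding normal_density_def by measurable
  then show "(\<lambda>x. emeasure (normal_law (f x) (g x)) A) \<in> borel_measurable M"
    by (simp add: normal_law_def emeasure_density)
qed (simp_all add: subprob_space_normal_law)

lemma prob_space_data_law: "prob_space (data_law n \<theta>)"
proof -
  interpret prob_space "normal_law 0 1"
    by (rule prob_space_normal_law) simp
  interpret product_prob_space "\<lambda>_::nat. normal_law 0 1" "{..<n}"
    by unfold_locales
  show ?thesis
    unfolding data_law_def by (intro prob_space_distr) measurable
qed

lemma half_cauchy_density_nonneg [simp]: "0 \<le> half_cauchy_density l"
  by (simp add: half_cauchy_density_def)

lemma borel_measurable_half_cauchy_density [measurable]: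
  "half_cauchy_density \<in> borel_measurable borel"
  unfolding half_cauchy_density_def by measurable

lemma sets_half_cauchy [simp, measurable_cong]: "sets half_cauchy = sets borel"
  by (simp add: half_cauchy_def)

lemma space_half_cauchy [simp]: "space half_cauchy = UNIV"
  by (simp add: half_cauchy_def)

lemma prob_space_half_cauchy: "prob_space half_cauchy"
proof
  have "((\<lambda>x. 2 / pi * arctan x) \<longlongrightarrow> 2 / pi * (pi / 2)) at_top"
    by (intro tendsto_intros tendsto_arctan_at_top)
  then have lim: "((\<lambda>x. 2 / pi * arctan x) \<longlongrightarrow> 1) at_top"
    by simp
  have "(\<integral>\<^sup>+l. ennreal (2 / (pi * (1 + l\<^sup>2))) * indicator {0..} l \<partial>lborel)
      = ennreal (1 - 2 / pi * arctan 0)"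
  proof (rule nn_integral_FTC_atLeast[OF _ _ _ lim])
    show "DERIV (\<lambda>x. 2 / pi * arctan x) x :> 2 / (pi * (1 + x\<^sup>2))" for x
      using sum_power2_gt_zero_iff[of 1 x]
      by (auto intro!: derivative_eq_intros simp: divide_simps)
  qed auto
  moreover have "(\<integral>\<^sup>+l. ennreal (half_cauchy_density l) \<partial>lborel)
      = (\<integral>\<^sup>+l. ennreal (2 / (pi * (1 + l\<^sup>2))) * indicator {0..} l \<partial>lborel)"
    by (intro nn_integral_cong_AE eventually_mono[OF AE_lborel_singleton[of 0]])
       (auto simp: half_cauchy_density_def split: split_indicator)
  ultimately show "emeasure half_cauchy (space half_cauchy) = 1"
    by (simp add: half_cauchy_def emeasure_density)
qed

lemma sets_horseshoe [simp, measurable_cong]: "sets (horseshoe \<tau>) = sets borel"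
  unfolding horseshoe_def by (rule sets_bind) auto

lemma space_horseshoe [simp]: "space (horseshoe \<tau>) = UNIV"
  using sets_eq_imp_space_eq[OF sets_horseshoe] by simp

lemma emeasure_horseshoe:
  assumes [measurable]: "A \<in> sets borel"
  shows "emeasure (horseshoe \<tau>) A = (\<integral>\<^sup>+l. emeasure (normal_law 0 (l * \<tau>)) A \<partial>half_cauchy)"
  unfolding horseshoe_def by (rule emeasure_bind[where N = borel]) auto

lemma prob_space_horseshoe:
  assumes "\<tau> > 0"
  shows "prob_space (horseshoe \<tau>)"
proof
  interpret prob_space half_cauchy by (rule prob_space_half_cauchy)
  have "AE l in half_cauchy. l > 0"
    unfolding half_cauchy_def
    by (subst AE_density) (auto simp: half_cauchy_density_def split: split_indicator)
  then have "AE l in half_cauchy. emeasure (normal_law 0 (l * \<tau>)) UNIV = 1"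
  proof eventually_elim
    case (elim l)
    interpret N: prob_space "normal_law 0 (l * \<tau>)"
      using elim assms by (intro prob_space_normal_law) auto
    show ?case using N.emeasure_space_1 by simp
  qed
  then have "(\<integral>\<^sup>+l. emeasure (normal_law 0 (l * \<tau>)) UNIV \<partial>half_cauchy) = (\<integral>\<^sup>+l. 1 \<partial>half_cauchy)"
    by (rule nn_integral_cong_AE)
  also have "\<dots> = 1"
    using emeasure_space_1 by simp
  finally show "emeasure (horseshoe \<tau>) (space (horseshoe \<tau>)) = 1"
    by (simp add: emeasure_horseshoe)
qed

lemma horseshoe_density_nonneg: "0 \<le> horseshoe_density \<tau> \<theta>"
  unfolding horseshoe_density_def by (intro Bochner_Integration.integral_nonneg) auto

theorem horseshoe_eq_density:
  assumes "\<tau> > 0"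
  shows "horseshoe \<tau> = density lborel (horseshoe_density \<tau>)"
proof -
  define I where
    "I \<theta> = (\<integral>\<^sup>+l. ennreal (half_cauchy_density l * normal_density 0 (l * \<tau>) \<theta>) \<partial>lborel)" for \<theta>
  have [measurable]: "I \<in> borel_measurable borel"
    unfolding I_def normal_density_def by measurable
  have eq: "horseshoe \<tau> = density lborel I"
  proof (rule measure_eqI)
    fix A assume "A \<in> sets (horseshoe \<tau>)"
    then have [measurable]: "A \<in> sets borel" by simp
    have "emeasure (horseshoe \<tau>) A =
        (\<integral>\<^sup>+l. \<integral>\<^sup>+\<theta>. ennreal (half_cauchy_density l * normal_density 0 (l * \<tau>) \<theta>) * indicator A \<theta>
          \<partial>lborel \<partial>lborel)"
      by (simp add: emeasure_horseshoe half_cauchy_def nn_integral_density emeasure_density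
          normal_law_def [symmetric] measurable_emeasure_subprob_algebra[THEN measurable_compose[rotated]])
         (simp add: normal_law_def emeasure_density nn_integral_cmult[symmetric] ennreal_mult
          mult.assoc)
    also have "\<dots> = (\<integral>\<^sup>+\<theta>. \<integral>\<^sup>+l. ennreal (half_cauchy_density l * normal_density 0 (l * \<tau>) \<theta>) * indicator A \<theta>
          \<partial>lborel \<partial>lborel)"
      by (intro lborel_pair.Fubini') (simp add: normal_density_def)
    also have "\<dots> = emeasure (density lborel I) A"
      by (simp add: emeasure_density I_def nn_integral_multc normal_density_def)
    finally show "emeasure (horseshoe \<tau>) A = emeasure (density lborel I) A" .
  qed simp
  interpret prob_space "horseshoe \<tau>" using assms by (rule prob_space_horseshoe)
  have "(\<integral>\<^sup>+\<theta>. I \<theta> \<partial>lborel) = 1"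
    using emeasure_space_1 by (simp add: eq emeasure_density)
  then have "AE \<theta> in lborel. I \<theta> \<noteq> \<infinity>"
    by (intro nn_integral_PInf_AE) auto
  moreover have "horseshoe_density \<tau> \<theta> = enn2real (I \<theta>)" for \<theta>
    unfolding horseshoe_density_def I_def normal_density_def
    by (subst integral_eq_nn_integral) auto
  ultimately have "AE \<theta> in lborel. I \<theta> = ennreal (horseshoe_density \<tau> \<theta>)"
    by (auto simp: less_top)
  moreover have "horseshoe_density \<tau> \<in> borel_measurable borel"
    unfolding horseshoe_density_def normal_density_def by measurable
  ultimately show ?thesis
    unfolding eq by (intro density_cong) auto
qed

lemma prob_space_bayes_law:
  assumes "\<tau> > 0"
  shows "prob_space (bayes_law \<tau>)"
  unfolding bayes_law_def
proof (rule prob_space.prob_space_bind[where S = "borel \<Otimes>\<^sub>M borel"])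
  show "prob_space (horseshoe \<tau>)" using assms by (rule prob_space_horseshoe)
  show "AE \<theta> in horseshoe \<tau>. prob_space (normal_law \<theta> 1 \<bind> (\<lambda>x. return (borel \<Otimes>\<^sub>M borel) (\<theta>, x)))"
    by (intro AE_I2 prob_space.prob_space_bind[where S = "borel \<Otimes>\<^sub>M borel"] prob_space_normal_law
        prob_space_return) (auto simp: space_pair_measure)
qed (measurable)

end

theory Submission
  imports Defs "HOL-Real_Asymp.Real_Asymp"
begin

text \<open>Write \<open>R \<tau>\<close> for the density of the horseshoe marginal relative to \<open>N(0, 1)\<close> and \<open>\<zeta>(\<tau>)\<close> for
  \<open>sqrt (2 log (1 / \<tau>))\<close>. The estimator maximizes \<open>\<Sum>\<^sub>i ln (R \<tau> (X\<^sub>i))\<close>. The function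
  \<open>\<tau> * (ln R \<tau> x)'\<close> of \<open>x\<close>, the score, takes values in \<open>[-1, 1]\<close> and increases with \<open>\<bar>x\<bar>\<close>. Under
  \<open>N(0, 1)\<close> its mean is \<open>- 2 c0 \<tau> / \<zeta>(\<tau>)\<close> to first order, and its second moment has the order
  \<open>\<tau> / \<zeta>(\<tau>)\<close>; when \<open>\<tau>\<close> is near the value \<open>\<tau>'\<close> below, the score is close to \<open>1\<close> at points slightly
  above \<open>\<zeta>(s\<^sub>n / n)\<close> in absolute value and close to \<open>0\<close> at points slightly below. Null and signal
  coordinates therefore balance at the \<open>\<tau>'\<close> for which \<open>2 c0 n \<tau>' / \<zeta>(\<tau>')\<close> equals the number
  \<open>p s\<^sub>n\<close> of signals above that point, where \<open>p = P[N(0, 1) > - b]\<close>. Comparing log likelihoods by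
  integrating the score over \<open>\<tau>\<close>, with Markov's inequality for the integrated absolute noise, shows
  that the estimator divided by \<open>\<tau>'\<close> tends to \<open>1\<close> in probability.

  For large \<open>\<bar>x\<bar>\<close> the S-value is below \<open>t\<close> essentially if \<open>P[N(0, 1) > \<bar>x\<bar>]\<close> is below
  \<open>t / (1 - t) * c0 \<tau> / \<bar>x\<bar>\<close>. At \<open>\<tau> = \<tau>'\<close> this threshold lets through about \<open>t / (1 - t) * p s\<^sub>n\<close>
  nulls, and it differs from \<open>\<zeta>(s\<^sub>n / n)\<close> by \<open>o(1)\<close>, so it lets through about \<open>p s\<^sub>n\<close> signals. The
  two rates follow, as both counts concentrate.\<close>

section \<open>Gaussian tails\<close>

text \<open>The score is the derivative in log \<tau>. A change of scale in the half-Cauchy law has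
  the logarithmic derivative \<open>kap\<close>, which is bounded by 1; so is the score. Weighted by
  the likelihood ratio, the null mean of the score vanishes, so the plain null mean is minus the
  mean of score times (ratio - 1). That mean concentrates where |x| exceeds \<zeta>(\<tau>) and the
  score is near 1, and becomes twice the excess of the marginal tail over the normal tail; hence the
  constant 2 c0. The obstacle is uniformity, as the maximizer may lie anywhere in [1/n, 1]. A log
  likelihood difference is an integral of the score, so one bound on an integrated absolute noise
  serves all end points at once. Above the target drift and noise both grow with \<tau>, and a
  weight in the noise integral keeps the noise a fixed fraction of the drift. With x = \<tau> /
  \<tau>' the limiting contest, per detectable signal, is between ln x and x - 1, and the strict
  inequality ln x < x - 1 for x other than 1 localizes the maximizer.\<close>

abbreviation gauss :: "real measure" where "gauss \<equiv> normal_law 0 1"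

interpretation gauss: prob_space gauss
  by (rule prob_space_normal_law) simp

lemma normal_law_eq_distr:
  assumes "s > 0"
  shows "normal_law m s = distr gauss borel (\<lambda>z. m + s * z)"
proof -
  interpret G: prob_space "density lborel (normal_density 0 1)"
    by (rule prob_space_normal_density) simp
  have "distributed (density lborel (normal_density 0 1)) lborel (\<lambda>x. x) (normal_density 0 1)"
    by (simp add: distributed_def distr_id2)
  from G.normal_density_affine[OF this, of s m] assms
  have "distributed (density lborel (normal_density 0 1)) lborel (\<lambda>x. m + s * x) (normal_density m s)"
    by simp
  then have "distr (density lborel (normal_density 0 1)) lborel (\<lambda>x. m + s * x) = density lborel (normal_density m s)"
    by (simp add: distributed_def)
  moreover have "distr gauss borel (\<lambda>z. m + s * z) = distr gauss lborel (\<lambda>z. m + s * z)"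
    by (intro distr_cong) auto
  ultimately show ?thesis
    by (simp add: normal_law_def)
qed

lemma integral_gauss:
  assumes [measurable]: "f \<in> borel_measurable borel"
  shows "(\<integral>x. f x \<partial>gauss) = (\<integral>x. std_normal_density x * f x \<partial>lborel)"
  unfolding normal_law_def by (subst integral_density) auto

lemma nn_integral_gauss:
  assumes [measurable]: "f \<in> borel_measurable borel"
  shows "(\<integral>\<^sup>+x. f x \<partial>gauss) = (\<integral>\<^sup>+x. ennreal (std_normal_density x) * f x \<partial>lborel)"
  unfolding normal_law_def by (subst nn_integral_density) auto

lemma normal_tail_nonneg [simp]: "0 \<le> normal_tail x"
  and normal_tail_le_1 [simp]: "normal_tail x \<le> 1"
  by (simp_all add: normal_tail_def)

lemma normal_tail_antimono: "x \<le> y \<Longrightarrow> normal_tail y \<le> normal_tail x"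
  unfolding normal_tail_def by (rule gauss.finite_measure_mono) auto

lemma measure_gauss_singleton [simp]: "measure gauss {x} = 0"
  by (simp add: normal_law_def measure_def emeasure_density)

lemma measure_gauss_atLeast: "measure gauss {x..} = normal_tail x"
proof -
  have "{x..} = {x<..} \<union> {x}" by auto
  then have "measure gauss {x..} = measure gauss {x<..} + measure gauss {x}"
    by (simp only:) (rule gauss.finite_measure_Union, auto)
  then show ?thesis by (simp add: normal_tail_def)
qed

lemma gauss_reflect: "distr gauss borel uminus = gauss"
proof -
  have "distr gauss borel uminus = density lborel (\<lambda>x. ennreal (normal_density 0 1 x))"
  proof (rule measure_eqI)
    fix A assume "A \<in> sets (distr gauss borel uminus)"
    then have [measurable]: "A \<in> sets borel" by simp
    have "emeasure (distr gauss borel uminus) A = (\<integral>\<^sup>+x. indicator A (-x) \<partial>gauss)"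
      by (subst nn_integral_indicator[symmetric], simp, subst nn_integral_distr) auto
    also have "\<dots> = (\<integral>\<^sup>+x. ennreal (std_normal_density x) * indicator A (-x) \<partial>lborel)"
      by (rule nn_integral_gauss) simp
    also have "\<dots> = (\<integral>\<^sup>+x. ennreal (std_normal_density x) * indicator A x \<partial>lborel)"
      by (subst nn_integral_real_affine[where c="-1" and t=0])
         (auto simp: normal_density_def)
    finally show "emeasure (distr gauss borel uminus) A =
        emeasure (density lborel (\<lambda>x. ennreal (normal_density 0 1 x))) A"
      by (simp add: emeasure_density)
  qed simp
  then show ?thesis by (simp add: normal_law_def)
qed

lemma measure_gauss_lessThan: "measure gauss {..<x} = normal_tail (- x)"
proof -
  have "measure gauss {..<x} = measure (distr gauss borel uminus) {..<x}"
    by (simp add: gauss_reflect)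
  also have "\<dots> = measure gauss {-x<..}"
    by (subst measure_distr) (auto intro!: arg_cong[where f="measure gauss"])
  finally show ?thesis by (simp add: normal_tail_def)
qed

lemma normal_tail_uminus: "normal_tail (- x) = 1 - normal_tail x"
proof -
  have "UNIV - {x..} = {..<x}" by auto
  then show ?thesis
    using gauss.prob_compl[of "{x..}"] measure_gauss_lessThan[of x] measure_gauss_atLeast[of x]
    by simp
qed

lemma normal_tail_0 [simp]: "normal_tail 0 = 1/2"
  using normal_tail_uminus[of 0] by simp

lemma measure_normal_law_greaterThan:
  assumes "s > 0"
  shows "measure (normal_law m s) {x<..} = normal_tail ((x - m) / s)"
  unfolding normal_law_eq_distr[OF assms] normal_tail_def using assms
  by (subst measure_distr) (auto intro!: arg_cong[where f="measure gauss"] simp: field_simps)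

lemma measure_normal_law_atLeast:
  assumes "s > 0"
  shows "measure (normal_law m s) {x..} = normal_tail ((x - m) / s)"
  unfolding normal_law_eq_distr[OF assms] measure_gauss_atLeast[symmetric] using assms
  by (subst measure_distr) (auto intro!: arg_cong[where f="measure gauss"] simp: field_simps)

text \<open>In this form, with a continuous integrand over an interval, the fundamental theorem of
  calculus yields the derivative of \<open>normal_tail\<close>.\<close>

lemma normal_tail_diff:
  assumes "x \<le> y"
  shows "normal_tail x - normal_tail y = integral {x..y} std_normal_density"
proof -
  have "measure gauss ({x<..y} \<union> {y<..}) = measure gauss {x<..y} + measure gauss {y<..}"
    by (rule gauss.finite_measure_Union) auto
  moreover have "{x<..y} \<union> {y<..} = {x<..}" using assms by auto
  ultimately have "normal_tail x = measure gauss {x<..y} + normal_tail y"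
    unfolding normal_tail_def by simp
  moreover have "measure gauss {x<..y} = integral {x..y} std_normal_density"
  proof -
    have "measure gauss ({x} \<union> {x<..y}) = measure gauss {x} + measure gauss {x<..y}"
      by (rule gauss.finite_measure_Union) auto
    moreover have "{x} \<union> {x<..y} = {x..y}" using assms by auto
    ultimately have "measure gauss {x<..y} = measure gauss {x..y}" by simp
    also have "\<dots> = (\<integral>z. indicator {x..y} z \<partial>gauss)" by simp
    also have "\<dots> = (\<integral>z. indicator {x..y} z *\<^sub>R std_normal_density z \<partial>lborel)"
      by (subst integral_gauss) (auto simp: mult.commute)
    also have "\<dots> = integral {x..y} std_normal_density"
      using set_borel_integral_eq_integral(2)[of "{x..y}" std_normal_density]
        integrable_mult_indicator[OF _ integrable_normal_density[of 1 0], of "{x..y}"]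
      by (simp add: set_lebesgue_integral_def set_integrable_def)
    finally show ?thesis .
  qed
  ultimately show ?thesis by simp
qed

lemma normal_tail_has_derivative: "(normal_tail has_real_derivative - std_normal_density x) (at x)"
proof -
  have cont: "continuous_on {x-1..x+1} std_normal_density"
    unfolding normal_density_def by (intro continuous_intros) auto
  have "((\<lambda>u. integral {x-1..u} std_normal_density) has_real_derivative std_normal_density x)
          (at x within {x-1..x+1})"
    by (rule integral_has_real_derivative[OF cont]) auto
  then have "((\<lambda>u. normal_tail (x-1) - integral {x-1..u} std_normal_density) has_real_derivative
      0 - std_normal_density x) (at x within {x-1..x+1})"
    by (intro derivative_intros)
  then have "(normal_tail has_real_derivative 0 - std_normal_density x) (at x within {x-1..x+1})"
    by (rule has_field_derivative_transform_within[where d=1]) (auto simp: normal_tail_diff[symmetric])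
  moreover have "at x within {x-1..x+1} = at x"
    by (rule at_within_interior) auto
  ultimately show ?thesis by simp
qed

lemmas normal_tail_deriv [derivative_intros] = DERIV_chain2[OF normal_tail_has_derivative]

lemma std_normal_density_deriv:
  "(std_normal_density has_real_derivative - x * std_normal_density x) (at x)"
proof -
  have "((\<lambda>x. 1 / sqrt (2 * pi) * exp (- x\<^sup>2 / 2)) has_real_derivative
      - x * (1 / sqrt (2 * pi) * exp (- x\<^sup>2 / 2))) (at x)"
    by (rule derivative_eq_intros | simp)+
  then show ?thesis
    unfolding std_normal_density_def .
qed

lemmas std_normal_density_deriv' [derivative_intros] = DERIV_chain2[OF std_normal_density_deriv]

lemma isCont_normal_tail: "isCont normal_tail x"
  using normal_tail_has_derivative by (rule DERIV_isCont)

lemma borel_measurable_normal_tail [measurable]: "normal_tail \<in> borel_measurable borel"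
  by (intro borel_measurable_continuous_onI continuous_at_imp_continuous_on ballI isCont_normal_tail)

section \<open>Limits at infinity and Mills ratio bounds\<close>

lemma std_normal_density_tendsto_0: "(std_normal_density \<longlongrightarrow> 0) at_top"
  unfolding std_normal_density_def by real_asymp

lemma normal_tail_tendsto_0: "(normal_tail \<longlongrightarrow> 0) at_top"
proof -
  have "(\<lambda>n. measure gauss {real n<..}) \<longlonglongrightarrow> measure gauss (\<Inter>n. {real n<..})"
    by (intro gauss.finite_Lim_measure_decseq) (auto simp: decseq_def)
  also have "(\<Inter>n. {real n<..}) = {}"
    by auto (meson less_asym reals_Archimedean2)
  finally have lim: "(\<lambda>n. normal_tail (real n)) \<longlonglongrightarrow> 0" by (simp add: normal_tail_def)
  show ?thesis
  proof (rule tendstoI)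
    fix e :: real assume "e > 0"
    then obtain n where n: "normal_tail (real n) < e"
      using order_tendstoD(2)[OF lim] by (force simp: eventually_sequentially)
    show "\<forall>\<^sub>F x in at_top. dist (normal_tail x) 0 < e"
      using eventually_ge_at_top[of "real n"]
      by eventually_elim (use n normal_tail_antimono in \<open>auto intro: le_less_trans\<close>)
  qed
qed

text \<open>A nonincreasing function stays above its limit. With limit 0 this reduces each Gaussian
  tail inequality below to the sign of a derivative.\<close>

lemma DERIV_nonpos_tendsto_0_imp_nonneg:
  fixes f :: "real \<Rightarrow> real"
  assumes "\<And>y. y \<ge> x \<Longrightarrow> (f has_real_derivative f' y) (at y)" "\<And>y. y \<ge> x \<Longrightarrow> f' y \<le> 0"
    and "(f \<longlongrightarrow> 0) at_top"
  shows "0 \<le> f x"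
proof (rule tendsto_upperbound[OF assms(3)])
  show "\<forall>\<^sub>F y in at_top. f y \<le> f x"
    using eventually_ge_at_top[of x]
  proof eventually_elim
    case (elim y)
    show ?case
      by (rule DERIV_nonpos_imp_nonincreasing[OF elim]) (use assms in blast)
  qed
qed simp

lemma normal_tail_le:
  assumes "x > 0"
  shows "normal_tail x \<le> std_normal_density x / x"
proof -
  let ?f = "\<lambda>x. std_normal_density x / x - normal_tail x"
  have "0 \<le> ?f x"
  proof (rule DERIV_nonpos_tendsto_0_imp_nonneg[where f = ?f])
    fix y assume y: "y \<ge> x"
    have "(?f has_real_derivative ((- y * std_normal_density y) * y - std_normal_density y * 1) / (y * y)
        - (- std_normal_density y)) (at y)"
      using assms y by (intro derivative_intros normal_tail_has_derivative std_normal_density_deriv) auto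
    also have "((- y * std_normal_density y) * y - std_normal_density y * 1) / (y * y)
        - (- std_normal_density y) = - std_normal_density y / y\<^sup>2"
      using assms y by (simp add: divide_simps power2_eq_square)
    finally show "(?f has_real_derivative - std_normal_density y / y\<^sup>2) (at y)" .
    show "- std_normal_density y / y\<^sup>2 \<le> 0" by simp
  next
    have "((\<lambda>x. std_normal_density x / x) \<longlongrightarrow> 0) at_top"
      unfolding std_normal_density_def by real_asymp
    from tendsto_diff[OF this normal_tail_tendsto_0]
    show "((\<lambda>x. std_normal_density x / x - normal_tail x) \<longlongrightarrow> 0) at_top" by simp
  qed
  then show ?thesis by simp
qed

text \<open>The denominator 1 + x, chosen instead of the classical x + 1 / x, gives a nontrivial
  bound even at 0, and the derivative of the difference is a plain nonpositive multiple of the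
  density.\<close>

lemma normal_tail_ge:
  assumes "x \<ge> 0"
  shows "normal_tail x \<ge> std_normal_density x / (1 + x)"
proof -
  let ?f = "\<lambda>x. normal_tail x - std_normal_density x / (1 + x)"
  have "0 \<le> ?f x"
  proof (rule DERIV_nonpos_tendsto_0_imp_nonneg[where f = ?f])
    fix y assume y: "y \<ge> x"
    have "(?f has_real_derivative - std_normal_density y -
        ((- y * std_normal_density y) * (1 + y) - std_normal_density y * (0 + 1)) / ((1 + y) * (1 + y))) (at y)"
      using assms y by (intro derivative_intros normal_tail_has_derivative std_normal_density_deriv) auto
    also have "- std_normal_density y -
        ((- y * std_normal_density y) * (1 + y) - std_normal_density y * (0 + 1)) / ((1 + y) * (1 + y))
        = - std_normal_density y * (y / (1 + y)\<^sup>2)"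
      using assms y by (simp add: divide_simps) (simp add: power2_eq_square algebra_simps)
    finally show "(?f has_real_derivative - std_normal_density y * (y / (1 + y)\<^sup>2)) (at y)" .
    show "- std_normal_density y * (y / (1 + y)\<^sup>2) \<le> 0" using y assms by simp
  next
    have "((\<lambda>x. std_normal_density x / (1 + x)) \<longlongrightarrow> 0) at_top"
      unfolding std_normal_density_def by real_asymp
    from tendsto_diff[OF normal_tail_tendsto_0 this]
    show "((\<lambda>x. normal_tail x - std_normal_density x / (1 + x)) \<longlongrightarrow> 0) at_top" by simp
  qed
  then show ?thesis by simp
qed

lemma normal_tail_pos: "normal_tail x > 0"
proof (cases "x \<ge> 0")
  case True
  have "0 < std_normal_density x / (1 + x)" using True by (simp add: normal_density_pos)
  with normal_tail_ge[OF True] show ?thesis by linarith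
next
  case False
  with normal_tail_antimono[of x 0] show ?thesis by simp
qed

lemma std_normal_density_le_exp: "std_normal_density x \<le> exp (- x\<^sup>2 / 2)"
proof -
  have "1 \<le> sqrt (2 * pi)" using pi_gt3 by (simp add: real_le_rsqrt)
  then show ?thesis by (simp add: std_normal_density_def divide_simps)
qed

text \<open>The closed form of the integral of \<open>normal_tail\<close> over \<open>{w..}\<close>.\<close>

definition tail_integral :: "real \<Rightarrow> real" where
  "tail_integral w = std_normal_density w - w * normal_tail w"

lemma tail_integral_deriv: "(tail_integral has_real_derivative - normal_tail w) (at w)"
  unfolding tail_integral_def by (auto intro!: derivative_eq_intros)

lemmas tail_integral_deriv' [derivative_intros] = DERIV_chain2[OF tail_integral_deriv]

lemma tail_integral_0: "tail_integral 0 = 1 / sqrt (2 * pi)"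
  by (simp add: tail_integral_def std_normal_density_def)

lemma tail_integral_tendsto_0: "(tail_integral \<longlongrightarrow> 0) at_top"
proof -
  have "((\<lambda>w. w * normal_tail w) \<longlongrightarrow> 0) at_top"
  proof (rule tendsto_sandwich[OF _ _ tendsto_const std_normal_density_tendsto_0])
    show "\<forall>\<^sub>F w in at_top. w * normal_tail w \<le> std_normal_density w"
      using eventually_gt_at_top[of 0]
      by eventually_elim (use normal_tail_le in \<open>auto simp: field_simps\<close>)
  qed (auto intro!: eventually_mono[OF eventually_ge_at_top[of 0]])
  from tendsto_diff[OF std_normal_density_tendsto_0 this] show ?thesis
    unfolding tail_integral_def[abs_def] by simp
qed

lemma tail_integral_nonneg: "0 \<le> tail_integral w"
  by (rule DERIV_nonpos_tendsto_0_imp_nonneg[OF tail_integral_deriv _ tail_integral_tendsto_0]) simp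

lemma normal_tail_lipschitz: "\<bar>normal_tail x - normal_tail y\<bar> \<le> \<bar>x - y\<bar>"
proof -
  have *: "normal_tail x - normal_tail y \<le> y - x" if xy: "x < y" for x y
  proof -
    obtain z where "normal_tail y - normal_tail x = (y - x) * - std_normal_density z"
      using MVT2[where f = normal_tail and f' = "\<lambda>z. - std_normal_density z" and a = x and b = y,
          OF xy] normal_tail_has_derivative by blast
    moreover have "std_normal_density z \<le> 1"
      using std_normal_density_le_exp[of z] by (rule order_trans) simp
    ultimately show ?thesis using xy mult_left_mono[of "std_normal_density z" 1 "y - x"]
      by (simp add: algebra_simps)
  qed
  show ?thesis
    using *[of x y] *[of y x] normal_tail_antimono[of x y] normal_tail_antimono[of y x]
    by (cases x y rule: linorder_cases) auto
qed

text \<open>Mean value theorem, with the density at x bounded by (1 + x) times the tail. The loss is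
  relative to the tail, as the ratio of small probabilities in \<open>S_value_ge\<close>
  requires.\<close>

lemma normal_tail_shift_ge:
  assumes "x \<ge> 0" "d \<ge> 0"
  shows "normal_tail (x + d) \<ge> (1 - d * (1 + x)) * normal_tail x"
proof (cases "d = 0")
  case False
  then obtain z where z: "x < z" "normal_tail (x + d) - normal_tail x = (x + d - x) * - std_normal_density z"
    using MVT2[of x "x+d" normal_tail "\<lambda>x. - std_normal_density x"] normal_tail_has_derivative assms
    by (metis add_less_same_cancel1 less_add_same_cancel1 order_le_imp_less_or_eq)
  have "std_normal_density z \<le> std_normal_density x"
    unfolding std_normal_density_def using z assms by (intro mult_left_mono) (auto intro!: power_mono)
  also have "\<dots> \<le> (1 + x) * normal_tail x"
    using normal_tail_ge[OF assms(1)] assms by (simp add: divide_simps mult.commute)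
  finally have "d * std_normal_density z \<le> d * ((1 + x) * normal_tail x)"
    using assms by (intro mult_left_mono)
  with z show ?thesis by (simp add: algebra_simps)
qed simp

section \<open>The likelihood ratio of the horseshoe marginal\<close>

interpretation half_cauchy: prob_space half_cauchy
  by (rule prob_space_half_cauchy)

lemma half_cauchy_UNIV [simp]: "measure half_cauchy UNIV = 1"
  using half_cauchy.prob_space by simp

lemma gauss_UNIV [simp]: "measure gauss UNIV = 1"
  using gauss.prob_space by simp

lemma integral_half_cauchy:
  assumes [measurable]: "f \<in> borel_measurable borel"
  shows "(\<integral>l. f l \<partial>half_cauchy) = (\<integral>l. half_cauchy_density l * f l \<partial>lborel)"
  unfolding half_cauchy_def by (subst integral_density) auto

lemma nn_integral_half_cauchy:
  assumes [measurable]: "f \<in> borel_measurable borel"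
  shows "(\<integral>\<^sup>+l. f l \<partial>half_cauchy) = (\<integral>\<^sup>+l. ennreal (half_cauchy_density l) * f l \<partial>lborel)"
  unfolding half_cauchy_def by (subst nn_integral_density) auto

lemma AE_half_cauchy_pos: "AE l in half_cauchy. l > 0"
  unfolding half_cauchy_def
  by (subst AE_density) (auto simp: half_cauchy_density_def split: split_indicator)

lemma integrable_half_cauchy_bounded:
  fixes f :: "real \<Rightarrow> real"
  assumes [measurable]: "f \<in> borel_measurable borel" and "\<And>l. \<bar>f l\<bar> \<le> B"
  shows "integrable half_cauchy f"
  by (rule half_cauchy.integrable_const_bound[where B=B]) (use assms in auto)

text \<open>\<open>gker x u\<close> is the density of \<open>N(0, 1 + u\<^sup>2)\<close> relative to that of \<open>N(0, 1)\<close>.\<close>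

definition gker :: "real \<Rightarrow> real \<Rightarrow> real" where
  "gker x u = exp (x\<^sup>2 * u\<^sup>2 / (2 * (1 + u\<^sup>2))) / sqrt (1 + u\<^sup>2)"

text \<open>Origin: the half-Cauchy density of scale \<tau> is proportional to \<tau> / (\<tau>^2 +
  u^2), and its logarithmic derivative in \<tau> is
  \<open>kap (u / \<tau>) / \<tau>\<close>.\<close>

definition kap :: "real \<Rightarrow> real" where
  "kap l = (l\<^sup>2 - 1) / (l\<^sup>2 + 1)"

text \<open>Given the scale l, the observation has law N(0, 1 + (l \<tau>)^2), so mixing
  \<open>gker\<close> over l gives the density of the horseshoe marginal relative to N(0,
  1).\<close>

definition lik_ratio :: "real \<Rightarrow> real \<Rightarrow> real" where
  "lik_ratio \<tau> x = (\<integral>l. gker x (l * \<tau>) \<partial>half_cauchy)"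

definition score_num :: "real \<Rightarrow> real \<Rightarrow> real" where
  "score_num \<tau> x = (\<integral>l. kap l * gker x (l * \<tau>) \<partial>half_cauchy)"

text \<open>\<open>score \<tau> x / \<tau>\<close> is the derivative of \<open>\<tau> \<mapsto> ln (lik_ratio \<tau> x)\<close>.\<close>

definition score :: "real \<Rightarrow> real \<Rightarrow> real" where
  "score \<tau> x = score_num \<tau> x / lik_ratio \<tau> x"

lemma one_plus_sq_pos [simp]: "0 < 1 + (u::real)\<^sup>2" "0 < (u::real)\<^sup>2 + 1"
  by (simp_all add: add_pos_nonneg add_nonneg_pos)

lemma one_plus_sq_nz [simp]: "1 + (u::real)\<^sup>2 \<noteq> 0" "(u::real)\<^sup>2 + 1 \<noteq> 0"
  using one_plus_sq_pos[of u] by linarith+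

lemma gker_pos: "0 < gker x u"
  by (simp add: gker_def)

lemma gker_nonneg [simp]: "0 \<le> gker x u"
  using gker_pos[of x u] by simp

lemma gker_measurable [measurable]:
  assumes [measurable]: "f \<in> borel_measurable M" "g \<in> borel_measurable M"
  shows "(\<lambda>z. gker (f z) (g z)) \<in> borel_measurable M"
  unfolding gker_def by measurable

lemma kap_measurable [measurable]: "kap \<in> borel_measurable borel"
  unfolding kap_def[abs_def] by measurable

lemma abs_kap_le: "\<bar>kap l\<bar> \<le> 1"
proof -
  have "\<bar>l\<^sup>2 - 1\<bar> \<le> l\<^sup>2 + 1" by (auto simp: abs_if)
  then show ?thesis unfolding kap_def by (simp add: abs_divide)
qed

lemma kap_le: "kap l \<le> 1" and kap_ge: "-1 \<le> kap l"
  using abs_kap_le[of l] by (auto simp: abs_le_iff)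

lemma gker_le: "gker x u \<le> exp (x\<^sup>2 / 2)"
proof -
  have "x\<^sup>2 * u\<^sup>2 / (2 * (1 + u\<^sup>2)) \<le> x\<^sup>2 / 2"
    using mult_left_mono[of "u\<^sup>2 / (1 + u\<^sup>2)" 1 "x\<^sup>2 / 2"] by simp
  then have "exp (x\<^sup>2 * u\<^sup>2 / (2 * (1 + u\<^sup>2))) \<le> exp (x\<^sup>2 / 2)" by simp
  moreover have "exp (x\<^sup>2 * u\<^sup>2 / (2 * (1 + u\<^sup>2))) / sqrt (1 + u\<^sup>2) \<le> exp (x\<^sup>2 * u\<^sup>2 / (2 * (1 + u\<^sup>2))) / 1"
    by (intro divide_left_mono) auto
  ultimately show ?thesis unfolding gker_def by linarith
qed

lemma std_normal_density_gker:
  "std_normal_density x * gker x u = normal_density 0 (sqrt (1 + u\<^sup>2)) x"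
proof -
  have "- x\<^sup>2 / 2 + x\<^sup>2 * u\<^sup>2 / (2 * (1 + u\<^sup>2)) = - x\<^sup>2 / (2 * (1 + u\<^sup>2))"
  proof -
    have "x\<^sup>2 * u\<^sup>2 / (2 * (1 + u\<^sup>2)) = x\<^sup>2 / 2 * (1 - 1 / (1 + u\<^sup>2))"
      by (simp add: divide_simps)
    then show ?thesis by (simp add: right_diff_distrib)
  qed
  then have "exp (- x\<^sup>2 / 2) * exp (x\<^sup>2 * u\<^sup>2 / (2 * (1 + u\<^sup>2))) = exp (- x\<^sup>2 / (2 * (1 + u\<^sup>2)))"
    by (simp only: exp_add[symmetric])
  then show ?thesis
    by (simp add: gker_def normal_density_def real_sqrt_mult power2_eq_square)
qed

lemma gker_ge_0: "gker 0 u \<ge> 1 - u\<^sup>2 / 2"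
proof -
  have "(1 - u\<^sup>2 / 2) * sqrt (1 + u\<^sup>2) \<le> 1"
  \<comment> \<open>The square of the left side is 1 - u^4 (3 - u^2) / 4, which is at most 1 in the
    first case; in the second the factor 1 - u^2 / 2 is negative.\<close>
  proof (cases "u\<^sup>2 \<le> 2")
    case True
    have "((1 - u\<^sup>2 / 2) * sqrt (1 + u\<^sup>2))\<^sup>2 = (1 - u\<^sup>2 / 2)\<^sup>2 * (1 + u\<^sup>2)"
      by (simp add: power_mult_distrib)
    also have "\<dots> = 1 - u\<^sup>2 * u\<^sup>2 * (3 - u\<^sup>2) / 4"
      by (simp add: power2_eq_square field_simps)
    also have "\<dots> \<le> 1\<^sup>2" using True by simp
    finally show ?thesis by (rule power2_le_imp_le) simp
  next
    case False
    then have "(1 - u\<^sup>2 / 2) * sqrt (1 + u\<^sup>2) \<le> 0" by (intro mult_nonpos_nonneg) auto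
    then show ?thesis by simp
  qed
  then show ?thesis by (simp add: gker_def divide_simps)
qed

lemma gker_mono: "\<bar>x\<bar> \<le> \<bar>y\<bar> \<Longrightarrow> gker x u \<le> gker y u"
  unfolding gker_def by (auto intro!: divide_right_mono mult_right_mono simp: abs_le_square_iff)

text \<open>The exponent of \<open>gker x u\<close> is x^2 / 2 times u^2 / (1 + u^2), hence at most
  x^2 / 4 for |u| \<le> 1. The spare factor exp (x^2 / 4) absorbs the x^2 that comes out of exp y -
  1 \<le> y exp y, so no power of x is left.\<close>

lemma abs_gker_minus_1_le: "\<bar>gker x u - 1\<bar> \<le> 2 * exp (x\<^sup>2 / 2) * min 1 (u\<^sup>2)"
proof (cases "\<bar>u\<bar> \<le> 1")
  case False
  then have "u\<^sup>2 \<ge> 1" using abs_le_square_iff[of 1 u] by simp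
  moreover have "\<bar>gker x u - 1\<bar> \<le> 2 * exp (x\<^sup>2 / 2)"
  proof -
    have "1 \<le> exp (x\<^sup>2 / 2)" by simp
    then show ?thesis using gker_le[of x u] gker_nonneg[of x u] by linarith
  qed
  ultimately show ?thesis by simp
next
  case True
  then have u: "u\<^sup>2 \<le> 1" by (simp add: abs_square_le_1)
  define y where "y = x\<^sup>2 * u\<^sup>2 / (2 * (1 + u\<^sup>2))"
  have y0: "y \<ge> 0" by (simp add: y_def)
  have y_eq: "y = x\<^sup>2 / 2 * (u\<^sup>2 / (1 + u\<^sup>2))" by (simp add: y_def)
  have "u\<^sup>2 / (1 + u\<^sup>2) \<le> 1 / 2" "u\<^sup>2 / (1 + u\<^sup>2) \<le> u\<^sup>2 / 1"
  proof -
    show "u\<^sup>2 / (1 + u\<^sup>2) \<le> 1 / 2" using u by (simp add: divide_simps)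
    show "u\<^sup>2 / (1 + u\<^sup>2) \<le> u\<^sup>2 / 1" by (intro divide_left_mono) auto
  qed
  then have y1: "y \<le> x\<^sup>2 / 4" and y2: "y \<le> x\<^sup>2 / 2 * u\<^sup>2"
    unfolding y_eq using mult_left_mono[of "u\<^sup>2 / (1 + u\<^sup>2)" "1/2" "x\<^sup>2/2"]
      mult_left_mono[of "u\<^sup>2 / (1 + u\<^sup>2)" "u\<^sup>2" "x\<^sup>2/2"] by simp_all
  have "gker x u \<le> exp y / 1" unfolding gker_def y_def[symmetric] by (intro divide_left_mono) auto
  moreover have "exp y - 1 \<le> y * exp y"
    using exp_ge_add_one_self[of "-y"] by (simp add: exp_minus field_simps)
  moreover have "y * exp y \<le> (x\<^sup>2 / 2 * u\<^sup>2) * exp (x\<^sup>2 / 4)"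
    using y0 y1 y2 by (intro mult_mono) auto
  moreover have "x\<^sup>2 / 4 * exp (x\<^sup>2 / 4) \<le> exp (x\<^sup>2 / 4) * exp (x\<^sup>2 / 4)"
  proof (rule mult_right_mono)
    show "x\<^sup>2 / 4 \<le> exp (x\<^sup>2 / 4)" using exp_ge_add_one_self[of "x\<^sup>2/4"] by linarith
  qed simp
  then have "x\<^sup>2 / 4 * exp (x\<^sup>2 / 4) * (2 * u\<^sup>2) \<le> exp (x\<^sup>2 / 2) * (2 * u\<^sup>2)"
    by (intro mult_right_mono) (simp_all add: exp_add[symmetric])
  ultimately have up: "gker x u - 1 \<le> 2 * exp (x\<^sup>2 / 2) * u\<^sup>2" by (simp add: mult_ac)
  have "1 - gker x u \<le> 1 - gker 0 u" using gker_mono[of 0 x u] by simp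
  also have "\<dots> \<le> u\<^sup>2 / 2" using gker_ge_0[of u] by simp
  also have "\<dots> \<le> 2 * exp (x\<^sup>2 / 2) * u\<^sup>2"
    using mult_right_mono[of "1/2" "2 * exp (x\<^sup>2/2)" "u\<^sup>2"] one_le_exp_iff[of "x\<^sup>2/2"]
    by (auto simp del: one_le_exp_iff)
  finally show ?thesis using up u by (simp add: abs_le_iff)
qed

lemma integrable_gker [simp]: "integrable half_cauchy (\<lambda>l. gker x (l * \<tau>))"
  by (rule integrable_half_cauchy_bounded[where B="exp (x\<^sup>2/2)"]) (auto simp: gker_le)

lemma integrable_kap_gker [simp]: "integrable half_cauchy (\<lambda>l. kap l * gker x (l * \<tau>))"
proof (rule integrable_half_cauchy_bounded[where B="exp (x\<^sup>2/2)"])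
  show "\<bar>kap l * gker x (l * \<tau>)\<bar> \<le> exp (x\<^sup>2/2)" for l
    using mult_mono[OF abs_kap_le[of l] gker_le[of x "l*\<tau>"]] by (simp add: abs_mult)
qed simp

lemma lik_ratio_measurable [measurable]:
  assumes [measurable]: "f \<in> borel_measurable M" "g \<in> borel_measurable M"
  shows "(\<lambda>z. lik_ratio (f z) (g z)) \<in> borel_measurable M"
  unfolding lik_ratio_def by measurable

lemma score_num_measurable [measurable]:
  assumes [measurable]: "f \<in> borel_measurable M" "g \<in> borel_measurable M"
  shows "(\<lambda>z. score_num (f z) (g z)) \<in> borel_measurable M"
  unfolding score_num_def by measurable

lemma score_measurable [measurable]:
  assumes [measurable]: "f \<in> borel_measurable M" "g \<in> borel_measurable M"
  shows "(\<lambda>z. score (f z) (g z)) \<in> borel_measurable M"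
  unfolding score_def by measurable

lemma lik_ratio_pos: "0 < lik_ratio \<tau> x"
proof -
  have "0 \<le> lik_ratio \<tau> x" unfolding lik_ratio_def by (rule Bochner_Integration.integral_nonneg) simp
  moreover have "lik_ratio \<tau> x \<noteq> 0"
  proof
    assume "lik_ratio \<tau> x = 0"
    then have "AE l in half_cauchy. gker x (l * \<tau>) = 0"
      unfolding lik_ratio_def by (subst (asm) integral_nonneg_eq_0_iff_AE) auto
    then have "AE l in half_cauchy. False"
      by eventually_elim (use gker_pos in \<open>metis less_irrefl\<close>)
    then show False by simp
  qed
  ultimately show ?thesis by simp
qed

lemma abs_score_num_le: "\<bar>score_num \<tau> x\<bar> \<le> lik_ratio \<tau> x"
proof -
  have "\<bar>score_num \<tau> x\<bar> \<le> (\<integral>l. \<bar>kap l * gker x (l * \<tau>)\<bar> \<partial>half_cauchy)"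
    unfolding score_num_def by (rule integral_abs_bound)
  also have "\<dots> \<le> lik_ratio \<tau> x"
    unfolding lik_ratio_def
  proof (rule integral_mono)
    show "\<bar>kap l * gker x (l * \<tau>)\<bar> \<le> gker x (l * \<tau>)" for l
      using mult_right_mono[OF abs_kap_le[of l] gker_nonneg[of x "l*\<tau>"]] by (simp add: abs_mult)
  qed (auto intro!: integrable_abs)
  finally show ?thesis .
qed

lemma abs_score_le: "\<bar>score \<tau> x\<bar> \<le> 1"
  using abs_score_num_le[of \<tau> x] lik_ratio_pos[of \<tau> x] by (simp add: score_def abs_divide)

lemma score_le: "score \<tau> x \<le> 1" and score_ge: "-1 \<le> score \<tau> x"
  using abs_score_le[of \<tau> x] by (auto simp: abs_le_iff)

lemma lik_ratio_mono: "\<bar>x\<bar> \<le> \<bar>y\<bar> \<Longrightarrow> lik_ratio \<tau> x \<le> lik_ratio \<tau> y"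
  unfolding lik_ratio_def by (rule integral_mono) (auto intro: gker_mono)

lemma lik_ratio_0_le: "lik_ratio \<tau> 0 \<le> 1"
proof -
  have "lik_ratio \<tau> 0 \<le> (\<integral>l. 1 \<partial>half_cauchy)"
    unfolding lik_ratio_def
    by (rule integral_mono) (use gker_le[of 0] in auto)
  then show ?thesis by (simp add: half_cauchy.prob_space)
qed

subsection \<open>Half-Cauchy integrals\<close>

text \<open>The heavy Cauchy tail makes this linear in \<tau>. Up to l = 1 / \<tau> the density
  cancels the factor l^2 and the integral is at most (2 / pi) \<tau>; the mass beyond is at most (2
  / pi) \<tau> as well.\<close>

lemma half_cauchy_min_le:
  assumes "\<tau> > 0"
  shows "(\<integral>l. min 1 ((l * \<tau>)\<^sup>2) \<partial>half_cauchy) \<le> 2 * \<tau>"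
proof -
  have "(\<integral>\<^sup>+l. ennreal (min 1 ((l * \<tau>)\<^sup>2)) \<partial>half_cauchy)
      = (\<integral>\<^sup>+l. ennreal (half_cauchy_density l * min 1 ((l * \<tau>)\<^sup>2)) \<partial>lborel)"
    by (subst nn_integral_half_cauchy) (auto simp: ennreal_mult)
  also have "\<dots> \<le> (\<integral>\<^sup>+l. ennreal (2 / pi * \<tau>\<^sup>2) * indicator {0..1/\<tau>} l
      + ennreal (2 / (pi * l\<^sup>2)) * indicator {1/\<tau>..} l \<partial>lborel)"
  proof (rule nn_integral_mono)
    fix l :: real
    show "ennreal (half_cauchy_density l * min 1 ((l * \<tau>)\<^sup>2)) \<le> ennreal (2 / pi * \<tau>\<^sup>2) * indicator {0..1/\<tau>} l
      + ennreal (2 / (pi * l\<^sup>2)) * indicator {1/\<tau>..} l"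
    proof (cases "l > 0")
      case False
      then show ?thesis by (simp add: half_cauchy_density_def)
    next
      case True
      show ?thesis
      proof (cases "l \<le> 1/\<tau>")
        case le: True
        have "2 / (pi * (1 + l\<^sup>2)) * min 1 ((l * \<tau>)\<^sup>2) \<le> 2 / (pi * (1 + l\<^sup>2)) * ((l * \<tau>)\<^sup>2)"
          by (intro mult_left_mono) auto
        also have "\<dots> = 2 / pi * \<tau>\<^sup>2 * (l\<^sup>2 / (1 + l\<^sup>2))" by (simp add: power_mult_distrib)
        also have "\<dots> \<le> 2 / pi * \<tau>\<^sup>2 * 1" by (intro mult_left_mono) (auto simp: divide_simps)
        finally have "ennreal (half_cauchy_density l * min 1 ((l * \<tau>)\<^sup>2)) \<le> ennreal (2 / pi * \<tau>\<^sup>2)"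
          using True by (intro ennreal_leI) (simp add: half_cauchy_density_def)
        then show ?thesis using le True by (simp add: add_increasing2)
      next
        case gt: False
        have "2 / (pi * (1 + l\<^sup>2)) * min 1 ((l * \<tau>)\<^sup>2) \<le> 2 / (pi * (1 + l\<^sup>2)) * 1"
          by (intro mult_left_mono) auto
        also have "\<dots> \<le> 2 / (pi * l\<^sup>2)" using True by (simp add: divide_simps)
        finally have "ennreal (half_cauchy_density l * min 1 ((l * \<tau>)\<^sup>2)) \<le> ennreal (2 / (pi * l\<^sup>2))"
          using True by (intro ennreal_leI) (simp add: half_cauchy_density_def)
        then show ?thesis using gt True by (simp add: add_increasing)
      qed
    qed
  qed
  also have "\<dots> = (\<integral>\<^sup>+l. ennreal (2 / pi * \<tau>\<^sup>2) * indicator {0..1/\<tau>} l \<partial>lborel)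
      + (\<integral>\<^sup>+l. ennreal (2 / (pi * l\<^sup>2)) * indicator {1/\<tau>..} l \<partial>lborel)"
    by (rule nn_integral_add) auto
  also have "(\<integral>\<^sup>+l. ennreal (2 / pi * \<tau>\<^sup>2) * indicator {0..1/\<tau>} l \<partial>lborel) = ennreal (2 / pi * \<tau>)"
    using assms by (subst nn_integral_cmult_indicator)
      (auto simp: ennreal_mult'[symmetric] power2_eq_square)
  also have "(\<integral>\<^sup>+l. ennreal (2 / (pi * l\<^sup>2)) * indicator {1/\<tau>..} l \<partial>lborel) = ennreal (0 - - 2 / (pi * (1/\<tau>)))"
  proof (rule nn_integral_FTC_atLeast)
    show "DERIV (\<lambda>l. - 2 / (pi * l)) l :> 2 / (pi * l\<^sup>2)" if "1 / \<tau> \<le> l" for l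
    proof -
      have "l > 0" using that assms by (smt (verit) divide_pos_pos)
      then have "DERIV (\<lambda>l. - (2 / pi) * inverse l) l :> - (2 / pi) * - (inverse l * inverse l)"
        by (intro derivative_eq_intros) (auto simp: power2_eq_square)
      then show ?thesis using \<open>l > 0\<close> by (simp add: field_simps power2_eq_square)
    qed
    show "((\<lambda>l. - 2 / (pi * l)) \<longlongrightarrow> 0) at_top"
      by real_asymp
  qed auto
  also have "ennreal (2 / pi * \<tau>) + ennreal (0 - - 2 / (pi * (1/\<tau>))) = ennreal (4 / pi * \<tau>)"
    using assms by (subst ennreal_plus[symmetric]) (auto simp: field_simps)
  also have "\<dots> \<le> ennreal (2 * \<tau>)"
    using assms pi_gt3 by (intro ennreal_leI) (auto simp: field_simps)
  finally have *: "(\<integral>\<^sup>+l. ennreal (min 1 ((l * \<tau>)\<^sup>2)) \<partial>half_cauchy) \<le> ennreal (2 * \<tau>)" .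
  have "ennreal (\<integral>l. min 1 ((l * \<tau>)\<^sup>2) \<partial>half_cauchy) = (\<integral>\<^sup>+l. ennreal (min 1 ((l * \<tau>)\<^sup>2)) \<partial>half_cauchy)"
    by (rule nn_integral_eq_integral[symmetric])
       (auto intro!: integrable_half_cauchy_bounded[where B=1])
  with * have "ennreal (\<integral>l. min 1 ((l * \<tau>)\<^sup>2) \<partial>half_cauchy) \<le> ennreal (2 * \<tau>)" by simp
  then show ?thesis using assms by (subst (asm) ennreal_le_iff) auto
qed

text \<open>The rescaled half-Cauchy densities all have mass 1, so their derivative in the scale
  integrates to 0. This centring is what makes \<open>score_num\<close> of order \<tau>.\<close>

lemma integral_kap: "(\<integral>l. kap l \<partial>half_cauchy) = 0"
proof -
  \<comment> \<open>Antiderivative of the density times 1 - \<open>kap\<close>, which is 4 / (pi (1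
    + l^2)^2).\<close>
  define F where "F l = (2/pi) * (l / (1 + l\<^sup>2) + arctan l)" for l :: real
  have eq0: "ennreal (half_cauchy_density l * (1 - kap l)) = 0" if "l < 0" for l
    using that by (simp add: half_cauchy_density_def)
  have eq: "half_cauchy_density l * (1 - kap l) = 4 / (pi * (1 + l\<^sup>2)\<^sup>2)" if "l > 0" for l
    using that by (simp add: half_cauchy_density_def kap_def divide_simps power2_eq_square)
  have "(\<integral>\<^sup>+l. ennreal (1 - kap l) \<partial>half_cauchy) = (\<integral>\<^sup>+l. ennreal (half_cauchy_density l * (1 - kap l)) \<partial>lborel)"
    using kap_le by (subst nn_integral_half_cauchy) (auto simp: ennreal_mult)
  also have "\<dots> = (\<integral>\<^sup>+l. ennreal (4 / (pi * (1 + l\<^sup>2)\<^sup>2)) * indicator {0..} l \<partial>lborel)"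
    by (intro nn_integral_cong_AE eventually_mono[OF AE_lborel_singleton[of 0]])
       (metis (no_types) eq eq0 indicator_simps atLeast_iff linorder_less_linear mult.right_neutral mult_zero_right less_imp_le not_le)
  also have "\<dots> = ennreal (1 - F 0)"
  proof (rule nn_integral_FTC_atLeast)
    show "DERIV F l :> 4 / (pi * (1 + l\<^sup>2)\<^sup>2)" for l
    proof -
      have "DERIV F l :> (2/pi) * ((1 * (1 + l\<^sup>2) - l * (2 * l)) / ((1 + l\<^sup>2) * (1 + l\<^sup>2)) + inverse (1 + l\<^sup>2))"
        unfolding F_def[abs_def] by (rule derivative_eq_intros refl one_plus_sq_nz | simp)+
      also have "(2/pi) * ((1 * (1 + l\<^sup>2) - l * (2 * l)) / ((1 + l\<^sup>2) * (1 + l\<^sup>2)) + inverse (1 + l\<^sup>2))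
          = 4 / (pi * (1 + l\<^sup>2)\<^sup>2)"
      proof -
        have "(2/pi) * ((1 * a - 2 * (a - 1)) / (a * a) + inverse a) = 4 / (pi * a\<^sup>2)" if "a > 0" for a :: real
          using that by (simp add: field_simps power2_eq_square)
        from this[OF one_plus_sq_pos(1)[of l]] show ?thesis by (simp add: power2_eq_square)
      qed
      finally show ?thesis .
    qed
    have "(F \<longlongrightarrow> (2/pi) * (0 + pi/2)) at_top"
      unfolding F_def by (intro tendsto_intros tendsto_arctan_at_top) real_asymp
    then show "(F \<longlongrightarrow> 1) at_top" by simp
  qed auto
  finally have *: "(\<integral>\<^sup>+l. ennreal (1 - kap l) \<partial>half_cauchy) = 1" by (simp add: F_def)
  have int: "integrable half_cauchy kap"
    by (rule integrable_half_cauchy_bounded[where B=1]) (auto simp: abs_kap_le)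
  have "(\<integral>l. 1 - kap l \<partial>half_cauchy) = 1"
    using * kap_le by (subst integral_eq_nn_integral) auto
  then show ?thesis using int by (simp add: half_cauchy.prob_space)
qed

lemma integrable_kap: "integrable half_cauchy kap"
  by (rule integrable_half_cauchy_bounded[where B=1]) (auto simp: abs_kap_le)

text \<open>With w = 1 this controls the likelihood ratio minus 1; with w = \<open>kap\<close> it
  controls the score numerator, because \<open>kap\<close> has mean 0.\<close>

lemma half_cauchy_weighted_le:
  assumes "\<tau> > 0" and [measurable]: "w \<in> borel_measurable borel" and w: "\<And>l. \<bar>w l\<bar> \<le> 1"
  shows "\<bar>\<integral>l. w l * (gker x (l * \<tau>) - 1) \<partial>half_cauchy\<bar> \<le> 4 * \<tau> * exp (x\<^sup>2 / 2)"
proof -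
  have "\<bar>\<integral>l. w l * (gker x (l * \<tau>) - 1) \<partial>half_cauchy\<bar>
      \<le> (\<integral>l. \<bar>w l * (gker x (l * \<tau>) - 1)\<bar> \<partial>half_cauchy)"
    by (rule integral_abs_bound)
  also have "\<dots> \<le> (\<integral>l. 2 * exp (x\<^sup>2 / 2) * min 1 ((l * \<tau>)\<^sup>2) \<partial>half_cauchy)"
  proof (rule integral_mono)
    have b: "\<bar>w l * (gker x (l * \<tau>) - 1)\<bar> \<le> 2 * exp (x\<^sup>2 / 2) * min 1 ((l * \<tau>)\<^sup>2)" for l
      using mult_mono[OF w[of l] abs_gker_minus_1_le[of x "l*\<tau>"]] by (simp add: abs_mult)
    then show "\<bar>w l * (gker x (l * \<tau>) - 1)\<bar> \<le> 2 * exp (x\<^sup>2 / 2) * min 1 ((l * \<tau>)\<^sup>2)" for l .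
    have b2: "2 * exp (x\<^sup>2 / 2) * min 1 ((l * \<tau>)\<^sup>2) \<le> 2 * exp (x\<^sup>2 / 2)" for l by simp
    show "integrable half_cauchy (\<lambda>l. \<bar>w l * (gker x (l * \<tau>) - 1)\<bar>)"
    proof (rule integrable_half_cauchy_bounded)
      show "\<bar>\<bar>w l * (gker x (l * \<tau>) - 1)\<bar>\<bar> \<le> 2 * exp (x\<^sup>2 / 2)" for l
        using order_trans[OF b b2] by simp
    qed simp
    show "integrable half_cauchy (\<lambda>l. 2 * exp (x\<^sup>2 / 2) * min 1 ((l * \<tau>)\<^sup>2))"
      by (intro integrable_half_cauchy_bounded[where B="2 * exp (x\<^sup>2 / 2)"]) auto
  qed
  also have "\<dots> = 2 * exp (x\<^sup>2 / 2) * (\<integral>l. min 1 ((l * \<tau>)\<^sup>2) \<partial>half_cauchy)" by simp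
  also have "\<dots> \<le> 2 * exp (x\<^sup>2 / 2) * (2 * \<tau>)"
    by (intro mult_left_mono half_cauchy_min_le assms) auto
  finally show ?thesis by (simp add: mult_ac)
qed

lemma abs_lik_ratio_minus_1_le:
  assumes "\<tau> > 0"
  shows "\<bar>lik_ratio \<tau> x - 1\<bar> \<le> 4 * \<tau> * exp (x\<^sup>2 / 2)"
  using half_cauchy_weighted_le[of \<tau> "\<lambda>_. 1" x] assms
  by (simp add: lik_ratio_def half_cauchy.prob_space)

lemma abs_score_num_le_exp:
  assumes "\<tau> > 0"
  shows "\<bar>score_num \<tau> x\<bar> \<le> 4 * \<tau> * exp (x\<^sup>2 / 2)"
  using half_cauchy_weighted_le[of \<tau> kap x] assms abs_kap_le
  by (simp add: score_num_def right_diff_distrib integrable_kap integral_kap)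

lemma lik_ratio_ge: "\<tau> > 0 \<Longrightarrow> lik_ratio \<tau> x \<ge> 1 - 4 * \<tau>"
  using abs_lik_ratio_minus_1_le[of \<tau> 0] lik_ratio_mono[of 0 x \<tau>] by (auto simp: abs_le_iff)

text \<open>Informative for |x| up to about \<zeta>(\<tau>), where exp (x^2 / 2) reaches 1 / \<tau>;
  further out \<open>abs_score_le\<close> takes over.\<close>

lemma abs_score_le_exp:
  assumes "\<tau> > 0" "\<tau> \<le> 1/8"
  shows "\<bar>score \<tau> x\<bar> \<le> 8 * \<tau> * exp (x\<^sup>2 / 2)"
proof -
  have "lik_ratio \<tau> x \<ge> 1/2" using lik_ratio_ge[of \<tau> x] assms by simp
  then have "\<bar>score_num \<tau> x\<bar> / lik_ratio \<tau> x \<le> (4 * \<tau> * exp (x\<^sup>2 / 2)) / (1/2)"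
    using abs_score_num_le_exp[of \<tau> x] assms by (intro frac_le) auto
  then show ?thesis using lik_ratio_pos[of \<tau> x] by (simp add: score_def abs_divide)
qed

subsection \<open>Monotonicity in \<open>\<bar>x\<bar>\<close>\<close>

text \<open>Chebyshev's association inequality: average the nonnegative product over two independent
  copies and expand.\<close>

lemma (in prob_space) chebyshev_association:
  fixes f g :: "'a \<Rightarrow> real"
  assumes co: "\<And>x y. (f x - f y) * (g x - g y) \<ge> 0"
    and f: "integrable M f" and g: "integrable M g" and fg: "integrable M (\<lambda>x. f x * g x)"
  shows "expectation f * expectation g \<le> expectation (\<lambda>x. f x * g x)"
proof -
  have in1: "integrable M (\<lambda>y. f x * g x - f x * g y - f y * g x + f y * g y)" for x
    using f g fg by auto
  have "0 \<le> (\<integral>x. \<integral>y. (f x - f y) * (g x - g y) \<partial>M \<partial>M)"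
    by (intro Bochner_Integration.integral_nonneg co)
  also have "\<dots> = (\<integral>x. f x * g x - f x * expectation g - expectation f * g x + expectation (\<lambda>x. f x * g x) \<partial>M)"
  proof (rule Bochner_Integration.integral_cong[OF refl])
    fix x
    have "(\<integral>y. (f x - f y) * (g x - g y) \<partial>M) = (\<integral>y. f x * g x - f x * g y - f y * g x + f y * g y \<partial>M)"
      by (simp add: algebra_simps)
    also have "\<dots> = f x * g x - f x * expectation g - expectation f * g x + expectation (\<lambda>x. f x * g x)"
      using f g fg by (simp add: prob_space)
    finally show "(\<integral>y. (f x - f y) * (g x - g y) \<partial>M) =
       f x * g x - f x * expectation g - expectation f * g x + expectation (\<lambda>x. f x * g x)" .
  qed
  also have "\<dots> = 2 * (expectation (\<lambda>x. f x * g x) - expectation f * expectation g)"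
    using f g fg by (simp add: prob_space)
  finally show ?thesis by simp
qed

text \<open>The score at x is the mean of \<open>kap\<close> under the half-Cauchy law tilted by
  \<open>gker x\<close>. Passing from x to y tilts further by \<open>r\<close>, which increases with
  l^2 just as \<open>kap\<close> does, so association raises the mean.\<close>

lemma score_mono:
  assumes xy: "\<bar>x\<bar> \<le> \<bar>y\<bar>"
  shows "score \<tau> x \<le> score \<tau> y"
proof -
  define w where "w l = gker x (l * \<tau>) / lik_ratio \<tau> x" for l
  define r where "r l = gker y (l * \<tau>) / gker x (l * \<tau>)" for l
  define P where "P = density half_cauchy w"
  note Rx = lik_ratio_pos[of \<tau> x]
  have w: "0 \<le> w l" for l using Rx by (simp add: w_def)
  have [measurable]: "w \<in> borel_measurable borel" "r \<in> borel_measurable borel"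
    unfolding w_def[abs_def] r_def[abs_def] by measurable
  have wr: "w l * r l = gker y (l * \<tau>) / lik_ratio \<tau> x" for l
    using gker_pos[of x "l * \<tau>"] by (simp add: w_def r_def)
  have iw: "integrable half_cauchy w" unfolding w_def[abs_def] by simp
  interpret P: prob_space P
  proof
    have "(\<integral>\<^sup>+l. ennreal (w l) \<partial>half_cauchy) = ennreal (\<integral>l. w l \<partial>half_cauchy)"
      using iw w by (intro nn_integral_eq_integral) auto
    also have "(\<integral>l. w l \<partial>half_cauchy) = 1"
      using Rx by (simp add: w_def[abs_def] lik_ratio_def[symmetric])
    finally show "emeasure P (space P) = 1"
      by (simp add: P_def emeasure_density)
  qed
  have intP: "integrable P f \<longleftrightarrow> integrable half_cauchy (\<lambda>l. w l * f l)"
    and integralP: "(\<integral>l. f l \<partial>P) = (\<integral>l. w l * f l \<partial>half_cauchy)"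
    if [measurable]: "f \<in> borel_measurable borel" for f :: "real \<Rightarrow> real"
    using w unfolding P_def by (auto simp: integrable_density integral_density)
  have r_exp: "r l = exp ((y\<^sup>2 - x\<^sup>2) / 2 * (1 - 1 / (1 + (l * \<tau>)\<^sup>2)))" for l
  proof -
    have "r l = exp (y\<^sup>2 * (l * \<tau>)\<^sup>2 / (2 * (1 + (l * \<tau>)\<^sup>2)) - x\<^sup>2 * (l * \<tau>)\<^sup>2 / (2 * (1 + (l * \<tau>)\<^sup>2)))"
      by (simp add: r_def gker_def exp_diff)
    also have "y\<^sup>2 * (l * \<tau>)\<^sup>2 / (2 * (1 + (l * \<tau>)\<^sup>2)) - x\<^sup>2 * (l * \<tau>)\<^sup>2 / (2 * (1 + (l * \<tau>)\<^sup>2))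
       = (y\<^sup>2 - x\<^sup>2) / 2 * ((l * \<tau>)\<^sup>2 / (1 + (l * \<tau>)\<^sup>2))"
      by (simp add: diff_divide_distrib left_diff_distrib)
    also have "(l * \<tau>)\<^sup>2 / (1 + (l * \<tau>)\<^sup>2) = 1 - 1 / (1 + (l * \<tau>)\<^sup>2)"
      using one_plus_sq_nz(1)[of "l * \<tau>"] by (simp only: divide_simps) simp
    finally show ?thesis .
  qed
  have r_mono: "r l \<le> r m" if "l\<^sup>2 \<le> m\<^sup>2" for l m
  proof -
    have "(l * \<tau>)\<^sup>2 \<le> (m * \<tau>)\<^sup>2" using that by (simp add: power_mult_distrib mult_right_mono)
    then have "1 / (1 + (m * \<tau>)\<^sup>2) \<le> 1 / (1 + (l * \<tau>)\<^sup>2)" by (intro divide_left_mono) auto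
    moreover have "x\<^sup>2 \<le> y\<^sup>2" using xy by (simp add: abs_le_square_iff)
    ultimately show ?thesis unfolding r_exp by (auto intro!: mult_left_mono)
  qed
  have k_mono: "kap l \<le> kap m" if "l\<^sup>2 \<le> m\<^sup>2" for l m
  proof -
    have "kap l = 1 - 2 / (1 + l\<^sup>2)" for l by (simp add: kap_def divide_simps)
    moreover have "2 / (1 + m\<^sup>2) \<le> 2 / (1 + l\<^sup>2)" using that by (intro divide_left_mono) auto
    ultimately show ?thesis by simp
  qed
  have "P.expectation kap * P.expectation r \<le> P.expectation (\<lambda>l. kap l * r l)"
  proof (rule P.chebyshev_association)
    show "0 \<le> (kap l - kap m) * (r l - r m)" for l m
      using k_mono[of l m] r_mono[of l m] k_mono[of m l] r_mono[of m l]
      by (cases "l\<^sup>2 \<le> m\<^sup>2") (auto intro: mult_nonneg_nonneg mult_nonpos_nonpos)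
    have "(\<lambda>l. w l * kap l) = (\<lambda>l. kap l * gker x (l * \<tau>) / lik_ratio \<tau> x)" by (auto simp: w_def)
    then show "integrable P kap" by (simp add: intP)
    show "integrable P r" by (simp add: intP wr)
    have "(\<lambda>l. w l * (kap l * r l)) = (\<lambda>l. kap l * gker y (l * \<tau>) / lik_ratio \<tau> x)"
      using wr by (auto simp: mult_ac)
    then show "integrable P (\<lambda>l. kap l * r l)" by (simp add: intP)
  qed
  also have "P.expectation kap = score \<tau> x"
    by (simp add: integralP w_def score_def score_num_def mult.commute)
  also have "P.expectation r = lik_ratio \<tau> y / lik_ratio \<tau> x"
    by (simp add: integralP wr lik_ratio_def)
  also have "P.expectation (\<lambda>l. kap l * r l) = score_num \<tau> y / lik_ratio \<tau> x"
  proof -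
    have "(\<lambda>l. w l * (kap l * r l)) = (\<lambda>l. kap l * gker y (l * \<tau>) / lik_ratio \<tau> x)"
      using wr by (auto simp: mult_ac)
    then show ?thesis by (simp add: integralP score_num_def)
  qed
  finally show ?thesis
    using Rx lik_ratio_pos[of \<tau> y] by (simp add: score_def divide_simps mult_ac)
qed

subsection \<open>Expectations under the standard normal law\<close>

interpretation gauss_hc: pair_sigma_finite gauss half_cauchy ..

lemma lik_ratio_minus [simp]: "lik_ratio \<tau> (- x) = lik_ratio \<tau> x"
  by (simp add: lik_ratio_def gker_def)

lemma score_num_minus [simp]: "score_num \<tau> (- x) = score_num \<tau> x"
  by (simp add: score_num_def gker_def)

lemma score_minus [simp]: "score \<tau> (- x) = score \<tau> x"
  by (simp add: score_def)

text \<open>Tonelli, after which \<open>gker x u\<close> turns N(0, 1) into N(0, 1 + u^2). The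
  weight w makes room for both 1 and 1 - \<open>kap\<close>.\<close>

lemma nn_integral_gauss_gker:
  assumes [measurable]: "f \<in> borel_measurable borel" "w \<in> borel_measurable borel"
  shows "(\<integral>\<^sup>+x. f x * (\<integral>\<^sup>+l. w l * ennreal (gker x (l * \<tau>)) \<partial>half_cauchy) \<partial>gauss)
    = (\<integral>\<^sup>+l. w l * (\<integral>\<^sup>+x. f x \<partial>normal_law 0 (sqrt (1 + (l * \<tau>)\<^sup>2))) \<partial>half_cauchy)"
proof -
  have "(\<integral>\<^sup>+x. f x * (\<integral>\<^sup>+l. w l * ennreal (gker x (l * \<tau>)) \<partial>half_cauchy) \<partial>gauss)
    = (\<integral>\<^sup>+x. \<integral>\<^sup>+l. f x * (w l * ennreal (gker x (l * \<tau>))) \<partial>half_cauchy \<partial>gauss)"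
    by (intro nn_integral_cong nn_integral_cmult[symmetric]) auto
  also have "\<dots> = (\<integral>\<^sup>+l. \<integral>\<^sup>+x. f x * (w l * ennreal (gker x (l * \<tau>))) \<partial>gauss \<partial>half_cauchy)"
    by (rule gauss_hc.Fubini'[symmetric]) simp
  also have "\<dots> = (\<integral>\<^sup>+l. w l * (\<integral>\<^sup>+x. f x \<partial>normal_law 0 (sqrt (1 + (l * \<tau>)\<^sup>2))) \<partial>half_cauchy)"
  proof (rule nn_integral_cong)
    fix l
    have "(\<integral>\<^sup>+x. f x * (w l * ennreal (gker x (l * \<tau>))) \<partial>gauss)
      = (\<integral>\<^sup>+x. w l * (ennreal (std_normal_density x * gker x (l * \<tau>)) * f x) \<partial>lborel)"
      by (subst nn_integral_gauss) (auto simp: ennreal_mult mult_ac intro!: nn_integral_cong)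
    also have "\<dots> = w l * (\<integral>\<^sup>+x. f x \<partial>normal_law 0 (sqrt (1 + (l * \<tau>)\<^sup>2)))"
      by (subst nn_integral_cmult)
         (auto simp: normal_law_def nn_integral_density std_normal_density_gker)
    finally show "(\<integral>\<^sup>+x. f x * (w l * ennreal (gker x (l * \<tau>))) \<partial>gauss)
      = w l * (\<integral>\<^sup>+x. f x \<partial>normal_law 0 (sqrt (1 + (l * \<tau>)\<^sup>2)))" .
  qed
  finally show ?thesis .
qed

lemma nn_integral_gauss_lik_ratio:
  assumes [measurable]: "f \<in> borel_measurable borel"
  shows "(\<integral>\<^sup>+x. f x * ennreal (lik_ratio \<tau> x) \<partial>gauss)
    = (\<integral>\<^sup>+l. (\<integral>\<^sup>+x. f x \<partial>normal_law 0 (sqrt (1 + (l * \<tau>)\<^sup>2))) \<partial>half_cauchy)"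
proof -
  have "ennreal (lik_ratio \<tau> x) = (\<integral>\<^sup>+l. 1 * ennreal (gker x (l * \<tau>)) \<partial>half_cauchy)" for x
    unfolding lik_ratio_def by (simp add: nn_integral_eq_integral)
  then show ?thesis
    using nn_integral_gauss_gker[of f "\<lambda>_. 1" \<tau>] by simp
qed

lemma nn_integral_normal_law_1: "s > 0 \<Longrightarrow> (\<integral>\<^sup>+x. 1 \<partial>normal_law m s) = 1"
  using prob_space.emeasure_space_1[OF prob_space_normal_law[of s m]] by simp

lemma sqrt_one_plus_sq_pos [simp]: "0 < sqrt (1 + (u::real)\<^sup>2)"
  by simp

lemma integrable_lik_ratio [simp]: "integrable gauss (lik_ratio \<tau>)"
  and integral_lik_ratio [simp]: "(\<integral>x. lik_ratio \<tau> x \<partial>gauss) = 1"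
proof -
  have *: "(\<integral>\<^sup>+x. ennreal (lik_ratio \<tau> x) \<partial>gauss) = 1"
    using nn_integral_gauss_lik_ratio[of "\<lambda>_. 1" \<tau>] half_cauchy.emeasure_space_1
    by (simp only: nn_integral_normal_law_1[OF sqrt_one_plus_sq_pos]) simp
  have pos: "0 \<le> lik_ratio \<tau> x" for x using lik_ratio_pos[of \<tau> x] by simp
  show "integrable gauss (lik_ratio \<tau>)"
    using * pos by (intro integrableI_bounded) auto
  show "(\<integral>x. lik_ratio \<tau> x \<partial>gauss) = 1"
    using * pos by (subst integral_eq_nn_integral) auto
qed

lemma integrable_score_num [simp]: "integrable gauss (score_num \<tau>)"
  by (rule Bochner_Integration.integrable_bound[OF integrable_lik_ratio[of \<tau>]])
     (use abs_score_num_le lik_ratio_pos in \<open>auto simp: less_imp_le abs_of_pos\<close>)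

text \<open>Formally the derivative of the constant total mass of the marginal. Rigorously, 1 -
  \<open>kap\<close> is nonnegative with half-Cauchy mean 1, so Tonelli applies to
  \<open>lik_ratio\<close> minus \<open>score_num\<close>.\<close>

lemma integral_score_num [simp]: "(\<integral>x. score_num \<tau> x \<partial>gauss) = 0"
proof -
  have eq: "lik_ratio \<tau> x - score_num \<tau> x = (\<integral>l. (1 - kap l) * gker x (l * \<tau>) \<partial>half_cauchy)" for x
    unfolding lik_ratio_def score_num_def
    by (subst Bochner_Integration.integral_diff[symmetric]) (auto simp: algebra_simps)
  have nn: "0 \<le> (1 - kap l) * gker x (l * \<tau>)" for x l
    using kap_le[of l] by simp
  have int: "integrable half_cauchy (\<lambda>l. (1 - kap l) * gker x (l * \<tau>))" for x
    by (simp add: left_diff_distrib)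
  have "ennreal (lik_ratio \<tau> x - score_num \<tau> x) = (\<integral>\<^sup>+l. ennreal (1 - kap l) * ennreal (gker x (l * \<tau>)) \<partial>half_cauchy)" for x
    unfolding eq using kap_le int nn
    by (subst nn_integral_eq_integral[symmetric]) (auto simp: ennreal_mult)
  then have "(\<integral>\<^sup>+x. ennreal (lik_ratio \<tau> x - score_num \<tau> x) \<partial>gauss)
     = (\<integral>\<^sup>+l. ennreal (1 - kap l) * (\<integral>\<^sup>+x. 1 \<partial>normal_law 0 (sqrt (1 + (l * \<tau>)\<^sup>2))) \<partial>half_cauchy)"
    using nn_integral_gauss_gker[of "\<lambda>_. 1" "\<lambda>l. ennreal (1 - kap l)" \<tau>] by simp
  also have "\<dots> = (\<integral>\<^sup>+l. ennreal (1 - kap l) \<partial>half_cauchy)"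
    by (simp only: nn_integral_normal_law_1[OF sqrt_one_plus_sq_pos] mult_1_right)
  also have "\<dots> = ennreal (\<integral>l. 1 - kap l \<partial>half_cauchy)"
    using kap_le integrable_kap by (intro nn_integral_eq_integral) auto
  also have "\<dots> = 1" by (simp add: integrable_kap integral_kap)
  finally have *: "(\<integral>\<^sup>+x. ennreal (lik_ratio \<tau> x - score_num \<tau> x) \<partial>gauss) = 1" .
  have "(\<integral>x. lik_ratio \<tau> x - score_num \<tau> x \<partial>gauss) = 1"
    using * abs_score_num_le[of \<tau>]
    by (subst integral_eq_nn_integral) (auto intro!: AE_I2 simp: abs_le_iff)
  then show ?thesis by simp
qed

lemma integrable_gauss_bounded:
  fixes f :: "real \<Rightarrow> real"
  assumes [measurable]: "f \<in> borel_measurable borel" and "\<And>l. \<bar>f l\<bar> \<le> B"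
  shows "integrable gauss f"
  by (rule gauss.integrable_const_bound[where B=B]) (use assms in auto)

lemma integrable_score [simp]: "integrable gauss (score \<tau>)"
  by (rule integrable_gauss_bounded[where B=1]) (auto simp: abs_score_le)

lemma score_times_lik_ratio: "score \<tau> x * lik_ratio \<tau> x = score_num \<tau> x"
  using lik_ratio_pos[of \<tau> x] by (simp add: score_def)

definition null_drift :: "real \<Rightarrow> real" where
  "null_drift \<tau> = - (\<integral>x. score \<tau> x \<partial>gauss)"

lemma null_drift_measurable [measurable]: "null_drift \<in> borel_measurable borel"
  unfolding null_drift_def[abs_def] by measurable

lemma abs_null_drift_le: "\<bar>null_drift \<tau>\<bar> \<le> 1"
proof -
  have "\<bar>\<integral>x. score \<tau> x \<partial>gauss\<bar> \<le> (\<integral>x. \<bar>score \<tau> x\<bar> \<partial>gauss)" by (rule integral_abs_bound)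
  also have "\<dots> \<le> (\<integral>x. 1 \<partial>gauss)"
    by (rule integral_mono) (auto simp: abs_score_le)
  finally show ?thesis by (simp add: null_drift_def)
qed

text \<open>Score and likelihood ratio both increase with |x|, so they are positively associated
  under N(0, 1), and their product \<open>score_num\<close> has mean 0.\<close>

lemma null_drift_nonneg: "0 \<le> null_drift \<tau>"
proof -
  have "(\<integral>x. score \<tau> x \<partial>gauss) * (\<integral>x. lik_ratio \<tau> x \<partial>gauss) \<le> (\<integral>x. score \<tau> x * lik_ratio \<tau> x \<partial>gauss)"
  proof (rule gauss.chebyshev_association)
    fix x y
    show "0 \<le> (score \<tau> x - score \<tau> y) * (lik_ratio \<tau> x - lik_ratio \<tau> y)"
      using score_mono[of x y \<tau>] score_mono[of y x \<tau>] lik_ratio_mono[of x y \<tau>] lik_ratio_mono[of y x \<tau>]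
      by (cases "\<bar>x\<bar> \<le> \<bar>y\<bar>") (auto intro: mult_nonneg_nonneg mult_nonpos_nonpos)
  qed (auto simp: score_times_lik_ratio)
  then show ?thesis by (simp add: null_drift_def score_times_lik_ratio)
qed

text \<open>The score has mean 0 under the horseshoe marginal, and it is smallest at 0.\<close>

lemma score_0_le: "score \<tau> 0 \<le> 0"
proof -
  have "score \<tau> 0 = (\<integral>x. score \<tau> 0 * lik_ratio \<tau> x \<partial>gauss)" by simp
  also have "\<dots> \<le> (\<integral>x. score \<tau> x * lik_ratio \<tau> x \<partial>gauss)"
  proof (rule integral_mono)
    show "score \<tau> 0 * lik_ratio \<tau> x \<le> score \<tau> x * lik_ratio \<tau> x" for x
      using score_mono[of 0 x \<tau>] lik_ratio_pos[of \<tau> x] by (intro mult_right_mono) auto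
  qed (auto simp: score_times_lik_ratio)
  finally show ?thesis by (simp add: score_times_lik_ratio)
qed

text \<open>The mass of \<open>{a<..}\<close> under the horseshoe marginal minus that under N(0, 1).
  Both the null drift and the S-value are governed by it.\<close>

definition tail_excess :: "real \<Rightarrow> real \<Rightarrow> real" where
  "tail_excess \<tau> a = (\<integral>x. indicator {a<..} x * (lik_ratio \<tau> x - 1) \<partial>gauss)"

lemma integrable_indicator_lik_ratio [simp]:
  "A \<in> sets borel \<Longrightarrow> integrable gauss (\<lambda>x. indicator A x * lik_ratio \<tau> x)"
  using integrable_mult_indicator[OF _ integrable_lik_ratio[of \<tau>], of A] by simp

lemma integrable_indicator_lik_ratio_diff [simp]:
  "A \<in> sets borel \<Longrightarrow> integrable gauss (\<lambda>x. indicator A x * (lik_ratio \<tau> x - c))"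
  using integrable_mult_indicator[of A gauss "\<lambda>x. lik_ratio \<tau> x - c"] by simp

lemma integrable_gauss_indicator [simp]:
  "A \<in> sets borel \<Longrightarrow> integrable gauss (indicator A :: real \<Rightarrow> real)"
  by (intro integrable_gauss_bounded[where B=1]) (auto split: split_indicator)

lemma integral_gauss_tail_lik_ratio:
  "(\<integral>x. indicator {a<..} x * lik_ratio \<tau> x \<partial>gauss) = normal_tail a + tail_excess \<tau> a"
  by (simp add: tail_excess_def right_diff_distrib normal_tail_def)

lemma integral_gauss_tail_lik_ratio_mix:
  "(\<integral>x. indicator {a<..} x * lik_ratio \<tau> x \<partial>gauss)
     = (\<integral>l. normal_tail (a / sqrt (1 + (l * \<tau>)\<^sup>2)) \<partial>half_cauchy)"
proof -
  have "ennreal (\<integral>x. indicator {a<..} x * lik_ratio \<tau> x \<partial>gauss)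
     = (\<integral>\<^sup>+x. ennreal (indicator {a<..} x * lik_ratio \<tau> x) \<partial>gauss)"
    using lik_ratio_pos by (intro nn_integral_eq_integral[symmetric]) (auto simp: less_imp_le)
  also have "\<dots> = (\<integral>\<^sup>+x. indicator {a<..} x * ennreal (lik_ratio \<tau> x) \<partial>gauss)"
    by (intro nn_integral_cong) (auto split: split_indicator)
  also have "\<dots> = (\<integral>\<^sup>+l. (\<integral>\<^sup>+x. indicator {a<..} x \<partial>normal_law 0 (sqrt (1 + (l * \<tau>)\<^sup>2))) \<partial>half_cauchy)"
    by (rule nn_integral_gauss_lik_ratio) simp
  also have "\<dots> = (\<integral>\<^sup>+l. ennreal (normal_tail (a / sqrt (1 + (l * \<tau>)\<^sup>2))) \<partial>half_cauchy)"
  proof (rule nn_integral_cong)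
    fix l
    interpret N: prob_space "normal_law 0 (sqrt (1 + (l * \<tau>)\<^sup>2))"
      by (rule prob_space_normal_law) (use sqrt_one_plus_sq_pos[of "l * \<tau>"] in linarith)
    show "(\<integral>\<^sup>+x. indicator {a<..} x \<partial>normal_law 0 (sqrt (1 + (l * \<tau>)\<^sup>2))) =
        ennreal (normal_tail (a / sqrt (1 + (l * \<tau>)\<^sup>2)))"
      using measure_normal_law_greaterThan[OF sqrt_one_plus_sq_pos[of "l * \<tau>"], of 0 a]
      by (simp add: N.emeasure_eq_measure)
  qed
  also have "\<dots> = ennreal (\<integral>l. normal_tail (a / sqrt (1 + (l * \<tau>)\<^sup>2)) \<partial>half_cauchy)"
    by (intro nn_integral_eq_integral integrable_half_cauchy_bounded[where B=1]) auto
  finally show ?thesis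
    by (subst (asm) ennreal_inj)
       (auto intro!: Bochner_Integration.integral_nonneg simp: less_imp_le[OF lik_ratio_pos])
qed

lemma tail_excess_eq:
  "tail_excess \<tau> a = (\<integral>l. normal_tail (a / sqrt (1 + (l * \<tau>)\<^sup>2)) - normal_tail a \<partial>half_cauchy)"
proof -
  have "integrable half_cauchy (\<lambda>l. normal_tail (a / sqrt (1 + (l * \<tau>)\<^sup>2)))"
    by (rule integrable_half_cauchy_bounded[where B=1]) auto
  then show ?thesis
    using integral_gauss_tail_lik_ratio[of a \<tau>] integral_gauss_tail_lik_ratio_mix[of a \<tau>] by simp
qed

lemma integral_gauss_reflect:
  assumes [measurable]: "(f :: real \<Rightarrow> real) \<in> borel_measurable borel"
  shows "(\<integral>x. f (- x) \<partial>gauss) = (\<integral>x. f x \<partial>gauss)"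
proof -
  have "(\<integral>x. f x \<partial>gauss) = (\<integral>x. f x \<partial>distr gauss borel uminus)" by (simp add: gauss_reflect)
  also have "\<dots> = (\<integral>x. f (- x) \<partial>gauss)" by (rule integral_distr) auto
  finally show ?thesis by simp
qed

lemma integral_gauss_two_sided:
  assumes "a \<ge> 0"
  shows "(\<integral>x. indicator {x. \<bar>x\<bar> > a} x * (lik_ratio \<tau> x - 1) \<partial>gauss) = 2 * tail_excess \<tau> a"
proof -
  have "indicator {x. \<bar>x\<bar> > a} x * (lik_ratio \<tau> x - 1) =
     indicator {a<..} x * (lik_ratio \<tau> x - 1) + indicator {a<..} (- x) * (lik_ratio \<tau> (- x) - 1)" for x
    using assms by (auto split: split_indicator)
  moreover have "integrable gauss (\<lambda>x. indicator {a<..} (- x) * (lik_ratio \<tau> (- x) - 1))"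
  proof -
    have "(\<lambda>x. indicator {a<..} (- x) * (lik_ratio \<tau> (- x) - 1)) = (\<lambda>x. indicator {..<-a} x * (lik_ratio \<tau> x - 1))"
      by (auto split: split_indicator)
    then show ?thesis by simp
  qed
  ultimately have "(\<integral>x. indicator {x. \<bar>x\<bar> > a} x * (lik_ratio \<tau> x - 1) \<partial>gauss) =
     tail_excess \<tau> a + (\<integral>x. indicator {a<..} (- x) * (lik_ratio \<tau> (- x) - 1) \<partial>gauss)"
    by (simp add: tail_excess_def)
  also have "(\<integral>x. indicator {a<..} (- x) * (lik_ratio \<tau> (- x) - 1) \<partial>gauss) = tail_excess \<tau> a"
    unfolding tail_excess_def by (rule integral_gauss_reflect) simp
  finally show ?thesis by simp
qed

lemma measure_gauss_two_sided:
  assumes "a \<ge> 0"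
  shows "measure gauss {x. \<bar>x\<bar> \<ge> a} = (if a = 0 then 1 else 2 * normal_tail a)"
proof (cases "a = 0")
  case False
  then have "{x. \<bar>x\<bar> \<ge> a} = {a..} \<union> {..-a}" using assms by auto
  moreover have "measure gauss ({a..} \<union> {..-a}) = measure gauss {a..} + measure gauss {..-a}"
    using False assms by (intro gauss.finite_measure_Union) auto
  moreover have "measure gauss ({..<-a} \<union> {-a}) = measure gauss {..<-a} + measure gauss {-a}"
    by (intro gauss.finite_measure_Union) auto
  moreover have "{..<-a} \<union> {-a} = {..-a}" by auto
  ultimately show ?thesis using False by (simp add: measure_gauss_atLeast measure_gauss_lessThan)
qed simp

lemma tail_excess_nonneg:
  assumes "a \<ge> 0"
  shows "0 \<le> tail_excess \<tau> a"
  unfolding tail_excess_eq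
proof (rule Bochner_Integration.integral_nonneg)
  fix l
  have "1 \<le> sqrt (1 + (l * \<tau>)\<^sup>2)" by simp
  then have "a / sqrt (1 + (l * \<tau>)\<^sup>2) \<le> a / 1" using assms by (intro divide_left_mono) auto
  then show "0 \<le> normal_tail (a / sqrt (1 + (l * \<tau>)\<^sup>2)) - normal_tail a"
    using normal_tail_antimono by simp
qed

subsection \<open>Bounds for the drift and the variance of the score\<close>

text \<open>Subtracting their minima at 0 makes score and ratio nonnegative, so the mean of the
  product may be restricted to |x| > B, where the score is nearly 1. Expanding the product and using
  \<open>integral_score_num\<close> returns the drift up to the product of the small numbers q0 and
  1 - R0.\<close>

lemma null_drift_ge:
  assumes "0 < \<tau>" "\<tau> \<le> 1/8" "B \<ge> 0" "score \<tau> B \<ge> 1 - \<delta>" "\<delta> \<le> 1"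
  shows "null_drift \<tau> \<ge> (1 - \<delta>) * (2 * tail_excess \<tau> B) - 32 * \<tau>\<^sup>2"
proof -
  define q0 R0 where "q0 = score \<tau> 0" and "R0 = lik_ratio \<tau> 0"
  have q0: "q0 \<le> 0" "\<bar>q0\<bar> \<le> 8 * \<tau>"
    using score_0_le[of \<tau>] abs_score_le_exp[of \<tau> 0] assms by (auto simp: q0_def)
  have R0: "R0 \<le> 1" "1 - R0 \<le> 4 * \<tau>" "0 < R0"
    using lik_ratio_0_le[of \<tau>] lik_ratio_ge[of \<tau> 0] lik_ratio_pos[of \<tau> 0] assms by (auto simp: R0_def)
  have expand: "(score \<tau> x - q0) * (lik_ratio \<tau> x - R0)
      = score_num \<tau> x - R0 * score \<tau> x - q0 * lik_ratio \<tau> x + q0 * R0" for x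
    using score_times_lik_ratio[of \<tau> x] by (simp add: algebra_simps)
  have int: "integrable gauss (\<lambda>x. (score \<tau> x - q0) * (lik_ratio \<tau> x - R0))"
    unfolding expand by simp
  have "(\<integral>x. (score \<tau> x - q0) * (lik_ratio \<tau> x - R0) \<partial>gauss) = R0 * null_drift \<tau> - q0 + q0 * R0"
    unfolding expand by (simp add: null_drift_def)
  moreover have "(1 - \<delta>) * (2 * tail_excess \<tau> B) \<le> (\<integral>x. (score \<tau> x - q0) * (lik_ratio \<tau> x - R0) \<partial>gauss)"
    unfolding integral_gauss_two_sided[OF assms(3), symmetric] integral_mult_right_zero[symmetric]
  proof (rule integral_mono)
    show "integrable gauss (\<lambda>x. (1 - \<delta>) * (indicator {x. B < \<bar>x\<bar>} x * (lik_ratio \<tau> x - 1)))"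
      by (intro integrable_mult_right integrable_indicator_lik_ratio_diff) measurable
    fix x
    have q: "score \<tau> x \<ge> q0" and R: "lik_ratio \<tau> x \<ge> R0"
      using score_mono[of 0 x \<tau>] lik_ratio_mono[of 0 x \<tau>] by (auto simp: q0_def R0_def)
    show "(1 - \<delta>) * (indicator {x. B < \<bar>x\<bar>} x * (lik_ratio \<tau> x - 1))
        \<le> (score \<tau> x - q0) * (lik_ratio \<tau> x - R0)"
    proof (cases "B < \<bar>x\<bar>")
      case True
      have "score \<tau> x \<ge> score \<tau> B" using True assms by (intro score_mono) auto
      then have "(1 - \<delta>) * (lik_ratio \<tau> x - R0) \<le> (score \<tau> x - q0) * (lik_ratio \<tau> x - R0)"
        using assms q0 R by (intro mult_right_mono) auto
      moreover have "(1 - \<delta>) * (lik_ratio \<tau> x - 1) \<le> (1 - \<delta>) * (lik_ratio \<tau> x - R0)"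
        using assms R0 by (intro mult_left_mono) auto
      ultimately show ?thesis using True by simp
    qed (use q R in simp)
  qed (rule int)
  moreover have "R0 * null_drift \<tau> \<le> null_drift \<tau>"
    using R0 null_drift_nonneg[of \<tau>] by (simp add: mult_left_le_one_le)
  moreover have "\<bar>q0 * (1 - R0)\<bar> \<le> (8 * \<tau>) * (4 * \<tau>)"
    unfolding abs_mult using q0 R0 assms by (intro mult_mono) auto
  ultimately show ?thesis
    by (simp add: algebra_simps power2_eq_square abs_le_iff)
qed

text \<open>As \<open>score_num\<close> has mean 0, the drift is the mean of score times (ratio -
  1). For |x| \<le> A both factors obey their exp (x^2 / 2) bounds. Outside, the score is at most 1
  and |ratio - 1| is at most ratio - 1 + 8 \<tau>, because the ratio is at least 1 - 4
  \<tau>.\<close>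

lemma null_drift_le:
  assumes "0 < \<tau>" "\<tau> \<le> 1/8" "A > 0"
  shows "null_drift \<tau> \<le> 64 * A * \<tau>\<^sup>2 * exp (A\<^sup>2 / 2) + 2 * tail_excess \<tau> A + 16 * \<tau> * normal_tail A"
proof -
  define b where "b x = indicator {-A..A} x * (32 * \<tau>\<^sup>2 * exp (x\<^sup>2))
      + (indicator {x. \<bar>x\<bar> > A} x * (lik_ratio \<tau> x - 1) + 8 * \<tau> * indicator {x. \<bar>x\<bar> \<ge> A} x)" for x :: real
  have ib: "integrable gauss (\<lambda>x. indicator {-A..A} x * (32 * \<tau>\<^sup>2 * exp (x\<^sup>2)))"
  proof (rule integrable_gauss_bounded)
    show "\<bar>indicator {-A..A} x * (32 * \<tau>\<^sup>2 * exp (x\<^sup>2))\<bar> \<le> 32 * \<tau>\<^sup>2 * exp (A\<^sup>2)" for x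
      using abs_le_square_iff[of x A] assms by (auto simp: abs_mult split: split_indicator)
  qed simp
  have ib2: "integrable gauss (\<lambda>x. indicator {x. \<bar>x\<bar> > A} x * (lik_ratio \<tau> x - 1))"
    by (rule integrable_indicator_lik_ratio_diff) simp
  have ib3: "integrable gauss (\<lambda>x. 8 * \<tau> * indicator {x. \<bar>x\<bar> \<ge> A} x)"
    by (rule integrable_gauss_bounded[where B="8 * \<tau>"]) (use assms in \<open>auto split: split_indicator\<close>)
  have "null_drift \<tau> = (\<integral>x. score_num \<tau> x - score \<tau> x \<partial>gauss)"
    by (simp add: null_drift_def)
  also have "\<dots> \<le> (\<integral>x. b x \<partial>gauss)"
  proof (rule integral_mono)
    show "integrable gauss b" unfolding b_def[abs_def] using ib ib2 ib3 by simp
    fix x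
    have eq: "score_num \<tau> x - score \<tau> x = score \<tau> x * (lik_ratio \<tau> x - 1)"
      using score_times_lik_ratio[of \<tau> x] by (simp add: algebra_simps)
    have le: "score \<tau> x * (lik_ratio \<tau> x - 1) \<le> \<bar>score \<tau> x\<bar> * \<bar>lik_ratio \<tau> x - 1\<bar>"
      by (metis abs_ge_self abs_mult)
    show "score_num \<tau> x - score \<tau> x \<le> b x"
    proof (cases "\<bar>x\<bar> > A")
      case False
      have "\<bar>score \<tau> x\<bar> * \<bar>lik_ratio \<tau> x - 1\<bar> \<le> (8 * \<tau> * exp (x\<^sup>2/2)) * (4 * \<tau> * exp (x\<^sup>2/2))"
        using abs_score_le_exp[of \<tau> x] abs_lik_ratio_minus_1_le[of \<tau> x] assms by (intro mult_mono) auto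
      also have "\<dots> = 32 * \<tau>\<^sup>2 * exp (x\<^sup>2)"
        by (simp add: power2_eq_square[of \<tau>] exp_add[symmetric])
      also have "\<dots> \<le> b x" using False assms by (auto simp: b_def abs_le_iff split: split_indicator)
      finally show ?thesis using le eq by simp
    next
      case True
      have "\<bar>score \<tau> x\<bar> * \<bar>lik_ratio \<tau> x - 1\<bar> \<le> 1 * \<bar>lik_ratio \<tau> x - 1\<bar>"
        using abs_score_le by (intro mult_right_mono) auto
      also have "\<dots> \<le> lik_ratio \<tau> x - 1 + 8 * \<tau>"
        using lik_ratio_ge[of \<tau> x] assms by (auto simp: abs_if)
      also have "\<dots> = b x" using True assms by (auto simp: b_def split: split_indicator)
      finally show ?thesis using le eq by simp
    qed
  qed simp
  also have "\<dots> = (\<integral>x. indicator {-A..A} x * (32 * \<tau>\<^sup>2 * exp (x\<^sup>2)) \<partial>gauss) + 2 * tail_excess \<tau> A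
      + 8 * \<tau> * (2 * normal_tail A)"
    unfolding b_def using ib ib2 ib3 assms
    by (simp add: integral_gauss_two_sided measure_gauss_two_sided del: integral_indicator)
  also have "(\<integral>x. indicator {-A..A} x * (32 * \<tau>\<^sup>2 * exp (x\<^sup>2)) \<partial>gauss)
      = (\<integral>x. std_normal_density x * (indicator {-A..A} x * (32 * \<tau>\<^sup>2 * exp (x\<^sup>2))) \<partial>lborel)"
    by (rule integral_gauss) simp
  \<comment> \<open>The density reduces exp (x^2) to at most exp (A^2 / 2), on an interval of length
    2 A.\<close>
  also have "\<dots> \<le> (\<integral>x. indicator {-A..A} x * (32 * \<tau>\<^sup>2 * exp (A\<^sup>2 / 2)) \<partial>lborel)"
  proof (rule integral_mono')
    show "integrable lborel (\<lambda>x. indicator {-A..A} x * (32 * \<tau>\<^sup>2 * exp (A\<^sup>2 / 2)))"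
      by (intro integrable_mult_left integrable_real_indicator) (auto simp: emeasure_lborel_Icc_eq)
    fix x :: real
    show "std_normal_density x * (indicator {-A..A} x * (32 * \<tau>\<^sup>2 * exp (x\<^sup>2))) \<le> indicator {-A..A} x * (32 * \<tau>\<^sup>2 * exp (A\<^sup>2 / 2))"
    proof (cases "x \<in> {-A..A}")
      case True
      then have "x\<^sup>2 \<le> A\<^sup>2" using abs_le_square_iff[of x A] by auto
      have "std_normal_density x * exp (x\<^sup>2) \<le> exp (- x\<^sup>2/2) * exp (x\<^sup>2)"
        using std_normal_density_le_exp by (intro mult_right_mono) auto
      also have "\<dots> = exp (x\<^sup>2 / 2)" by (simp add: exp_add[symmetric])
      also have "\<dots> \<le> exp (A\<^sup>2 / 2)" using \<open>x\<^sup>2 \<le> A\<^sup>2\<close> by simp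
      finally have "(32 * \<tau>\<^sup>2) * (std_normal_density x * exp (x\<^sup>2)) \<le> (32 * \<tau>\<^sup>2) * exp (A\<^sup>2 / 2)"
        by (intro mult_left_mono) auto
      then show ?thesis using True by (simp add: mult_ac)
    qed simp
  qed (auto split: split_indicator)
  also have "\<dots> = 64 * A * \<tau>\<^sup>2 * exp (A\<^sup>2 / 2)" using assms by simp
  finally show ?thesis by simp
qed

text \<open>On [-A, A] the integrand is at most 64 \<tau>^2 exp (x^2 / 2). Replacing x^2 by A |x|
  gives a closed form and saves the factor 1 / A that bounding by the interval length would miss; at
  A = \<zeta>(\<tau>) this produces the order \<tau> / \<zeta>(\<tau>).\<close>

lemma score_second_moment_le:
  assumes "0 < \<tau>" "\<tau> \<le> 1/8" "A > 0"
  shows "(\<integral>x. (score \<tau> x)\<^sup>2 \<partial>gauss) \<le> 256 * \<tau>\<^sup>2 * exp (A\<^sup>2 / 2) / A + 2 * normal_tail A"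
proof -
  have i1: "has_bochner_integral lborel (\<lambda>x. exp (A * x / 2) * indicator {0..A} x) (2/A * exp (A * A / 2) - 2/A * exp (A * 0 / 2))"
    using assms by (intro has_bochner_integral_FTC_Icc_real) (auto intro!: derivative_eq_intros continuous_intros)
  have i2: "has_bochner_integral lborel (\<lambda>x. exp (A * (- x) / 2) * indicator {-A..0} x) (- (2/A) * exp (A * - 0 / 2) - - (2/A) * exp (A * - (-A) / 2))"
    using assms by (intro has_bochner_integral_FTC_Icc_real) (auto intro!: derivative_eq_intros continuous_intros)
  define b where "b x = indicator {-A..A} x * (64 * \<tau>\<^sup>2 * exp (x\<^sup>2)) + indicator {x. \<bar>x\<bar> \<ge> A} x" for x :: real
  have ib: "integrable gauss (\<lambda>x. indicator {-A..A} x * (64 * \<tau>\<^sup>2 * exp (x\<^sup>2)))"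
  proof (rule integrable_gauss_bounded)
    show "\<bar>indicator {-A..A} x * (64 * \<tau>\<^sup>2 * exp (x\<^sup>2))\<bar> \<le> 64 * \<tau>\<^sup>2 * exp (A\<^sup>2)" for x
      using abs_le_square_iff[of x A] assms by (auto simp: abs_mult split: split_indicator)
  qed simp
  have ib3: "integrable gauss (\<lambda>x. indicator {x. \<bar>x\<bar> \<ge> A} x :: real)"
    by (rule integrable_gauss_bounded[where B=1]) (use assms in \<open>auto split: split_indicator\<close>)
  have "(\<integral>x. (score \<tau> x)\<^sup>2 \<partial>gauss) \<le> (\<integral>x. b x \<partial>gauss)"
  proof (rule integral_mono)
    show "integrable gauss b" unfolding b_def[abs_def] using ib ib3 by simp
    have sq: "(score \<tau> x)\<^sup>2 \<le> 1" for x
      using abs_score_le[of \<tau> x] by (simp add: abs_square_le_1)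
    then show "integrable gauss (\<lambda>x. (score \<tau> x)\<^sup>2)"
      by (intro integrable_gauss_bounded[where B=1]) auto
    fix x
    show "(score \<tau> x)\<^sup>2 \<le> b x"
    proof (cases "\<bar>x\<bar> \<ge> A")
      case False
      have "(score \<tau> x)\<^sup>2 \<le> (8 * \<tau> * exp (x\<^sup>2/2))\<^sup>2"
        using abs_score_le_exp[of \<tau> x] assms by (subst abs_le_square_iff[symmetric]) auto
      also have "\<dots> = 64 * \<tau>\<^sup>2 * exp (x\<^sup>2)"
        by (simp add: power_mult_distrib exp_double[symmetric])
      also have "\<dots> \<le> b x" using False assms by (auto simp: b_def abs_le_iff split: split_indicator)
      finally show ?thesis .
    next
      case True
      then have "1 \<le> b x" by (simp add: b_def indicator_def)
      then show ?thesis using sq[of x] by linarith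
    qed
  qed
  also have "\<dots> = (\<integral>x. indicator {-A..A} x * (64 * \<tau>\<^sup>2 * exp (x\<^sup>2)) \<partial>gauss) + 2 * normal_tail A"
    unfolding b_def using ib ib3 assms
    by (simp add: measure_gauss_two_sided)
  also have "(\<integral>x. indicator {-A..A} x * (64 * \<tau>\<^sup>2 * exp (x\<^sup>2)) \<partial>gauss)
      = (\<integral>x. std_normal_density x * (indicator {-A..A} x * (64 * \<tau>\<^sup>2 * exp (x\<^sup>2))) \<partial>lborel)"
    by (rule integral_gauss) simp
  also have "\<dots> \<le> (\<integral>x. 64 * \<tau>\<^sup>2 * (exp (A * x / 2) * indicator {0..A} x) + 64 * \<tau>\<^sup>2 * (exp (A * (- x) / 2) * indicator {-A..0} x) \<partial>lborel)"
  proof (rule integral_mono')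
    show "integrable lborel (\<lambda>x. 64 * \<tau>\<^sup>2 * (exp (A * x / 2) * indicator {0..A} x) + 64 * \<tau>\<^sup>2 * (exp (A * (- x) / 2) * indicator {-A..0} x))"
      by (intro Bochner_Integration.integrable_add integrable_mult_right integrable.intros[OF i1] integrable.intros[OF i2])
    fix x :: real
    show "std_normal_density x * (indicator {-A..A} x * (64 * \<tau>\<^sup>2 * exp (x\<^sup>2))) \<le>
       64 * \<tau>\<^sup>2 * (exp (A * x / 2) * indicator {0..A} x) + 64 * \<tau>\<^sup>2 * (exp (A * (- x) / 2) * indicator {-A..0} x)"
    proof (cases "x \<in> {-A..A}")
      case True
      then have "\<bar>x\<bar> * \<bar>x\<bar> \<le> A * \<bar>x\<bar>" by (intro mult_right_mono) auto
      then have "x\<^sup>2 \<le> A * \<bar>x\<bar>" by (simp add: power2_eq_square abs_if split: if_splits)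
      have "std_normal_density x * exp (x\<^sup>2) \<le> exp (- x\<^sup>2/2) * exp (x\<^sup>2)"
        using std_normal_density_le_exp by (intro mult_right_mono) auto
      also have "\<dots> = exp (x\<^sup>2 / 2)" by (simp add: exp_add[symmetric])
      also have "\<dots> \<le> exp (A * \<bar>x\<bar> / 2)" using \<open>x\<^sup>2 \<le> A * \<bar>x\<bar>\<close> by simp
      also have "\<dots> \<le> exp (A * x / 2) * indicator {0..A} x + exp (A * (- x) / 2) * indicator {-A..0} x"
        using True by (cases "x \<ge> 0") (auto split: split_indicator)
      finally have "(64 * \<tau>\<^sup>2) * (std_normal_density x * exp (x\<^sup>2)) \<le>
         (64 * \<tau>\<^sup>2) * (exp (A * x / 2) * indicator {0..A} x + exp (A * (- x) / 2) * indicator {-A..0} x)"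
        by (intro mult_left_mono) auto
      moreover have "std_normal_density x * (indicator {-A..A} x * (64 * \<tau>\<^sup>2 * exp (x\<^sup>2))) = (64 * \<tau>\<^sup>2) * (std_normal_density x * exp (x\<^sup>2))"
        using True by simp
      ultimately show ?thesis by (simp only: distrib_left)
    qed simp
  qed (auto split: split_indicator)
  also have "\<dots> = 64 * \<tau>\<^sup>2 * (2/A * exp (A * A / 2) - 2/A * exp (A * 0 / 2)) +
      64 * \<tau>\<^sup>2 * (- (2/A) * exp (A * - 0 / 2) - - (2/A) * exp (A * - (-A) / 2))"
    by (intro has_bochner_integral_integral_eq has_bochner_integral_add has_bochner_integral_mult_right i1 i2)
  also have "\<dots> \<le> 256 * \<tau>\<^sup>2 * exp (A\<^sup>2 / 2) / A"
    using assms by (simp add: power2_eq_square[of A] divide_simps)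
  finally show ?thesis by simp
qed

subsection \<open>The excess tail mass\<close>

text \<open>The prior mass beyond a large \<open>x\<close> is about \<open>c0 * \<tau> / x\<close>: the half-Cauchy mass beyond \<open>l\<close> is
  about \<open>2 / (pi * l)\<close>, and the positive part of a standard normal variable has mean \<open>1 / sqrt (2 * pi)\<close>.\<close>

definition c0 :: real where
  "c0 = 2 / pi * (1 / sqrt (2 * pi))"

lemma c0_pos: "c0 > 0"
  by (simp add: c0_def)

lemma half_cauchy_density_le: "l > 0 \<Longrightarrow> half_cauchy_density l \<le> 2 / (pi * l\<^sup>2)"
  by (simp add: half_cauchy_density_def divide_simps)

lemma nn_integral_inverse_square:
  assumes "a > 0"
  shows "(\<integral>\<^sup>+l. ennreal (2 / (pi * l\<^sup>2)) * indicator {a..} l \<partial>lborel) = ennreal (2 / (pi * a))"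
proof -
  have "(\<integral>\<^sup>+l. ennreal (2 / (pi * l\<^sup>2)) * indicator {a..} l \<partial>lborel) = ennreal (0 - - 2 / (pi * a))"
  proof (rule nn_integral_FTC_atLeast)
    show "DERIV (\<lambda>l. - 2 / (pi * l)) l :> 2 / (pi * l\<^sup>2)" if "a \<le> l" for l
    proof -
      have "l > 0" using that assms by simp
      then have "DERIV (\<lambda>l. - (2 / pi) * inverse l) l :> - (2 / pi) * - (inverse l * inverse l)"
        by (intro derivative_eq_intros) (auto simp: power2_eq_square)
      then show ?thesis using \<open>l > 0\<close> by (simp add: field_simps power2_eq_square)
    qed
    show "((\<lambda>l. - 2 / (pi * l)) \<longlongrightarrow> 0) at_top"
      by real_asymp
  qed auto
  then show ?thesis by simp
qed

text \<open>The substitution w = r / l leaves \<open>normal_tail\<close>, whose antiderivative is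
  minus \<open>tail_integral\<close>.\<close>

lemma nn_integral_inverse_square_tail:
  assumes "a > 0" "r > 0"
  shows "(\<integral>\<^sup>+l. ennreal (2 / (pi * l\<^sup>2) * normal_tail (r / l)) * indicator {a..} l \<partial>lborel)
    = ennreal (2 / (pi * r) * (tail_integral 0 - tail_integral (r / a)))"
proof -
  have "(\<integral>\<^sup>+l. ennreal (2 / (pi * l\<^sup>2) * normal_tail (r / l)) * indicator {a..} l \<partial>lborel)
    = ennreal (2 / (pi * r) * tail_integral 0 - 2 / (pi * r) * tail_integral (r / a))"
  proof (rule nn_integral_FTC_atLeast[where F = "\<lambda>l. 2 / (pi * r) * tail_integral (r / l)"])
    show "DERIV (\<lambda>l. 2 / (pi * r) * tail_integral (r / l)) l :> 2 / (pi * l\<^sup>2) * normal_tail (r / l)" if "a \<le> l" for l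
    proof -
      have l: "l > 0" using that assms by simp
      have "DERIV (\<lambda>l. tail_integral (r / l)) l :> - normal_tail (r / l) * ((0 * l - r * 1) / (l * l))"
        using l by (intro tail_integral_deriv' derivative_intros) auto
      then have "DERIV (\<lambda>l. 2 / (pi * r) * tail_integral (r / l)) l :> 2 / (pi * r) * (- normal_tail (r / l) * ((0 * l - r * 1) / (l * l)))"
        by (rule DERIV_cmult)
      also have "2 / (pi * r) * (- normal_tail (r / l) * ((0 * l - r * 1) / (l * l))) = 2 / (pi * l\<^sup>2) * normal_tail (r / l)"
        using l assms by (simp add: field_simps power2_eq_square)
      finally show ?thesis .
    qed
    have "((\<lambda>l. r / l) \<longlongrightarrow> 0) at_top" by real_asymp
    moreover have "isCont tail_integral 0" using tail_integral_deriv by (rule DERIV_isCont)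
    ultimately have "((\<lambda>l. tail_integral (r / l)) \<longlongrightarrow> tail_integral 0) at_top"
      by (rule isCont_tendsto_compose[rotated])
    then show "((\<lambda>l. 2 / (pi * r) * tail_integral (r / l)) \<longlongrightarrow> 2 / (pi * r) * tail_integral 0) at_top"
      by (intro tendsto_intros)
  qed (use assms in auto)
  then show ?thesis by (simp add: right_diff_distrib)
qed

lemma measure_half_cauchy:
  "A \<in> sets borel \<Longrightarrow> ennreal (measure half_cauchy A) = (\<integral>\<^sup>+l. ennreal (half_cauchy_density l) * indicator A l \<partial>lborel)"
  unfolding half_cauchy.emeasure_eq_measure[symmetric] by (simp add: half_cauchy_def emeasure_density)

lemma half_cauchy_tail_le:
  assumes "a > 0"
  shows "measure half_cauchy {l. a \<le> \<bar>l\<bar>} \<le> 1 / a"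
proof -
  have "ennreal (measure half_cauchy {l. a \<le> \<bar>l\<bar>}) = (\<integral>\<^sup>+l. ennreal (half_cauchy_density l) * indicator {l. a \<le> \<bar>l\<bar>} l \<partial>lborel)"
    by (rule measure_half_cauchy) simp
  also have "\<dots> \<le> (\<integral>\<^sup>+l. ennreal (2 / (pi * l\<^sup>2)) * indicator {a..} l \<partial>lborel)"
  proof (rule nn_integral_mono)
    fix l
    show "ennreal (half_cauchy_density l) * indicator {l. a \<le> \<bar>l\<bar>} l \<le> ennreal (2 / (pi * l\<^sup>2)) * indicator {a..} l"
      using half_cauchy_density_le[of l] assms
      by (cases "l > 0") (auto intro!: ennreal_leI simp: half_cauchy_density_def split: split_indicator)
  qed
  also have "\<dots> = ennreal (2 / (pi * a))" using assms by (rule nn_integral_inverse_square)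
  finally have "measure half_cauchy {l. a \<le> \<bar>l\<bar>} \<le> 2 / (pi * a)" using assms by (simp add: ennreal_le_iff)
  also have "\<dots> \<le> 1 / a" using assms pi_gt3 by (simp add: divide_simps)
  finally show ?thesis .
qed

lemma sqrt_one_plus_sq_ge_1: "1 \<le> sqrt (1 + (u::real)\<^sup>2)"
  by simp

lemma tail_diff_nonneg:
  assumes "x \<ge> 0"
  shows "0 \<le> normal_tail (x / sqrt (1 + u\<^sup>2)) - normal_tail x"
proof -
  have "x / sqrt (1 + u\<^sup>2) \<le> x / 1" using assms by (intro divide_left_mono sqrt_one_plus_sq_ge_1) auto
  then show ?thesis using normal_tail_antimono by simp
qed

lemma ennreal_tail_excess:
  assumes "x \<ge> 0"
  shows "ennreal (tail_excess \<tau> x) =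
    (\<integral>\<^sup>+l. ennreal (half_cauchy_density l * (normal_tail (x / sqrt (1 + (l * \<tau>)\<^sup>2)) - normal_tail x)) \<partial>lborel)"
proof -
  have "ennreal (tail_excess \<tau> x) = (\<integral>\<^sup>+l. ennreal (normal_tail (x / sqrt (1 + (l * \<tau>)\<^sup>2)) - normal_tail x) \<partial>half_cauchy)"
    unfolding tail_excess_eq using tail_diff_nonneg[OF assms]
    by (intro nn_integral_eq_integral[symmetric] Bochner_Integration.integrable_diff
        integrable_half_cauchy_bounded[where B=1]) auto
  also have "\<dots> = (\<integral>\<^sup>+l. ennreal (half_cauchy_density l * (normal_tail (x / sqrt (1 + (l * \<tau>)\<^sup>2)) - normal_tail x)) \<partial>lborel)"
    by (subst nn_integral_half_cauchy) (auto simp: ennreal_mult')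
  finally show ?thesis .
qed

text \<open>For |u| \<le> 1 the reduced argument is at least x / sqrt 2, so the density at the
  intermediate point of the mean value theorem is at most exp (- x^2 / 4).\<close>

lemma small_scale_tail_diff:
  assumes "x > 0" "\<bar>u\<bar> \<le> 1"
  shows "normal_tail (x / sqrt (1 + u\<^sup>2)) - normal_tail x \<le> x * u\<^sup>2 / 2 * exp (- x\<^sup>2 / 4)"
proof (cases "u = 0")
  case False
  define y where "y = x / sqrt (1 + u\<^sup>2)"
  have u1: "u\<^sup>2 \<le> 1" using assms by (simp add: abs_square_le_1)
  have "1 < sqrt (1 + u\<^sup>2)" using False by simp
  then have "y < x / 1" unfolding y_def using assms by (intro divide_strict_left_mono) auto
  then have yx: "y < x" by simp
  obtain z where z: "y < z" "z < x" "normal_tail x - normal_tail y = (x - y) * - std_normal_density z"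
    using MVT2[where f = normal_tail and f' = "\<lambda>z. - std_normal_density z" and a = y and b = x, OF yx]
      normal_tail_has_derivative by blast
  have y0: "y > 0" using assms by (simp add: y_def)
  have ysq: "y\<^sup>2 = x\<^sup>2 / (1 + u\<^sup>2)" by (simp add: y_def power_divide)
  have "x\<^sup>2 / 2 \<le> x\<^sup>2 / (1 + u\<^sup>2)" using u1 by (intro divide_left_mono mult_pos_pos one_plus_sq_pos) auto
  also have "\<dots> \<le> z\<^sup>2" unfolding ysq[symmetric] using z y0 by (intro power_mono) auto
  finally have "std_normal_density z \<le> exp (- x\<^sup>2 / 4)"
    using std_normal_density_le_exp[of z] by (intro order_trans[OF std_normal_density_le_exp]) simp
  moreover have "x - y \<le> x * u\<^sup>2 / 2"
  proof -
    have "1 - u\<^sup>2 / 2 \<le> 1 / sqrt (1 + u\<^sup>2)" using gker_ge_0[of u] by (simp add: gker_def)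
    then have "x * (1 - u\<^sup>2 / 2) \<le> x * (1 / sqrt (1 + u\<^sup>2))" using assms by (intro mult_left_mono) auto
    then show ?thesis by (simp add: y_def right_diff_distrib)
  qed
  ultimately have "(x - y) * std_normal_density z \<le> x * u\<^sup>2 / 2 * exp (- x\<^sup>2 / 4)"
    using yx assms by (intro mult_mono) auto
  then show ?thesis using z by (simp add: y_def)
qed simp

text \<open>Three ranges of u = l \<tau>: up to 1 the two tails differ by an exponentially small
  amount; from 1 to a the larger tail is itself small; beyond a, sqrt (1 + u^2) is at most u /
  \<open>rho\<close>, with \<open>rho\<close> near 1 for large a. Only the last range survives in
  the limit.\<close>

lemma tail_excess_le:
  assumes "x > 0" "\<tau> > 0" "a \<ge> 1"
  shows "tail_excess \<tau> x \<le> \<tau> / x *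
    (x\<^sup>2 * exp (- x\<^sup>2 / 4) + x * normal_tail (x / sqrt (1 + a\<^sup>2)) + c0 * (sqrt (1 + a\<^sup>2) / a))"
proof -
  define rho where "rho = a / sqrt (1 + a\<^sup>2)"
  define t1 t2 t3 where "t1 = x * \<tau>\<^sup>2 * exp (- x\<^sup>2 / 4)" and "t2 = normal_tail (x / sqrt (1 + a\<^sup>2))"
    and "t3 = 2 / (pi * (rho * x / \<tau>)) * tail_integral 0"
  have rho: "rho > 0" using assms by (simp add: rho_def)
  have "ennreal (tail_excess \<tau> x) \<le> (\<integral>\<^sup>+l. ennreal t1 * indicator {0..1/\<tau>} l
      + (ennreal t2 * (ennreal (2 / (pi * l\<^sup>2)) * indicator {1/\<tau>..} l)
      + ennreal (2 / (pi * l\<^sup>2) * normal_tail (rho * x / \<tau> / l)) * indicator {a/\<tau>..} l) \<partial>lborel)"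
    unfolding ennreal_tail_excess[OF less_imp_le[OF assms(1)]]
  proof (rule nn_integral_mono)
    fix l :: real
    let ?f = "normal_tail (x / sqrt (1 + (l * \<tau>)\<^sup>2)) - normal_tail x"
    have f0: "0 \<le> ?f" by (rule tail_diff_nonneg) (use assms in simp)
    show "ennreal (half_cauchy_density l * ?f) \<le> ennreal t1 * indicator {0..1/\<tau>} l
      + (ennreal t2 * (ennreal (2 / (pi * l\<^sup>2)) * indicator {1/\<tau>..} l)
      + ennreal (2 / (pi * l\<^sup>2) * normal_tail (rho * x / \<tau> / l)) * indicator {a/\<tau>..} l)"
    proof (cases "l > 0")
      case False
      then show ?thesis by (simp add: half_cauchy_density_def)
    next
      case l: True
      have hc: "half_cauchy_density l * ?f \<le> 2 / (pi * l\<^sup>2) * ?f"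
        by (intro mult_right_mono half_cauchy_density_le l f0)
      consider "l \<le> 1/\<tau>" | "l > 1/\<tau>" "l < a/\<tau>" | "l \<ge> a/\<tau>" by linarith
      then show ?thesis
      proof cases
        case 1
        then have "\<bar>l * \<tau>\<bar> \<le> 1" using assms l by (simp add: field_simps)
        from small_scale_tail_diff[OF assms(1) this]
        have "2 / (pi * l\<^sup>2) * ?f \<le> 2 / (pi * l\<^sup>2) * (x * (l * \<tau>)\<^sup>2 / 2 * exp (- x\<^sup>2 / 4))"
          by (intro mult_left_mono) auto
        also have "\<dots> = t1 / pi" using l by (simp add: t1_def power_mult_distrib field_simps)
        also have "\<dots> \<le> t1 / 1" using pi_gt3 assms by (intro divide_left_mono) (auto simp: t1_def)
        finally have "half_cauchy_density l * ?f \<le> t1" using hc by simp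
        then have "ennreal (half_cauchy_density l * ?f) \<le> ennreal t1" by (rule ennreal_leI)
        then show ?thesis using 1 l by (simp add: add_increasing2)
      next
        case 2
        have "(l * \<tau>)\<^sup>2 \<le> a\<^sup>2" using 2 l assms by (intro power_mono) (auto simp: field_simps)
        then have "x / sqrt (1 + a\<^sup>2) \<le> x / sqrt (1 + (l * \<tau>)\<^sup>2)" using assms
          by (intro divide_left_mono) (auto intro: mult_pos_pos)
        then have "?f \<le> t2" using normal_tail_antimono normal_tail_nonneg[of x]
          unfolding t2_def by (smt (verit))
        then have "2 / (pi * l\<^sup>2) * ?f \<le> 2 / (pi * l\<^sup>2) * t2" by (intro mult_left_mono) auto
        with hc have "ennreal (half_cauchy_density l * ?f) \<le> ennreal (t2 * (2 / (pi * l\<^sup>2)))"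
          by (intro ennreal_leI) (simp add: mult.commute)
        then have "ennreal (half_cauchy_density l * ?f) \<le> ennreal t2 * (ennreal (2 / (pi * l\<^sup>2)) * indicator {1/\<tau>..} l)"
          using 2 by (subst (asm) ennreal_mult) (auto simp: t2_def)
        then show ?thesis by (simp add: add_increasing add_increasing2)
      next
        case 3
        have la: "a \<le> l * \<tau>" using 3 assms by (simp add: field_simps)
        have "rho \<le> l * \<tau> / sqrt (1 + (l * \<tau>)\<^sup>2)"
        proof -
          have "a\<^sup>2 / (1 + a\<^sup>2) \<le> (l * \<tau>)\<^sup>2 / (1 + (l * \<tau>)\<^sup>2)"
          proof -
            have "a\<^sup>2 \<le> (l * \<tau>)\<^sup>2" using la assms by (intro power_mono) auto
            then have "1 / (1 + (l * \<tau>)\<^sup>2) \<le> 1 / (1 + a\<^sup>2)" by (intro divide_left_mono mult_pos_pos one_plus_sq_pos) auto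
            moreover have "v\<^sup>2 / (1 + v\<^sup>2) = 1 - 1 / (1 + v\<^sup>2)" for v :: real
              using one_plus_sq_nz(1)[of v] by (simp only: divide_simps) simp
            ultimately show ?thesis by simp
          qed
          then have "sqrt (a\<^sup>2 / (1 + a\<^sup>2)) \<le> sqrt ((l * \<tau>)\<^sup>2 / (1 + (l * \<tau>)\<^sup>2))" by simp
          then show ?thesis unfolding rho_def real_sqrt_divide using assms l by simp
        qed
        then have "rho * x / \<tau> / l \<le> (l * \<tau> / sqrt (1 + (l * \<tau>)\<^sup>2)) * x / \<tau> / l"
          using assms l by (intro divide_right_mono mult_right_mono) auto
        also have "\<dots> = x / sqrt (1 + (l * \<tau>)\<^sup>2)" using assms l by (simp add: field_simps)
        finally have "?f \<le> normal_tail (rho * x / \<tau> / l)"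
          using normal_tail_antimono[of "rho * x / \<tau> / l" "x / sqrt (1 + (l * \<tau>)\<^sup>2)"] normal_tail_nonneg[of x] by linarith
        then have "2 / (pi * l\<^sup>2) * ?f \<le> 2 / (pi * l\<^sup>2) * normal_tail (rho * x / \<tau> / l)" by (intro mult_left_mono) auto
        with hc have "ennreal (half_cauchy_density l * ?f) \<le> ennreal (2 / (pi * l\<^sup>2) * normal_tail (rho * x / \<tau> / l))"
          by (intro ennreal_leI) linarith
        then show ?thesis using 3 by (simp add: add_increasing)
      qed
    qed
  qed
  also have "\<dots> = (\<integral>\<^sup>+l. ennreal t1 * indicator {0..1/\<tau>} l \<partial>lborel)
      + ((\<integral>\<^sup>+l. ennreal t2 * (ennreal (2 / (pi * l\<^sup>2)) * indicator {1/\<tau>..} l) \<partial>lborel)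
      + (\<integral>\<^sup>+l. ennreal (2 / (pi * l\<^sup>2) * normal_tail (rho * x / \<tau> / l)) * indicator {a/\<tau>..} l \<partial>lborel))"
    by (simp add: nn_integral_add)
  also have "(\<integral>\<^sup>+l. ennreal t1 * indicator {0..1/\<tau>} l \<partial>lborel) = ennreal (t1 * (1/\<tau>))"
    using assms by (subst nn_integral_cmult_indicator) (auto simp: ennreal_mult''[symmetric] t1_def)
  also have "(\<integral>\<^sup>+l. ennreal t2 * (ennreal (2 / (pi * l\<^sup>2)) * indicator {1/\<tau>..} l) \<partial>lborel) = ennreal (t2 * (2 / (pi * (1/\<tau>))))"
    using assms by (subst nn_integral_cmult) (simp_all add: nn_integral_inverse_square ennreal_mult'[symmetric] t2_def)
  also have "(\<integral>\<^sup>+l. ennreal (2 / (pi * l\<^sup>2) * normal_tail (rho * x / \<tau> / l)) * indicator {a/\<tau>..} l \<partial>lborel)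
      = ennreal (2 / (pi * (rho * x / \<tau>)) * (tail_integral 0 - tail_integral (rho * x / \<tau> / (a / \<tau>))))"
    using assms rho by (intro nn_integral_inverse_square_tail) auto
  also have "ennreal (t1 * (1/\<tau>)) + (ennreal (t2 * (2 / (pi * (1/\<tau>))))
      + ennreal (2 / (pi * (rho * x / \<tau>)) * (tail_integral 0 - tail_integral (rho * x / \<tau> / (a / \<tau>)))))
      \<le> ennreal (t1 * (1/\<tau>)) + (ennreal (t2 * (2 / (pi * (1/\<tau>)))) + ennreal t3)"
    using assms rho tail_integral_nonneg unfolding t3_def by (intro add_left_mono ennreal_leI mult_left_mono) auto
  also have "ennreal (t1 * (1/\<tau>)) + (ennreal (t2 * (2 / (pi * (1/\<tau>)))) + ennreal t3) = ennreal (t1 * (1/\<tau>) + (t2 * (2 / (pi * (1/\<tau>))) + t3))"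
    using assms rho by (subst ennreal_plus[symmetric]; (subst ennreal_plus[symmetric])?)
      (auto simp: t1_def t2_def t3_def tail_integral_0)
  finally have "tail_excess \<tau> x \<le> t1 * (1/\<tau>) + (t2 * (2 / (pi * (1/\<tau>))) + t3)"
    using assms rho by (subst (asm) ennreal_le_iff) (auto simp: t1_def t2_def t3_def tail_integral_0 intro!: add_nonneg_nonneg)
  also have "t2 * (2 / (pi * (1/\<tau>))) \<le> t2 * \<tau>"
    using assms pi_gt3 by (intro mult_left_mono) (auto simp: field_simps t2_def)
  also have "t1 * (1/\<tau>) + (t2 * \<tau> + t3) = \<tau> / x *
    (x\<^sup>2 * exp (- x\<^sup>2 / 4) + x * normal_tail (x / sqrt (1 + a\<^sup>2)) + c0 * (sqrt (1 + a\<^sup>2) / a))"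
    using assms by (simp add: t1_def t2_def t3_def c0_def rho_def tail_integral_0 field_simps power2_eq_square)
  finally show ?thesis by simp
qed

text \<open>Only l \<ge> 1 / \<tau> is kept. There sqrt (1 + (l \<tau>)^2) \<ge> l \<tau> leads to
  an integral in closed form, and 1 + l^2 \<le> (1 + \<tau>^2) l^2 replaces the half-Cauchy density
  by 2 / (pi l^2).\<close>

lemma tail_excess_ge:
  assumes "x > 0" "\<tau> > 0"
  shows "tail_excess \<tau> x \<ge> \<tau> / x * (c0 - tail_integral x - x * normal_tail x) / (1 + \<tau>\<^sup>2)"
proof -
  have "(\<integral>\<^sup>+l. ennreal (2 / (pi * l\<^sup>2) * normal_tail (x / \<tau> / l)) * indicator {1/\<tau>..} l \<partial>lborel)
     \<le> (\<integral>\<^sup>+l. ennreal (1 + \<tau>\<^sup>2) * ennreal (half_cauchy_density l * (normal_tail (x / sqrt (1 + (l * \<tau>)\<^sup>2)) - normal_tail x))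
         + ennreal (normal_tail x) * (ennreal (2 / (pi * l\<^sup>2)) * indicator {1/\<tau>..} l) \<partial>lborel)"
  proof (rule nn_integral_mono)
    fix l :: real
    let ?f = "normal_tail (x / sqrt (1 + (l * \<tau>)\<^sup>2)) - normal_tail x"
    show "ennreal (2 / (pi * l\<^sup>2) * normal_tail (x / \<tau> / l)) * indicator {1/\<tau>..} l
       \<le> ennreal (1 + \<tau>\<^sup>2) * ennreal (half_cauchy_density l * ?f)
         + ennreal (normal_tail x) * (ennreal (2 / (pi * l\<^sup>2)) * indicator {1/\<tau>..} l)"
    proof (cases "l \<ge> 1/\<tau>")
      case True
      have l: "l > 0" using True assms by (smt (verit) divide_pos_pos)
      have "l * \<tau> \<le> sqrt (1 + (l * \<tau>)\<^sup>2)" by (rule real_le_rsqrt) simp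
      then have "x / sqrt (1 + (l * \<tau>)\<^sup>2) \<le> x / (l * \<tau>)" using assms l by (intro divide_left_mono) auto
      then have f: "normal_tail (x / \<tau> / l) - normal_tail x \<le> ?f" using normal_tail_antimono by (simp add: mult.commute)
      have "2 / (pi * l\<^sup>2) \<le> (1 + \<tau>\<^sup>2) * half_cauchy_density l"
      proof -
        have "1 \<le> \<tau>\<^sup>2 * l\<^sup>2" using True assms l power_mono[of 1 "\<tau> * l" 2]
          by (simp add: power_mult_distrib field_simps)
        then have "1 + l\<^sup>2 \<le> (1 + \<tau>\<^sup>2) * l\<^sup>2" by (simp add: algebra_simps)
        then have "2 / (pi * l\<^sup>2) \<le> (2 * (1 + \<tau>\<^sup>2)) / (pi * (1 + l\<^sup>2))"
        proof -
          have "2 / (pi * l\<^sup>2) = (2 * (1 + \<tau>\<^sup>2)) / ((pi * l\<^sup>2) * (1 + \<tau>\<^sup>2))"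
            by (rule mult_divide_mult_cancel_right[symmetric]) simp
          also have "\<dots> = (2 * (1 + \<tau>\<^sup>2)) / (pi * ((1 + \<tau>\<^sup>2) * l\<^sup>2))" by (simp only: mult_ac)
          also have "\<dots> \<le> (2 * (1 + \<tau>\<^sup>2)) / (pi * (1 + l\<^sup>2))"
            using l \<open>1 + l\<^sup>2 \<le> (1 + \<tau>\<^sup>2) * l\<^sup>2\<close>
            by (intro divide_left_mono mult_left_mono mult_pos_pos one_plus_sq_pos) auto
          finally show ?thesis .
        qed
        then show ?thesis using l by (simp add: half_cauchy_density_def mult.commute)
      qed
      moreover have "0 \<le> ?f" by (rule tail_diff_nonneg) (use assms in simp)
      ultimately have "2 / (pi * l\<^sup>2) * (normal_tail (x / \<tau> / l) - normal_tail x) \<le> (1 + \<tau>\<^sup>2) * half_cauchy_density l * ?f"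
        by (intro order_trans[OF mult_left_mono[OF f] mult_right_mono]) auto
      then have "2 / (pi * l\<^sup>2) * normal_tail (x / \<tau> / l) \<le> (1 + \<tau>\<^sup>2) * (half_cauchy_density l * ?f) + normal_tail x * (2 / (pi * l\<^sup>2))"
      proof -
        have "c * (A - B) \<le> d * h * F \<Longrightarrow> c * A \<le> d * (h * F) + B * c" for c A B d h F :: real
          by (simp add: algebra_simps)
        then show "2 / (pi * l\<^sup>2) * (normal_tail (x / \<tau> / l) - normal_tail x) \<le> (1 + \<tau>\<^sup>2) * half_cauchy_density l * ?f
          \<Longrightarrow> ?thesis" .
      qed
      then have "ennreal (2 / (pi * l\<^sup>2) * normal_tail (x / \<tau> / l)) \<le> ennreal ((1 + \<tau>\<^sup>2) * (half_cauchy_density l * ?f) + normal_tail x * (2 / (pi * l\<^sup>2)))"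
        by (rule ennreal_leI)
      also have "\<dots> = ennreal (1 + \<tau>\<^sup>2) * ennreal (half_cauchy_density l * ?f) + ennreal (normal_tail x) * ennreal (2 / (pi * l\<^sup>2))"
        using \<open>0 \<le> ?f\<close> by (subst ennreal_plus) (auto intro!: mult_nonneg_nonneg ennreal_mult'[symmetric] simp: ennreal_mult'[symmetric] simp del: ennreal_plus)
      finally show ?thesis using True by simp
    qed simp
  qed
  also have "\<dots> = ennreal (1 + \<tau>\<^sup>2) * ennreal (tail_excess \<tau> x) + ennreal (normal_tail x) * ennreal (2 / (pi * (1/\<tau>)))"
    using assms by (subst nn_integral_add)
      (auto simp: nn_integral_cmult ennreal_tail_excess nn_integral_inverse_square)
  also have "\<dots> = ennreal ((1 + \<tau>\<^sup>2) * tail_excess \<tau> x + normal_tail x * (2 / (pi * (1/\<tau>))))"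
    using tail_excess_nonneg[of x \<tau>] assms
    by (subst ennreal_plus) (auto simp: ennreal_mult'[symmetric] intro!: mult_nonneg_nonneg simp del: ennreal_plus)
  also have "(\<integral>\<^sup>+l. ennreal (2 / (pi * l\<^sup>2) * normal_tail (x / \<tau> / l)) * indicator {1/\<tau>..} l \<partial>lborel)
     = ennreal (2 / (pi * (x / \<tau>)) * (tail_integral 0 - tail_integral (x / \<tau> / (1 / \<tau>))))"
    using assms by (intro nn_integral_inverse_square_tail) auto
  finally have "2 / (pi * (x / \<tau>)) * (tail_integral 0 - tail_integral (x / \<tau> / (1 / \<tau>)))
      \<le> (1 + \<tau>\<^sup>2) * tail_excess \<tau> x + normal_tail x * (2 / (pi * (1/\<tau>)))"
    using tail_excess_nonneg[of x \<tau>] assms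
    by (subst (asm) ennreal_le_iff) (auto intro!: add_nonneg_nonneg mult_nonneg_nonneg)
  moreover have "normal_tail x * (2 / (pi * (1/\<tau>))) \<le> normal_tail x * \<tau>"
    using assms pi_gt3 by (intro mult_left_mono) (auto simp: field_simps)
  moreover have "2 / (pi * (x / \<tau>)) * (tail_integral 0 - tail_integral (x / \<tau> / (1 / \<tau>)))
      = \<tau> / x * (c0 - 2 / pi * tail_integral x)"
    using assms by (simp add: c0_def tail_integral_0 field_simps)
  moreover have "2 / pi * tail_integral x \<le> 1 * tail_integral x"
    using pi_gt3 tail_integral_nonneg by (intro mult_right_mono) auto
  then have "\<tau> / x * (c0 - tail_integral x) \<le> \<tau> / x * (c0 - 2 / pi * tail_integral x)"
    using assms by (intro mult_left_mono) auto
  moreover have "\<tau> / x * (c0 - tail_integral x - x * normal_tail x) = \<tau> / x * (c0 - tail_integral x) - normal_tail x * \<tau>"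
    using assms by (simp add: field_simps)
  ultimately have "\<tau> / x * (c0 - tail_integral x - x * normal_tail x) \<le> (1 + \<tau>\<^sup>2) * tail_excess \<tau> x"
    by linarith
  then show ?thesis by (subst pos_divide_le_eq) (simp_all only: one_plus_sq_pos mult.commute)
qed

text \<open>The estimate is uniform in x and \<tau> jointly because later both vary together. The
  cut-off a is fixed first, from sqrt (1 + a^2) / a tending to 1; X then depends on a, and t0 only
  takes care of the factor 1 + \<tau>^2.\<close>

lemma tail_excess_asymp:
  assumes "\<delta> > 0"
  shows "\<exists>X>0. \<exists>t0>0. \<forall>x\<ge>X. \<forall>\<tau>. 0 < \<tau> \<and> \<tau> \<le> t0 \<longrightarrow>
    (c0 - \<delta>) * (\<tau> / x) \<le> tail_excess \<tau> x \<and> tail_excess \<tau> x \<le> (c0 + \<delta>) * (\<tau> / x)"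
proof -
  have "((\<lambda>a. c0 * (sqrt (1 + a\<^sup>2) / a)) \<longlongrightarrow> c0 * 1) at_top"
    by (intro tendsto_intros) real_asymp
  then have "\<forall>\<^sub>F a in at_top. c0 * (sqrt (1 + a\<^sup>2) / a) < c0 + \<delta> / 2"
    using assms by (intro order_tendstoD(2)) auto
  then have "\<forall>\<^sub>F a in at_top. c0 * (sqrt (1 + a\<^sup>2) / a) < c0 + \<delta> / 2 \<and> a \<ge> (1::real)"
    using eventually_ge_at_top by (rule eventually_conj)
  then obtain a :: real where a: "c0 * (sqrt (1 + a\<^sup>2) / a) < c0 + \<delta> / 2" "a \<ge> 1"
    by (auto simp: eventually_at_top_linorder)
  have xnt: "((\<lambda>w. w * normal_tail w) \<longlongrightarrow> 0) at_top"
    using tendsto_diff[OF std_normal_density_tendsto_0 tail_integral_tendsto_0]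
    by (simp add: tail_integral_def)
  have sa: "0 < sqrt (1 + a\<^sup>2)" by simp
  have "filterlim (\<lambda>x. x / sqrt (1 + a\<^sup>2)) at_top at_top"
    using filterlim_tendsto_pos_mult_at_top[OF tendsto_const _ filterlim_ident, of "1 / sqrt (1 + a\<^sup>2)"] sa by simp
  from filterlim_compose[OF xnt this]
  have "((\<lambda>x. sqrt (1 + a\<^sup>2) * (x / sqrt (1 + a\<^sup>2) * normal_tail (x / sqrt (1 + a\<^sup>2)))) \<longlongrightarrow> sqrt (1 + a\<^sup>2) * 0) at_top"
    by (intro tendsto_intros)
  then have l1: "((\<lambda>x. x * normal_tail (x / sqrt (1 + a\<^sup>2))) \<longlongrightarrow> 0) at_top"
    using sa by (simp add: mult.assoc[symmetric])
  have l2: "((\<lambda>x::real. x\<^sup>2 * exp (- x\<^sup>2 / 4)) \<longlongrightarrow> 0) at_top" by real_asymp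
  have "((\<lambda>x. x\<^sup>2 * exp (- x\<^sup>2 / 4) + x * normal_tail (x / sqrt (1 + a\<^sup>2))) \<longlongrightarrow> 0 + 0) at_top"
    by (intro tendsto_add l1 l2)
  then have e1: "\<forall>\<^sub>F x in at_top. x\<^sup>2 * exp (- x\<^sup>2 / 4) + x * normal_tail (x / sqrt (1 + a\<^sup>2)) < \<delta> / 2"
    using assms by (intro order_tendstoD(2)) auto
  have "((\<lambda>x. tail_integral x + x * normal_tail x) \<longlongrightarrow> 0 + 0) at_top"
    by (intro tendsto_add tail_integral_tendsto_0 xnt)
  then have e2: "\<forall>\<^sub>F x in at_top. tail_integral x + x * normal_tail x < \<delta> / 2"
    using assms by (intro order_tendstoD(2)) auto
  obtain X where X: "X > 0" "\<And>x. x \<ge> X \<Longrightarrow> x\<^sup>2 * exp (- x\<^sup>2 / 4) + x * normal_tail (x / sqrt (1 + a\<^sup>2)) < \<delta> / 2"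
    "\<And>x. x \<ge> X \<Longrightarrow> tail_integral x + x * normal_tail x < \<delta> / 2"
    using eventually_conj[OF eventually_conj[OF e1 e2] eventually_gt_at_top[of 0]]
    unfolding eventually_at_top_linorder by (metis order_refl)
  have "((\<lambda>\<tau>::real. (c0 - \<delta> / 2) / (1 + \<tau>\<^sup>2)) \<longlongrightarrow> (c0 - \<delta> / 2) / (1 + 0\<^sup>2)) (at_right 0)"
    by (intro tendsto_intros) auto
  then have "\<forall>\<^sub>F \<tau> in at_right 0. c0 - \<delta> < (c0 - \<delta> / 2) / (1 + (\<tau>::real)\<^sup>2)"
    using assms by (intro order_tendstoD(1)) auto
  then obtain t1 where t1: "t1 > 0" "\<And>\<tau>. 0 < \<tau> \<Longrightarrow> \<tau> < t1 \<Longrightarrow> c0 - \<delta> < (c0 - \<delta> / 2) / (1 + (\<tau>::real)\<^sup>2)"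
    unfolding eventually_at_right_field by auto
  have "(c0 - \<delta>) * (\<tau> / x) \<le> tail_excess \<tau> x \<and> tail_excess \<tau> x \<le> (c0 + \<delta>) * (\<tau> / x)"
    if x: "x \<ge> X" and t: "0 < \<tau> \<and> \<tau> \<le> t1 / 2" for x \<tau>
  proof
    have x0: "x > 0" using x X by simp
    have "tail_excess \<tau> x \<le> \<tau> / x *
      (x\<^sup>2 * exp (- x\<^sup>2 / 4) + x * normal_tail (x / sqrt (1 + a\<^sup>2)) + c0 * (sqrt (1 + a\<^sup>2) / a))"
      using x0 t a by (intro tail_excess_le) auto
    also have "\<dots> \<le> \<tau> / x * (\<delta> / 2 + (c0 + \<delta> / 2))"
      using X(2)[OF x] a x0 t by (intro mult_left_mono add_mono) auto
    finally show "tail_excess \<tau> x \<le> (c0 + \<delta>) * (\<tau> / x)" by (simp add: mult.commute add.commute)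
    have "(c0 - \<delta>) * (\<tau> / x) \<le> (c0 - \<delta> / 2) / (1 + \<tau>\<^sup>2) * (\<tau> / x)"
      using t1(2)[of \<tau>] t1(1) t x0 by (intro mult_right_mono) auto
    also have "\<dots> = \<tau> / x * (c0 - \<delta> / 2) / (1 + \<tau>\<^sup>2)" by (simp add: mult_ac)
    also have "\<dots> \<le> \<tau> / x * (c0 - tail_integral x - x * normal_tail x) / (1 + \<tau>\<^sup>2)"
      using X(3)[OF x] x0 t by (intro divide_right_mono mult_left_mono) auto
    also have "\<dots> \<le> tail_excess \<tau> x" using x0 t by (intro tail_excess_ge) auto
    finally show "(c0 - \<delta>) * (\<tau> / x) \<le> tail_excess \<tau> x" .
  qed
  then show ?thesis using X(1) t1(1) by (meson half_gt_zero)
qed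

subsection \<open>The score at large observations\<close>

text \<open>Only scales with x \<le> l \<tau> \<le> 2 x are kept. There the exponent of
  \<open>gker\<close> is within 1 / 2 of its supremum x^2 / 2, the standard deviation is at most 5 x
  / 2, and the half-Cauchy mass is at least \<tau> / (10 x).\<close>

lemma lik_ratio_large_ge:
  assumes "x \<ge> 1" "0 < \<tau>" "\<tau> \<le> 1"
  shows "lik_ratio \<tau> x \<ge> \<tau> * exp (x\<^sup>2 / 2) / (50 * x\<^sup>2)"
proof -
  define I where "I = {x / \<tau>..2 * x / \<tau>}"
  define g where "g = exp (x\<^sup>2 / 2) / (5 * x)"
  have g: "gker x (l * \<tau>) \<ge> g" if "l \<in> I" for l
  proof -
    have u: "x \<le> l * \<tau>" "l * \<tau> \<le> 2 * x" using that assms by (auto simp: I_def field_simps)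
    have u2: "x\<^sup>2 \<le> (l * \<tau>)\<^sup>2" "(l * \<tau>)\<^sup>2 \<le> (2 * x)\<^sup>2" using u assms by (intro power_mono; simp)+
    define v where "v = (l * \<tau>)\<^sup>2"
    have v: "x\<^sup>2 \<le> v" "v \<le> 4 * x\<^sup>2" using u2 by (auto simp: v_def power_mult_distrib)
    have x1: "1 \<le> x\<^sup>2" using assms by simp
    have "x\<^sup>2 * v / (2 * (1 + v)) = x\<^sup>2 / 2 - x\<^sup>2 / (2 * (1 + v))"
      using v x1 by (simp add: field_simps)
    moreover have "x\<^sup>2 / (2 * (1 + v)) \<le> 1 / 2" using v x1 by (simp add: field_simps)
    ultimately have "exp (x\<^sup>2 / 2 - 1 / 2) \<le> exp (x\<^sup>2 * v / (2 * (1 + v)))" by simp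
    moreover have "sqrt (1 + v) \<le> 5 / 2 * x"
      by (rule real_le_lsqrt) (use v x1 assms in \<open>auto simp: power_mult_distrib power2_eq_square\<close>)
    ultimately have "exp (x\<^sup>2 / 2 - 1 / 2) / (5 / 2 * x) \<le> gker x (l * \<tau>)"
      unfolding gker_def v_def[symmetric] using v x1 by (intro frac_le) auto
    moreover have "exp (x\<^sup>2 / 2) / 2 \<le> exp (x\<^sup>2 / 2 - 1 / 2)"
    proof -
      have "1/2 \<le> exp (- 1/2 :: real)" using exp_ge_add_one_self[of "-1/2 :: real"] by simp
      then have "exp (x\<^sup>2 / 2) * (1/2) \<le> exp (x\<^sup>2 / 2) * exp (- 1/2)" by (intro mult_left_mono) auto
      then show ?thesis by (simp add: exp_add[symmetric])
    qed
    then have "exp (x\<^sup>2 / 2) / 2 / (5 / 2 * x) \<le> exp (x\<^sup>2 / 2 - 1 / 2) / (5 / 2 * x)"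
      using assms by (intro divide_right_mono) auto
    ultimately show ?thesis by (simp add: g_def)
  qed
  have meas: "measure half_cauchy I \<ge> \<tau> / (10 * x)"
  proof -
    define h where "h = 2 / (pi * (5 * x\<^sup>2 / \<tau>\<^sup>2))"
    have "ennreal (\<tau> / (10 * x)) \<le> ennreal (h * (x / \<tau>))"
      using assms pi_less_4 by (intro ennreal_leI) (simp add: h_def field_simps power2_eq_square)
    also have "\<dots> = (\<integral>\<^sup>+l. ennreal h * indicator I l \<partial>lborel)"
      using assms by (subst nn_integral_cmult_indicator)
        (auto simp: I_def h_def ennreal_mult'[symmetric] divide_right_mono diff_divide_distrib[symmetric])
    also have "\<dots> \<le> (\<integral>\<^sup>+l. ennreal (half_cauchy_density l) * indicator I l \<partial>lborel)"
    proof (rule nn_integral_mono)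
      fix l
      have "h \<le> half_cauchy_density l" if "l \<in> I"
      proof -
        have l: "0 < l" "l \<le> 2 * x / \<tau>" using that assms by (auto simp: I_def intro: less_le_trans[of 0 "x/\<tau>"])
        have "l\<^sup>2 \<le> (2 * x / \<tau>)\<^sup>2" using l by (intro power_mono) auto
        then have l2: "l\<^sup>2 \<le> 4 * x\<^sup>2 / \<tau>\<^sup>2" by (simp add: power_divide power_mult_distrib)
        have "1 \<le> x / \<tau>" using assms by simp
        then have "1\<^sup>2 \<le> (x / \<tau>)\<^sup>2" by (intro power_mono) auto
        then have "1 \<le> x\<^sup>2 / \<tau>\<^sup>2" by (simp add: power_divide)
        with l2 have "1 + l\<^sup>2 \<le> 5 * x\<^sup>2 / \<tau>\<^sup>2" by simp
        then have "h \<le> 2 / (pi * (1 + l\<^sup>2))" unfolding h_def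
          using \<open>1 \<le> x\<^sup>2 / \<tau>\<^sup>2\<close> assms by (intro divide_left_mono mult_left_mono mult_pos_pos one_plus_sq_pos) auto
        then show ?thesis using l by (simp add: half_cauchy_density_def)
      qed
      then show "ennreal h * indicator I l \<le> ennreal (half_cauchy_density l) * indicator I l"
        by (auto split: split_indicator intro: ennreal_leI)
    qed
    also have "\<dots> = ennreal (measure half_cauchy I)"
      by (simp add: measure_half_cauchy I_def)
    finally show ?thesis by (simp add: ennreal_le_iff)
  qed
  have "\<tau> * exp (x\<^sup>2 / 2) / (50 * x\<^sup>2) = g * (\<tau> / (10 * x))"
    by (simp add: g_def power2_eq_square)
  also have "\<dots> \<le> g * measure half_cauchy I" using meas assms by (intro mult_left_mono) (auto simp: g_def)
  also have "\<dots> = (\<integral>l. g * indicator I l \<partial>half_cauchy)" by (simp add: I_def)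
  also have "\<dots> \<le> lik_ratio \<tau> x"
    unfolding lik_ratio_def
  proof (rule integral_mono)
    show "integrable half_cauchy (\<lambda>l. g * indicator I l)"
      by (rule integrable_half_cauchy_bounded[where B="\<bar>g\<bar>"]) (auto simp: I_def split: split_indicator)
    show "g * indicator I l \<le> gker x (l * \<tau>)" for l using g[of l] by (auto split: split_indicator)
  qed simp
  finally show ?thesis .
qed

text \<open>1 - score is the mean of (1 - \<open>kap\<close>) \<open>gker\<close> over the
  likelihood ratio. For |l| \<le> a the kernel is at most 2 and 1 - \<open>kap\<close> has mean 1;
  beyond a, 1 - \<open>kap\<close> is at most 2 / a^2 on a set of mass at most 1 / a, hence the
  cubic term. Dividing by the bound of \<open>lik_ratio_large_ge\<close> gives the two
  errors.\<close>

lemma score_large_ge: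
  assumes "x \<ge> 1" "0 < \<tau>" "\<tau> \<le> 1"
  shows "score \<tau> x \<ge> 1 - 100 * x\<^sup>2 * exp (- x\<^sup>2 / 2) / \<tau> - 100 * x ^ 5 * \<tau>\<^sup>2"
proof -
  define a where "a = 1 / (x * \<tau>)"
  have a0: "a > 0" using assms by (simp add: a_def)
  have int: "integrable half_cauchy (\<lambda>l. (1 - kap l) * gker x (l * \<tau>))" by (simp add: left_diff_distrib)
  have "lik_ratio \<tau> x - score_num \<tau> x = (\<integral>l. (1 - kap l) * gker x (l * \<tau>) \<partial>half_cauchy)"
    unfolding lik_ratio_def score_num_def
    by (subst Bochner_Integration.integral_diff[symmetric]) (auto simp: algebra_simps)
  also have "\<dots> \<le> (\<integral>l. 2 * (1 - kap l) + (2 * (x * \<tau>)\<^sup>2 * exp (x\<^sup>2/2)) * indicator {l. a \<le> \<bar>l\<bar>} l \<partial>half_cauchy)"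
  proof (rule integral_mono[OF int])
    show "integrable half_cauchy (\<lambda>l. 2 * (1 - kap l) + (2 * (x * \<tau>)\<^sup>2 * exp (x\<^sup>2/2)) * indicator {l. a \<le> \<bar>l\<bar>} l)"
      using integrable_kap
      by (intro Bochner_Integration.integrable_add integrable_mult_right integrable_half_cauchy_bounded[where B=1 and f="indicator {l. a \<le> \<bar>l\<bar>}"]) (auto split: split_indicator)
    fix l
    have k: "0 \<le> 1 - kap l" using kap_le[of l] by simp
    show "(1 - kap l) * gker x (l * \<tau>) \<le> 2 * (1 - kap l) + (2 * (x * \<tau>)\<^sup>2 * exp (x\<^sup>2/2)) * indicator {l. a \<le> \<bar>l\<bar>} l"
    proof (cases "\<bar>l\<bar> \<le> a")
      case True
      have "\<bar>x * (l * \<tau>)\<bar> \<le> 1" using True assms by (simp add: a_def abs_mult field_simps)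
      then have "x\<^sup>2 * (l * \<tau>)\<^sup>2 \<le> 1" using abs_square_le_1[of "x * (l * \<tau>)"] by (simp add: power_mult_distrib)
      then have "x\<^sup>2 * (l * \<tau>)\<^sup>2 / (2 * (1 + (l * \<tau>)\<^sup>2)) \<le> 1 / 2"
        using frac_le[of "1" "x\<^sup>2 * (l * \<tau>)\<^sup>2" 2 "2 * (1 + (l * \<tau>)\<^sup>2)"] by simp
      then have "exp (x\<^sup>2 * (l * \<tau>)\<^sup>2 / (2 * (1 + (l * \<tau>)\<^sup>2))) \<le> exp (1/2)" by simp
      also have "exp (1/2) \<le> (2::real)" using exp_half_le2 by simp
      finally have "gker x (l * \<tau>) \<le> 2 / 1" unfolding gker_def by (intro frac_le sqrt_one_plus_sq_ge_1) auto
      then have "(1 - kap l) * gker x (l * \<tau>) \<le> (1 - kap l) * 2" using k by (intro mult_left_mono) auto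
      then show ?thesis by (simp add: mult.commute add_increasing2)
    next
      case False
      then have al: "a \<le> \<bar>l\<bar>" "a\<^sup>2 \<le> l\<^sup>2" using a0 by (auto simp: abs_le_square_iff[symmetric])
      have "1 - kap l = 2 / (1 + l\<^sup>2)" by (simp add: kap_def divide_simps)
      also have "\<dots> \<le> 2 / a\<^sup>2" using al a0 by (intro divide_left_mono mult_pos_pos one_plus_sq_pos) auto
      also have "\<dots> = 2 * (x * \<tau>)\<^sup>2" by (simp add: a_def power_divide)
      finally have "(1 - kap l) * gker x (l * \<tau>) \<le> 2 * (x * \<tau>)\<^sup>2 * exp (x\<^sup>2/2)"
        using gker_le[of x "l * \<tau>"] k by (intro mult_mono) auto
      then show ?thesis using al k by simp
    qed
  qed
  also have "\<dots> = 2 + 2 * (x * \<tau>)\<^sup>2 * exp (x\<^sup>2/2) * measure half_cauchy {l. a \<le> \<bar>l\<bar>}"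
  proof -
    have "integrable half_cauchy (\<lambda>l. 2 * (1 - kap l))" using integrable_kap by simp
    moreover have "integrable half_cauchy (\<lambda>l. (2 * (x * \<tau>)\<^sup>2 * exp (x\<^sup>2/2)) * indicator {l. a \<le> \<bar>l\<bar>} l)"
      by (intro integrable_mult_right integrable_half_cauchy_bounded[where B=1]) (auto split: split_indicator)
    ultimately show ?thesis
      by (subst Bochner_Integration.integral_add) (simp_all add: integrable_kap integral_kap)
  qed
  also have "\<dots> \<le> 2 + 2 * (x * \<tau>)\<^sup>2 * exp (x\<^sup>2/2) * (x * \<tau>)"
    using half_cauchy_tail_le[OF a0] by (intro add_left_mono mult_left_mono) (auto simp: a_def)
  finally have H: "lik_ratio \<tau> x - score_num \<tau> x \<le> 2 + 2 * (x * \<tau>)^3 * exp (x\<^sup>2/2)"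
    by (simp add: power2_eq_square power3_eq_cube mult_ac)
  have R: "lik_ratio \<tau> x \<ge> \<tau> * exp (x\<^sup>2 / 2) / (50 * x\<^sup>2)" by (rule lik_ratio_large_ge[OF assms])
  have "1 - score \<tau> x = (lik_ratio \<tau> x - score_num \<tau> x) / lik_ratio \<tau> x"
    using lik_ratio_pos[of \<tau> x] by (simp add: score_def field_simps)
  also have "\<dots> \<le> (2 + 2 * (x * \<tau>)^3 * exp (x\<^sup>2/2)) / (\<tau> * exp (x\<^sup>2 / 2) / (50 * x\<^sup>2))"
    using H R assms lik_ratio_pos[of \<tau> x] abs_score_num_le[of \<tau> x]
    by (intro frac_le) (auto intro!: divide_pos_pos)
  also have "\<dots> = 100 * x\<^sup>2 * exp (- x\<^sup>2 / 2) / \<tau> + 100 * x ^ 5 * \<tau>\<^sup>2"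
    using assms by (simp add: exp_minus field_simps power_numeral_reduce)
  finally show ?thesis by linarith
qed


subsection \<open>The derivative in \<open>\<tau>\<close>\<close>

text \<open>Substituting \<open>u = l * \<tau>\<close> moves \<open>\<tau>\<close> from the kernel \<open>gker\<close> into the mixing weight, the density of
  the half-Cauchy law with scale \<open>\<tau>\<close> relative to the one with scale \<open>1\<close>, where one can differentiate.\<close>

definition scale_weight :: "real \<Rightarrow> real \<Rightarrow> real" where
  "scale_weight \<tau> u = \<tau> * (1 + u\<^sup>2) / (\<tau>\<^sup>2 + u\<^sup>2)"

lemma half_cauchy_rescale:
  assumes "\<tau> > 0" and [measurable]: "f \<in> borel_measurable borel"
  shows "(\<integral>l. f l \<partial>half_cauchy) = (\<integral>u. scale_weight \<tau> u * f (u / \<tau>) \<partial>half_cauchy)"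
proof -
  have "(\<integral>l. f l \<partial>half_cauchy) = (\<integral>l. half_cauchy_density l * f l \<partial>lborel)"
    by (rule integral_half_cauchy) simp
  also have "\<dots> = \<bar>1/\<tau>\<bar> *\<^sub>R (\<integral>u. half_cauchy_density (0 + (1/\<tau>) * u) * f (0 + (1/\<tau>) * u) \<partial>lborel)"
    using assms by (intro lborel_integral_real_affine) auto
  also have "\<dots> = (\<integral>u. (1/\<tau>) * half_cauchy_density (u / \<tau>) * f (u / \<tau>) \<partial>lborel)"
    using assms by (simp add: mult.assoc)
  also have "\<dots> = (\<integral>u. half_cauchy_density u * (scale_weight \<tau> u * f (u / \<tau>)) \<partial>lborel)"
  proof (rule Bochner_Integration.integral_cong[OF refl])
    fix u :: real
    have "(1/\<tau>) * half_cauchy_density (u / \<tau>) = half_cauchy_density u * scale_weight \<tau> u"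
    proof (cases "u > 0")
      case True
      have "1 + (u / \<tau>)\<^sup>2 = (\<tau>\<^sup>2 + u\<^sup>2) / \<tau>\<^sup>2" using assms by (simp add: field_simps)
      then have "(1/\<tau>) * half_cauchy_density (u / \<tau>) = 2 * \<tau> / (pi * (\<tau>\<^sup>2 + u\<^sup>2))"
        using True assms by (simp add: half_cauchy_density_def power2_eq_square)
      then show ?thesis using True by (simp add: half_cauchy_density_def scale_weight_def)
    qed (use assms in \<open>simp add: half_cauchy_density_def zero_less_divide_iff\<close>)
    then show "(1/\<tau>) * half_cauchy_density (u / \<tau>) * f (u / \<tau>) = half_cauchy_density u * (scale_weight \<tau> u * f (u / \<tau>))"
      by simp
  qed
  also have "\<dots> = (\<integral>u. scale_weight \<tau> u * f (u / \<tau>) \<partial>half_cauchy)"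
    unfolding scale_weight_def by (rule integral_half_cauchy[symmetric]) simp
  finally show ?thesis .
qed

definition scale_weight' :: "real \<Rightarrow> real \<Rightarrow> real" where
  "scale_weight' \<tau> u = (1 + u\<^sup>2) * (u\<^sup>2 - \<tau>\<^sup>2) / (\<tau>\<^sup>2 + u\<^sup>2)\<^sup>2"

lemma sum_sq_pos: "\<tau> > 0 \<Longrightarrow> 0 < \<tau>\<^sup>2 + (u::real)\<^sup>2"
  by (simp add: add_pos_nonneg)

lemma scale_weight_deriv:
  assumes "\<tau> > 0"
  shows "((\<lambda>\<tau>. scale_weight \<tau> u) has_real_derivative scale_weight' \<tau> u) (at \<tau>)"
proof -
  have nz: "\<tau>\<^sup>2 + u\<^sup>2 \<noteq> 0" using sum_sq_pos[OF assms, of u] by linarith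
  have "((\<lambda>\<tau>. scale_weight \<tau> u) has_real_derivative
      ((1 + u\<^sup>2) * (\<tau>\<^sup>2 + u\<^sup>2) - \<tau> * (1 + u\<^sup>2) * (2 * \<tau>)) / ((\<tau>\<^sup>2 + u\<^sup>2) * (\<tau>\<^sup>2 + u\<^sup>2))) (at \<tau>)"
    unfolding scale_weight_def using nz by (auto intro!: derivative_eq_intros)
  also have "((1 + u\<^sup>2) * (\<tau>\<^sup>2 + u\<^sup>2) - \<tau> * (1 + u\<^sup>2) * (2 * \<tau>)) = (1 + u\<^sup>2) * (u\<^sup>2 - \<tau>\<^sup>2)"
    by (simp add: algebra_simps power2_eq_square)
  finally show ?thesis by (simp add: scale_weight'_def power2_eq_square[of "\<tau>\<^sup>2 + u\<^sup>2"])
qed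

lemma scale_weight_kap:
  assumes "\<tau> > 0"
  shows "scale_weight \<tau> u * kap (u / \<tau>) = \<tau> * scale_weight' \<tau> u"
proof -
  have nz: "\<tau>\<^sup>2 + u\<^sup>2 \<noteq> 0" using sum_sq_pos[OF assms, of u] by linarith
  have "kap (u / \<tau>) = ((u\<^sup>2 - \<tau>\<^sup>2) / \<tau>\<^sup>2) / ((\<tau>\<^sup>2 + u\<^sup>2) / \<tau>\<^sup>2)"
    unfolding kap_def using assms by (simp add: power_divide diff_divide_distrib add_divide_distrib add.commute)
  then have "kap (u / \<tau>) = (u\<^sup>2 - \<tau>\<^sup>2) / (\<tau>\<^sup>2 + u\<^sup>2)" using assms by simp
  then show ?thesis by (simp add: scale_weight_def scale_weight'_def power2_eq_square[of "\<tau>\<^sup>2 + u\<^sup>2"])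
qed

text \<open>Uniform in \<tau> \<ge> t: this is the domination behind Fubini in
  \<open>lik_ratio_diff\<close>.\<close>

lemma abs_scale_weight'_le:
  assumes "0 < t" "t \<le> \<tau>"
  shows "\<bar>scale_weight' \<tau> u\<bar> \<le> 1 + 1 / t\<^sup>2"
proof -
  have p: "0 < \<tau>\<^sup>2 + u\<^sup>2" using assms by (intro sum_sq_pos) auto
  have t2: "t\<^sup>2 \<le> \<tau>\<^sup>2" using assms by (intro power_mono) auto
  have "\<bar>u\<^sup>2 - \<tau>\<^sup>2\<bar> / (\<tau>\<^sup>2 + u\<^sup>2) \<le> 1" using p by (simp add: divide_le_eq abs_le_iff)
  moreover have "(1 + u\<^sup>2) / (\<tau>\<^sup>2 + u\<^sup>2) \<le> 1 + 1 / t\<^sup>2"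
  proof -
    have "1 / (\<tau>\<^sup>2 + u\<^sup>2) \<le> 1 / t\<^sup>2" using assms t2 by (intro divide_left_mono) (auto intro!: mult_pos_pos p simp: add_increasing2)
    moreover have "u\<^sup>2 / (\<tau>\<^sup>2 + u\<^sup>2) \<le> 1" using p by (simp add: divide_le_eq)
    ultimately show ?thesis by (simp add: add_divide_distrib)
  qed
  ultimately have "((1 + u\<^sup>2) / (\<tau>\<^sup>2 + u\<^sup>2)) * (\<bar>u\<^sup>2 - \<tau>\<^sup>2\<bar> / (\<tau>\<^sup>2 + u\<^sup>2)) \<le> (1 + 1 / t\<^sup>2) * 1"
    using p by (intro mult_mono) auto
  then show ?thesis
    by (simp add: scale_weight'_def abs_mult power2_eq_square[of "\<tau>\<^sup>2 + u\<^sup>2"])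
qed

lemma scale_weight'_measurable [measurable]:
  assumes [measurable]: "f \<in> borel_measurable M" "g \<in> borel_measurable M"
  shows "(\<lambda>z. scale_weight' (f z) (g z)) \<in> borel_measurable M"
  unfolding scale_weight'_def by measurable

lemma score_num_eq_scale_weight':
  assumes "\<tau> > 0"
  shows "score_num \<tau> x / \<tau> = (\<integral>u. scale_weight' \<tau> u * gker x u \<partial>half_cauchy)"
proof -
  have "score_num \<tau> x = (\<integral>u. scale_weight \<tau> u * (kap (u / \<tau>) * gker x (u / \<tau> * \<tau>)) \<partial>half_cauchy)"
    unfolding score_num_def by (rule half_cauchy_rescale[OF assms]) simp
  also have "\<dots> = (\<integral>u. \<tau> * (scale_weight' \<tau> u * gker x u) \<partial>half_cauchy)"
    using assms scale_weight_kap[OF assms]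
    by (intro Bochner_Integration.integral_cong) (simp_all add: mult.assoc[symmetric])
  finally show ?thesis using assms by simp
qed

interpretation lborel_hc: pair_sigma_finite lborel half_cauchy ..

text \<open>The fundamental theorem of calculus is applied to the weight at each fixed scale, and
  Fubini exchanges the integrals; this avoids differentiating under the integral sign.\<close>

lemma lik_ratio_diff:
  assumes "0 < t1" "t1 \<le> t2"
  shows "lik_ratio t2 x - lik_ratio t1 x = (\<integral>\<tau>. indicator {t1..t2} \<tau> * (score_num \<tau> x / \<tau>) \<partial>lborel)"
proof -
  define f where "f \<tau> u = indicator {t1..t2} \<tau> * (scale_weight' \<tau> u * gker x u)" for \<tau> u
  define B where "B = (1 + 1 / t1\<^sup>2) * exp (x\<^sup>2 / 2)"
  have [measurable]: "case_prod f \<in> borel_measurable (lborel \<Otimes>\<^sub>M half_cauchy)"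
    unfolding f_def by measurable
  have b: "\<bar>f \<tau> u\<bar> \<le> B" for \<tau> u
  proof (cases "\<tau> \<in> {t1..t2}")
    case True
    then have "\<bar>scale_weight' \<tau> u\<bar> * gker x u \<le> (1 + 1 / t1\<^sup>2) * exp (x\<^sup>2 / 2)"
      using assms by (intro mult_mono abs_scale_weight'_le gker_le) (auto intro: add_nonneg_nonneg)
    then show ?thesis using True by (simp add: f_def B_def abs_mult)
  qed (simp add: f_def B_def)
  have int: "integrable (lborel \<Otimes>\<^sub>M half_cauchy) (case_prod f)"
  proof (rule integrableI_bounded_set[where A="{t1..t2} \<times> UNIV" and B=B])
    show "emeasure (lborel \<Otimes>\<^sub>M half_cauchy) ({t1..t2} \<times> UNIV) < \<infinity>"
      using half_cauchy.emeasure_space_1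
      by (subst half_cauchy.emeasure_pair_measure_Times) (auto simp: emeasure_lborel_Icc_eq)
    show "AE z in lborel \<Otimes>\<^sub>M half_cauchy. z \<in> {t1..t2} \<times> UNIV \<longrightarrow> norm (case_prod f z) \<le> B"
      using b by (auto intro!: AE_I2)
    show "AE z in lborel \<Otimes>\<^sub>M half_cauchy. z \<notin> {t1..t2} \<times> UNIV \<longrightarrow> case_prod f z = 0"
      by (auto intro!: AE_I2 simp: f_def indicator_def)
  qed auto
  have R: "lik_ratio \<tau> x = (\<integral>u. scale_weight \<tau> u * gker x u \<partial>half_cauchy)" if "\<tau> > 0" for \<tau>
    unfolding lik_ratio_def using that
    by (subst half_cauchy_rescale[OF that]) (auto intro!: Bochner_Integration.integral_cong)
  have intR: "integrable half_cauchy (\<lambda>u. scale_weight \<tau> u * gker x u)" if "\<tau> > 0" for \<tau>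
  proof (rule integrable_half_cauchy_bounded)
    fix u
    have "(1 + u\<^sup>2) / (\<tau>\<^sup>2 + u\<^sup>2) \<le> 1 + 1 / \<tau>\<^sup>2"
    proof -
      have "1 / (\<tau>\<^sup>2 + u\<^sup>2) \<le> 1 / \<tau>\<^sup>2" using that by (intro divide_left_mono) (auto intro!: mult_pos_pos sum_sq_pos)
      moreover have "u\<^sup>2 / (\<tau>\<^sup>2 + u\<^sup>2) \<le> 1" using sum_sq_pos[OF that, of u] by (simp add: divide_le_eq)
      ultimately show ?thesis by (simp add: add_divide_distrib)
    qed
    then have "\<tau> * ((1 + u\<^sup>2) / (\<tau>\<^sup>2 + u\<^sup>2)) * gker x u \<le> \<tau> * (1 + 1 / \<tau>\<^sup>2) * exp (x\<^sup>2 / 2)"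
      using that by (intro mult_mono mult_left_mono gker_le) (auto intro: add_nonneg_nonneg)
    moreover have "0 \<le> \<tau> * ((1 + u\<^sup>2) / (\<tau>\<^sup>2 + u\<^sup>2)) * gker x u"
      using that by (intro mult_nonneg_nonneg divide_nonneg_nonneg) auto
    ultimately show "\<bar>scale_weight \<tau> u * gker x u\<bar> \<le> \<tau> * (1 + 1 / \<tau>\<^sup>2) * exp (x\<^sup>2 / 2)"
      by (simp add: scale_weight_def)
  qed (simp add: scale_weight_def)
  have "lik_ratio t2 x - lik_ratio t1 x = (\<integral>u. (scale_weight t2 u - scale_weight t1 u) * gker x u \<partial>half_cauchy)"
    using assms R intR by (simp add: left_diff_distrib)
  also have "\<dots> = (\<integral>u. \<integral>\<tau>. f \<tau> u \<partial>lborel \<partial>half_cauchy)"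
  proof (rule Bochner_Integration.integral_cong[OF refl])
    fix u
    have "(\<integral>\<tau>. scale_weight' \<tau> u * indicator {t1..t2} \<tau> \<partial>lborel) = scale_weight t2 u - scale_weight t1 u"
    proof (rule integral_FTC_Icc_real[OF assms(2)])
      fix \<tau> assume "t1 \<le> \<tau>" "\<tau> \<le> t2"
      then have "\<tau> > 0" using assms by simp
      then show "((\<lambda>\<tau>. scale_weight \<tau> u) has_real_derivative scale_weight' \<tau> u) (at \<tau>)"
        by (rule scale_weight_deriv)
      show "isCont (\<lambda>\<tau>. scale_weight' \<tau> u) \<tau>"
        unfolding scale_weight'_def using sum_sq_pos[OF \<open>\<tau> > 0\<close>, of u] by (intro continuous_intros) auto
    qed
    then have "(scale_weight t2 u - scale_weight t1 u) * gker x u = (\<integral>\<tau>. scale_weight' \<tau> u * indicator {t1..t2} \<tau> \<partial>lborel) * gker x u"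
      by simp
    also have "\<dots> = (\<integral>\<tau>. f \<tau> u \<partial>lborel)"
      by (subst integral_mult_left_zero[symmetric]) (auto simp: f_def mult_ac intro!: Bochner_Integration.integral_cong)
    finally show "(scale_weight t2 u - scale_weight t1 u) * gker x u = (\<integral>\<tau>. f \<tau> u \<partial>lborel)" .
  qed
  also have "\<dots> = (\<integral>\<tau>. \<integral>u. f \<tau> u \<partial>half_cauchy \<partial>lborel)"
    by (rule lborel_hc.Fubini_integral[OF int])
  also have "\<dots> = (\<integral>\<tau>. indicator {t1..t2} \<tau> * (score_num \<tau> x / \<tau>) \<partial>lborel)"
  proof (rule Bochner_Integration.integral_cong[OF refl])
    fix \<tau>
    show "(\<integral>u. f \<tau> u \<partial>half_cauchy) = indicator {t1..t2} \<tau> * (score_num \<tau> x / \<tau>)"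
      using assms by (cases "\<tau> \<in> {t1..t2}") (auto simp: f_def score_num_eq_scale_weight')
  qed
  finally show ?thesis .
qed

lemma isCont_score_num: "isCont (\<lambda>\<tau>. score_num \<tau> x) t"
  unfolding continuous_at_sequentially
proof (intro allI impI)
  fix X assume X: "X \<longlonglongrightarrow> t"
  show "((\<lambda>\<tau>. score_num \<tau> x) \<circ> X) \<longlonglongrightarrow> score_num t x"
    unfolding score_num_def comp_def
  proof (rule integral_dominated_convergence[where w="\<lambda>_. exp (x\<^sup>2/2)"])
    show "AE l in half_cauchy. (\<lambda>i. kap l * gker x (l * X i)) \<longlonglongrightarrow> kap l * gker x (l * t)"
    proof (rule AE_I2)
      fix l
      have "(\<lambda>i. gker x (l * X i)) \<longlonglongrightarrow> gker x (l * t)"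
        unfolding gker_def using one_plus_sq_nz(1)[of "l * t"] sqrt_one_plus_sq_pos[of "l * t"] by (intro tendsto_intros X) (simp only: mult_eq_0_iff, simp, linarith)
      then show "(\<lambda>i. kap l * gker x (l * X i)) \<longlonglongrightarrow> kap l * gker x (l * t)" by (intro tendsto_intros)
    qed
    show "AE l in half_cauchy. norm (kap l * gker x (l * X i)) \<le> exp (x\<^sup>2/2)" for i
      using mult_mono[OF abs_kap_le gker_le[of x]] by (auto simp: abs_mult)
  qed auto
qed

text \<open>Differentiates the formula of \<open>lik_ratio_diff\<close>, whose integrand is
  continuous in \<tau>. The window from t / 2 to 2 t stays away from 0 and has t in its
  interior.\<close>

lemma lik_ratio_deriv:
  assumes "t > 0"
  shows "((\<lambda>\<tau>. lik_ratio \<tau> x) has_real_derivative score_num t x / t) (at t)"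
proof -
  define S where "S = {t/2..2*t}"
  have cont: "continuous_on S (\<lambda>\<tau>. score_num \<tau> x / \<tau>)"
    unfolding S_def using assms isCont_score_num
    by (intro continuous_on_divide continuous_at_imp_continuous_on) auto
  have eq: "lik_ratio \<tau> x - lik_ratio (t/2) x = integral {t/2..\<tau>} (\<lambda>\<tau>. score_num \<tau> x / \<tau>)" if "\<tau> \<in> S" for \<tau>
  proof -
    have sub: "{t/2..\<tau>} \<subseteq> S" using that by (auto simp: S_def)
    have "set_integrable lborel {t/2..\<tau>} (\<lambda>\<tau>. score_num \<tau> x / \<tau>)"
      by (rule borel_integrable_atLeastAtMost') (rule continuous_on_subset[OF cont sub])
    from set_borel_integral_eq_integral(2)[OF this]
    show ?thesis
      using lik_ratio_diff[of "t/2" \<tau> x] that assms by (simp add: S_def set_lebesgue_integral_def)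
  qed
  have "((\<lambda>\<tau>. integral {t/2..\<tau>} (\<lambda>\<tau>. score_num \<tau> x / \<tau>)) has_real_derivative score_num t x / t) (at t within S)"
    using cont unfolding S_def by (rule integral_has_real_derivative) (use assms in auto)
  then have "((\<lambda>\<tau>. lik_ratio \<tau> x - lik_ratio (t/2) x) has_real_derivative score_num t x / t) (at t within S)"
    by (rule has_field_derivative_transform_within[where d=1]) (use assms eq in \<open>auto simp: S_def\<close>)
  then have "((\<lambda>\<tau>. lik_ratio \<tau> x - lik_ratio (t/2) x) has_real_derivative score_num t x / t) (at t)"
    using at_within_interior[of t S] assms by (simp add: S_def)
  from DERIV_add[OF this DERIV_const[of "lik_ratio (t/2) x"]] show ?thesis by simp
qed

lemma has_bochner_integral_score:
  assumes "0 < t1" "t1 \<le> t2"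
  shows "has_bochner_integral lborel (\<lambda>\<tau>. score \<tau> x / \<tau> * indicator {t1..t2} \<tau>)
    (ln (lik_ratio t2 x) - ln (lik_ratio t1 x))"
proof (rule has_bochner_integral_FTC_Icc_real[OF assms(2)])
  fix \<tau> assume "t1 \<le> \<tau>" "\<tau> \<le> t2"
  then have t: "\<tau> > 0" using assms by simp
  note D = lik_ratio_deriv[OF t, of x]
  show "((\<lambda>\<tau>. ln (lik_ratio \<tau> x)) has_real_derivative score \<tau> x / \<tau>) (at \<tau>)"
    using DERIV_chain2[OF DERIV_ln[OF lik_ratio_pos] D] by (simp add: score_def field_simps)
  show "isCont (\<lambda>\<tau>. score \<tau> x / \<tau>) \<tau>"
    unfolding score_def using t lik_ratio_pos[of \<tau> x]
    by (intro continuous_intros isCont_score_num DERIV_isCont[OF D]) auto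
qed

section \<open>The S-value in terms of the likelihood ratio\<close>

lemma nn_integral_horseshoe:
  assumes [measurable]: "f \<in> borel_measurable borel"
  shows "(\<integral>\<^sup>+\<theta>. f \<theta> \<partial>horseshoe \<tau>) = (\<integral>\<^sup>+l. \<integral>\<^sup>+\<theta>. f \<theta> \<partial>normal_law 0 (l * \<tau>) \<partial>half_cauchy)"
  unfolding horseshoe_def by (rule nn_integral_bind[where B=borel]) auto

lemma nn_integral_horseshoe_gauss:
  assumes "\<tau> > 0" and [measurable]: "f \<in> borel_measurable borel"
  shows "(\<integral>\<^sup>+\<theta>. f \<theta> \<partial>horseshoe \<tau>) = (\<integral>\<^sup>+l. \<integral>\<^sup>+z. f (l * \<tau> * z) \<partial>gauss \<partial>half_cauchy)"
  unfolding nn_integral_horseshoe[OF assms(2)]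
proof (rule nn_integral_cong_AE)
  \<comment> \<open>At l = 0 \<open>normal_law\<close> is the null measure rather than a point mass,
    so the identity is claimed only almost everywhere.\<close>
  show "AE l in half_cauchy. (\<integral>\<^sup>+\<theta>. f \<theta> \<partial>normal_law 0 (l * \<tau>)) = (\<integral>\<^sup>+z. f (l * \<tau> * z) \<partial>gauss)"
    using AE_half_cauchy_pos
  proof eventually_elim
    case (elim l)
    then have "l * \<tau> > 0" using assms by simp
    from normal_law_eq_distr[OF this, of 0] show ?case
      by (simp add: nn_integral_distr)
  qed
qed

lemma horseshoe_density_measurable [measurable]: "horseshoe_density \<tau> \<in> borel_measurable borel"
  unfolding horseshoe_density_def[abs_def] normal_density_def by measurable

lemma nn_integral_normal_density_horseshoe:
  assumes "\<tau> > 0"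
  shows "(\<integral>\<^sup>+\<theta>. ennreal (std_normal_density (x - \<theta>)) \<partial>horseshoe \<tau>) = ennreal (std_normal_density x * lik_ratio \<tau> x)"
proof -
  have "(\<integral>\<^sup>+\<theta>. ennreal (std_normal_density (x - \<theta>)) \<partial>horseshoe \<tau>)
      = (\<integral>\<^sup>+l. \<integral>\<^sup>+\<theta>. ennreal (std_normal_density (x - \<theta>)) \<partial>normal_law 0 (l * \<tau>) \<partial>half_cauchy)"
    by (rule nn_integral_horseshoe) simp
  also have "\<dots> = (\<integral>\<^sup>+l. ennreal (std_normal_density x * gker x (l * \<tau>)) \<partial>half_cauchy)"
  proof (rule nn_integral_cong_AE)
    show "AE l in half_cauchy. (\<integral>\<^sup>+\<theta>. ennreal (std_normal_density (x - \<theta>)) \<partial>normal_law 0 (l * \<tau>))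
        = ennreal (std_normal_density x * gker x (l * \<tau>))"
      using AE_half_cauchy_pos
    proof eventually_elim
      case (elim l)
      then have lt: "l * \<tau> > 0" using assms by simp
      have "(\<integral>\<^sup>+\<theta>. ennreal (std_normal_density (x - \<theta>)) \<partial>normal_law 0 (l * \<tau>))
          = (\<integral>\<^sup>+\<theta>. ennreal (std_normal_density (x - \<theta>) * normal_density 0 (l * \<tau>) \<theta>) \<partial>lborel)"
        unfolding normal_law_def by (subst nn_integral_density) (auto simp: ennreal_mult' mult.commute)
      \<comment> \<open>Convolution of N(0, (l \<tau>)^2) with the standard normal error.\<close>
      also have "\<dots> = ennreal (normal_density 0 (sqrt (1\<^sup>2 + (l * \<tau>)\<^sup>2)) x)"
        using fun_cong[OF conv_normal_density_zero_mean[OF zero_less_one lt], of x] by simp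
      finally show ?case by (simp add: std_normal_density_gker)
    qed
  qed
  also have "\<dots> = ennreal (\<integral>l. std_normal_density x * gker x (l * \<tau>) \<partial>half_cauchy)"
    by (intro nn_integral_eq_integral integrable_mult_right integrable_gker) auto
  finally show ?thesis by (simp add: lik_ratio_def)
qed

lemma integral_normal_density_horseshoe_density:
  assumes "\<tau> > 0"
  shows "(\<integral>\<theta>. std_normal_density (x - \<theta>) * horseshoe_density \<tau> \<theta> \<partial>lborel) = std_normal_density x * lik_ratio \<tau> x"
proof -
  have "(\<integral>\<^sup>+\<theta>. ennreal (std_normal_density (x - \<theta>) * horseshoe_density \<tau> \<theta>) \<partial>lborel)
     = (\<integral>\<^sup>+\<theta>. ennreal (std_normal_density (x - \<theta>)) \<partial>horseshoe \<tau>)"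
    unfolding horseshoe_eq_density[OF assms] 
    by (subst nn_integral_density) (auto simp: ennreal_mult' horseshoe_density_nonneg mult.commute)
  also have "\<dots> = ennreal (std_normal_density x * lik_ratio \<tau> x)"
    by (rule nn_integral_normal_density_horseshoe[OF assms])
  finally show ?thesis
    using lik_ratio_pos[of \<tau> x]
    by (subst integral_eq_nn_integral) (auto simp: horseshoe_density_nonneg)
qed

lemma marginal_likelihood_eq:
  assumes "\<tau> > 0"
  shows "marginal_likelihood n X \<tau> = (\<Prod>i<n. std_normal_density (X i)) * (\<Prod>i<n. lik_ratio \<tau> (X i))"
  by (simp add: marginal_likelihood_def integral_normal_density_horseshoe_density[OF assms] prod.distrib)

lemma is_mmle_range:
  assumes "is_mmle n T" "X \<in> Rn n"
  shows "T X \<in> {1 / real n..1}"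
  using assms by (auto simp: is_mmle_def is_arg_max_def)

lemma is_mmle_maximal:
  assumes T: "is_mmle n T" "n \<ge> 1" "X \<in> Rn n" and t: "\<tau> \<in> {1 / real n..1}"
  shows "(\<Sum>i<n. ln (lik_ratio \<tau> (X i))) \<le> (\<Sum>i<n. ln (lik_ratio (T X) (X i)))"
proof -
  have n: "1 / real n > 0" using T by simp
  have pos: "\<tau> > 0" "T X > 0"
    using t is_mmle_range[OF T(1,3)] less_le_trans[OF n] by (simp_all del: divide_le_eq_1)
  have "\<not> marginal_likelihood n X (T X) < marginal_likelihood n X \<tau>"
    using T t by (auto simp: is_mmle_def is_arg_max_def)
  then have "(\<Prod>i<n. lik_ratio \<tau> (X i)) \<le> (\<Prod>i<n. lik_ratio (T X) (X i))"
    using pos by (simp add: marginal_likelihood_eq not_less mult_le_cancel_left_pos prod_pos normal_density_pos)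
  then have "ln (\<Prod>i<n. lik_ratio \<tau> (X i)) \<le> ln (\<Prod>i<n. lik_ratio (T X) (X i))"
    by (subst ln_le_cancel_iff) (auto intro!: prod_pos lik_ratio_pos)
  then show ?thesis
    using lik_ratio_pos by (subst (asm) (1 2) ln_prod) (auto simp: less_imp_neq[symmetric])
qed

section \<open>Conditional probabilities in the Bayesian model\<close>

lemma emeasure_bayes_law:
  assumes [measurable]: "A \<in> sets (borel \<Otimes>\<^sub>M borel)"
  shows "emeasure (bayes_law \<tau>) A = (\<integral>\<^sup>+\<theta>. (\<integral>\<^sup>+y. indicator A (\<theta>, y) \<partial>normal_law \<theta> 1) \<partial>horseshoe \<tau>)"
proof -
  have "emeasure (bayes_law \<tau>) A =
    (\<integral>\<^sup>+\<theta>. emeasure (normal_law \<theta> 1 \<bind> (\<lambda>x. return (borel \<Otimes>\<^sub>M borel) (\<theta>, x))) A \<partial>horseshoe \<tau>)"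
    unfolding bayes_law_def by (rule emeasure_bind[where N="borel \<Otimes>\<^sub>M borel"]) (auto, measurable)
  also have "\<dots> = (\<integral>\<^sup>+\<theta>. (\<integral>\<^sup>+y. indicator A (\<theta>, y) \<partial>normal_law \<theta> 1) \<partial>horseshoe \<tau>)"
  proof (rule nn_integral_cong)
    fix \<theta>
    have "emeasure (normal_law \<theta> 1 \<bind> (\<lambda>x. return (borel \<Otimes>\<^sub>M borel) (\<theta>, x))) A =
      (\<integral>\<^sup>+y. emeasure (return (borel \<Otimes>\<^sub>M borel) (\<theta>, y)) A \<partial>normal_law \<theta> 1)"
      by (rule emeasure_bind[where N="borel \<Otimes>\<^sub>M borel"]) (auto, measurable)
    then show "emeasure (normal_law \<theta> 1 \<bind> (\<lambda>x. return (borel \<Otimes>\<^sub>M borel) (\<theta>, x))) A =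
      (\<integral>\<^sup>+y. indicator A (\<theta>, y) \<partial>normal_law \<theta> 1)"
      by simp
  qed
  finally show ?thesis .
qed

lemma sets_bayes_law [simp]: "sets (bayes_law \<tau>) = sets (borel \<Otimes>\<^sub>M borel)"
  unfolding bayes_law_def by (rule sets_bind) (auto simp: sets_bind[where N="borel \<Otimes>\<^sub>M borel"])

lemma space_bayes_law [simp]: "space (bayes_law \<tau>) = UNIV"
  using sets_eq_imp_space_eq[OF sets_bayes_law] by (simp add: space_pair_measure)

lemma integrable_horseshoe_bounded:
  fixes f :: "real \<Rightarrow> real"
  assumes "\<tau> > 0" and [measurable]: "f \<in> borel_measurable borel" and "\<And>l. \<bar>f l\<bar> \<le> B"
  shows "integrable (horseshoe \<tau>) f"
  by (rule finite_measure.integrable_const_bound[where B=B])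
     (use assms prob_space_horseshoe in \<open>auto simp: prob_space_def\<close>)

lemma measure_bayes_law_ge:
  assumes "\<tau> > 0" and [measurable]: "B \<in> sets borel"
  shows "measure (bayes_law \<tau>) {w. fst w \<in> B \<and> snd w \<ge> x} = (\<integral>\<theta>. indicator B \<theta> * normal_tail (x - \<theta>) \<partial>horseshoe \<tau>)"
proof -
  have "emeasure (bayes_law \<tau>) {w. fst w \<in> B \<and> snd w \<ge> x}
    = (\<integral>\<^sup>+\<theta>. (\<integral>\<^sup>+y. indicator {w. fst w \<in> B \<and> snd w \<ge> x} (\<theta>, y) \<partial>normal_law \<theta> 1) \<partial>horseshoe \<tau>)"
  proof (rule emeasure_bayes_law)
    have "{w. fst w \<in> B \<and> snd w \<ge> x} = B \<times> {x..}" by auto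
    then show "{w. fst w \<in> B \<and> snd w \<ge> x} \<in> sets (borel \<Otimes>\<^sub>M borel)" by simp
  qed
  also have "\<dots> = (\<integral>\<^sup>+\<theta>. ennreal (indicator B \<theta> * normal_tail (x - \<theta>)) \<partial>horseshoe \<tau>)"
  proof (rule nn_integral_cong)
    fix \<theta>
    interpret N: prob_space "normal_law \<theta> 1" by (rule prob_space_normal_law) simp
    have "(\<integral>\<^sup>+y. indicator {w. fst w \<in> B \<and> snd w \<ge> x} (\<theta>, y) \<partial>normal_law \<theta> 1) =
      (\<integral>\<^sup>+y. indicator B \<theta> * indicator {x..} y \<partial>normal_law \<theta> 1)"
      by (intro nn_integral_cong) (auto split: split_indicator)
    also have "\<dots> = indicator B \<theta> * emeasure (normal_law \<theta> 1) {x..}"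
      by (subst nn_integral_cmult) auto
    also have "\<dots> = ennreal (indicator B \<theta> * normal_tail (x - \<theta>))"
      using measure_normal_law_atLeast[of 1 \<theta> x] by (simp add: N.emeasure_eq_measure split: split_indicator)
    finally show "(\<integral>\<^sup>+y. indicator {w. fst w \<in> B \<and> snd w \<ge> x} (\<theta>, y) \<partial>normal_law \<theta> 1) =
      ennreal (indicator B \<theta> * normal_tail (x - \<theta>))" .
  qed
  finally show ?thesis
    by (subst integral_eq_nn_integral) (auto simp: measure_def)
qed

lemma horseshoe_reflect:
  assumes "\<tau> > 0" and [measurable]: "f \<in> borel_measurable borel"
  shows "(\<integral>\<^sup>+\<theta>. f (- \<theta>) \<partial>horseshoe \<tau>) = (\<integral>\<^sup>+\<theta>. f \<theta> \<partial>horseshoe \<tau>)"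
proof -
  have "(\<integral>\<^sup>+z. f (l * \<tau> * z) \<partial>gauss) = (\<integral>\<^sup>+z. f (- (l * \<tau> * z)) \<partial>gauss)" for l
  proof -
    have "(\<integral>\<^sup>+z. f (l * \<tau> * z) \<partial>gauss) = (\<integral>\<^sup>+z. f (l * \<tau> * z) \<partial>distr gauss borel uminus)" by (simp add: gauss_reflect)
    also have "\<dots> = (\<integral>\<^sup>+z. f (- (l * \<tau> * z)) \<partial>gauss)" by (subst nn_integral_distr) auto
    finally show ?thesis .
  qed
  then show ?thesis using assms by (subst (1 2) nn_integral_horseshoe_gauss) auto
qed

lemma integral_horseshoe_reflect:
  assumes "\<tau> > 0" and [measurable]: "f \<in> borel_measurable borel" and "\<And>x. 0 \<le> (f x :: real)"
  shows "(\<integral>\<theta>. f (- \<theta>) \<partial>horseshoe \<tau>) = (\<integral>\<theta>. f \<theta> \<partial>horseshoe \<tau>)"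
  using assms horseshoe_reflect[of \<tau> "\<lambda>x. ennreal (f x)"]
  by (subst (1 2) integral_eq_nn_integral) auto

lemma AE_horseshoe_nonzero: 
  assumes "\<tau> > 0"
  shows "AE \<theta> in horseshoe \<tau>. \<theta> \<noteq> 0"
  unfolding horseshoe_eq_density[OF assms]
  by (subst AE_density) (auto intro!: eventually_mono[OF AE_lborel_singleton[of 0]])

text \<open>The numerator of the first conditional probability in \<open>S_value\<close>. By
  symmetry of the prior, its value at - x is the numerator of the second.\<close>

definition neg_tail :: "real \<Rightarrow> real \<Rightarrow> real" where
  "neg_tail \<tau> x = (\<integral>\<theta>. indicator {..<0} \<theta> * normal_tail (x - \<theta>) \<partial>horseshoe \<tau>)"

definition marg_tail :: "real \<Rightarrow> real \<Rightarrow> real" where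
  "marg_tail \<tau> x = (\<integral>\<theta>. normal_tail (x - \<theta>) \<partial>horseshoe \<tau>)"

text \<open>Reflecting \<theta> turns the lower tail at x into the upper tail at - x, so both
  branches of \<open>S_value\<close> are expressed by the same two functions.\<close>

lemma measure_bayes_law_le:
  assumes "\<tau> > 0" and [measurable]: "B \<in> sets borel"
  shows "measure (bayes_law \<tau>) {w. fst w \<in> B \<and> snd w \<le> x} = (\<integral>\<theta>. indicator (uminus ` B) \<theta> * normal_tail (- x - \<theta>) \<partial>horseshoe \<tau>)"
proof -
  have [measurable]: "uminus ` B \<in> sets borel"
  proof -
    have "uminus ` B = uminus -` B" by force
    then show ?thesis using measurable_sets[of uminus borel borel B] by simp
  qed
  have "emeasure (bayes_law \<tau>) {w. fst w \<in> B \<and> snd w \<le> x}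
    = (\<integral>\<^sup>+\<theta>. (\<integral>\<^sup>+y. indicator {w. fst w \<in> B \<and> snd w \<le> x} (\<theta>, y) \<partial>normal_law \<theta> 1) \<partial>horseshoe \<tau>)"
  proof (rule emeasure_bayes_law)
    have "{w. fst w \<in> B \<and> snd w \<le> x} = B \<times> {..x}" by auto
    then show "{w. fst w \<in> B \<and> snd w \<le> x} \<in> sets (borel \<Otimes>\<^sub>M borel)" by simp
  qed
  also have "\<dots> = (\<integral>\<^sup>+\<theta>. ennreal (indicator (uminus ` B) (- \<theta>) * normal_tail (- x - - \<theta>)) \<partial>horseshoe \<tau>)"
  proof (rule nn_integral_cong)
    fix \<theta>
    interpret N: prob_space "normal_law \<theta> 1" by (rule prob_space_normal_law) simp
    have "(\<integral>\<^sup>+y. indicator {w. fst w \<in> B \<and> snd w \<le> x} (\<theta>, y) \<partial>normal_law \<theta> 1) =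
      (\<integral>\<^sup>+y. indicator B \<theta> * indicator {..x} y \<partial>normal_law \<theta> 1)"
      by (intro nn_integral_cong) (auto split: split_indicator)
    also have "\<dots> = indicator B \<theta> * emeasure (normal_law \<theta> 1) {..x}"
      by (subst nn_integral_cmult) auto
    also have "measure (normal_law \<theta> 1) {..x} = 1 - normal_tail (x - \<theta>)"
      using N.prob_compl[of "{x<..}"] measure_normal_law_greaterThan[of 1 \<theta> x]
      by (simp add: Compl_eq_Diff_UNIV[symmetric] Compl_greaterThan)
    then have "indicator B \<theta> * emeasure (normal_law \<theta> 1) {..x} = ennreal (indicator (uminus ` B) (- \<theta>) * normal_tail (- x - - \<theta>))"
      using normal_tail_uminus[of "x - \<theta>"] by (auto simp: N.emeasure_eq_measure algebra_simps split: split_indicator)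
    finally show "(\<integral>\<^sup>+y. indicator {w. fst w \<in> B \<and> snd w \<le> x} (\<theta>, y) \<partial>normal_law \<theta> 1) =
      ennreal (indicator (uminus ` B) (- \<theta>) * normal_tail (- x - - \<theta>))" .
  qed
  also have "\<dots> = (\<integral>\<^sup>+\<theta>. ennreal (indicator (uminus ` B) \<theta> * normal_tail (- x - \<theta>)) \<partial>horseshoe \<tau>)"
    by (rule horseshoe_reflect[OF assms(1), of "\<lambda>\<theta>. ennreal (indicator (uminus ` B) \<theta> * normal_tail (- x - \<theta>))"]) simp
  finally show ?thesis
    by (subst integral_eq_nn_integral) (auto simp: measure_def)
qed

lemma S_value_eq:
  assumes "\<tau> > 0"
  shows "S_value x \<tau> = 2 * min (neg_tail \<tau> x / marg_tail \<tau> x) (neg_tail \<tau> (- x) / marg_tail \<tau> (- x))"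
proof -
  have im: "uminus ` {0<..} = {..<0 :: real}" "uminus ` UNIV = (UNIV :: real set)"
    by (auto intro: image_eqI[where x="- _"])
  have "measure (bayes_law \<tau>) {w. fst w < 0 \<and> x \<le> snd w} = neg_tail \<tau> x"
    using measure_bayes_law_ge[OF assms, of "{..<0}" x] by (simp add: neg_tail_def)
  moreover have "measure (bayes_law \<tau>) {w. x \<le> snd w} = marg_tail \<tau> x"
    using measure_bayes_law_ge[OF assms, of UNIV x] by (simp add: marg_tail_def)
  moreover have "measure (bayes_law \<tau>) {w. 0 < fst w \<and> snd w \<le> x} = neg_tail \<tau> (- x)"
    using measure_bayes_law_le[OF assms, of "{0<..}" x] by (simp add: neg_tail_def im)
  moreover have "measure (bayes_law \<tau>) {w. snd w \<le> x} = marg_tail \<tau> (- x)"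
    using measure_bayes_law_le[OF assms, of UNIV x] by (simp add: marg_tail_def im)
  ultimately show ?thesis
    unfolding S_value_def cond_prob_def by (simp add: case_prod_beta)
qed

text \<open>Tonelli: the marginal density is the normal density times \<open>lik_ratio\<close>, and
  it is integrated over \<open>{x<..}\<close>.\<close>

lemma marg_tail_eq:
  assumes "\<tau> > 0"
  shows "marg_tail \<tau> x = normal_tail x + tail_excess \<tau> x"
proof -
  interpret H: prob_space "horseshoe \<tau>" by (rule prob_space_horseshoe[OF assms])
  interpret P: pair_sigma_finite "horseshoe \<tau>" lborel ..
  have nt: "ennreal (normal_tail (x - \<theta>)) = (\<integral>\<^sup>+y. indicator {x<..} y * ennreal (std_normal_density (y - \<theta>)) \<partial>lborel)" for \<theta>
  proof -
    interpret N: prob_space "normal_law \<theta> 1" by (rule prob_space_normal_law) simp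
    have "ennreal (normal_tail (x - \<theta>)) = emeasure (normal_law \<theta> 1) {x<..}"
      using measure_normal_law_greaterThan[of 1 \<theta> x] by (simp add: N.emeasure_eq_measure)
    also have "\<dots> = (\<integral>\<^sup>+y. indicator {x<..} y * ennreal (std_normal_density (y - \<theta>)) \<partial>lborel)"
      by (simp add: normal_law_def emeasure_density) (simp add: normal_density_def mult.commute)
    finally show ?thesis .
  qed
  have "ennreal (marg_tail \<tau> x) = (\<integral>\<^sup>+\<theta>. ennreal (normal_tail (x - \<theta>)) \<partial>horseshoe \<tau>)"
    unfolding marg_tail_def
    by (intro nn_integral_eq_integral[symmetric] integrable_horseshoe_bounded[OF assms, where B=1]) auto
  also have "\<dots> = (\<integral>\<^sup>+\<theta>. \<integral>\<^sup>+y. indicator {x<..} y * ennreal (std_normal_density (y - \<theta>)) \<partial>lborel \<partial>horseshoe \<tau>)"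
    by (simp only: nt)
  also have "\<dots> = (\<integral>\<^sup>+y. \<integral>\<^sup>+\<theta>. indicator {x<..} y * ennreal (std_normal_density (y - \<theta>)) \<partial>horseshoe \<tau> \<partial>lborel)"
    by (rule P.Fubini'[symmetric]) simp
  also have "\<dots> = (\<integral>\<^sup>+y. ennreal (std_normal_density y * (indicator {x<..} y * lik_ratio \<tau> y)) \<partial>lborel)"
    using lik_ratio_pos
    by (intro nn_integral_cong)
       (auto simp: nn_integral_cmult nn_integral_normal_density_horseshoe[OF assms] split: split_indicator)
  also have "\<dots> = (\<integral>\<^sup>+y. ennreal (indicator {x<..} y * lik_ratio \<tau> y) \<partial>gauss)"
    using lik_ratio_pos by (subst nn_integral_gauss) (auto simp: ennreal_mult' less_imp_le)
  also have "\<dots> = ennreal (normal_tail x + tail_excess \<tau> x)"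
    unfolding integral_gauss_tail_lik_ratio[symmetric]
    using lik_ratio_pos by (intro nn_integral_eq_integral) (auto simp: less_imp_le)
  finally show ?thesis
    unfolding integral_gauss_tail_lik_ratio[symmetric]
    by (subst (asm) ennreal_inj)
       (auto simp: marg_tail_def less_imp_le[OF lik_ratio_pos] intro!: Bochner_Integration.integral_nonneg)
qed

lemma marg_tail_pos:
  assumes "\<tau> > 0"
  shows "0 < marg_tail \<tau> x"
proof -
  have "0 \<le> marg_tail \<tau> x" unfolding marg_tail_def by (intro Bochner_Integration.integral_nonneg) simp
  moreover have "marg_tail \<tau> x \<noteq> 0"
  proof
    interpret H: prob_space "horseshoe \<tau>" by (rule prob_space_horseshoe[OF assms])
    assume "marg_tail \<tau> x = 0"
    then have "AE \<theta> in horseshoe \<tau>. normal_tail (x - \<theta>) = 0"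
      unfolding marg_tail_def using integrable_horseshoe_bounded[OF assms, where B=1 and f="\<lambda>\<theta>. normal_tail (x - \<theta>)"]
      by (subst (asm) integral_nonneg_eq_0_iff_AE) auto
    then have "AE \<theta> in horseshoe \<tau>. False"
      by eventually_elim (use normal_tail_pos in \<open>metis less_irrefl\<close>)
    then show False by simp
  qed
  ultimately show ?thesis by simp
qed

lemma marg_tail_uminus:
  assumes "\<tau> > 0"
  shows "marg_tail \<tau> (- x) = 1 - marg_tail \<tau> x"
proof -
  interpret H: prob_space "horseshoe \<tau>" by (rule prob_space_horseshoe[OF assms])
  have "marg_tail \<tau> (- x) = (\<integral>\<theta>. normal_tail (- x - (- \<theta>)) \<partial>horseshoe \<tau>)"
    unfolding marg_tail_def using integral_horseshoe_reflect[OF assms, of "\<lambda>\<theta>. normal_tail (- x - \<theta>)"] by simp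
  also have "\<dots> = (\<integral>\<theta>. 1 - normal_tail (x - \<theta>) \<partial>horseshoe \<tau>)"
    using normal_tail_uminus by (intro Bochner_Integration.integral_cong) (auto simp: normal_tail_uminus[symmetric])
  also have "\<dots> = 1 - marg_tail \<tau> x"
    unfolding marg_tail_def
    using H.prob_space integrable_horseshoe_bounded[OF assms, where B=1 and f="\<lambda>\<theta>. normal_tail (x - \<theta>)"]
    by (subst Bochner_Integration.integral_diff) auto
  finally show ?thesis .
qed

section \<open>Bounds for the S-value\<close>

lemma measure_horseshoe_neg:
  assumes "\<tau> > 0"
  shows "measure (horseshoe \<tau>) {..<0} = 1 / 2"
proof -
  interpret H: prob_space "horseshoe \<tau>" by (rule prob_space_horseshoe[OF assms])
  have "(\<integral>\<theta>. indicator {..<0} (- \<theta>) \<partial>horseshoe \<tau>) = (\<integral>\<theta>. (indicator {..<0} \<theta> :: real) \<partial>horseshoe \<tau>)"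
    by (rule integral_horseshoe_reflect[OF assms, of "indicator {..<0}"]) auto
  moreover have "(\<lambda>\<theta>::real. indicator {..<0} (- \<theta>) :: real) = indicator {0<..}" by (auto split: split_indicator)
  ultimately have eq: "H.prob {0<..} = H.prob {..<0}" by simp
  have "H.prob {..<0} + H.prob {0<..} = H.prob ({..<0} \<union> {0<..})"
    by (rule H.finite_measure_Union[symmetric]) auto
  also have "\<dots> = 1" using AE_horseshoe_nonzero[OF assms] by (subst H.prob_eq_1) auto
  finally show ?thesis using eq by simp
qed

text \<open>A negative \<theta> has prior probability 1 / 2, and it makes X \<ge> x no more likely
  than under N(0, 1).\<close>

lemma neg_tail_le:
  assumes "\<tau> > 0"
  shows "neg_tail \<tau> x \<le> normal_tail x / 2"
proof -
  interpret H: prob_space "horseshoe \<tau>" by (rule prob_space_horseshoe[OF assms])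
  have "neg_tail \<tau> x \<le> (\<integral>\<theta>. normal_tail x * indicator {..<0} \<theta> \<partial>horseshoe \<tau>)"
    unfolding neg_tail_def
    by (intro integral_mono integrable_horseshoe_bounded[OF assms, where B=1])
       (auto simp: normal_tail_antimono split: split_indicator)
  then show ?thesis by (simp add: measure_horseshoe_neg[OF assms])
qed

lemma normal_tail_le_inverse_square:
  assumes "x > 0"
  shows "normal_tail x \<le> 1 / x\<^sup>2"
proof -
  have "x * exp (- x\<^sup>2 / 2) \<le> 1"
  proof -
    have "x \<le> 1 + x\<^sup>2 / 2" using sum_squares_ge_zero[of "x - 1" 1] by (simp add: power2_eq_square algebra_simps)
    also have "\<dots> \<le> exp (x\<^sup>2 / 2)" by (rule exp_ge_add_one_self)
    finally show ?thesis by (simp add: exp_minus field_simps)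
  qed
  moreover have "x * std_normal_density x \<le> x * exp (- x\<^sup>2 / 2)"
    using assms by (intro mult_left_mono std_normal_density_le_exp) auto
  ultimately have "x * std_normal_density x \<le> 1" by linarith
  then have "std_normal_density x / x \<le> 1 / x\<^sup>2" using assms by (simp add: field_simps power2_eq_square)
  with normal_tail_le[OF assms] show ?thesis by simp
qed

text \<open>Given l, the probability is a normal tail at 1 / (l sqrt \<tau>), at most min 1 (l^2
  \<tau>). Its half-Cauchy mean is covered by \<open>half_cauchy_min_le\<close> with sqrt \<tau> in
  place of \<tau>.\<close>

lemma measure_horseshoe_far:
  assumes "0 < \<tau>"
  shows "measure (horseshoe \<tau>) {..<- sqrt \<tau>} \<le> 2 * sqrt \<tau>"
proof -
  interpret H: prob_space "horseshoe \<tau>" by (rule prob_space_horseshoe[OF assms])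
  have "ennreal (H.prob {..<- sqrt \<tau>}) = (\<integral>\<^sup>+\<theta>. indicator {..<- sqrt \<tau>} \<theta> \<partial>horseshoe \<tau>)"
    by (simp add: H.emeasure_eq_measure)
  also have "\<dots> = (\<integral>\<^sup>+l. \<integral>\<^sup>+z. indicator {..<- sqrt \<tau>} (l * \<tau> * z) \<partial>gauss \<partial>half_cauchy)"
    by (rule nn_integral_horseshoe_gauss[OF assms]) simp
  also have "\<dots> \<le> (\<integral>\<^sup>+l. ennreal (min 1 ((l * sqrt \<tau>)\<^sup>2)) \<partial>half_cauchy)"
  proof (rule nn_integral_mono_AE)
    show "AE l in half_cauchy. (\<integral>\<^sup>+z. indicator {..<- sqrt \<tau>} (l * \<tau> * z) \<partial>gauss) \<le> ennreal (min 1 ((l * sqrt \<tau>)\<^sup>2))"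
      using AE_half_cauchy_pos
    proof eventually_elim
      case (elim l)
      define r where "r = 1 / (l * sqrt \<tau>)"
      have r: "r > 0" using elim assms by (simp add: r_def)
      have "(\<integral>\<^sup>+z. indicator {..<- sqrt \<tau>} (l * \<tau> * z) \<partial>gauss) = (\<integral>\<^sup>+z. indicator {..<- r} z \<partial>gauss)"
      proof (rule nn_integral_cong)
        fix z
        have "l * \<tau> * z = (l * sqrt \<tau> * z) * sqrt \<tau>"
          using assms real_sqrt_mult_self[of \<tau>] by (metis abs_of_pos mult.assoc mult.commute)
        then have "l * \<tau> * z < - sqrt \<tau> \<longleftrightarrow> (l * sqrt \<tau> * z) * sqrt \<tau> < (- 1) * sqrt \<tau>"
          by (simp only: minus_mult_left[symmetric] mult_1_left)
        also have "\<dots> \<longleftrightarrow> l * sqrt \<tau> * z < - 1" using assms by (subst mult_less_cancel_right_pos) auto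
        also have "\<dots> \<longleftrightarrow> z < - r" using elim assms by (simp add: r_def field_simps)
        finally show "indicator {..<- sqrt \<tau>} (l * \<tau> * z) = (indicator {..<- r} z :: ennreal)"
          by (auto split: split_indicator)
      qed
      also have "\<dots> = ennreal (normal_tail r)" by (simp add: gauss.emeasure_eq_measure measure_gauss_lessThan)
      also have "\<dots> \<le> ennreal (min 1 ((l * sqrt \<tau>)\<^sup>2))"
        using normal_tail_le_inverse_square[OF r] by (intro ennreal_leI) (simp add: r_def power_divide)
      finally show ?case .
    qed
  qed
  also have "\<dots> = ennreal (\<integral>l. min 1 ((l * sqrt \<tau>)\<^sup>2) \<partial>half_cauchy)"
    by (intro nn_integral_eq_integral integrable_half_cauchy_bounded[where B=1]) auto
  also have "\<dots> \<le> ennreal (2 * sqrt \<tau>)"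
    using assms by (intro ennreal_leI half_cauchy_min_le) simp
  finally show ?thesis using assms by (simp add: ennreal_le_iff)
qed

text \<open>Only \<theta> in [- sqrt \<tau>, 0) is kept, where the tail argument moves by at most
  sqrt \<tau>. The prior is so concentrated at 0 that at most 2 sqrt \<tau> of the mass 1 / 2 is
  lost.\<close>

lemma neg_tail_ge:
  assumes "\<tau> > 0"
  shows "neg_tail \<tau> x \<ge> (1 / 2 - 2 * sqrt \<tau>) * normal_tail (x + sqrt \<tau>)"
proof -
  interpret H: prob_space "horseshoe \<tau>" by (rule prob_space_horseshoe[OF assms])
  have "H.prob ({..<- sqrt \<tau>} \<union> {- sqrt \<tau>..<0}) = H.prob {..<- sqrt \<tau>} + H.prob {- sqrt \<tau>..<0}"
    by (rule H.finite_measure_Union) auto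
  moreover have "{..<- sqrt \<tau>} \<union> {- sqrt \<tau>..<0} = {..<0}"   proof -
    have "- sqrt \<tau> < 0" using assms by simp
    then show ?thesis by (auto simp del: real_sqrt_gt_0_iff neg_less_0_iff_less)
  qed
  ultimately have "H.prob {- sqrt \<tau>..<0} \<ge> 1 / 2 - 2 * sqrt \<tau>"
    using measure_horseshoe_far[OF assms] measure_horseshoe_neg[OF assms] by simp
  then have "(1 / 2 - 2 * sqrt \<tau>) * normal_tail (x + sqrt \<tau>) \<le> H.prob {- sqrt \<tau>..<0} * normal_tail (x + sqrt \<tau>)"
    by (intro mult_right_mono) auto
  also have "\<dots> = (\<integral>\<theta>. indicator {- sqrt \<tau>..<0} \<theta> * normal_tail (x + sqrt \<tau>) \<partial>horseshoe \<tau>)"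
    by simp
  also have "\<dots> \<le> neg_tail \<tau> x"
    unfolding neg_tail_def
    by (intro integral_mono integrable_horseshoe_bounded[OF assms, where B=1])
       (auto simp: normal_tail_antimono split: split_indicator)
  finally show ?thesis .
qed

lemma S_value_minus: "\<tau> > 0 \<Longrightarrow> S_value (- x) \<tau> = S_value x \<tau>"
  by (simp add: S_value_eq min.commute)

lemma S_value_le:
  assumes "\<tau> > 0"
  shows "S_value x \<tau> \<le> normal_tail x / (normal_tail x + tail_excess \<tau> x)"
proof -
  have "S_value x \<tau> \<le> 2 * (neg_tail \<tau> x / marg_tail \<tau> x)"
    unfolding S_value_eq[OF assms] by simp
  also have "\<dots> \<le> 2 * (normal_tail x / 2 / marg_tail \<tau> x)"
    using neg_tail_le[OF assms] marg_tail_pos[OF assms] by (intro mult_left_mono divide_right_mono) (auto simp: less_imp_le)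
  also have "\<dots> = normal_tail x / marg_tail \<tau> x" by simp
  finally show ?thesis by (simp only: marg_tail_eq[OF assms])
qed

text \<open>The first branch equals the tail ratio up to factors tending to 1 when sqrt \<tau> (1 +
  x) is small. The second branch, which tests against the sign of x, stays near 1 and so cannot fall
  below a level t < 1.\<close>

lemma S_value_ge:
  assumes "\<tau> > 0" "x \<ge> 0" and small: "4 * sqrt \<tau> \<le> 1" "sqrt \<tau> * (1 + x) \<le> 1"
  shows "S_value x \<tau> \<ge> min
    ((1 - 4 * sqrt \<tau>) * (1 - sqrt \<tau> * (1 + x)) * (normal_tail x / (normal_tail x + tail_excess \<tau> x)))
    ((1 - 4 * sqrt \<tau>) * (1 - 2 * sqrt \<tau>))"
proof -
  define s where "s = sqrt \<tau>"
  have s: "s > 0" using assms by (simp add: s_def)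
  have m: "0 < marg_tail \<tau> x" "0 < marg_tail \<tau> (- x)" using marg_tail_pos[OF assms(1)] by auto
  have "(1 - 4 * s) * (1 - s * (1 + x)) * normal_tail x \<le> (1 - 4 * s) * normal_tail (x + s)"
    using normal_tail_shift_ge[of x s] assms s by (simp add: mult.assoc mult_left_mono s_def)
  also have "\<dots> \<le> 2 * neg_tail \<tau> x" using neg_tail_ge[OF assms(1), of x] by (simp add: s_def algebra_simps)
  finally have 1: "(1 - 4 * s) * (1 - s * (1 + x)) * (normal_tail x / marg_tail \<tau> x) \<le> 2 * (neg_tail \<tau> x / marg_tail \<tau> x)"
    using m by (simp add: divide_right_mono)
  have half: "1 / 2 \<le> normal_tail (- x)" using normal_tail_antimono[of "-x" 0] assms by simp
  have "marg_tail \<tau> (- x) \<le> normal_tail (- x)"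
    using marg_tail_uminus[OF assms(1), of x] marg_tail_eq[OF assms(1), of x] tail_excess_nonneg[OF assms(2), of \<tau>]
      normal_tail_uminus[of x] by simp
  then have "(1 - 4 * s) * (1 - 2 * s) * marg_tail \<tau> (- x) \<le> (1 - 4 * s) * (1 - 2 * s) * normal_tail (- x)"
    using small s by (intro mult_left_mono) (auto simp: s_def)
  also have "\<dots> \<le> (1 - 4 * s) * normal_tail (- x + s)"
  proof -
    have "normal_tail (- x) - s \<le> normal_tail (- x + s)" using normal_tail_lipschitz[of "-x" "-x + s"] s by simp
    moreover have "s * 1 \<le> s * (2 * normal_tail (- x))" using half s by (intro mult_left_mono) auto
    ultimately have "(1 - 2 * s) * normal_tail (- x) \<le> normal_tail (- x + s)" by (simp add: algebra_simps)
    then show ?thesis using small by (simp add: mult.assoc mult_left_mono s_def)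
  qed
  also have "\<dots> \<le> 2 * neg_tail \<tau> (- x)" using neg_tail_ge[OF assms(1), of "- x"] by (simp add: s_def algebra_simps)
  finally have 2: "(1 - 4 * s) * (1 - 2 * s) \<le> 2 * (neg_tail \<tau> (- x) / marg_tail \<tau> (- x))"
    using m by (simp add: pos_le_divide_eq)
  show ?thesis
    using 1 2 unfolding S_value_eq[OF assms(1)] s_def[symmetric] marg_tail_eq[OF assms(1), of x, symmetric]
    by (auto simp: min_def)
qed

text \<open>Beyond a nonnegative point, the marginal tail grows relative to the normal tail because the
  likelihood ratio increases.\<close>

lemma tail_ratio_antimono:
  assumes "\<tau> > 0" "0 \<le> x" "x \<le> y"
  shows "normal_tail y / (normal_tail y + tail_excess \<tau> y) \<le> normal_tail x / (normal_tail x + tail_excess \<tau> x)"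
proof -
  define g where "g a = (\<integral>z. indicator {a<..} z * lik_ratio \<tau> z \<partial>gauss)" for a
  have g: "normal_tail a + tail_excess \<tau> a = g a" for a by (simp add: g_def integral_gauss_tail_lik_ratio)
  have gp: "g a > 0" for a using marg_tail_pos[OF assms(1), of a] by (simp add: marg_tail_eq[OF assms(1)] g)
  have "g x - g y = (\<integral>z. indicator {x<..y} z * lik_ratio \<tau> z \<partial>gauss)"
  proof -
    have "indicator {x<..} z * lik_ratio \<tau> z - indicator {y<..} z * lik_ratio \<tau> z = indicator {x<..y} z * lik_ratio \<tau> z" for z
      using assms by (auto split: split_indicator)
    then show ?thesis
      unfolding g_def by (subst Bochner_Integration.integral_diff[symmetric]) simp_all
  qed
  also have "\<dots> \<le> (\<integral>z. indicator {x<..y} z * lik_ratio \<tau> y \<partial>gauss)"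
    using assms by (intro integral_mono integrable_mult_left) (auto intro: lik_ratio_mono split: split_indicator)
  also have "\<dots> = (normal_tail x - normal_tail y) * lik_ratio \<tau> y"
  proof -
    have "measure gauss ({x<..y} \<union> {y<..}) = measure gauss {x<..y} + measure gauss {y<..}"
      by (rule gauss.finite_measure_Union) auto
    moreover have "{x<..y} \<union> {y<..} = {x<..}" using assms by auto
    ultimately show ?thesis by (simp add: normal_tail_def)
  qed
  finally have 1: "g x - g y \<le> (normal_tail x - normal_tail y) * lik_ratio \<tau> y" .
  have "normal_tail y * lik_ratio \<tau> y = (\<integral>z. indicator {y<..} z * lik_ratio \<tau> y \<partial>gauss)"
    by (simp add: normal_tail_def)
  also have "\<dots> \<le> g y"
    unfolding g_def using assms by (intro integral_mono integrable_mult_left) (auto intro: lik_ratio_mono split: split_indicator)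
  finally have 2: "lik_ratio \<tau> y \<le> g y / normal_tail y" using normal_tail_pos[of y] by (simp add: pos_le_divide_eq mult.commute)
  have "(normal_tail x - normal_tail y) * lik_ratio \<tau> y \<le> (normal_tail x - normal_tail y) * (g y / normal_tail y)"
    using 2 normal_tail_antimono[OF assms(3)] by (intro mult_left_mono) auto
  with 1 have "g x \<le> normal_tail x * (g y / normal_tail y)"
    using normal_tail_pos[of y] by (simp add: algebra_simps diff_divide_distrib)
  then have "normal_tail y * g x \<le> normal_tail x * g y" using normal_tail_pos[of y] by (simp add: field_simps)
  then show ?thesis unfolding g using gp[of x] gp[of y] by (simp add: divide_simps mult.commute)
qed

text \<open>Joint measurability in x and \<tau> is needed because a data-dependent \<tau> is
  inserted. Integrals over the prior are rewritten over the fixed laws \<open>gauss\<close> and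
  \<open>half_cauchy\<close>, so that \<tau> enters only through the integrand; this rewriting holds
  for \<tau> > 0.\<close>

lemma S_value_measurable:
  "(\<lambda>z. S_value (fst z) (snd z)) \<in> borel_measurable (restrict_space (borel \<Otimes>\<^sub>M borel) {z. snd z > 0})"
proof -
  define N where "N \<tau> x = enn2real (\<integral>\<^sup>+l. \<integral>\<^sup>+z. ennreal (indicator {..<0} (l * \<tau> * z) * normal_tail (x - l * \<tau> * z)) \<partial>gauss \<partial>half_cauchy)" for \<tau> x
  define M where "M \<tau> x = enn2real (\<integral>\<^sup>+l. \<integral>\<^sup>+z. ennreal (normal_tail (x - l * \<tau> * z)) \<partial>gauss \<partial>half_cauchy)" for \<tau> x
  have eq: "S_value x \<tau> = 2 * min (N \<tau> x / M \<tau> x) (N \<tau> (- x) / M \<tau> (- x))" if "\<tau> > 0" for x \<tau>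
  proof -
    have "neg_tail \<tau> x = N \<tau> x" for x
      unfolding neg_tail_def N_def
      by (subst nn_integral_horseshoe_gauss[OF that, symmetric]) (auto simp: integral_eq_nn_integral)
    moreover have "marg_tail \<tau> x = M \<tau> x" for x
      unfolding marg_tail_def M_def
      by (subst nn_integral_horseshoe_gauss[OF that, symmetric]) (auto simp: integral_eq_nn_integral)
    ultimately show ?thesis using S_value_eq[OF that, of x] by simp
  qed
  have "(\<lambda>z. 2 * min (N (snd z) (fst z) / M (snd z) (fst z)) (N (snd z) (- fst z) / M (snd z) (- fst z)))
     \<in> borel_measurable (borel \<Otimes>\<^sub>M borel)"
    unfolding N_def M_def by measurable
  then have "(\<lambda>z. 2 * min (N (snd z) (fst z) / M (snd z) (fst z)) (N (snd z) (- fst z) / M (snd z) (- fst z)))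
     \<in> borel_measurable (restrict_space (borel \<Otimes>\<^sub>M borel) {z. snd z > 0})"
    by (rule measurable_restrict_space1)
  then show ?thesis
    by (rule measurable_cong[THEN iffD1, rotated]) (simp add: eq space_restrict_space)
qed

section \<open>Asymptotics for small \<open>\<tau>\<close>\<close>

lemma normal_tail_le_exp:
  assumes "x \<ge> 1"
  shows "normal_tail x \<le> exp (- x\<^sup>2 / 2)"
proof -
  have "normal_tail x \<le> std_normal_density x / x" using assms by (intro normal_tail_le) auto
  also have "\<dots> \<le> std_normal_density x / 1" using assms by (intro divide_left_mono) auto
  also have "\<dots> \<le> exp (- x\<^sup>2 / 2)" using std_normal_density_le_exp by simp
  finally show ?thesis .
qed

definition zeta :: "real \<Rightarrow> real" where
  "zeta \<tau> = sqrt (2 * ln (1 / \<tau>))"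

lemma exp_zeta: "0 < \<tau> \<Longrightarrow> \<tau> \<le> 1 \<Longrightarrow> exp (- (zeta \<tau>)\<^sup>2 / 2) = \<tau>"
  by (simp add: zeta_def ln_div)

lemma zeta_at_top: "filterlim zeta at_top (at_right 0)"
  unfolding zeta_def by real_asymp

lemma zeta_antimono: "0 < x \<Longrightarrow> x \<le> y \<Longrightarrow> zeta y \<le> zeta x"
  unfolding zeta_def by (intro real_sqrt_le_mono) (simp add: ln_div)

lemma zeta_pos: "0 < \<tau> \<Longrightarrow> \<tau> < 1 \<Longrightarrow> 0 < zeta \<tau>"
  by (simp add: zeta_def ln_div)

lemma zeta_measurable [measurable]: "zeta \<in> borel_measurable borel"
  unfolding zeta_def[abs_def] by measurable

text \<open>A statement about small \<open>\<tau>\<close> is best read as one about large \<open>z = \<zeta>(\<tau>)\<close>, with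
  \<open>\<tau> = exp (- z\<^sup>2 / 2)\<close>.\<close>

lemma eventually_at_right_0_zeta:
  assumes "\<forall>\<^sub>F z in at_top. P (exp (- z\<^sup>2 / 2)) z"
  shows "\<forall>\<^sub>F \<tau> in at_right 0. P \<tau> (zeta \<tau>)"
proof -
  have "\<forall>\<^sub>F \<tau> in at_right 0. P (exp (- (zeta \<tau>)\<^sup>2 / 2)) (zeta \<tau>)"
    using eventually_compose_filterlim[OF assms zeta_at_top] .
  moreover have "\<forall>\<^sub>F \<tau> in at_right (0::real). 0 < \<tau> \<and> \<tau> \<le> 1"
    unfolding eventually_at_right_field by (intro exI[of _ 1]) auto
  ultimately show ?thesis by eventually_elim (metis exp_zeta)
qed

text \<open>\<open>null_drift_le\<close> at A = z - 1. One unit below the threshold the inner term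
  is of relative order z^2 exp (- z), while the tail excess, of order \<tau> / x, changes only by
  the factor z / (z - 1).\<close>

lemma null_drift_upper:
  assumes "\<delta> > 0"
  shows "\<forall>\<^sub>F \<tau> in at_right 0. null_drift \<tau> \<le> (2 * c0 + \<delta>) * (\<tau> / zeta \<tau>)"
proof (rule eventually_at_right_0_zeta)
  obtain X t0 where X: "X > 0" "t0 > 0" "\<And>x \<tau>. x \<ge> X \<Longrightarrow> 0 < \<tau> \<Longrightarrow> \<tau> \<le> t0 \<Longrightarrow> tail_excess \<tau> x \<le> (c0 + \<delta> / 8) * (\<tau> / x)"
    using tail_excess_asymp[of "\<delta> / 8"] assms by auto
  have "((\<lambda>z::real. 64 * (z - 1) * exp (- z\<^sup>2 / 2) * exp ((z - 1)\<^sup>2 / 2) * z + 16 * exp (- (z - 1)\<^sup>2 / 2) * z) \<longlongrightarrow> 0) at_top"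
    by real_asymp
  then have e1: "\<forall>\<^sub>F z in at_top. 64 * (z - 1) * exp (- z\<^sup>2 / 2) * exp ((z - 1)\<^sup>2 / 2) * z + 16 * exp (- (z - 1)\<^sup>2 / 2) * z < \<delta> / 4"
    using assms by (intro order_tendstoD(2)) auto
  have "((\<lambda>z::real. 2 * (c0 + \<delta> / 8) * (z / (z - 1))) \<longlongrightarrow> 2 * (c0 + \<delta> / 8) * 1) at_top"
    by (intro tendsto_intros) real_asymp
  then have e2: "\<forall>\<^sub>F z in at_top. 2 * (c0 + \<delta> / 8) * (z / (z - 1)) < 2 * c0 + \<delta> / 2"
    using assms by (intro order_tendstoD(2)) auto
  have e3: "\<forall>\<^sub>F z in at_top. exp (- z\<^sup>2 / 2) < min t0 (1/8 :: real)"
    using X by (intro order_tendstoD(2)[of _ 0]) (real_asymp | simp)+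
  show "\<forall>\<^sub>F z in at_top. null_drift (exp (- z\<^sup>2 / 2)) \<le> (2 * c0 + \<delta>) * (exp (- z\<^sup>2 / 2) / z)"
    using e1 e2 e3 eventually_ge_at_top[of "X + 1"] eventually_ge_at_top[of 2]
  proof eventually_elim
    case (elim z)
    define \<tau> where "\<tau> = exp (- z\<^sup>2 / 2)"
    have t: "0 < \<tau>" "\<tau> \<le> t0" "\<tau> \<le> 1/8" using elim by (auto simp: \<tau>_def)
    have "null_drift \<tau> \<le> 64 * (z - 1) * \<tau>\<^sup>2 * exp ((z - 1)\<^sup>2 / 2) + 2 * tail_excess \<tau> (z - 1) + 16 * \<tau> * normal_tail (z - 1)"
      using t elim by (intro null_drift_le) auto
    also have "\<dots> \<le> 64 * (z - 1) * \<tau>\<^sup>2 * exp ((z - 1)\<^sup>2 / 2) + 2 * ((c0 + \<delta> / 8) * (\<tau> / (z - 1))) + 16 * \<tau> * exp (- (z - 1)\<^sup>2 / 2)"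
      using t elim X(3)[of "z - 1" \<tau>] normal_tail_le_exp[of "z - 1"] by (intro add_mono mult_left_mono) auto
    also have "\<dots> = (64 * (z - 1) * \<tau> * exp ((z - 1)\<^sup>2 / 2) * z + 16 * exp (- (z - 1)\<^sup>2 / 2) * z + 2 * (c0 + \<delta> / 8) * (z / (z - 1))) * (\<tau> / z)"
      using elim by (simp add: field_simps power2_eq_square)
    also have "\<dots> \<le> (\<delta> / 4 + (2 * c0 + \<delta> / 2)) * (\<tau> / z)"
      using elim t by (intro mult_right_mono) (auto simp: \<tau>_def)
    also have "\<dots> \<le> (2 * c0 + \<delta>) * (\<tau> / z)"
      using assms elim t by (intro mult_right_mono) auto
    finally show ?case by (simp add: \<tau>_def)
  qed
qed

text \<open>\<open>null_drift_ge\<close> at B = z + 1. One unit above the threshold the score is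
  already 1 - o(1), with error r, and the shift costs only the factor z / (z + 1).\<close>

lemma null_drift_lower:
  assumes "\<delta> > 0"
  shows "\<forall>\<^sub>F \<tau> in at_right 0. null_drift \<tau> \<ge> (2 * c0 - \<delta>) * (\<tau> / zeta \<tau>)"
proof (rule eventually_at_right_0_zeta)
  define d where "d = min (\<delta> / 8) (c0 / 2)"
  have d: "d > 0" "d \<le> \<delta> / 8" "d < c0" using assms c0_pos by (auto simp: d_def)
  obtain X t0 where X: "X > 0" "t0 > 0" "\<And>x \<tau>. x \<ge> X \<Longrightarrow> 0 < \<tau> \<Longrightarrow> \<tau> \<le> t0 \<Longrightarrow> (c0 - d) * (\<tau> / x) \<le> tail_excess \<tau> x"
    using tail_excess_asymp[of d] d by auto
  define r where "r z = 100 * (z + 1)\<^sup>2 * exp (- (z + 1)\<^sup>2 / 2) / exp (- z\<^sup>2 / 2) + 100 * (z + 1) ^ 5 * (exp (- z\<^sup>2 / 2))\<^sup>2" for z :: real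
  have r: "(r \<longlongrightarrow> 0) at_top" unfolding r_def by real_asymp
  have "((\<lambda>z. (1 - r z) * (2 * (c0 - d) * (z / (z + 1))) - 32 * exp (- z\<^sup>2 / 2) * z) \<longlongrightarrow> (1 - 0) * (2 * (c0 - d) * 1) - 0) at_top"
    by (intro tendsto_intros r) real_asymp+
  then have e1: "\<forall>\<^sub>F z in at_top. (1 - r z) * (2 * (c0 - d) * (z / (z + 1))) - 32 * exp (- z\<^sup>2 / 2) * z > 2 * c0 - \<delta>"
    using assms d by (intro order_tendstoD(1)) auto
  have e2: "\<forall>\<^sub>F z in at_top. r z < 1" using order_tendstoD(2)[OF r, of 1] by simp
  have e3: "\<forall>\<^sub>F z in at_top. exp (- z\<^sup>2 / 2) < min t0 (1/8 :: real)"
    using X by (intro order_tendstoD(2)[of _ 0]) (real_asymp | simp)+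
  show "\<forall>\<^sub>F z in at_top. null_drift (exp (- z\<^sup>2 / 2)) \<ge> (2 * c0 - \<delta>) * (exp (- z\<^sup>2 / 2) / z)"
    using e1 e2 e3 eventually_ge_at_top[of X] eventually_ge_at_top[of 1]
  proof eventually_elim
    case (elim z)
    define \<tau> where "\<tau> = exp (- z\<^sup>2 / 2)"
    have t: "0 < \<tau>" "\<tau> \<le> t0" "\<tau> \<le> 1/8" using elim by (auto simp: \<tau>_def)
    have "(2 * c0 - \<delta>) * (\<tau> / z) \<le> ((1 - r z) * (2 * (c0 - d) * (z / (z + 1))) - 32 * \<tau> * z) * (\<tau> / z)"
      using elim t by (intro mult_right_mono) (auto simp: \<tau>_def)
    also have "\<dots> = (1 - r z) * (2 * ((c0 - d) * (\<tau> / (z + 1)))) - 32 * \<tau>\<^sup>2"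
    proof -
      have "(A * (2 * c * u) - 32 * t * w) * v = A * (2 * (c * (u * v))) - 32 * (t * (w * v))" for A c u t w v :: real
        by (simp add: algebra_simps)
      moreover have "z / (z + 1) * (\<tau> / z) = \<tau> / (z + 1)" "\<tau> * (z * (\<tau> / z)) = \<tau>\<^sup>2"
        using elim by (auto simp: power2_eq_square)
      ultimately show ?thesis by (simp only:)
    qed
    also have "\<dots> \<le> (1 - r z) * (2 * tail_excess \<tau> (z + 1)) - 32 * \<tau>\<^sup>2"
      using elim t X(3)[of "z + 1" \<tau>] by (intro diff_right_mono mult_left_mono) auto
    also have "\<dots> \<le> null_drift \<tau>"
      using elim t score_large_ge[of "z + 1" \<tau>] by (intro null_drift_ge) (auto simp: r_def \<tau>_def)
    finally show ?case by (simp add: \<tau>_def)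
  qed
qed

text \<open>At A = \<zeta>(\<tau>) the factor exp (A^2 / 2) is 1 / \<tau>, and both terms of
  \<open>score_second_moment_le\<close> are bounded by multiples of \<tau> /
  \<zeta>(\<tau>).\<close>

lemma score_second_moment_zeta:
  assumes "0 < \<tau>" "\<tau> \<le> 1/8"
  shows "(\<integral>x. (score \<tau> x)\<^sup>2 \<partial>gauss) \<le> 258 * (\<tau> / zeta \<tau>)"
proof -
  have z: "zeta \<tau> > 0" using assms by (intro zeta_pos) auto
  have e: "exp (- (zeta \<tau>)\<^sup>2 / 2) = \<tau>" using assms by (intro exp_zeta) auto
  then have e': "exp ((zeta \<tau>)\<^sup>2 / 2) = 1 / \<tau>" using assms by (simp add: exp_minus field_simps)
  have "(\<integral>x. (score \<tau> x)\<^sup>2 \<partial>gauss) \<le> 256 * \<tau>\<^sup>2 * exp ((zeta \<tau>)\<^sup>2 / 2) / zeta \<tau> + 2 * normal_tail (zeta \<tau>)"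
    using assms z by (intro score_second_moment_le)
  also have "normal_tail (zeta \<tau>) \<le> std_normal_density (zeta \<tau>) / zeta \<tau>" by (rule normal_tail_le[OF z])
  also have "\<dots> \<le> \<tau> / zeta \<tau>" using std_normal_density_le_exp[of "zeta \<tau>"] z e by (intro divide_right_mono) auto
  also have "256 * \<tau>\<^sup>2 * exp ((zeta \<tau>)\<^sup>2 / 2) / zeta \<tau> = 256 * (\<tau> / zeta \<tau>)"
    unfolding e' using assms by (simp add: power2_eq_square)
  finally show ?thesis by simp
qed

section \<open>The target of the marginal maximum likelihood estimator\<close>

text \<open>Here \<open>z = \<zeta>(s\<^sub>n / n)\<close> is the universal threshold. The target balances the drift
  \<open>2 c\<^sub>0 n \<tau> / \<zeta>(\<tau>)\<close> of the null coordinates against the number \<open>s\<^sub>n \<Phi>(b)\<close> of detectable signals.\<close>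

definition target :: "real \<Rightarrow> real \<Rightarrow> real" where
  "target b z = normal_tail (- b) / (2 * c0) * z * exp (- z\<^sup>2 / 2)"

lemma target_coeff_pos: "normal_tail (- b) / (2 * c0) > 0"
  using c0_pos normal_tail_pos by simp

lemma target_pos: "z > 0 \<Longrightarrow> target b z > 0"
  unfolding target_def using target_coeff_pos[of b] by (intro mult_pos_pos) auto

lemma target_at_right: "filterlim (target b) (at_right 0) at_top"
proof -
  define C where "C = normal_tail (- b) / (2 * c0)"
  have "C > 0" using target_coeff_pos by (simp add: C_def)
  then show ?thesis unfolding target_def C_def[symmetric] by real_asymp
qed

text \<open>The factor C z in front of exp (- z^2 / 2) changes ln (1 / \<tau>) only by O(ln
  z).\<close>

lemma zeta_target: "((\<lambda>z. zeta (target b z) / z) \<longlongrightarrow> 1) at_top"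
proof -
  define C where "C = normal_tail (- b) / (2 * c0)"
  have "C > 0" using target_coeff_pos by (simp add: C_def)
  then show ?thesis unfolding target_def zeta_def C_def[symmetric] by real_asymp
qed

text \<open>A margin \<eta> above z multiplies exp (- z^2 / 2) by at most exp (- z \<eta>). This
  beats the powers of z in \<open>score_large_ge\<close>, for every \<tau> within a factor K below
  the target.\<close>

lemma score_above_threshold:
  assumes "K \<ge> 1" "\<eta> > 0" "\<delta> > 0"
  shows "\<forall>\<^sub>F z in at_top. \<forall>\<tau>\<in>{target b z / K..target b z}. \<forall>x. \<bar>x\<bar> \<ge> z + \<eta> \<longrightarrow> 1 - \<delta> \<le> score \<tau> x"
proof -
  define C where "C = normal_tail (- b) / (2 * c0)"
  have C: "C > 0" using target_coeff_pos by (simp add: C_def)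
  have tg: "target b z = C * z * exp (- z\<^sup>2 / 2)" for z by (simp add: target_def C_def)
  have "((\<lambda>z. 100 * (z + \<eta>)\<^sup>2 * exp (- (z + \<eta>)\<^sup>2 / 2) * K / (C * z * exp (- z\<^sup>2 / 2)) + 100 * (z + \<eta>) ^ 5 * (C * z * exp (- z\<^sup>2 / 2))\<^sup>2) \<longlongrightarrow> 0) at_top"
    using C assms by real_asymp
  then have e1: "\<forall>\<^sub>F z in at_top. 100 * (z + \<eta>)\<^sup>2 * exp (- (z + \<eta>)\<^sup>2 / 2) * K / target b z + 100 * (z + \<eta>) ^ 5 * (target b z)\<^sup>2 < \<delta>"
    unfolding tg using assms by (intro order_tendstoD(2)) auto
  have e2: "\<forall>\<^sub>F z in at_top. target b z < 1"
    using order_tendstoD(2)[of "target b" 0 at_top 1] target_at_right[of b]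
    by (auto simp: filterlim_at)
  show ?thesis
    using e1 e2 eventually_ge_at_top[of 1]
  proof eventually_elim
    case (elim z)
    show ?case
    proof (intro ballI allI impI)
      fix \<tau> x assume t: "\<tau> \<in> {target b z / K..target b z}" and x: "z + \<eta> \<le> \<bar>x\<bar>"
      have T: "target b z > 0" using elim by (intro target_pos) auto
      then have t0: "0 < target b z / K" using assms by simp
      then have t1: "0 < \<tau>" "\<tau> \<le> 1" using t elim by auto
      have "1 / \<tau> \<le> 1 / (target b z / K)" using t t0 t1 by (intro divide_left_mono mult_pos_pos) auto
      then have "100 * (z + \<eta>)\<^sup>2 * exp (- (z + \<eta>)\<^sup>2 / 2) * (1 / \<tau>) \<le> 100 * (z + \<eta>)\<^sup>2 * exp (- (z + \<eta>)\<^sup>2 / 2) * (1 / (target b z / K))"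
        by (intro mult_left_mono) auto
      moreover have "100 * (z + \<eta>) ^ 5 * \<tau>\<^sup>2 \<le> 100 * (z + \<eta>) ^ 5 * (target b z)\<^sup>2"
        using t t1 elim assms by (intro mult_left_mono power_mono) auto
      ultimately have "1 - \<delta> \<le> 1 - 100 * (z + \<eta>)\<^sup>2 * exp (- (z + \<eta>)\<^sup>2 / 2) / \<tau> - 100 * (z + \<eta>) ^ 5 * \<tau>\<^sup>2"
        using elim by simp
      also have "\<dots> \<le> score \<tau> (z + \<eta>)" using elim assms t1 by (intro score_large_ge) auto
      also have "\<dots> \<le> score \<tau> x" using x elim assms by (intro score_mono) auto
      finally show "1 - \<delta> \<le> score \<tau> x" .
    qed
  qed
qed

text \<open>For |x| \<le> z - \<eta> and \<tau> up to K times the target, the bound 8 \<tau> exp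
  (x^2 / 2) is of order z exp (- z \<eta>).\<close>

lemma score_below_threshold:
  assumes "K > 0" "\<eta> > 0" "\<delta> > 0"
  shows "\<forall>\<^sub>F z in at_top. \<forall>\<tau>\<in>{0<..K * target b z}. \<forall>x. \<bar>x\<bar> \<le> z - \<eta> \<longrightarrow> score \<tau> x \<le> \<delta>"
proof -
  define C where "C = normal_tail (- b) / (2 * c0)"
  have C: "C > 0" using target_coeff_pos by (simp add: C_def)
  have tg: "target b z = C * z * exp (- z\<^sup>2 / 2)" for z by (simp add: target_def C_def)
  have "((\<lambda>z. 8 * (K * (C * z * exp (- z\<^sup>2 / 2))) * exp ((z - \<eta>)\<^sup>2 / 2)) \<longlongrightarrow> 0) at_top"
    using C assms by real_asymp
  then have e1: "\<forall>\<^sub>F z in at_top. 8 * (K * target b z) * exp ((z - \<eta>)\<^sup>2 / 2) < \<delta>"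
    unfolding tg using assms by (intro order_tendstoD(2)) auto
  have "((\<lambda>z. K * (C * z * exp (- z\<^sup>2 / 2))) \<longlongrightarrow> 0) at_top"
    using C assms by real_asymp
  then have e2: "\<forall>\<^sub>F z in at_top. K * target b z < 1/8"
    unfolding tg by (intro order_tendstoD(2)) auto
  show ?thesis
    using e1 e2
  proof eventually_elim
    case (elim z)
    show ?case
    proof (intro ballI allI impI)
      fix \<tau> x assume t: "\<tau> \<in> {0<..K * target b z}" and x: "\<bar>x\<bar> \<le> z - \<eta>"
      have "score \<tau> x \<le> 8 * \<tau> * exp (x\<^sup>2 / 2)" using abs_score_le_exp[of \<tau> x] t elim by simp
      also have "x\<^sup>2 \<le> (z - \<eta>)\<^sup>2" using x by (subst abs_le_square_iff[symmetric]) auto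
      then have "8 * \<tau> * exp (x\<^sup>2 / 2) \<le> 8 * (K * target b z) * exp ((z - \<eta>)\<^sup>2 / 2)"
        using t by (intro mult_mono) auto
      finally show "score \<tau> x \<le> \<delta>" using elim by simp
    qed
  qed
qed

section \<open>Rejection thresholds\<close>

text \<open>A constant factor on the tail probability moves the quantile by o(1) only. With exp (-
  z^2 / 2) = s / n, the level means that n nulls have \<kappa> p s expected exceedances of y on both
  sides together, where p is \<open>normal_tail (- b)\<close>. The quantile stays implicit;
  \<open>normal_tail_eq_solution\<close> supplies it.\<close>

lemma quantile_near_threshold:
  assumes "\<kappa> > 0" "\<eta> > 0"
  shows "\<forall>\<^sub>F z in at_top. \<forall>y. normal_tail y = \<kappa> * (normal_tail (- b) * exp (- z\<^sup>2 / 2) / 2) \<longrightarrow> z - \<eta> \<le> y \<and> y \<le> z + \<eta>"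
proof -
  define p where "p = \<kappa> * normal_tail (- b) / 2"
  have p: "p > 0" using assms normal_tail_pos by (simp add: p_def)
  have "((\<lambda>z. exp (- (z + \<eta>)\<^sup>2 / 2) / (p * exp (- z\<^sup>2 / 2))) \<longlongrightarrow> 0) at_top"
    using p assms by real_asymp
  then have e1: "\<forall>\<^sub>F z in at_top. exp (- (z + \<eta>)\<^sup>2 / 2) / (p * exp (- z\<^sup>2 / 2)) < 1"
    by (intro order_tendstoD(2)) auto
  have "((\<lambda>z. p * exp (- z\<^sup>2 / 2) / (exp (- (z - \<eta>)\<^sup>2 / 2) / (1 + (z - \<eta>)))) \<longlongrightarrow> 0) at_top"
    using p assms by real_asymp
  then have e2: "\<forall>\<^sub>F z in at_top. p * exp (- z\<^sup>2 / 2) / (exp (- (z - \<eta>)\<^sup>2 / 2) / (1 + (z - \<eta>))) < 1 / sqrt (2 * pi)"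
    by (intro order_tendstoD(2)) auto
  show ?thesis
    using e1 e2 eventually_ge_at_top[of "1 + \<eta>"]
  proof eventually_elim
    case (elim z)
    have 1: "normal_tail (z + \<eta>) < p * exp (- z\<^sup>2 / 2)"
    proof -
      have "normal_tail (z + \<eta>) \<le> exp (- (z + \<eta>)\<^sup>2 / 2)" using elim assms by (intro normal_tail_le_exp) auto
      also have "\<dots> < p * exp (- z\<^sup>2 / 2)" using elim(1) p by (simp add: divide_less_eq)
      finally show ?thesis .
    qed
    have 2: "p * exp (- z\<^sup>2 / 2) < normal_tail (z - \<eta>)"
    proof -
      have "p * exp (- z\<^sup>2 / 2) < 1 / sqrt (2 * pi) * (exp (- (z - \<eta>)\<^sup>2 / 2) / (1 + (z - \<eta>)))"
        using elim by (subst (asm) pos_divide_less_eq) (auto intro!: divide_pos_pos)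
      also have "\<dots> = std_normal_density (z - \<eta>) / (1 + (z - \<eta>))" by (simp add: std_normal_density_def)
      also have "\<dots> \<le> normal_tail (z - \<eta>)" using elim by (intro normal_tail_ge) auto
      finally show ?thesis .
    qed
    show ?case
    proof (intro allI impI)
      fix y assume "normal_tail y = \<kappa> * (normal_tail (- b) * exp (- z\<^sup>2 / 2) / 2)"
      then have y: "normal_tail y = p * exp (- z\<^sup>2 / 2)" by (simp add: p_def)
      show "z - \<eta> \<le> y \<and> y \<le> z + \<eta>"
        using 1 2 y normal_tail_antimono[of "z + \<eta>" y] normal_tail_antimono[of y "z - \<eta>"] by linarith
    qed
  qed
qed

lemma S_value_abs: "\<tau> > 0 \<Longrightarrow> S_value \<bar>x\<bar> \<tau> = S_value x \<tau>"
  by (simp add: abs_if S_value_minus)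

text \<open>With P from the proof, the normal tail at y is \<kappa> P, and the tail excess, about c0
  \<tau> / y, is at least about (1 - \<epsilon>) P by the choice of the target. The ratio \<kappa> /
  (\<kappa> + 1 - \<epsilon>) is below t exactly if \<kappa> (1 - t) < t (1 - \<epsilon>). Larger
  |x| follow from \<open>tail_ratio_antimono\<close>.\<close>

lemma S_value_reject:
  assumes t: "0 < t" "t < 1" and \<epsilon>: "0 < \<epsilon>" "\<epsilon> < 1" and \<kappa>: "\<kappa> > 0" "\<kappa> * (1 - t) < t * (1 - \<epsilon>)"
  shows "\<forall>\<^sub>F z in at_top. \<forall>y. normal_tail y = \<kappa> * (normal_tail (- b) * exp (- z\<^sup>2 / 2) / 2) \<longrightarrow>
    (\<forall>\<tau>\<in>{(1 - \<epsilon>) * target b z..(1 + \<epsilon>) * target b z}. \<forall>x. \<bar>x\<bar> \<ge> y \<longrightarrow> S_value x \<tau> < t)"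
proof -
  \<comment> \<open>Half of the relative slack in the assumption on \<kappa>; the other half absorbs
    the remaining asymptotic errors.\<close>
  define d where "d = (t * (1 - \<epsilon>) - \<kappa> * (1 - t)) / (2 * (t * (1 - \<epsilon>)))"
  have te: "t * (1 - \<epsilon>) > 0" using t \<epsilon> by simp
  have d: "d > 0" using te \<kappa> by (simp add: d_def)
  have "d * (2 * (t * (1 - \<epsilon>))) = t * (1 - \<epsilon>) - \<kappa> * (1 - t)" using te t \<epsilon> by (simp add: d_def)
  then have td: "t * ((1 - d) * (1 - \<epsilon>)) > \<kappa> * (1 - t)" using \<kappa> by (simp add: algebra_simps)
  have d1: "d < 1"
  proof -
    have "0 < \<kappa> * (1 - t)" using \<kappa> t by simp
    then show ?thesis using te by (simp add: d_def divide_less_eq)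
  qed
  obtain X t0 where X: "X > 0" "t0 > 0" "\<And>x \<tau>. x \<ge> X \<Longrightarrow> 0 < \<tau> \<Longrightarrow> \<tau> \<le> t0 \<Longrightarrow> (c0 - c0 * d) * (\<tau> / x) \<le> tail_excess \<tau> x"
    using tail_excess_asymp[of "c0 * d"] d c0_pos by auto
  have "((\<lambda>z. t * ((1 - d) * (1 - \<epsilon>) * (z / (z + 1)))) \<longlongrightarrow> t * ((1 - d) * (1 - \<epsilon>) * 1)) at_top"
    by (intro tendsto_intros) real_asymp
  then have e1: "\<forall>\<^sub>F z in at_top. t * ((1 - d) * (1 - \<epsilon>) * (z / (z + 1))) > \<kappa> * (1 - t)"
    using td by (intro order_tendstoD(1)) auto
  have e2: "\<forall>\<^sub>F z in at_top. target b z < t0 / 2"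
    using order_tendstoD(2)[of "target b" 0 at_top "t0/2"] target_at_right[of b] X
    by (auto simp: filterlim_at)
  show ?thesis
    using e1 e2 quantile_near_threshold[OF \<kappa>(1) zero_less_one, of b] eventually_ge_at_top[of "X + 1"]
  proof eventually_elim
    case (elim z)
    define P where "P = normal_tail (- b) * exp (- z\<^sup>2 / 2) / 2"
    have P: "P > 0" using normal_tail_pos by (simp add: P_def)
    have z: "z > 1" using elim X by simp
    have Tg: "target b z > 0" using z by (intro target_pos) auto
    define G where "G = (1 - d) * (1 - \<epsilon>) * (z / (z + 1))"
    have G: "t * G > \<kappa> * (1 - t)" using elim by (simp add: G_def)
    show ?case
    proof (intro allI impI ballI)
      fix y \<tau> x
      assume y: "normal_tail y = \<kappa> * (normal_tail (- b) * exp (- z\<^sup>2 / 2) / 2)"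
        and \<tau>: "\<tau> \<in> {(1 - \<epsilon>) * target b z..(1 + \<epsilon>) * target b z}" and x: "y \<le> \<bar>x\<bar>"
      have yP: "normal_tail y = \<kappa> * P" using y by (simp add: P_def)
      have yz: "z - 1 \<le> y" "y \<le> z + 1" using elim(3) y by auto
      then have y0: "X \<le> y" "y > 0" using elim X by auto
      have "0 < (1 - \<epsilon>) * target b z" using Tg \<epsilon> by simp
      then have t0: "\<tau> > 0" using \<tau> by simp
      have "(1 + \<epsilon>) * target b z \<le> 2 * target b z" using \<epsilon> Tg by (intro mult_right_mono) auto
      then have "\<tau> \<le> 2 * target b z" using \<tau> by simp
      then have "\<tau> \<le> t0" using elim by simp
      with X(3)[OF y0(1) t0] have E: "(c0 - c0 * d) * (\<tau> / y) \<le> tail_excess \<tau> y" by simp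
      have "G * P = (c0 - c0 * d) * ((1 - \<epsilon>) * target b z / (z + 1))"
      proof -
        have "P * z = c0 * target b z" using c0_pos by (simp add: P_def target_def)
        moreover have "G * P = (1 - d) * (1 - \<epsilon>) * (P * z) / (z + 1)" by (simp add: G_def mult_ac)
        moreover have "c0 - c0 * d = c0 * (1 - d)" by (simp add: right_diff_distrib)
        ultimately show ?thesis by (simp add: mult_ac)
      qed
      also have "\<dots> \<le> (c0 - c0 * d) * (\<tau> / y)"
        using c0_pos d1 \<tau> yz y0 t0 Tg \<epsilon> by (intro mult_left_mono frac_le) auto
      finally have E2: "G * P \<le> tail_excess \<tau> y" using E by simp
      have "S_value x \<tau> = S_value \<bar>x\<bar> \<tau>" using t0 by (simp add: S_value_abs)
      also have "\<dots> \<le> normal_tail \<bar>x\<bar> / (normal_tail \<bar>x\<bar> + tail_excess \<tau> \<bar>x\<bar>)" by (rule S_value_le[OF t0])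
      also have "\<dots> \<le> normal_tail y / (normal_tail y + tail_excess \<tau> y)"
        using x y0 t0 by (intro tail_ratio_antimono) auto
      also have "\<dots> < t"
      proof -
        have "0 \<le> tail_excess \<tau> y" using y0 by (intro tail_excess_nonneg) auto
        then have pos: "0 < normal_tail y + tail_excess \<tau> y" using normal_tail_pos[of y] by simp
        have "\<kappa> * (1 - t) * P < t * G * P" using G P by (intro mult_strict_right_mono) auto
        then have "\<kappa> * P < t * (\<kappa> * P) + t * (G * P)" by (simp add: algebra_simps)
        also have "\<dots> \<le> t * (\<kappa> * P) + t * tail_excess \<tau> y" using E2 t by simp
        finally show ?thesis using pos by (simp add: divide_less_eq yP distrib_left)
      qed
      finally show "S_value x \<tau> < t" .
    qed
  qed
qed

text \<open>Mirror image of \<open>S_value_reject\<close>, with two further losses from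
  \<open>S_value_ge\<close>: the factors in sqrt \<tau>, and the second branch of the minimum, which
  tends to 1 > t.\<close>

lemma S_value_accept:
  assumes t: "0 < t" "t < 1" and \<epsilon>: "0 < \<epsilon>" "\<epsilon> < 1" and \<kappa>: "\<kappa> > 0" "\<kappa> * (1 - t) > t * (1 + \<epsilon>)"
  shows "\<forall>\<^sub>F z in at_top. \<forall>y. normal_tail y = \<kappa> * (normal_tail (- b) * exp (- z\<^sup>2 / 2) / 2) \<longrightarrow>
    (\<forall>\<tau>\<in>{(1 - \<epsilon>) * target b z..(1 + \<epsilon>) * target b z}. \<forall>x. \<bar>x\<bar> \<le> y \<longrightarrow> S_value x \<tau> \<ge> t)"
proof -
  define d where "d = (\<kappa> * (1 - t) - t * (1 + \<epsilon>)) / (2 * (t * (1 + \<epsilon>)))"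
  have te: "t * (1 + \<epsilon>) > 0" using t \<epsilon> by simp
  have d: "d > 0" using te \<kappa> by (simp add: d_def)
  have "d * (2 * (t * (1 + \<epsilon>))) = \<kappa> * (1 - t) - t * (1 + \<epsilon>)" using te t \<epsilon> by (simp add: d_def)
  then have td: "t * ((1 + d) * (1 + \<epsilon>)) < \<kappa> * (1 - t)" using \<kappa> by (simp add: algebra_simps)
  obtain X t0 where X: "X > 0" "t0 > 0" "\<And>x \<tau>. x \<ge> X \<Longrightarrow> 0 < \<tau> \<Longrightarrow> \<tau> \<le> t0 \<Longrightarrow> tail_excess \<tau> x \<le> (c0 + c0 * d) * (\<tau> / x)"
    using tail_excess_asymp[of "c0 * d"] d c0_pos by auto
  define C where "C = normal_tail (- b) / (2 * c0)"
  have C: "C > 0" using target_coeff_pos by (simp add: C_def)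
  have tg: "target b z = C * z * exp (- z\<^sup>2 / 2)" for z by (simp add: target_def C_def)
  \<comment> \<open>Dominates sqrt \<tau>, because \<tau> is at most twice the target.\<close>
  define s' where "s' z = sqrt (2 * target b z)" for z
  have l1: "(s' \<longlongrightarrow> 0) at_top" unfolding s'_def tg using C by real_asymp
  have l2: "((\<lambda>z. s' z * (2 + z)) \<longlongrightarrow> 0) at_top" unfolding s'_def tg using C by real_asymp
  define G where "G z = (1 + d) * (1 + \<epsilon>) * (z / (z - 1))" for z :: real
  have lG: "(G \<longlongrightarrow> (1 + d) * (1 + \<epsilon>) * 1) at_top" unfolding G_def
    by (intro tendsto_intros) real_asymp
  have gp: "0 < \<kappa> + (1 + d) * (1 + \<epsilon>)" using \<kappa> d \<epsilon> by (intro add_pos_pos mult_pos_pos) auto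
  have "((\<lambda>z. (1 - 4 * s' z) * (1 - s' z * (2 + z)) * (\<kappa> / (\<kappa> + G z))) \<longlongrightarrow> (1 - 4 * 0) * (1 - 0) * (\<kappa> / (\<kappa> + (1 + d) * (1 + \<epsilon>) * 1))) at_top"
    using gp by (intro tendsto_intros l1 l2 lG) auto
  moreover have "(1 - 4 * 0) * (1 - 0) * (\<kappa> / (\<kappa> + (1 + d) * (1 + \<epsilon>) * 1)) > t"
    using td gp by (simp add: less_divide_eq algebra_simps)
  ultimately have e1: "\<forall>\<^sub>F z in at_top. t < (1 - 4 * s' z) * (1 - s' z * (2 + z)) * (\<kappa> / (\<kappa> + G z))"
    by (rule order_tendstoD(1))
  have "((\<lambda>z. (1 - 4 * s' z) * (1 - 2 * s' z)) \<longlongrightarrow> (1 - 4 * 0) * (1 - 2 * 0)) at_top"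
    by (intro tendsto_intros l1)
  then have e2: "\<forall>\<^sub>F z in at_top. t < (1 - 4 * s' z) * (1 - 2 * s' z)"
    using t by (intro order_tendstoD(1)) auto
  have e3: "\<forall>\<^sub>F z in at_top. s' z < 1/4" by (rule order_tendstoD(2)[OF l1]) simp
  have e4: "\<forall>\<^sub>F z in at_top. s' z * (2 + z) < 1" by (rule order_tendstoD(2)[OF l2]) simp
  have e5: "\<forall>\<^sub>F z in at_top. target b z < t0 / 2"
    using order_tendstoD(2)[of "target b" 0 at_top "t0/2"] target_at_right[of b] X
    by (auto simp: filterlim_at)
  show ?thesis
    using e1 e2 e3 e4 e5 quantile_near_threshold[OF \<kappa>(1) zero_less_one, of b] eventually_ge_at_top[of "X + 2"]
  proof eventually_elim
    case (elim z)
    define P where "P = normal_tail (- b) * exp (- z\<^sup>2 / 2) / 2"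
    have P: "P > 0" using normal_tail_pos by (simp add: P_def)
    have z: "z > 2" using elim X by simp
    have Tg: "target b z > 0" using z by (intro target_pos) auto
    have G: "G z > 0" using z d \<epsilon> by (auto simp: G_def intro!: mult_pos_pos add_pos_pos)
    show ?case
    proof (intro allI impI ballI)
      fix y \<tau> x
      assume y: "normal_tail y = \<kappa> * (normal_tail (- b) * exp (- z\<^sup>2 / 2) / 2)"
        and \<tau>: "\<tau> \<in> {(1 - \<epsilon>) * target b z..(1 + \<epsilon>) * target b z}" and x: "\<bar>x\<bar> \<le> y"
      have yP: "normal_tail y = \<kappa> * P" using y by (simp add: P_def)
      have yz: "z - 1 \<le> y" "y \<le> z + 1" using elim(6) y by auto
      then have y0: "X \<le> y" "y > 0" using elim X by auto
      have "0 < (1 - \<epsilon>) * target b z" using Tg \<epsilon> by simp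
      then have t0: "\<tau> > 0" using \<tau> by simp
      have "(1 + \<epsilon>) * target b z \<le> 2 * target b z" using \<epsilon> Tg by (intro mult_right_mono) auto
      then have t2: "\<tau> \<le> 2 * target b z" using \<tau> by simp
      then have "\<tau> \<le> t0" using elim by simp
      with X(3)[OF y0(1) t0] have E: "tail_excess \<tau> y \<le> (c0 + c0 * d) * (\<tau> / y)" by simp
      also have "\<dots> \<le> (c0 + c0 * d) * ((1 + \<epsilon>) * target b z / (z - 1))"
        using c0_pos d \<tau> yz y0 t0 Tg \<epsilon> z by (intro mult_left_mono frac_le) auto
      also have "\<dots> = G z * P"
        using c0_pos z by (simp add: G_def P_def target_def field_simps)
      finally have E2: "tail_excess \<tau> y \<le> G z * P" .
      define s where "s = sqrt \<tau>"
      have s: "0 < s" "s \<le> s' z" using t0 t2 by (auto simp: s_def s'_def)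
      have En: "0 \<le> tail_excess \<tau> y" using y0 by (intro tail_excess_nonneg) auto
      have "\<kappa> / (\<kappa> + G z) = \<kappa> * P / (\<kappa> * P + G z * P)"
        using P \<kappa> G by (simp add: distrib_right[symmetric])
      also have "\<dots> \<le> normal_tail y / (normal_tail y + tail_excess \<tau> y)"
        unfolding yP using E2 P \<kappa> En by (intro divide_left_mono mult_pos_pos add_pos_nonneg) (auto intro: add_pos_nonneg)
      also have "\<dots> \<le> normal_tail \<bar>x\<bar> / (normal_tail \<bar>x\<bar> + tail_excess \<tau> \<bar>x\<bar>)"
        using x t0 by (intro tail_ratio_antimono) auto
      finally have R: "\<kappa> / (\<kappa> + G z) \<le> normal_tail \<bar>x\<bar> / (normal_tail \<bar>x\<bar> + tail_excess \<tau> \<bar>x\<bar>)" .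
      have sx: "s * (1 + \<bar>x\<bar>) \<le> s' z * (2 + z)" using s x yz z by (intro mult_mono) auto
      have "t \<le> (1 - 4 * s' z) * (1 - s' z * (2 + z)) * (\<kappa> / (\<kappa> + G z))" using elim by simp
      also have "\<dots> \<le> (1 - 4 * s) * (1 - s * (1 + \<bar>x\<bar>)) * (normal_tail \<bar>x\<bar> / (normal_tail \<bar>x\<bar> + tail_excess \<tau> \<bar>x\<bar>))"
        using elim s sx R \<kappa> G by (intro mult_mono mult_nonneg_nonneg) auto
      finally have 1: "t \<le> (1 - 4 * s) * (1 - s * (1 + \<bar>x\<bar>)) * (normal_tail \<bar>x\<bar> / (normal_tail \<bar>x\<bar> + tail_excess \<tau> \<bar>x\<bar>))" .
      have "t \<le> (1 - 4 * s' z) * (1 - 2 * s' z)" using elim by simp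
      also have "\<dots> \<le> (1 - 4 * s) * (1 - 2 * s)" using elim s by (intro mult_mono) auto
      finally have 2: "t \<le> (1 - 4 * s) * (1 - 2 * s)" .
      have "S_value \<bar>x\<bar> \<tau> \<ge> min ((1 - 4 * sqrt \<tau>) * (1 - sqrt \<tau> * (1 + \<bar>x\<bar>)) * (normal_tail \<bar>x\<bar> / (normal_tail \<bar>x\<bar> + tail_excess \<tau> \<bar>x\<bar>)))
        ((1 - 4 * sqrt \<tau>) * (1 - 2 * sqrt \<tau>))"
        using t0 s sx elim by (intro S_value_ge) (auto simp: s_def)
      then have "t \<le> S_value \<bar>x\<bar> \<tau>" using 1 2 by (simp add: s_def min_def split: if_splits)
      then show "t \<le> S_value x \<tau>" using t0 by (simp add: S_value_abs)
    qed
  qed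
qed

section \<open>Localisation of the maximiser on a good event\<close>

lemma ln_lik_ratio_diff_le:
  assumes ab: "0 < a" "a \<le> b" and g: "has_bochner_integral lborel (\<lambda>\<tau>. g \<tau> * indicator {a..b} \<tau>) I"
    and le: "\<And>\<tau>. a \<le> \<tau> \<Longrightarrow> \<tau> \<le> b \<Longrightarrow> score \<tau> x / \<tau> \<le> g \<tau>"
  shows "ln (lik_ratio b x) - ln (lik_ratio a x) \<le> I"
proof -
  note h = has_bochner_integral_score[OF ab, of x]
  have "(\<integral>\<tau>. score \<tau> x / \<tau> * indicator {a..b} \<tau> \<partial>lborel) \<le> (\<integral>\<tau>. g \<tau> * indicator {a..b} \<tau> \<partial>lborel)"
    by (rule integral_mono[OF integrable.intros[OF h] integrable.intros[OF g]])
       (use le in \<open>auto split: split_indicator\<close>)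
  then show ?thesis
    unfolding has_bochner_integral_integral_eq[OF h] has_bochner_integral_integral_eq[OF g] .
qed

lemma ln_lik_ratio_diff_ge:
  assumes ab: "0 < a" "a \<le> b" and g: "has_bochner_integral lborel (\<lambda>\<tau>. g \<tau> * indicator {a..b} \<tau>) I"
    and le: "\<And>\<tau>. a \<le> \<tau> \<Longrightarrow> \<tau> \<le> b \<Longrightarrow> g \<tau> \<le> score \<tau> x / \<tau>"
  shows "I \<le> ln (lik_ratio b x) - ln (lik_ratio a x)"
proof -
  note h = has_bochner_integral_score[OF ab, of x]
  have "(\<integral>\<tau>. g \<tau> * indicator {a..b} \<tau> \<partial>lborel) \<le> (\<integral>\<tau>. score \<tau> x / \<tau> * indicator {a..b} \<tau> \<partial>lborel)"
    by (rule integral_mono[OF integrable.intros[OF g] integrable.intros[OF h]])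
       (use le in \<open>auto split: split_indicator\<close>)
  then show ?thesis
    unfolding has_bochner_integral_integral_eq[OF h] has_bochner_integral_integral_eq[OF g] .
qed

lemma has_bochner_integral_inverse:
  fixes a b c :: real
  assumes "0 < a" "a \<le> b"
  shows "has_bochner_integral lborel (\<lambda>\<tau>. c / \<tau> * indicator {a..b} \<tau>) (c * ln (b / a))"
proof -
  have "has_bochner_integral lborel (\<lambda>\<tau>. c / \<tau> * indicator {a..b} \<tau>) (c * ln b - c * ln a)"
    by (rule has_bochner_integral_FTC_Icc_real[OF assms(2)])
       (use assms in \<open>auto intro!: derivative_eq_intros continuous_intros\<close>)
  then show ?thesis using assms by (simp add: ln_div right_diff_distrib)
qed

lemma has_bochner_integral_const_Icc:
  assumes "a \<le> b"
  shows "has_bochner_integral lborel (\<lambda>\<tau>. c * indicator {a..b} \<tau>) (c * (b - a :: real))"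
proof -
  have "has_bochner_integral lborel (\<lambda>\<tau>. c * indicator {a..b} \<tau>) (c * b - c * a)"
    by (rule has_bochner_integral_FTC_Icc_real[OF assms])
       (auto intro!: derivative_eq_intros continuous_intros)
  then show ?thesis by (simp add: right_diff_distrib)
qed

lemma ln_lik_ratio_diff_le_score:
  assumes "0 < a" "a \<le> b" "\<And>\<tau>. a \<le> \<tau> \<Longrightarrow> \<tau> \<le> b \<Longrightarrow> score \<tau> x \<le> c"
  shows "ln (lik_ratio b x) - ln (lik_ratio a x) \<le> c * ln (b / a)"
  by (rule ln_lik_ratio_diff_le[OF assms(1,2) has_bochner_integral_inverse[OF assms(1,2)]])
     (use assms in \<open>auto intro!: divide_right_mono\<close>)

lemma ln_lik_ratio_diff_ge_score:
  assumes "0 < a" "a \<le> b" "\<And>\<tau>. a \<le> \<tau> \<Longrightarrow> \<tau> \<le> b \<Longrightarrow> c \<le> score \<tau> x"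
  shows "c * ln (b / a) \<le> ln (lik_ratio b x) - ln (lik_ratio a x)"
  by (rule ln_lik_ratio_diff_ge[OF assms(1,2) has_bochner_integral_inverse[OF assms(1,2)]])
     (use assms in \<open>auto intro!: divide_right_mono\<close>)

lemma score_ge_linear:
  assumes "0 < \<tau>" "\<tau> \<le> 1/8"
  shows "- 8 * \<tau> \<le> score \<tau> x"
  using abs_score_le_exp[OF assms, of 0] score_mono[of 0 x \<tau>] by simp

text \<open>The score is at least - 8 \<tau> everywhere, so after division by \<tau> a coordinate
  loses at most 8 times the length of the interval, without a logarithm.\<close>

lemma ln_lik_ratio_diff_ge_linear:
  assumes "0 < a" "a \<le> b" "b \<le> 1/8"
  shows "- 8 * (b - a) \<le> ln (lik_ratio b x) - ln (lik_ratio a x)"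
proof (rule ln_lik_ratio_diff_ge[OF assms(1,2) has_bochner_integral_const_Icc[OF assms(2)]])
  fix \<tau> assume "a \<le> \<tau>" "\<tau> \<le> b"
  then show "- 8 \<le> score \<tau> x / \<tau>"
    using score_ge_linear[of \<tau> x] assms by (simp add: pos_le_divide_eq)
qed

text \<open>The expected loss of log likelihood per null coordinate when \<tau> moves from a to
  b.\<close>

definition drift_integral :: "real \<Rightarrow> real \<Rightarrow> real" where
  "drift_integral a b = (\<integral>\<tau>. null_drift \<tau> / \<tau> * indicator {a..b} \<tau> \<partial>lborel)"

lemma integrable_drift:
  assumes "0 < a"
  shows "integrable lborel (\<lambda>\<tau>. null_drift \<tau> / \<tau> * indicator {a..b} \<tau>)"
proof (rule integrableI_bounded_set[where A="{a..b}" and B="1 / a"])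
  show "AE \<tau> in lborel. \<tau> \<in> {a..b} \<longrightarrow> norm (null_drift \<tau> / \<tau> * indicator {a..b} \<tau>) \<le> 1 / a"
  proof (intro AE_I2 impI)
    fix \<tau> assume t: "\<tau> \<in> {a..b}"
    then have "\<bar>null_drift \<tau>\<bar> / \<tau> \<le> 1 / a"
      using assms abs_null_drift_le[of \<tau>] by (intro frac_le) auto
    then show "norm (null_drift \<tau> / \<tau> * indicator {a..b} \<tau>) \<le> 1 / a"
      using t assms by (simp add: abs_divide)
  qed
qed (auto simp: emeasure_lborel_Icc_eq)

lemma drift_integral_le:
  assumes "0 < a" "a \<le> b" "\<And>\<tau>. a \<le> \<tau> \<Longrightarrow> \<tau> \<le> b \<Longrightarrow> null_drift \<tau> \<le> U * \<tau>"
  shows "drift_integral a b \<le> U * (b - a)"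
proof -
  note g = has_bochner_integral_const_Icc[OF assms(2), of U]
  have "drift_integral a b \<le> (\<integral>\<tau>. U * indicator {a..b} \<tau> \<partial>lborel)"
    unfolding drift_integral_def
    by (rule integral_mono[OF integrable_drift[OF assms(1)] integrable.intros[OF g]])
       (use assms in \<open>auto simp: pos_divide_le_eq split: split_indicator\<close>)
  then show ?thesis unfolding has_bochner_integral_integral_eq[OF g] .
qed

text \<open>As the drift is nonnegative, the part of the range below a' may be dropped.\<close>

lemma drift_integral_ge:
  assumes "0 < a" "a \<le> a'" "a' \<le> b" "\<And>\<tau>. a' \<le> \<tau> \<Longrightarrow> \<tau> \<le> b \<Longrightarrow> U * \<tau> \<le> null_drift \<tau>"
  shows "U * (b - a') \<le> drift_integral a b"
proof -
  note g = has_bochner_integral_const_Icc[OF assms(3), of U]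
  have "(\<integral>\<tau>. U * indicator {a'..b} \<tau> \<partial>lborel) \<le> drift_integral a b"
    unfolding drift_integral_def
  proof (rule integral_mono[OF integrable.intros[OF g] integrable_drift[OF assms(1)]])
    fix \<tau>
    show "U * indicator {a'..b} \<tau> \<le> null_drift \<tau> / \<tau> * indicator {a..b} \<tau>"
      using assms null_drift_nonneg[of \<tau>] by (auto simp: pos_le_divide_eq split: split_indicator)
  qed
  then show ?thesis unfolding has_bochner_integral_integral_eq[OF g] .
qed

lemma drift_integral_nonneg: "0 < a \<Longrightarrow> 0 \<le> drift_integral a b"
  unfolding drift_integral_def
  by (intro Bochner_Integration.integral_nonneg) (auto simp: null_drift_nonneg split: split_indicator)

definition null_noise :: "'i set \<Rightarrow> ('i \<Rightarrow> real) \<Rightarrow> real \<Rightarrow> real" where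
  "null_noise I X \<tau> = (\<Sum>i\<in>I. score \<tau> (X i) + null_drift \<tau>)"

lemma null_noise_measurable [measurable]: "null_noise I X \<in> borel_measurable borel"
  unfolding null_noise_def[abs_def] by measurable

text \<open>A deterministic identity lies behind this: the null log likelihood difference plus the
  drift part is the integral of \<open>null_noise\<close> over \<tau>. The noise bound passes to
  subintervals, so one bound covers all end points.\<close>

lemma abs_sum_ln_lik_ratio_diff:
  assumes ab: "0 < a" "a \<le> b" and c: "c \<ge> 0"
    "(\<integral>\<^sup>+\<tau>. ennreal (\<bar>null_noise I X \<tau>\<bar> / \<tau>) * indicator {a..b} \<tau> \<partial>lborel) \<le> ennreal c"
  shows "\<bar>(\<Sum>i\<in>I. ln (lik_ratio b (X i)) - ln (lik_ratio a (X i))) + card I * drift_integral a b\<bar> \<le> c"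
proof -
  define S where "S = (\<Sum>i\<in>I. ln (lik_ratio b (X i)) - ln (lik_ratio a (X i)))"
  have "has_bochner_integral lborel (\<lambda>\<tau>. \<Sum>i\<in>I. score \<tau> (X i) / \<tau> * indicator {a..b} \<tau>) S"
    unfolding S_def by (intro has_bochner_integral_sum has_bochner_integral_score ab)
  moreover have "has_bochner_integral lborel (\<lambda>\<tau>. real (card I) * (null_drift \<tau> / \<tau> * indicator {a..b} \<tau>)) (card I * drift_integral a b)"
    unfolding drift_integral_def by (intro has_bochner_integral_mult_right has_bochner_integral_integrable integrable_drift ab)
  ultimately have "has_bochner_integral lborel (\<lambda>\<tau>. (\<Sum>i\<in>I. score \<tau> (X i) / \<tau> * indicator {a..b} \<tau>) + real (card I) * (null_drift \<tau> / \<tau> * indicator {a..b} \<tau>))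
    (S + card I * drift_integral a b)"
    by (rule has_bochner_integral_add)
  moreover have "(\<Sum>i\<in>I. score \<tau> (X i) / \<tau> * indicator {a..b} \<tau>) + real (card I) * (null_drift \<tau> / \<tau> * indicator {a..b} \<tau>)
      = null_noise I X \<tau> / \<tau> * indicator {a..b} \<tau>" for \<tau>
    by (simp add: null_noise_def sum.distrib sum_distrib_right sum_divide_distrib add_divide_distrib distrib_right)
  ultimately have h: "has_bochner_integral lborel (\<lambda>\<tau>. null_noise I X \<tau> / \<tau> * indicator {a..b} \<tau>) (S + card I * drift_integral a b)"
    by simp
  have "ennreal (norm (S + card I * drift_integral a b)) \<le> (\<integral>\<^sup>+\<tau>. ennreal (norm (null_noise I X \<tau> / \<tau> * indicator {a..b} \<tau>)) \<partial>lborel)"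
    using integral_norm_bound_ennreal[OF integrable.intros[OF h]] unfolding has_bochner_integral_integral_eq[OF h] .
  also have "\<dots> = (\<integral>\<^sup>+\<tau>. ennreal (\<bar>null_noise I X \<tau>\<bar> / \<tau>) * indicator {a..b} \<tau> \<partial>lborel)"
    using ab by (intro nn_integral_cong) (auto simp: abs_mult abs_divide split: split_indicator)
  also note c(2)
  finally show ?thesis using c(1) by (simp add: S_def ennreal_le_iff)
qed

text \<open>Since ln (1 + \<epsilon>) \<le> 1 \<le> ln (1 / \<tau>), the rescaling at most doubles
  the logarithm under the root.\<close>

lemma zeta_slow:
  assumes "0 < \<tau>" "\<tau> \<le> 1/8" "0 < \<epsilon>" "\<epsilon> < 1"
  shows "zeta (\<tau> / (1 + \<epsilon>)) \<le> 2 * zeta \<tau>"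
proof -
  have "ln (1 + \<epsilon>) \<le> 1" using ln_add_one_self_le_self[of \<epsilon>] assms by simp
  moreover have "1 \<le> ln (1 / \<tau>)"
  proof -
    have "exp 1 \<le> (8::real)" using exp_le by simp
    then have "1 \<le> ln (8::real)" by (simp add: ln_ge_iff)
    also have "\<dots> \<le> ln (1 / \<tau>)" using assms by (subst ln_le_cancel_iff) (auto simp: field_simps)
    finally show ?thesis .
  qed
  ultimately have "2 * ln (1 / (\<tau> / (1 + \<epsilon>))) \<le> 4 * (2 * ln (1 / \<tau>))"
    using assms by (simp add: ln_div ln_mult)
  then have "sqrt (2 * ln (1 / (\<tau> / (1 + \<epsilon>)))) \<le> sqrt (4 * (2 * ln (1 / \<tau>)))" by simp
  then show ?thesis unfolding zeta_def real_sqrt_mult[of 4] by simp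
qed

lemma ratio_zeta_mono:
  assumes "0 < x" "x \<le> y" "y < 1"
  shows "x / zeta x \<le> y / zeta y"
  using zeta_antimono[of x y] zeta_pos[of y] assms by (intro frac_le) auto

text \<open>The good event of the localisation: \<open>I0\<close> are the null and \<open>I1\<close> the signal coordinates,
  \<open>ts\<close> is the target, \<open>p\<close> the proportion of detectable signals, and \<open>\<mu>\<close>, \<open>\<mu>'\<close>, \<open>\<eta>\<close>, \<open>\<delta>\<close> are small.\<close>

locale good_event =
  fixes I0 I1 :: "'i set" and X :: "'i \<Rightarrow> real" and n s ts t0 p \<epsilon> \<mu> \<mu>' \<eta> \<delta> \<gamma> K A B lo :: real
  assumes fin: "finite I0" "finite I1" and card: "card I0 \<le> n" "card I1 = s" "s > 0"
    and ts: "0 < lo" "lo \<le> ts" "K * ts \<le> t0" "t0 \<le> 1/8"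
    and pars: "0 < \<epsilon>" "\<epsilon> < 1" "K \<ge> 2" "0 < \<mu>" "0 < \<mu>'" "0 < \<eta>" "0 < \<delta>" "\<delta> < 2 * c0" "0 < \<gamma>" "0 < p"
    and drift_le: "\<And>\<tau>. 0 < \<tau> \<Longrightarrow> \<tau> \<le> t0 \<Longrightarrow> null_drift \<tau> \<le> (2 * c0 + \<delta>) * (\<tau> / zeta \<tau>)"
    and drift_ge: "\<And>\<tau>. 0 < \<tau> \<Longrightarrow> \<tau> \<le> t0 \<Longrightarrow> null_drift \<tau> \<ge> (2 * c0 - \<delta>) * (\<tau> / zeta \<tau>)"
    and bal_le: "n * ((2 * c0 + \<delta>) * (ts / zeta ts)) \<le> (p + \<mu>) * s"
    and bal_ge: "(card I0 - 4 * \<eta> / (\<epsilon> * (2 * c0 - \<delta>)) * n) * ((2 * c0 - \<delta>) * (ts / zeta ts)) \<ge> (p - \<mu>) * s"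
    and noise_small: "4 * \<eta> / (\<epsilon> * (2 * c0 - \<delta>)) * n \<le> card I0"
    and score_high: "\<And>\<tau> x. ts / K \<le> \<tau> \<Longrightarrow> \<tau> \<le> ts \<Longrightarrow> \<bar>x\<bar> \<ge> B \<Longrightarrow> 1 - \<mu> \<le> score \<tau> x"
    and score_low: "\<And>\<tau> x. 0 < \<tau> \<Longrightarrow> \<tau> \<le> K * ts \<Longrightarrow> \<bar>x\<bar> \<le> A \<Longrightarrow> score \<tau> x \<le> \<mu>"
    and count_high: "real (card {i\<in>I1. \<bar>X i\<bar> \<ge> B}) \<ge> (p - \<mu>) * s"
    and count_low: "real (card {i\<in>I1. \<bar>X i\<bar> \<ge> A}) \<le> (p + \<mu>) * s"
    and noise0: "(\<integral>\<^sup>+\<tau>. ennreal (\<bar>null_noise I0 X \<tau>\<bar> / \<tau>) * indicator {lo..ts} \<tau> \<partial>lborel) \<le> ennreal (\<mu> * s)"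
    and noise1: "(\<integral>\<^sup>+\<tau>. ennreal (\<bar>null_noise I0 X \<tau>\<bar> * zeta \<tau> / \<tau>\<^sup>2) * indicator {ts..t0} \<tau> \<partial>lborel) \<le> ennreal (\<eta> * n)"
    and noise2: "(\<integral>\<^sup>+\<tau>. ennreal (\<bar>null_noise I0 X \<tau>\<bar> / \<tau>) * indicator {t0..1} \<tau> \<partial>lborel) \<le> ennreal (\<mu>' * s / ts)"
    and small: "8 * ts \<le> \<mu>" "\<mu> \<le> p / 4" "\<mu> \<le> 1"
      "\<mu> * ((p + 1) * ln K + 3) < p * \<gamma>" "\<mu> * (2 * ln K + K) < p * \<gamma>"
    and gam: "\<gamma> \<le> - ln (1 - \<epsilon>) - \<epsilon>" "\<gamma> \<le> ln K - 1" "\<gamma> \<le> \<epsilon> - ln (1 + \<epsilon>)"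
    and K_ln: "\<And>x. x \<ge> K \<Longrightarrow> ln x \<le> p / 4 * (x - 1)"
    and top: "\<mu>' / ts + ln (1 / ts) < p / 2 * (t0 / ts - 1)"
begin

definition L0 :: "real \<Rightarrow> real" where "L0 \<tau> = (\<Sum>i\<in>I0. ln (lik_ratio \<tau> (X i)))"
definition L1 :: "real \<Rightarrow> real" where "L1 \<tau> = (\<Sum>i\<in>I1. ln (lik_ratio \<tau> (X i)))"

lemma ts_pos: "0 < ts" and t0_pos: "0 < t0" and ts_le_t0: "ts \<le> t0" and K_pos: "0 < K"
proof -
  show 1: "0 < ts" "0 < K" using ts pars by auto
  then have "1 * ts \<le> K * ts" using pars by (intro mult_right_mono) auto
  then show "ts \<le> t0" using ts by linarith
  with 1 show "0 < t0" by simp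
qed

lemma zeta_ts_pos: "0 < zeta ts"
  using ts_pos ts_le_t0 ts by (intro zeta_pos) auto

text \<open>With r = \<tau> / ts, moving down from ts costs the signals beyond B about p s (- ln r)
  and gains the nulls at most about p s (1 - r); the margin - ln r - (1 - r) is at least \<gamma>.
  As \<open>score_high\<close> covers only [ts / K, ts], signals are credited from a = max \<tau>
  (ts / K) on, which is enough because ln K - 1 \<ge> \<gamma>.\<close>

lemma not_maximal_low:
  assumes "lo \<le> \<tau>" "\<tau> < (1 - \<epsilon>) * ts"
  shows "L0 \<tau> + L1 \<tau> < L0 ts + L1 ts"
proof -
  define r where "r = \<tau> / ts"
  define a where "a = max \<tau> (ts / K)"
  have t: "0 < \<tau>" "\<tau> \<le> ts"
  proof -
    show "0 < \<tau>" using assms ts by simp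
    have "(1 - \<epsilon>) * ts \<le> 1 * ts" using pars ts_pos by (intro mult_right_mono) auto
    then show "\<tau> \<le> ts" using assms by simp
  qed
  have r: "0 < r" "r < 1 - \<epsilon>" "\<tau> = r * ts" using t ts_pos assms by (auto simp: r_def field_simps)
  have tsK: "ts / K \<le> ts" using ts_pos pars by (simp add: divide_le_eq)
  have a: "0 < a" "\<tau> \<le> a" "a \<le> ts" using t tsK K_pos ts_pos by (auto simp: a_def less_max_iff_disj)
  have nz: "\<bar>(\<Sum>i\<in>I0. ln (lik_ratio ts (X i)) - ln (lik_ratio \<tau> (X i))) + card I0 * drift_integral \<tau> ts\<bar> \<le> \<mu> * s"
  proof (rule abs_sum_ln_lik_ratio_diff[OF t])
    have "(\<integral>\<^sup>+\<tau>. ennreal (\<bar>null_noise I0 X \<tau>\<bar> / \<tau>) * indicator {lo..ts} \<tau> \<partial>lborel) \<ge> (\<integral>\<^sup>+u. ennreal (\<bar>null_noise I0 X u\<bar> / u) * indicator {\<tau>..ts} u \<partial>lborel)"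
      using assms by (intro nn_integral_mono mult_left_mono) (auto split: split_indicator)
    then show "(\<integral>\<^sup>+u. ennreal (\<bar>null_noise I0 X u\<bar> / u) * indicator {\<tau>..ts} u \<partial>lborel) \<le> ennreal (\<mu> * s)"
      using noise0 by (rule order_trans)
  qed (use pars card in simp)
  have "drift_integral \<tau> ts \<le> (2 * c0 + \<delta>) / zeta ts * (ts - \<tau>)"
  proof (rule drift_integral_le[OF t])
    fix u assume u: "\<tau> \<le> u" "u \<le> ts"
    have "null_drift u \<le> (2 * c0 + \<delta>) * (u / zeta u)" using u t ts_le_t0 by (intro drift_le) auto
    also have "\<dots> \<le> (2 * c0 + \<delta>) * (u / zeta ts)"
      using u t c0_pos pars zeta_ts_pos zeta_antimono[of u ts] by (intro mult_left_mono divide_left_mono mult_pos_pos) auto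
    finally show "null_drift u \<le> (2 * c0 + \<delta>) / zeta ts * u" by simp
  qed
  then have "card I0 * drift_integral \<tau> ts \<le> n * ((2 * c0 + \<delta>) / zeta ts * (ts - \<tau>))"
    using card drift_integral_nonneg[OF t(1)] by (intro mult_mono) auto
  also have "\<dots> = n * ((2 * c0 + \<delta>) * (ts / zeta ts)) * (1 - r)"
    using ts_pos by (simp add: r(3) field_simps)
  also have "\<dots> \<le> (p + \<mu>) * s * (1 - r)"
    using bal_le r pars by (intro mult_right_mono) auto
  finally have null: "L0 ts - L0 \<tau> \<ge> - (\<mu> * s) - (p + \<mu>) * s * (1 - r)"
    using nz by (simp add: L0_def sum_subtractf abs_le_iff)
  define H where "H = {i\<in>I1. \<bar>X i\<bar> \<ge> B}"
  have fH: "finite H" "H \<subseteq> I1" using fin by (auto simp: H_def)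
  have lg: "0 \<le> ln (ts / a)" using a ts_pos by simp
  \<comment> \<open>Every signal, detectable or not, is charged 8 ts for the possibly negative score
    on the range where no better bound is available.\<close>
  have each: "(if i \<in> H then (1 - \<mu>) * ln (ts / a) else 0) - 8 * ts \<le> ln (lik_ratio ts (X i)) - ln (lik_ratio \<tau> (X i))" for i
  proof (cases "i \<in> H")
    case True
    have "- 8 * (a - \<tau>) \<le> ln (lik_ratio a (X i)) - ln (lik_ratio \<tau> (X i))"
      using t a ts_le_t0 ts by (intro ln_lik_ratio_diff_ge_linear) auto
    moreover have "(1 - \<mu>) * ln (ts / a) \<le> ln (lik_ratio ts (X i)) - ln (lik_ratio a (X i))"
      using a True by (intro ln_lik_ratio_diff_ge_score score_high) (auto simp: a_def H_def)
    ultimately show ?thesis using True a t by auto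
  next
    case False
    have "- 8 * (ts - \<tau>) \<le> ln (lik_ratio ts (X i)) - ln (lik_ratio \<tau> (X i))"
      using t ts_le_t0 ts by (intro ln_lik_ratio_diff_ge_linear) auto
    then show ?thesis using False t by simp
  qed
  have "(\<Sum>i\<in>I1. (if i \<in> H then (1 - \<mu>) * ln (ts / a) else 0) - 8 * ts) \<le> (\<Sum>i\<in>I1. ln (lik_ratio ts (X i)) - ln (lik_ratio \<tau> (X i)))"
    by (rule sum_mono) (rule each)
  also have "(\<Sum>i\<in>I1. (if i \<in> H then (1 - \<mu>) * ln (ts / a) else 0) - 8 * ts) = card H * ((1 - \<mu>) * ln (ts / a)) - s * (8 * ts)"
  proof -
    have "(\<Sum>i\<in>I1. if i \<in> H then (1 - \<mu>) * ln (ts / a) else 0) = (\<Sum>i\<in>H. (1 - \<mu>) * ln (ts / a))"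
      using fin fH by (simp add: sum.inter_restrict[symmetric] Int_absorb1)
    then show ?thesis using card by (simp add: sum_subtractf)
  qed
  finally have sig0: "L1 ts - L1 \<tau> \<ge> card H * ((1 - \<mu>) * ln (ts / a)) - s * (8 * ts)"
    by (simp add: L1_def sum_subtractf)
  have "(p - \<mu>) * s * ((1 - \<mu>) * ln (ts / a)) \<le> card H * ((1 - \<mu>) * ln (ts / a))"
    using count_high lg small by (intro mult_right_mono) (auto simp: H_def)
  moreover have "s * (8 * ts) \<le> s * \<mu>" using small card by (intro mult_left_mono) auto
  ultimately have sig: "L1 ts - L1 \<tau> \<ge> (p - \<mu>) * s * ((1 - \<mu>) * ln (ts / a)) - s * \<mu>"
    using sig0 by linarith
  have lK: "ln (ts / a) \<le> ln K"
  proof -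
    have "ts / a \<le> ts / (ts / K)" using a ts_pos K_pos by (intro divide_left_mono) (auto simp: a_def)
    then show ?thesis using a ts_pos K_pos by (subst ln_le_cancel_iff) auto
  qed
  \<comment> \<open>The cases follow the maximum in \<open>a\<close>. In the first, the tangent of
    the logarithm at 1 - \<epsilon> gives the bound for all smaller r.\<close>
  have key: "\<gamma> \<le> ln (ts / a) - (1 - r)"
  proof (cases "\<tau> \<ge> ts / K")
    case True
    then have "ts / a = 1 / r" using ts_pos t by (simp add: a_def r_def)
    then have eq: "ln (ts / a) - (1 - r) = - ln r - (1 - r)" using r by (simp add: ln_div)
    have "ln (r / (1 - \<epsilon>)) \<le> r / (1 - \<epsilon>) - 1" using r pars by (intro ln_le_minus_one) auto
    also have "\<dots> = (r - (1 - \<epsilon>)) / (1 - \<epsilon>)" using pars by (simp add: diff_divide_distrib)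
    also have "\<dots> \<le> (r - (1 - \<epsilon>)) / 1"
      using r pars by (intro divide_left_mono_neg) auto
    finally have "ln r - ln (1 - \<epsilon>) \<le> r - (1 - \<epsilon>)" using r pars by (simp add: ln_div)
    then show ?thesis using gam(1) eq by linarith
  next
    case False
    then have "ts / a = K" using ts_pos K_pos by (simp add: a_def)
    then show ?thesis using gam(2) r by simp
  qed
  have "0 < p * \<gamma> - \<mu> * ((p + 1) * ln K + 3)" using small by simp
  also have "\<dots> \<le> p * (ln (ts / a) - (1 - r)) - \<mu> * ((p + 1) * ln (ts / a) + 3)"
    using key lK pars by (intro diff_mono mult_left_mono add_right_mono) auto
  also have "\<dots> \<le> (p - \<mu>) * ((1 - \<mu>) * ln (ts / a)) - \<mu> - \<mu> - (p + \<mu>) * (1 - r)"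
  proof -
    have "0 \<le> \<mu> * \<mu> * ln (ts / a)" using lg pars by simp
    moreover have "0 \<le> \<mu> * r" using pars r by simp
    ultimately show ?thesis by (simp add: algebra_simps)
  qed
  finally have "0 < s * ((p - \<mu>) * ((1 - \<mu>) * ln (ts / a)) - \<mu> - \<mu> - (p + \<mu>) * (1 - r))"
    using card by simp
  also have "\<dots> \<le> (L1 ts - L1 \<tau>) + (L0 ts - L0 \<tau>)"
    using sig null by (simp add: algebra_simps)
  finally show ?thesis by simp
qed

text \<open>Thanks to the weight in \<open>noise1\<close> the noise allowance W grows like n \<tau>
  / \<zeta>(\<tau>). The drift per coordinate over the last stretch, from \<tau> / (1 + \<epsilon>)
  to \<tau>, is already at least d \<epsilon> / 4 times \<tau> / \<zeta>(\<tau>) (D2). Hence the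
  noise is a fixed small fraction of the drift, and what remains is bounded below linearly in \<tau>
  (D1).\<close>

lemma null_change:
  assumes "(1 + \<epsilon>) * ts \<le> \<tau>" "\<tau> \<le> t0"
  shows "L0 \<tau> - L0 ts \<le> - (p - \<mu>) * s * (\<tau> / ts - 1)"
proof -
  have tt: "ts \<le> \<tau>" using assms pars ts_pos by (smt (verit) mult_le_cancel_right1)
  have t: "0 < \<tau>" "\<tau> \<le> 1/8" using tt ts_pos assms ts by auto
  have zt: "0 < zeta \<tau>" using t by (intro zeta_pos) auto
  define d where "d = 2 * c0 - \<delta>"
  have d: "d > 0" using pars by (simp add: d_def)
  define W where "W = \<eta> * n * (\<tau> / zeta \<tau>)"
  have n0: "0 \<le> n" using card by simp
  have nz: "\<bar>(\<Sum>i\<in>I0. ln (lik_ratio \<tau> (X i)) - ln (lik_ratio ts (X i))) + card I0 * drift_integral ts \<tau>\<bar> \<le> W"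
  proof (rule abs_sum_ln_lik_ratio_diff[OF ts_pos tt])
    show "0 \<le> W" using pars n0 t zt by (simp add: W_def)
    have "(\<integral>\<^sup>+u. ennreal (\<bar>null_noise I0 X u\<bar> / u) * indicator {ts..\<tau>} u \<partial>lborel)
      \<le> (\<integral>\<^sup>+u. ennreal (\<tau> / zeta \<tau>) * (ennreal (\<bar>null_noise I0 X u\<bar> * zeta u / u\<^sup>2) * indicator {ts..t0} u) \<partial>lborel)"
    proof (rule nn_integral_mono)
      fix u
      show "ennreal (\<bar>null_noise I0 X u\<bar> / u) * indicator {ts..\<tau>} u \<le> ennreal (\<tau> / zeta \<tau>) * (ennreal (\<bar>null_noise I0 X u\<bar> * zeta u / u\<^sup>2) * indicator {ts..t0} u)"
      proof (cases "u \<in> {ts..\<tau>}")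
        case True
        then have u: "0 < u" "u \<le> \<tau>" "u \<le> t0" "ts \<le> u" using ts_pos assms by auto
        have zu: "0 < zeta u" using u t by (intro zeta_pos) auto
        have "u / zeta u \<le> \<tau> / zeta \<tau>" using u t by (intro ratio_zeta_mono) auto
        then have "(u / zeta u) * (\<bar>null_noise I0 X u\<bar> * zeta u / u\<^sup>2) \<le> (\<tau> / zeta \<tau>) * (\<bar>null_noise I0 X u\<bar> * zeta u / u\<^sup>2)"
          using zu by (intro mult_right_mono) auto
        moreover have "(u / zeta u) * (\<bar>null_noise I0 X u\<bar> * zeta u / u\<^sup>2) = \<bar>null_noise I0 X u\<bar> / u"
          using zu u by (simp add: power2_eq_square)
        ultimately have "ennreal (\<bar>null_noise I0 X u\<bar> / u) \<le> ennreal ((\<tau> / zeta \<tau>) * (\<bar>null_noise I0 X u\<bar> * zeta u / u\<^sup>2))"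
          by (intro ennreal_leI) simp
        also have "\<dots> = ennreal (\<tau> / zeta \<tau>) * ennreal (\<bar>null_noise I0 X u\<bar> * zeta u / u\<^sup>2)"
          using t zt by (intro ennreal_mult') simp
        finally show ?thesis using True u by simp
      qed simp
    qed
    also have "\<dots> = ennreal (\<tau> / zeta \<tau>) * (\<integral>\<^sup>+u. (ennreal (\<bar>null_noise I0 X u\<bar> * zeta u / u\<^sup>2) * indicator {ts..t0} u) \<partial>lborel)"
      by (rule nn_integral_cmult) simp
    also have "\<dots> \<le> ennreal (\<tau> / zeta \<tau>) * ennreal (\<eta> * n)"
      by (intro mult_left_mono noise1) simp
    also have "\<dots> = ennreal W"
      using t zt by (subst ennreal_mult'[symmetric]) (simp_all add: W_def mult.commute)
    finally show "(\<integral>\<^sup>+u. ennreal (\<bar>null_noise I0 X u\<bar> / u) * indicator {ts..\<tau>} u \<partial>lborel) \<le> ennreal W" .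
  qed
  have D1: "d / zeta ts * (\<tau> - ts) \<le> drift_integral ts \<tau>"
  proof (rule drift_integral_ge[OF ts_pos order_refl tt])
    fix u assume u: "ts \<le> u" "u \<le> \<tau>"
    have "d * (u / zeta ts) \<le> d * (u / zeta u)"
      using u ts_pos d t zeta_antimono[of ts u] zeta_pos[of u] zeta_ts_pos
      by (intro mult_left_mono divide_left_mono mult_pos_pos) auto
    also have "\<dots> \<le> null_drift u" unfolding d_def using u assms ts_pos by (intro drift_ge) auto
    finally show "d / zeta ts * u \<le> null_drift u" by simp
  qed
  have D2: "d * (\<epsilon> / 4) * (\<tau> / zeta \<tau>) \<le> drift_integral ts \<tau>"
  proof -
    define a where "a = \<tau> / (1 + \<epsilon>)"
    have a: "ts \<le> a" "a \<le> \<tau>" "0 < a" using assms pars t by (auto simp: a_def field_simps)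
    have za: "0 < zeta a" "zeta a \<le> 2 * zeta \<tau>" using a t pars zeta_slow[of \<tau> \<epsilon>] by (auto intro!: zeta_pos simp: a_def)
    have "d / zeta a * (\<tau> - a) \<le> drift_integral ts \<tau>"
    proof (rule drift_integral_ge[OF ts_pos a(1,2)])
      fix u assume u: "a \<le> u" "u \<le> \<tau>"
      have "d * (u / zeta a) \<le> d * (u / zeta u)"
        using u a d t zeta_antimono[of a u] zeta_pos[of u] za
        by (intro mult_left_mono divide_left_mono mult_pos_pos) auto
      also have "\<dots> \<le> null_drift u" unfolding d_def using u a assms by (intro drift_ge) auto
      finally show "d / zeta a * u \<le> null_drift u" by simp
    qed
    moreover have "d * (\<epsilon> / 4) * (\<tau> / zeta \<tau>) \<le> d / zeta a * (\<tau> - a)"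
    proof -
      have "\<tau> - a = \<epsilon> / (1 + \<epsilon>) * \<tau>" using pars by (simp add: a_def field_simps)
      moreover have "\<epsilon> / 2 \<le> \<epsilon> / (1 + \<epsilon>)" using pars by (intro divide_left_mono) auto
      ultimately have "\<epsilon> / 2 * \<tau> \<le> \<tau> - a" using t by (simp only:) (intro mult_right_mono, auto)
      moreover have "d / (2 * zeta \<tau>) \<le> d / zeta a" using za d zt by (intro divide_left_mono) auto
      ultimately have "d / (2 * zeta \<tau>) * (\<epsilon> / 2 * \<tau>) \<le> d / zeta a * (\<tau> - a)"
        using d zt za t pars by (intro mult_mono) auto
      then show ?thesis by simp
    qed
    ultimately show ?thesis by simp
  qed
  \<comment> \<open>The noise consumes at most the drift of \<theta> n coordinates, and
    \<open>noise_small\<close> keeps this number below \<open>card I0\<close>.\<close>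
  define \<theta> where "\<theta> = 4 * \<eta> / (\<epsilon> * d)"
  have "W = \<theta> * n * (d * (\<epsilon> / 4) * (\<tau> / zeta \<tau>))"
    using d pars by (simp add: W_def \<theta>_def)
  also have "\<dots> \<le> \<theta> * n * drift_integral ts \<tau>"
    using D2 pars d n0 by (intro mult_left_mono) (auto simp: \<theta>_def)
  finally have W: "W \<le> \<theta> * n * drift_integral ts \<tau>" .
  have "L0 \<tau> - L0 ts \<le> W - card I0 * drift_integral ts \<tau>"
    using nz by (simp add: L0_def sum_subtractf abs_le_iff)
  also have "\<dots> \<le> - ((card I0 - \<theta> * n) * drift_integral ts \<tau>)"
    using W by (simp add: algebra_simps)
  also have "\<dots> \<le> - ((card I0 - \<theta> * n) * (d / zeta ts * (\<tau> - ts)))"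
    using D1 noise_small by (intro le_imp_neg_le mult_left_mono) (auto simp: \<theta>_def d_def)
  also have "(card I0 - \<theta> * n) * (d / zeta ts * (\<tau> - ts)) = (card I0 - \<theta> * n) * (d * (ts / zeta ts)) * (\<tau> / ts - 1)"
  proof -
    have "\<tau> - ts = ts * (\<tau> / ts - 1)" using ts_pos by (simp add: right_diff_distrib)
    then show ?thesis by simp
  qed
  also have "- \<dots> \<le> - ((p - \<mu>) * s * (\<tau> / ts - 1))"
    using bal_ge tt ts_pos by (intro le_imp_neg_le mult_right_mono) (auto simp: \<theta>_def d_def)
  finally show ?thesis by (simp only: minus_mult_left)
qed

lemma signal_change_le:
  assumes "ts \<le> \<tau>"
  shows "L1 \<tau> - L1 ts \<le> s * ln (\<tau> / ts)"
proof -
  have "L1 \<tau> - L1 ts = (\<Sum>i\<in>I1. ln (lik_ratio \<tau> (X i)) - ln (lik_ratio ts (X i)))"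
    by (simp add: L1_def sum_subtractf)
  also have "\<dots> \<le> (\<Sum>i\<in>I1. 1 * ln (\<tau> / ts))"
    using ts_pos assms score_le by (intro sum_mono ln_lik_ratio_diff_le_score) auto
  finally show ?thesis using card by simp
qed

text \<open>For \<tau> \<le> K ts only signals beyond A can have a score above \<mu>, and
  \<open>count_low\<close> limits their number.\<close>

lemma signal_change_le_near:
  assumes "ts \<le> \<tau>" "\<tau> \<le> K * ts"
  shows "L1 \<tau> - L1 ts \<le> (p + 2 * \<mu>) * s * ln (\<tau> / ts)"
proof -
  define H where "H = {i\<in>I1. \<bar>X i\<bar> \<ge> A}"
  have fH: "finite H" "H \<subseteq> I1" using fin by (auto simp: H_def)
  have lg: "0 \<le> ln (\<tau> / ts)" using assms ts_pos by simp
  have "L1 \<tau> - L1 ts = (\<Sum>i\<in>I1. ln (lik_ratio \<tau> (X i)) - ln (lik_ratio ts (X i)))"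
    by (simp add: L1_def sum_subtractf)
  also have "\<dots> \<le> (\<Sum>i\<in>I1. (if i \<in> H then ln (\<tau> / ts) else 0) + \<mu> * ln (\<tau> / ts))"
  proof (rule sum_mono)
    fix i assume i: "i \<in> I1"
    show "ln (lik_ratio \<tau> (X i)) - ln (lik_ratio ts (X i)) \<le> (if i \<in> H then ln (\<tau> / ts) else 0) + \<mu> * ln (\<tau> / ts)"
    proof (cases "i \<in> H")
      case True
      have "ln (lik_ratio \<tau> (X i)) - ln (lik_ratio ts (X i)) \<le> 1 * ln (\<tau> / ts)"
        using ts_pos assms score_le by (intro ln_lik_ratio_diff_le_score) auto
      then show ?thesis using True lg pars by (simp add: add_increasing2)
    next
      case False
      have "ln (lik_ratio \<tau> (X i)) - ln (lik_ratio ts (X i)) \<le> \<mu> * ln (\<tau> / ts)"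
        using ts_pos assms False i by (intro ln_lik_ratio_diff_le_score score_low) (auto simp: H_def)
      then show ?thesis using False by simp
    qed
  qed
  also have "\<dots> = card H * ln (\<tau> / ts) + s * (\<mu> * ln (\<tau> / ts))"
    using fin fH card by (simp add: sum.distrib sum.inter_restrict[symmetric] Int_absorb1)
  also have "\<dots> \<le> (p + \<mu>) * s * ln (\<tau> / ts) + s * (\<mu> * ln (\<tau> / ts))"
    using count_low lg by (intro add_right_mono mult_right_mono) (auto simp: H_def)
  also have "\<dots> = (p + 2 * \<mu>) * s * ln (\<tau> / ts)" by (simp add: algebra_simps)
  finally show ?thesis .
qed

text \<open>Let x = \<tau> / ts. Up to x = K the contest is p ln x against p (x - 1), with margin
  \<gamma>. From there to t0 each signal may gain ln x, but K is so large that this is at most p / 4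
  * (x - 1). Beyond t0 the further drift is discarded: by \<open>top\<close> the loss already
  incurred at t0 outweighs the noise and the largest signal gain ln (1 / ts).\<close>

lemma not_maximal_high:
  assumes "(1 + \<epsilon>) * ts < \<tau>" "\<tau> \<le> 1"
  shows "L0 \<tau> + L1 \<tau> < L0 ts + L1 ts"
proof -
  have tt: "ts \<le> \<tau>" using assms pars ts_pos by (smt (verit) mult_le_cancel_right1)
  define x where "x = \<tau> / ts"
  have x: "1 + \<epsilon> < x" using assms ts_pos by (simp add: x_def pos_less_divide_eq)
  then have x: "1 + \<epsilon> < x" "1 < x" using pars by auto
  have lnx: "0 \<le> ln x" using x by simp
  show ?thesis
  proof (cases "\<tau> \<le> t0")
    case True
    have null: "L0 \<tau> - L0 ts \<le> - (p - \<mu>) * s * (x - 1)"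
      unfolding x_def using assms True by (intro null_change) auto
    show ?thesis
    proof (cases "\<tau> \<le> K * ts")
      case near: True
      have xK: "x \<le> K" using near ts_pos by (simp add: x_def divide_le_eq)
      have lK: "ln x \<le> ln K" using xK x by simp
      have sig: "L1 \<tau> - L1 ts \<le> (p + 2 * \<mu>) * s * ln x"
        unfolding x_def using tt near by (rule signal_change_le_near)
      have "ln (x / (1 + \<epsilon>)) \<le> x / (1 + \<epsilon>) - 1" using x pars by (intro ln_le_minus_one) auto
      also have "\<dots> = (x - (1 + \<epsilon>)) / (1 + \<epsilon>)" using pars by (simp add: diff_divide_distrib)
      also have "\<dots> \<le> (x - (1 + \<epsilon>)) / 1" using x pars by (intro divide_left_mono) auto
      finally have "ln x - ln (1 + \<epsilon>) \<le> x - (1 + \<epsilon>)" using x pars by (simp add: ln_div)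
      then have "\<gamma> \<le> (x - 1) - ln x" using gam(3) by linarith
      then have "p * \<gamma> \<le> p * ((x - 1) - ln x)" using pars by (intro mult_left_mono) auto
      moreover have "\<mu> * (2 * ln x + (x - 1)) \<le> \<mu> * (2 * ln K + K)"
        using lK xK pars by (intro mult_left_mono) auto
      ultimately have "0 < (p - \<mu>) * (x - 1) - (p + 2 * \<mu>) * ln x"
        using small(5) by (simp add: algebra_simps)
      then have "0 < s * ((p - \<mu>) * (x - 1) - (p + 2 * \<mu>) * ln x)" using card by simp
      then show ?thesis using null sig by (simp add: algebra_simps)
    next
      case far: False
      have xK: "x \<ge> K" using far ts_pos by (simp add: x_def le_divide_eq)
      have sig: "L1 \<tau> - L1 ts \<le> s * ln x"
        unfolding x_def using tt by (rule signal_change_le)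
      also have "\<dots> \<le> s * (p / 4 * (x - 1))" using K_ln[OF xK] card by (intro mult_left_mono) auto
      also have "\<dots> < s * ((p - \<mu>) * (x - 1))"
        using small pars x card by (intro mult_strict_left_mono mult_strict_right_mono) auto
      finally show ?thesis using null by (simp add: algebra_simps)
    qed
  next
    case False
    have tK: "(1 + \<epsilon>) * ts \<le> t0"
    proof -
      have "(1 + \<epsilon>) * ts \<le> K * ts" using pars ts_pos by (intro mult_right_mono) auto
      then show ?thesis using ts by linarith
    qed
    have null1: "L0 t0 - L0 ts \<le> - (p - \<mu>) * s * (t0 / ts - 1)"
      using tK by (intro null_change) auto
    have nz: "\<bar>(\<Sum>i\<in>I0. ln (lik_ratio \<tau> (X i)) - ln (lik_ratio t0 (X i))) + card I0 * drift_integral t0 \<tau>\<bar> \<le> \<mu>' * s / ts"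
    proof (rule abs_sum_ln_lik_ratio_diff[OF t0_pos])
      have "(\<integral>\<^sup>+u. ennreal (\<bar>null_noise I0 X u\<bar> / u) * indicator {t0..\<tau>} u \<partial>lborel) \<le> (\<integral>\<^sup>+u. ennreal (\<bar>null_noise I0 X u\<bar> / u) * indicator {t0..1} u \<partial>lborel)"
        using assms by (intro nn_integral_mono mult_left_mono) (auto split: split_indicator)
      then show "(\<integral>\<^sup>+u. ennreal (\<bar>null_noise I0 X u\<bar> / u) * indicator {t0..\<tau>} u \<partial>lborel) \<le> ennreal (\<mu>' * s / ts)"
        using noise2 by (rule order_trans)
    qed (use pars card ts_pos False in auto)
    have "0 \<le> card I0 * drift_integral t0 \<tau>" using drift_integral_nonneg[OF t0_pos] by simp
    then have null2: "L0 \<tau> - L0 t0 \<le> \<mu>' * s / ts"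
      using nz by (simp add: L0_def sum_subtractf abs_le_iff)
    have "x \<le> 1 / ts" using assms ts_pos by (simp add: x_def divide_right_mono)
    then have "ln x \<le> ln (1 / ts)" using x ts_pos by (subst ln_le_cancel_iff) auto
    then have "s * ln x \<le> s * ln (1 / ts)" using card by simp
    moreover have "L1 \<tau> - L1 ts \<le> s * ln x"
      unfolding x_def using tt by (rule signal_change_le)
    ultimately have sig: "L1 \<tau> - L1 ts \<le> s * ln (1 / ts)" by linarith
    have "t0 / ts - 1 \<ge> 0" using ts_le_t0 ts_pos by simp
    then have "p / 2 * (t0 / ts - 1) \<le> (p - \<mu>) * (t0 / ts - 1)" using small pars by (intro mult_right_mono) auto
    with top have "\<mu>' / ts + ln (1 / ts) < (p - \<mu>) * (t0 / ts - 1)" by linarith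
    then have "s * (\<mu>' / ts + ln (1 / ts)) < s * ((p - \<mu>) * (t0 / ts - 1))" using card by (intro mult_strict_left_mono) auto
    moreover have "s * (\<mu>' / ts + ln (1 / ts)) = \<mu>' * s / ts + s * ln (1 / ts)"
      by (simp add: distrib_left mult.commute)
    moreover have "- (p - \<mu>) * s * (t0 / ts - 1) = - (s * ((p - \<mu>) * (t0 / ts - 1)))"
      by (simp only: mult_ac minus_mult_left)
    ultimately show ?thesis using null1 null2 sig by linarith
  qed
qed

lemma maximiser_near_target:
  assumes "\<tau> \<in> {lo..1}" "L0 ts + L1 ts \<le> L0 \<tau> + L1 \<tau>"
  shows "\<tau> \<in> {(1 - \<epsilon>) * ts..(1 + \<epsilon>) * ts}"
proof (rule ccontr)
  assume "\<not> ?thesis"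
  then have "\<tau> < (1 - \<epsilon>) * ts \<or> (1 + \<epsilon>) * ts < \<tau>" by auto
  then show False
    using not_maximal_low[of \<tau>] not_maximal_high[of \<tau>] assms by auto
qed

end

section \<open>Concentration in the sequence model\<close>

abbreviation noise_law :: "nat \<Rightarrow> (nat \<Rightarrow> real) measure" where
  "noise_law n \<equiv> Pi\<^sub>M {..<n} (\<lambda>_. gauss)"

abbreviation shift :: "nat \<Rightarrow> (nat \<Rightarrow> real) \<Rightarrow> (nat \<Rightarrow> real) \<Rightarrow> nat \<Rightarrow> real" where
  "shift n \<theta> \<omega> \<equiv> \<lambda>i\<in>{..<n}. \<theta> i + \<omega> i"

lemma prob_space_noise_law: "prob_space (noise_law n)"
proof -
  interpret product_prob_space "\<lambda>_::nat. gauss" "{..<n}" by unfold_locales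
  show ?thesis by unfold_locales
qed

lemma sets_noise_law [simp, measurable_cong]: "sets (noise_law n) = sets (borel_Rn n)"
  by (intro sets_PiM_cong) auto

lemma space_noise_law [simp]: "space (noise_law n) = Rn n"
  by (simp add: space_PiM)

lemma shift_measurable [measurable]: "shift n \<theta> \<in> noise_law n \<rightarrow>\<^sub>M borel_Rn n"
  by measurable

lemma coord_measurable [measurable]: "i < n \<Longrightarrow> (\<lambda>\<omega>. \<omega> i) \<in> borel_measurable (noise_law n)"
  by measurable

lemma distr_noise_coord: "i < n \<Longrightarrow> distr (noise_law n) borel (\<lambda>\<omega>. \<omega> i) = gauss"
proof -
  assume "i < n"
  then have "distr (noise_law n) gauss (\<lambda>\<omega>. \<omega> i) = gauss"
    by (intro distr_PiM_component) (auto intro: prob_space_normal_law)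
  moreover have "distr (noise_law n) gauss (\<lambda>\<omega>. \<omega> i) = distr (noise_law n) borel (\<lambda>\<omega>. \<omega> i)"
    by (rule distr_cong) auto
  ultimately show ?thesis by simp
qed

lemma integral_noise_coord:
  assumes "i < n" and [measurable]: "f \<in> borel_measurable borel"
  shows "(\<integral>\<omega>. f (\<omega> i) \<partial>noise_law n) = (\<integral>z. (f z :: real) \<partial>gauss)"
proof -
  have "(\<integral>z. f z \<partial>gauss) = (\<integral>z. f z \<partial>distr (noise_law n) borel (\<lambda>\<omega>. \<omega> i))"
    by (simp add: distr_noise_coord[OF assms(1)])
  also have "\<dots> = (\<integral>\<omega>. f (\<omega> i) \<partial>noise_law n)"
    using assms(1) by (intro integral_distr) measurable
  finally show ?thesis by simp
qed

lemma indep_noise_coords: "prob_space.indep_vars (noise_law n) (\<lambda>_. borel) (\<lambda>i \<omega>. \<omega> i) {..<n}"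
proof (cases "n = 0")
  case True
  interpret prob_space "noise_law n" by (rule prob_space_noise_law)
  show ?thesis using True unfolding indep_vars_def indep_sets_def by auto
next
  case False
  interpret prob_space "noise_law n" by (rule prob_space_noise_law)
  have "distr (noise_law n) (borel_Rn n) (\<lambda>x. \<lambda>i\<in>{..<n}. x i) = distr (noise_law n) (noise_law n) (\<lambda>x. x)"
    by (rule distr_cong) (auto simp: PiE_def extensional_restrict)
  also have "\<dots> = noise_law n" by (rule distr_id)
  also have "\<dots> = (\<Pi>\<^sub>M i\<in>{..<n}. distr (noise_law n) borel (\<lambda>\<omega>. \<omega> i))"
    by (intro PiM_cong) (auto simp: distr_noise_coord)
  finally show ?thesis
    using False by (subst indep_vars_iff_distr_eq_PiM') auto
qed

section \<open>Second moments of sums over independent coordinates\<close>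

lemma (in prob_space) expectation_sum_squared:
  fixes Y :: "'i \<Rightarrow> 'a \<Rightarrow> real"
  assumes J: "finite J" and ind: "indep_vars (\<lambda>_. borel) Y J"
    and b: "\<And>i \<omega>. i \<in> J \<Longrightarrow> \<bar>Y i \<omega>\<bar> \<le> C" and zero: "\<And>i. i \<in> J \<Longrightarrow> expectation (Y i) = 0"
  shows "expectation (\<lambda>\<omega>. (\<Sum>i\<in>J. Y i \<omega>)\<^sup>2) = (\<Sum>i\<in>J. expectation (\<lambda>\<omega>. (Y i \<omega>)\<^sup>2))"
proof -
  have meas: "Y i \<in> borel_measurable M" if "i \<in> J" for i
    using ind that by (auto simp: indep_vars_def)
  have int: "integrable M (Y i)" if "i \<in> J" for i
    using that meas b by (intro integrable_const_bound[where B=C]) auto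
  have C0: "0 \<le> C" if "i \<in> J" for i using b[OF that, of undefined] by linarith
  have int2: "integrable M (\<lambda>\<omega>. Y i \<omega> * Y j \<omega>)" if "i \<in> J" "j \<in> J" for i j
  proof (rule integrable_const_bound[where B="C * C"])
    show "AE \<omega> in M. norm (Y i \<omega> * Y j \<omega>) \<le> C * C"
      using b that C0[OF that(1)] by (auto simp: abs_mult intro!: mult_mono AE_I2)
  qed (use meas that in measurable)
  have off: "expectation (\<lambda>\<omega>. Y i \<omega> * Y j \<omega>) = 0" if "i \<in> J" "j \<in> J" "i \<noteq> j" for i j
  proof -
    have "indep_vars (\<lambda>_. borel) Y {i, j}" using ind that by (intro indep_vars_subset[OF ind]) auto
    then have "expectation (\<lambda>\<omega>. \<Prod>k\<in>{i, j}. Y k \<omega>) = (\<Prod>k\<in>{i, j}. expectation (Y k))"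
      using that int by (intro indep_vars_lebesgue_integral) auto
    then show ?thesis using that zero by simp
  qed
  have "expectation (\<lambda>\<omega>. (\<Sum>i\<in>J. Y i \<omega>)\<^sup>2) = expectation (\<lambda>\<omega>. \<Sum>i\<in>J. \<Sum>j\<in>J. Y i \<omega> * Y j \<omega>)"
    by (simp add: power2_eq_square sum_product)
  also have "\<dots> = (\<Sum>i\<in>J. \<Sum>j\<in>J. expectation (\<lambda>\<omega>. Y i \<omega> * Y j \<omega>))"
    using int2 by (simp add: Bochner_Integration.integral_sum)
  also have "\<dots> = (\<Sum>i\<in>J. \<Sum>j\<in>J. if i = j then expectation (\<lambda>\<omega>. (Y i \<omega>)\<^sup>2) else 0)"
    using off by (intro sum.cong) (auto simp: power2_eq_square)
  also have "\<dots> = (\<Sum>i\<in>J. expectation (\<lambda>\<omega>. (Y i \<omega>)\<^sup>2))"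
    using J by simp
  finally show ?thesis .
qed

lemma noise_sum_squared:
  fixes f :: "nat \<Rightarrow> real \<Rightarrow> real" and C :: real
  assumes J: "J \<subseteq> {..<n}" and [measurable]: "\<And>i. f i \<in> borel_measurable borel"
    and b: "\<And>i z. \<bar>f i z\<bar> \<le> C" and zero: "\<And>i. i \<in> J \<Longrightarrow> (\<integral>z. f i z \<partial>gauss) = 0"
  shows "(\<integral>\<omega>. (\<Sum>i\<in>J. f i (\<omega> i))\<^sup>2 \<partial>noise_law n) = (\<Sum>i\<in>J. \<integral>z. (f i z)\<^sup>2 \<partial>gauss)"
proof -
  interpret prob_space "noise_law n" by (rule prob_space_noise_law)
  have fin: "finite J" using J by (rule finite_subset) simp
  have "indep_vars (\<lambda>_. borel) (\<lambda>i \<omega>. f i (\<omega> i)) J"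
    by (rule indep_vars_compose2[OF indep_vars_subset[OF indep_noise_coords J]]) simp
  then have "expectation (\<lambda>\<omega>. (\<Sum>i\<in>J. f i (\<omega> i))\<^sup>2) = (\<Sum>i\<in>J. expectation (\<lambda>\<omega>. (f i (\<omega> i))\<^sup>2))"
    using J b zero by (intro expectation_sum_squared[where C=C] fin) (auto simp: integral_noise_coord subset_eq)
  also have "\<dots> = (\<Sum>i\<in>J. \<integral>z. (f i z)\<^sup>2 \<partial>gauss)"
    using J by (intro sum.cong refl) (subst integral_noise_coord[of _ n "\<lambda>z. (f _ z)\<^sup>2"], auto)
  finally show ?thesis .
qed

text \<open>Chebyshev's inequality; the variance of an indicator is at most its mean, so the
  expected count itself appears in the bound.\<close>

lemma count_concentration:
  assumes J: "J \<subseteq> {..<n}" and a: "a > 0"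
  shows "measure (noise_law n) {\<omega>\<in>Rn n. a \<le> \<bar>real (card {i\<in>J. y \<le> \<bar>\<theta> i + \<omega> i\<bar>}) - (\<Sum>i\<in>J. measure gauss {z. y \<le> \<bar>\<theta> i + z\<bar>})\<bar>}
    \<le> (\<Sum>i\<in>J. measure gauss {z. y \<le> \<bar>\<theta> i + z\<bar>}) / a\<^sup>2"
    and "{\<omega>\<in>Rn n. a \<le> \<bar>real (card {i\<in>J. y \<le> \<bar>\<theta> i + \<omega> i\<bar>}) - (\<Sum>i\<in>J. measure gauss {z. y \<le> \<bar>\<theta> i + z\<bar>})\<bar>} \<in> sets (noise_law n)"
proof -
  interpret prob_space "noise_law n" by (rule prob_space_noise_law)
  have fin: "finite J" using J by (rule finite_subset) simp
  define q where "q i = measure gauss {z. y \<le> \<bar>\<theta> i + z\<bar>}" for i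
  define f where "f i z = indicator {z. y \<le> \<bar>\<theta> i + z\<bar>} z - q i" for i z
  have [measurable]: "f i \<in> borel_measurable borel" for i unfolding f_def[abs_def] by measurable
  have q: "0 \<le> q i" "q i \<le> 1" for i by (auto simp: q_def)
  have b: "\<bar>f i z\<bar> \<le> 1" for i z using q[of i] by (auto simp: f_def split: split_indicator)
  have zero: "(\<integral>z. f i z \<partial>gauss) = 0" for i
    unfolding f_def by (subst Bochner_Integration.integral_diff) (auto simp: q_def)
  define S where "S \<omega> = (\<Sum>i\<in>J. f i (\<omega> i))" for \<omega>
  have [measurable]: "S \<in> borel_measurable (noise_law n)"
    unfolding S_def[abs_def] by (intro borel_measurable_sum) (use J in \<open>auto intro!: measurable_compose[OF coord_measurable]\<close>)
  have Sb: "\<bar>S \<omega>\<bar> \<le> card J" for \<omega>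
    unfolding S_def using sum_mono[of J "\<lambda>i. \<bar>f i (\<omega> i)\<bar>" "\<lambda>_. 1"] b
    by (intro order_trans[OF sum_abs]) auto
  have int: "integrable (noise_law n) (\<lambda>\<omega>. (S \<omega>)\<^sup>2)"
    by (rule integrable_const_bound[where B="(real (card J))\<^sup>2"])
       (auto intro!: AE_I2 simp: abs_le_square_iff[symmetric] Sb)
  have "prob {\<omega>\<in>space (noise_law n). a \<le> \<bar>S \<omega>\<bar>} \<le> expectation (\<lambda>\<omega>. (S \<omega>)\<^sup>2) / a\<^sup>2"
    using int a by (intro second_moment_method) auto
  also have "expectation (\<lambda>\<omega>. (S \<omega>)\<^sup>2) = (\<Sum>i\<in>J. \<integral>z. (f i z)\<^sup>2 \<partial>gauss)"
    unfolding S_def by (rule noise_sum_squared[OF J _ b zero]) simp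
  also have "(\<Sum>i\<in>J. \<integral>z. (f i z)\<^sup>2 \<partial>gauss) \<le> (\<Sum>i\<in>J. q i)"
  proof (rule sum_mono)
    fix i
    have "(f i z)\<^sup>2 = (1 - 2 * q i) * indicator {z. y \<le> \<bar>\<theta> i + z\<bar>} z + (q i)\<^sup>2" for z
      by (auto simp: f_def power2_eq_square algebra_simps split: split_indicator)
    then have "(\<integral>z. (f i z)\<^sup>2 \<partial>gauss) = (\<integral>z. (1 - 2 * q i) * indicator {z. y \<le> \<bar>\<theta> i + z\<bar>} z + (q i)\<^sup>2 \<partial>gauss)"
      by simp
    also have "\<dots> = (1 - 2 * q i) * q i + (q i)\<^sup>2"
      by (simp add: q_def)
    also have "\<dots> = q i - q i * q i" by (simp add: power2_eq_square algebra_simps)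
    also have "\<dots> \<le> q i" using mult_nonneg_nonneg[OF q(1) q(1), of i i] by linarith
    finally show "(\<integral>z. (f i z)\<^sup>2 \<partial>gauss) \<le> q i" .
  qed
  finally have main: "prob {\<omega>\<in>space (noise_law n). a \<le> \<bar>S \<omega>\<bar>} \<le> (\<Sum>i\<in>J. q i) / a\<^sup>2" using a by (simp add: divide_right_mono)
  have sets: "{\<omega>\<in>space (noise_law n). a \<le> \<bar>S \<omega>\<bar>} \<in> sets (noise_law n)" by measurable
  have eq: "S \<omega> = real (card {i\<in>J. y \<le> \<bar>\<theta> i + \<omega> i\<bar>}) - (\<Sum>i\<in>J. q i)" for \<omega>
  proof -
    have "(\<Sum>i\<in>J. indicator {z. y \<le> \<bar>\<theta> i + z\<bar>} (\<omega> i) :: real) = card {i\<in>J. y \<le> \<bar>\<theta> i + \<omega> i\<bar>}"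
      using fin by (simp add: indicator_def sum.If_cases Int_def)
    then show ?thesis by (simp add: S_def f_def sum_subtractf)
  qed
  show "measure (noise_law n) {\<omega>\<in>Rn n. a \<le> \<bar>real (card {i\<in>J. y \<le> \<bar>\<theta> i + \<omega> i\<bar>}) - (\<Sum>i\<in>J. measure gauss {z. y \<le> \<bar>\<theta> i + z\<bar>})\<bar>}
    \<le> (\<Sum>i\<in>J. measure gauss {z. y \<le> \<bar>\<theta> i + z\<bar>}) / a\<^sup>2"
    using main by (simp only: eq q_def space_noise_law)
  show "{\<omega>\<in>Rn n. a \<le> \<bar>real (card {i\<in>J. y \<le> \<bar>\<theta> i + \<omega> i\<bar>}) - (\<Sum>i\<in>J. measure gauss {z. y \<le> \<bar>\<theta> i + z\<bar>})\<bar>} \<in> sets (noise_law n)"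
    using sets by (simp only: eq q_def space_noise_law)
qed

text \<open>A first moment bound for the integrated noise controls it simultaneously for all \<open>\<tau>\<close>, with no
  union bound over a grid.\<close>

lemma noise_integral_Markov:
  assumes J: "J \<subseteq> {..<n}" and zero: "\<And>i. i \<in> J \<Longrightarrow> \<theta> i = 0"
    and [measurable]: "w \<in> borel_measurable borel" "v \<in> borel_measurable borel"
    and v: "\<And>\<tau>. \<tau> \<in> {a..b} \<Longrightarrow> card J * (\<integral>x. (score \<tau> x)\<^sup>2 \<partial>gauss) \<le> v \<tau>"
    and B: "(\<integral>\<^sup>+\<tau>. ennreal (w \<tau> * sqrt (v \<tau>)) * indicator {a..b} \<tau> \<partial>lborel) \<le> ennreal B"
    and c: "c > 0" and B0: "B \<ge> 0" and w: "\<And>\<tau>. \<tau> \<in> {a..b} \<Longrightarrow> 0 \<le> w \<tau>"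
  shows "measure (noise_law n) {\<omega>\<in>Rn n. ennreal c \<le> (\<integral>\<^sup>+\<tau>. ennreal (\<bar>null_noise J (shift n \<theta> \<omega>) \<tau>\<bar> * w \<tau>) * indicator {a..b} \<tau> \<partial>lborel)} \<le> B / c"
    and "{\<omega>\<in>Rn n. ennreal c \<le> (\<integral>\<^sup>+\<tau>. ennreal (\<bar>null_noise J (shift n \<theta> \<omega>) \<tau>\<bar> * w \<tau>) * indicator {a..b} \<tau> \<partial>lborel)} \<in> sets (noise_law n)"
proof -
  interpret prob_space "noise_law n" by (rule prob_space_noise_law)
  interpret L: pair_sigma_finite "noise_law n" lborel ..
  have fin: "finite J" using J by (rule finite_subset) simp
  define Z where "Z \<omega> \<tau> = (\<Sum>i\<in>J. score \<tau> (\<omega> i) + null_drift \<tau>)" for \<omega> \<tau>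
  have Z: "null_noise J (shift n \<theta> \<omega>) \<tau> = Z \<omega> \<tau>" for \<omega> \<tau>
    unfolding null_noise_def Z_def using J zero by (intro sum.cong) auto
  have Zm [measurable]: "case_prod Z \<in> borel_measurable (noise_law n \<Otimes>\<^sub>M lborel)"
    unfolding Z_def split_beta'
  proof (intro borel_measurable_sum)
    fix i assume "i \<in> J"
    then have [measurable]: "(\<lambda>\<omega>. \<omega> i) \<in> borel_measurable (noise_law n)" using J by auto
    show "(\<lambda>x. score (snd x) (fst x i) + null_drift (snd x)) \<in> borel_measurable (noise_law n \<Otimes>\<^sub>M lborel)"
      by measurable
  qed
  have Zm1 [measurable]: "(\<lambda>\<omega>. Z \<omega> \<tau>) \<in> borel_measurable (noise_law n)" for \<tau>
    using measurable_Pair1[OF Zm, where y=\<tau>] by simp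
  define W where "W \<omega> = (\<integral>\<^sup>+\<tau>. ennreal (\<bar>Z \<omega> \<tau>\<bar> * w \<tau>) * indicator {a..b} \<tau> \<partial>lborel)" for \<omega>
  have [measurable]: "W \<in> borel_measurable (noise_law n)"
    unfolding W_def[abs_def] by measurable
  have EZ: "(\<integral>\<^sup>+\<omega>. ennreal \<bar>Z \<omega> \<tau>\<bar> \<partial>noise_law n) \<le> ennreal (sqrt (v \<tau>))" if t: "\<tau> \<in> {a..b}" for \<tau>
  proof -
    define f where "f (i::nat) z = score \<tau> z + null_drift \<tau>" for i z
    have b: "\<bar>f i z\<bar> \<le> 2" for i z
      using abs_score_le[of \<tau> z] abs_null_drift_le[of \<tau>] by (auto simp: f_def)
    have Zb: "\<bar>Z \<omega> \<tau>\<bar> \<le> 2 * real (card J)" for \<omega>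
      unfolding Z_def using sum_mono[of J "\<lambda>i. \<bar>f i (\<omega> i)\<bar>" "\<lambda>_. 2"] b
      by (intro order_trans[OF sum_abs]) (auto simp: f_def mult.commute)
    have int: "integrable (noise_law n) (\<lambda>\<omega>. \<bar>Z \<omega> \<tau>\<bar>)"
      by (rule integrable_const_bound[where B="2 * real (card J)"]) (auto intro!: AE_I2 simp: Zb)
    have int2: "integrable (noise_law n) (\<lambda>\<omega>. \<bar>Z \<omega> \<tau>\<bar>\<^sup>2)"
      using power_mono[OF Zb, where n=2] by (intro integrable_const_bound[where B="(2 * real (card J))\<^sup>2"]) (auto intro!: AE_I2)
    have sq: "(\<integral>\<omega>. (Z \<omega> \<tau>)\<^sup>2 \<partial>noise_law n) = (\<Sum>i\<in>J. \<integral>z. (f i z)\<^sup>2 \<partial>gauss)"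
    proof -
      have "(\<integral>\<omega>. (\<Sum>i\<in>J. f i (\<omega> i))\<^sup>2 \<partial>noise_law n) = (\<Sum>i\<in>J. \<integral>z. (f i z)\<^sup>2 \<partial>gauss)"
        by (rule noise_sum_squared[OF J _ b]) (auto simp: f_def null_drift_def)
      then show ?thesis by (simp add: Z_def f_def)
    qed
    have "(\<integral>z. (f i z)\<^sup>2 \<partial>gauss) \<le> (\<integral>x. (score \<tau> x)\<^sup>2 \<partial>gauss)" for i
    proof -
      have i2: "integrable gauss (\<lambda>x. (score \<tau> x)\<^sup>2)"
        using abs_score_le[of \<tau>] by (intro integrable_gauss_bounded[where B=1]) (auto simp: abs_square_le_1)
      have "(\<integral>z. (f i z)\<^sup>2 \<partial>gauss) = (\<integral>z. (score \<tau> z)\<^sup>2 + 2 * null_drift \<tau> * score \<tau> z + (null_drift \<tau>)\<^sup>2 \<partial>gauss)"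
        by (intro Bochner_Integration.integral_cong) (auto simp: f_def power2_eq_square algebra_simps)
      also have "\<dots> = (\<integral>x. (score \<tau> x)\<^sup>2 \<partial>gauss) + 2 * null_drift \<tau> * (\<integral>x. score \<tau> x \<partial>gauss) + (null_drift \<tau>)\<^sup>2"
        using i2 by simp
      also have "\<dots> \<le> (\<integral>x. (score \<tau> x)\<^sup>2 \<partial>gauss)" by (simp add: null_drift_def power2_eq_square)
      finally show ?thesis .
    qed
    then have "(\<Sum>i\<in>J. \<integral>z. (f i z)\<^sup>2 \<partial>gauss) \<le> (\<Sum>i\<in>J. \<integral>x. (score \<tau> x)\<^sup>2 \<partial>gauss)" by (rule sum_mono)
    then have EZ2: "expectation (\<lambda>\<omega>. (Z \<omega> \<tau>)\<^sup>2) \<le> v \<tau>" using v[OF t] by (simp add: sq)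
    \<comment> \<open>Nonnegativity of the variance of |Z| serves as Jensen's inequality: the mean
      of |Z| is at most the root of the mean of Z^2.\<close>
    have "0 \<le> variance (\<lambda>\<omega>. \<bar>Z \<omega> \<tau>\<bar>)" by (rule variance_positive)
    also have "\<dots> = expectation (\<lambda>\<omega>. (Z \<omega> \<tau>)\<^sup>2) - (expectation (\<lambda>\<omega>. \<bar>Z \<omega> \<tau>\<bar>))\<^sup>2"
      using variance_eq[OF int int2] by simp
    finally have "(expectation (\<lambda>\<omega>. \<bar>Z \<omega> \<tau>\<bar>))\<^sup>2 \<le> v \<tau>" using EZ2 by simp
    then have "expectation (\<lambda>\<omega>. \<bar>Z \<omega> \<tau>\<bar>) \<le> sqrt (v \<tau>)" by (rule real_le_rsqrt)
    then show ?thesis using int by (subst nn_integral_eq_integral) (auto intro: ennreal_leI)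
  qed
  have "(\<integral>\<^sup>+\<omega>. W \<omega> \<partial>noise_law n) = (\<integral>\<^sup>+\<tau>. \<integral>\<^sup>+\<omega>. ennreal (\<bar>Z \<omega> \<tau>\<bar> * w \<tau>) * indicator {a..b} \<tau> \<partial>noise_law n \<partial>lborel)"
    unfolding W_def by (rule L.Fubini'[symmetric]) measurable
  also have "\<dots> \<le> (\<integral>\<^sup>+\<tau>. ennreal (w \<tau> * sqrt (v \<tau>)) * indicator {a..b} \<tau> \<partial>lborel)"
  proof (rule nn_integral_mono)
    fix \<tau>
    show "(\<integral>\<^sup>+\<omega>. ennreal (\<bar>Z \<omega> \<tau>\<bar> * w \<tau>) * indicator {a..b} \<tau> \<partial>noise_law n) \<le> ennreal (w \<tau> * sqrt (v \<tau>)) * indicator {a..b} \<tau>"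
    proof (cases "\<tau> \<in> {a..b}")
      case True
      have "(\<integral>\<^sup>+\<omega>. ennreal (\<bar>Z \<omega> \<tau>\<bar> * w \<tau>) * indicator {a..b} \<tau> \<partial>noise_law n) = (\<integral>\<^sup>+\<omega>. ennreal (w \<tau>) * ennreal \<bar>Z \<omega> \<tau>\<bar> \<partial>noise_law n)"
        using True w by (intro nn_integral_cong) (simp add: ennreal_mult'[symmetric] mult.commute)
      also have "\<dots> = ennreal (w \<tau>) * (\<integral>\<^sup>+\<omega>. ennreal \<bar>Z \<omega> \<tau>\<bar> \<partial>noise_law n)"
        by (rule nn_integral_cmult) simp
      also have "\<dots> \<le> ennreal (w \<tau>) * ennreal (sqrt (v \<tau>))" by (intro mult_left_mono EZ[OF True]) simp
      also have "\<dots> = ennreal (w \<tau> * sqrt (v \<tau>))" using w[OF True] by (simp add: ennreal_mult')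
      finally show ?thesis using True by simp
    qed simp
  qed
  also note B
  finally have EW: "(\<integral>\<^sup>+\<omega>. W \<omega> \<partial>noise_law n) \<le> ennreal B" .
  have set: "{\<omega>\<in>Rn n. ennreal c \<le> (\<integral>\<^sup>+\<tau>. ennreal (\<bar>null_noise J (shift n \<theta> \<omega>) \<tau>\<bar> * w \<tau>) * indicator {a..b} \<tau> \<partial>lborel)} = {\<omega>\<in>space (noise_law n). ennreal c \<le> W \<omega>}"
    by (simp add: Z W_def)
  \<comment> \<open>The Markov inequality has the form 1 \<le> c * u in \<open>ennreal\<close>, so
    the level is moved to the other side.\<close>
  have iff: "1 \<le> ennreal (1 / c) * u \<longleftrightarrow> ennreal c \<le> u" for u
  proof -
    have "ennreal c * (ennreal (1 / c) * u) = u"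
      using c by (simp add: mult.assoc[symmetric] ennreal_mult'[symmetric])
    moreover have "ennreal (1 / c) * ennreal c = 1" using c by (simp add: ennreal_mult'[symmetric])
    ultimately show ?thesis
      by (metis mult.right_neutral mult_left_mono zero_le)
  qed
  show "{\<omega>\<in>Rn n. ennreal c \<le> (\<integral>\<^sup>+\<tau>. ennreal (\<bar>null_noise J (shift n \<theta> \<omega>) \<tau>\<bar> * w \<tau>) * indicator {a..b} \<tau> \<partial>lborel)} \<in> sets (noise_law n)"
    unfolding set by measurable
  have "emeasure (noise_law n) {\<omega>\<in>space (noise_law n). 1 \<le> ennreal (1 / c) * W \<omega>} \<le> ennreal (1 / c) * (\<integral>\<^sup>+\<omega>. W \<omega> * indicator (space (noise_law n)) \<omega> \<partial>noise_law n)"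
    by (rule nn_integral_Markov_inequality) measurable
  also have "(\<integral>\<^sup>+\<omega>. W \<omega> * indicator (space (noise_law n)) \<omega> \<partial>noise_law n) = (\<integral>\<^sup>+\<omega>. W \<omega> \<partial>noise_law n)"
    by (intro nn_integral_cong) (auto split: split_indicator)
  also have "ennreal (1 / c) * (\<integral>\<^sup>+\<omega>. W \<omega> \<partial>noise_law n) \<le> ennreal (1 / c) * ennreal B"
    by (intro mult_left_mono EW) simp
  also have "\<dots> = ennreal (B / c)" using c by (simp add: ennreal_mult'[symmetric])
  finally have "emeasure (noise_law n) {\<omega>\<in>space (noise_law n). ennreal c \<le> W \<omega>} \<le> ennreal (B / c)"
    unfolding iff .
  then show "measure (noise_law n) {\<omega>\<in>Rn n. ennreal c \<le> (\<integral>\<^sup>+\<tau>. ennreal (\<bar>null_noise J (shift n \<theta> \<omega>) \<tau>\<bar> * w \<tau>) * indicator {a..b} \<tau> \<partial>lborel)} \<le> B / c"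
    unfolding set using B0 c by (simp add: emeasure_eq_measure ennreal_le_iff)
qed


section \<open>Noise integrals on the three ranges of \<tau>\<close>

lemma nn_integral_inverse_sqrt:
  assumes "0 < a" "a \<le> b" "0 \<le> c"
  shows "(\<integral>\<^sup>+\<tau>. ennreal (c / sqrt \<tau>) * indicator {a..b} \<tau> \<partial>lborel) \<le> ennreal (2 * c * sqrt b)"
proof -
  have "(\<integral>\<^sup>+\<tau>. ennreal (c / sqrt \<tau>) * indicator {a..b} \<tau> \<partial>lborel) = ennreal (2 * c * sqrt b - 2 * c * sqrt a)"
  proof (rule nn_integral_FTC_Icc[where F="\<lambda>\<tau>. 2 * c * sqrt \<tau>"])
    fix \<tau> assume "\<tau> \<in> {a..b}"
    then have t: "\<tau> > 0" using assms by simp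
    have d: "((\<lambda>\<tau>. 2 * c * sqrt \<tau>) has_real_derivative 2 * c * (inverse (sqrt \<tau>) / 2)) (at \<tau>)"
      by (intro DERIV_cmult DERIV_real_sqrt t)
    have e: "2 * c * (inverse (sqrt \<tau>) / 2) = c / sqrt \<tau>"
      by (simp only: divide_inverse mult_ac) simp
    show "((\<lambda>\<tau>. 2 * c * sqrt \<tau>) has_real_derivative c / sqrt \<tau>) (at \<tau>)"
      using d unfolding e .
    show "0 \<le> c / sqrt \<tau>" using assms t by simp
  qed (use assms in auto)
  also have "\<dots> \<le> ennreal (2 * c * sqrt b)" using assms by (intro ennreal_leI) auto
  finally show ?thesis .
qed

lemma nn_integral_inverse_three_halves:
  assumes "0 < a" "a \<le> b" "0 \<le> c"
  shows "(\<integral>\<^sup>+\<tau>. ennreal (c / (\<tau> * sqrt \<tau>)) * indicator {a..b} \<tau> \<partial>lborel) \<le> ennreal (2 * c / sqrt a)"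
proof -
  have "(\<integral>\<^sup>+\<tau>. ennreal (c / (\<tau> * sqrt \<tau>)) * indicator {a..b} \<tau> \<partial>lborel) = ennreal (- (2 * c) * inverse (sqrt b) - - (2 * c) * inverse (sqrt a))"
  proof (rule nn_integral_FTC_Icc[where F="\<lambda>\<tau>. - (2 * c) * inverse (sqrt \<tau>)"])
    fix \<tau> assume "\<tau> \<in> {a..b}"
    then have t: "\<tau> > 0" using assms by simp
    then have d: "((\<lambda>\<tau>. - (2 * c) * inverse (sqrt \<tau>)) has_real_derivative - (2 * c) * - (inverse (sqrt \<tau>) * (inverse (sqrt \<tau>) / 2) * inverse (sqrt \<tau>))) (at \<tau>)"
      by (intro DERIV_cmult DERIV_inverse' DERIV_real_sqrt) auto
    have e: "- (2 * c) * - (inverse (sqrt \<tau>) * (inverse (sqrt \<tau>) / 2) * inverse (sqrt \<tau>)) = c / (\<tau> * sqrt \<tau>)"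
    proof -
      have "inverse (sqrt \<tau>) * inverse (sqrt \<tau>) = inverse \<tau>"
        using t by (simp add: inverse_mult_distrib[symmetric] del: inverse_mult_distrib)
      moreover have "- (2 * c) * - (r * (r / 2) * r) = c * (r * r) * r" for r :: real by simp
      ultimately show ?thesis by (simp only: divide_inverse inverse_mult_distrib mult.assoc) (simp only: mult_ac)
    qed
    show "((\<lambda>\<tau>. - (2 * c) * inverse (sqrt \<tau>)) has_real_derivative c / (\<tau> * sqrt \<tau>)) (at \<tau>)"
      using d unfolding e .
    show "0 \<le> c / (\<tau> * sqrt \<tau>)" using assms t by simp
  qed (use assms in auto)
  also have "\<dots> \<le> ennreal (2 * c / sqrt a)" using assms by (intro ennreal_leI) (auto simp: divide_inverse)
  finally show ?thesis .
qed

context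
  fixes n :: nat and \<theta> :: "nat \<Rightarrow> real" and J :: "nat set"
  assumes J: "J \<subseteq> {..<n}" and zero: "\<And>i. i \<in> J \<Longrightarrow> \<theta> i = 0"
begin

lemma card_J_le: "real (card J) \<le> real n"
  using card_mono[OF _ J] by simp

text \<open>The noise has standard deviation at most of order sqrt (n \<tau> / \<zeta>(b)); division
  by \<tau> leaves the integrable 1 / sqrt \<tau>. With b the target the result is of order sqrt s,
  while the allowance in \<open>good_event\<close> is proportional to s.\<close>

lemma noise_low:
  assumes "0 < a" "a \<le> b" "b \<le> 1/8" "c > 0"
  defines "Bad \<equiv> {\<omega>\<in>Rn n. ennreal c \<le> (\<integral>\<^sup>+\<tau>. ennreal (\<bar>null_noise J (shift n \<theta> \<omega>) \<tau>\<bar> * (1 / \<tau>)) * indicator {a..b} \<tau> \<partial>lborel)}"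
  shows "measure (noise_law n) Bad \<le> 2 * sqrt (258 * (real n * (b / zeta b))) / c" "Bad \<in> sets (noise_law n)"
proof -
  define C where "C = 258 * (real n / zeta b)"
  have zb: "zeta b > 0" using assms by (intro zeta_pos) auto
  have C: "C \<ge> 0" using zb by (simp add: C_def)
  have v: "card J * (\<integral>x. (score \<tau> x)\<^sup>2 \<partial>gauss) \<le> C * \<tau>" if "\<tau> \<in> {a..b}" for \<tau>
  proof -
    have t: "0 < \<tau>" "\<tau> \<le> b" "\<tau> \<le> 1/8" using that assms by auto
    have "(\<integral>x. (score \<tau> x)\<^sup>2 \<partial>gauss) \<le> 258 * (\<tau> / zeta \<tau>)" using t by (intro score_second_moment_zeta)
    also have "\<dots> \<le> 258 * (\<tau> / zeta b)"
      using t zb zeta_antimono[of \<tau> b] by (intro mult_left_mono divide_left_mono mult_pos_pos) auto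
    finally have "card J * (\<integral>x. (score \<tau> x)\<^sup>2 \<partial>gauss) \<le> real n * (258 * (\<tau> / zeta b))"
      using card_J_le by (intro mult_mono) auto
    then show ?thesis by (simp add: C_def mult_ac)
  qed
  have B: "(\<integral>\<^sup>+\<tau>. ennreal (1 / \<tau> * sqrt (C * \<tau>)) * indicator {a..b} \<tau> \<partial>lborel) \<le> ennreal (2 * sqrt C * sqrt b)"
  proof -
    have "(\<integral>\<^sup>+\<tau>. ennreal (1 / \<tau> * sqrt (C * \<tau>)) * indicator {a..b} \<tau> \<partial>lborel) = (\<integral>\<^sup>+\<tau>. ennreal (sqrt C / sqrt \<tau>) * indicator {a..b} \<tau> \<partial>lborel)"
    proof (rule nn_integral_cong)
      fix \<tau> :: real
      show "ennreal (1 / \<tau> * sqrt (C * \<tau>)) * indicator {a..b} \<tau> = ennreal (sqrt C / sqrt \<tau>) * indicator {a..b} \<tau>"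
      proof (cases "\<tau> \<in> {a..b}")
        case True
        then have "\<tau> > 0" using assms by simp
        then have "1 / \<tau> * sqrt (C * \<tau>) = sqrt C / sqrt \<tau>"
          using real_sqrt_mult_self[of \<tau>] by (simp add: real_sqrt_mult field_simps)
        then show ?thesis by simp
      qed simp
    qed
    also have "\<dots> \<le> ennreal (2 * sqrt C * sqrt b)" using assms C by (intro nn_integral_inverse_sqrt) auto
    finally show ?thesis .
  qed
  have eq: "2 * sqrt C * sqrt b = 2 * sqrt (258 * (real n * (b / zeta b)))"
    by (simp add: C_def real_sqrt_mult[symmetric] mult_ac)
  show "measure (noise_law n) Bad \<le> 2 * sqrt (258 * (real n * (b / zeta b))) / c"
    unfolding Bad_def eq[symmetric] using assms C
    by (intro noise_integral_Markov(1)[OF J zero _ _ v B]) auto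
  show "Bad \<in> sets (noise_law n)"
    unfolding Bad_def using assms C
    by (intro noise_integral_Markov(2)[OF J zero _ _ v B]) auto
qed

text \<open>The weight turns the standard deviation sqrt (n \<tau> / \<zeta>(\<tau>)) into a
  multiple of \<tau> to the power - 3 / 2, so the lower end dominates. With a the target the bound
  before division by c is of order n / sqrt s, against an allowance proportional to n.\<close>

lemma noise_high:
  assumes "0 < a" "a \<le> b" "b \<le> 1/8" "c > 0"
  defines "Bad \<equiv> {\<omega>\<in>Rn n. ennreal c \<le> (\<integral>\<^sup>+\<tau>. ennreal (\<bar>null_noise J (shift n \<theta> \<omega>) \<tau>\<bar> * (zeta \<tau> / \<tau>\<^sup>2)) * indicator {a..b} \<tau> \<partial>lborel)}"
  shows "measure (noise_law n) Bad \<le> 2 * sqrt (258 * (real n * (zeta a / a))) / c" "Bad \<in> sets (noise_law n)"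
proof -
  define C where "C = 258 * (real n * zeta a)"
  have za: "zeta a > 0" using assms by (intro zeta_pos) auto
  have C: "C \<ge> 0" using za by (simp add: C_def)
  have v: "card J * (\<integral>x. (score \<tau> x)\<^sup>2 \<partial>gauss) \<le> 258 * real n * (\<tau> / zeta \<tau>)" if "\<tau> \<in> {a..b}" for \<tau>
  proof -
    have t: "0 < \<tau>" "\<tau> \<le> b" "\<tau> \<le> 1/8" using that assms by auto
    have "(\<integral>x. (score \<tau> x)\<^sup>2 \<partial>gauss) \<le> 258 * (\<tau> / zeta \<tau>)" using t by (intro score_second_moment_zeta)
    then have "card J * (\<integral>x. (score \<tau> x)\<^sup>2 \<partial>gauss) \<le> real n * (258 * (\<tau> / zeta \<tau>))"
      using card_J_le by (intro mult_mono) auto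
    then show ?thesis by (simp add: mult_ac)
  qed
  have B: "(\<integral>\<^sup>+\<tau>. ennreal (zeta \<tau> / \<tau>\<^sup>2 * sqrt (258 * real n * (\<tau> / zeta \<tau>))) * indicator {a..b} \<tau> \<partial>lborel) \<le> ennreal (2 * sqrt C / sqrt a)"
  proof -
    have "(\<integral>\<^sup>+\<tau>. ennreal (zeta \<tau> / \<tau>\<^sup>2 * sqrt (258 * real n * (\<tau> / zeta \<tau>))) * indicator {a..b} \<tau> \<partial>lborel) \<le> (\<integral>\<^sup>+\<tau>. ennreal (sqrt C / (\<tau> * sqrt \<tau>)) * indicator {a..b} \<tau> \<partial>lborel)"
    proof (rule nn_integral_mono)
      fix \<tau> :: real
      show "ennreal (zeta \<tau> / \<tau>\<^sup>2 * sqrt (258 * real n * (\<tau> / zeta \<tau>))) * indicator {a..b} \<tau> \<le> ennreal (sqrt C / (\<tau> * sqrt \<tau>)) * indicator {a..b} \<tau>"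
      proof (cases "\<tau> \<in> {a..b}")
        case True
        then have t: "\<tau> > 0" "\<tau> \<ge> a" "\<tau> < 1" using assms by auto
        have zt: "0 < zeta \<tau>" "zeta \<tau> \<le> zeta a" using t zeta_antimono[of a \<tau>] assms by (auto intro: zeta_pos)
        have "zeta \<tau> / \<tau>\<^sup>2 * sqrt (258 * real n * (\<tau> / zeta \<tau>)) = (zeta \<tau> / sqrt (zeta \<tau>)) * sqrt (258 * real n) * (sqrt \<tau> / \<tau>\<^sup>2)"
          by (simp add: real_sqrt_mult real_sqrt_divide mult_ac)
        also have "zeta \<tau> / sqrt (zeta \<tau>) = sqrt (zeta \<tau>)" using zt by (simp add: real_div_sqrt)
        also have "sqrt \<tau> / \<tau>\<^sup>2 = 1 / (\<tau> * sqrt \<tau>)"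
          using t real_sqrt_mult_self[of \<tau>] by (simp add: power2_eq_square field_simps)
        also have "sqrt (zeta \<tau>) * sqrt (258 * real n) * (1 / (\<tau> * sqrt \<tau>)) \<le> sqrt (zeta a) * sqrt (258 * real n) * (1 / (\<tau> * sqrt \<tau>))"
          using zt t by (intro mult_right_mono) auto
        also have "\<dots> = sqrt C / (\<tau> * sqrt \<tau>)" by (simp add: C_def real_sqrt_mult)
        finally show ?thesis using True by (simp add: ennreal_leI)
      qed simp
    qed
    also have "\<dots> \<le> ennreal (2 * sqrt C / sqrt a)" using assms C by (intro nn_integral_inverse_three_halves) auto
    finally show ?thesis .
  qed
  have eq: "2 * sqrt C / sqrt a = 2 * sqrt (258 * (real n * (zeta a / a)))"
    by (simp add: C_def real_sqrt_mult real_sqrt_divide)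
  have w: "0 \<le> zeta \<tau> / \<tau>\<^sup>2" if "\<tau> \<in> {a..b}" for \<tau>
    using that assms zeta_pos[of \<tau>] by simp
  show "measure (noise_law n) Bad \<le> 2 * sqrt (258 * (real n * (zeta a / a))) / c"
    unfolding Bad_def eq[symmetric] using assms C w
    by (intro noise_integral_Markov(1)[OF J zero _ _ v B]) auto
  show "Bad \<in> sets (noise_law n)"
    unfolding Bad_def using assms C w
    by (intro noise_integral_Markov(2)[OF J zero _ _ v B]) auto
qed

text \<open>Away from 0 the trivial bound 1 on the squared score is enough: the noise is of order
  sqrt n, while the allowance \<open>\<mu>' * s / ts\<close> is of order n / \<zeta>(s / n).\<close>

lemma noise_top:
  assumes "0 < a" "a \<le> 1" "c > 0"
  defines "Bad \<equiv> {\<omega>\<in>Rn n. ennreal c \<le> (\<integral>\<^sup>+\<tau>. ennreal (\<bar>null_noise J (shift n \<theta> \<omega>) \<tau>\<bar> * (1 / \<tau>)) * indicator {a..1} \<tau> \<partial>lborel)}"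
  shows "measure (noise_law n) Bad \<le> sqrt (real n) / a / c" "Bad \<in> sets (noise_law n)"
proof -
  have v: "card J * (\<integral>x. (score \<tau> x)\<^sup>2 \<partial>gauss) \<le> real n" if "\<tau> \<in> {a..1}" for \<tau>
  proof -
    have "(\<integral>x. (score \<tau> x)\<^sup>2 \<partial>gauss) \<le> (\<integral>x. 1 \<partial>gauss)"
      using abs_score_le[of \<tau>] by (intro integral_mono integrable_gauss_bounded[where B=1]) (auto simp: abs_square_le_1)
    then have "card J * (\<integral>x. (score \<tau> x)\<^sup>2 \<partial>gauss) \<le> real n * 1"
      using card_J_le by (intro mult_mono) auto
    then show ?thesis by simp
  qed
  have B: "(\<integral>\<^sup>+\<tau>. ennreal (1 / \<tau> * sqrt (real n)) * indicator {a..1} \<tau> \<partial>lborel) \<le> ennreal (sqrt (real n) / a)"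
  proof -
    have "(\<integral>\<^sup>+\<tau>. ennreal (1 / \<tau> * sqrt (real n)) * indicator {a..1} \<tau> \<partial>lborel) \<le> (\<integral>\<^sup>+\<tau>. ennreal (sqrt (real n) / a) * indicator {a..1} \<tau> \<partial>lborel)"
    proof (rule nn_integral_mono)
      fix \<tau>
      show "ennreal (1 / \<tau> * sqrt (real n)) * indicator {a..1} \<tau> \<le> ennreal (sqrt (real n) / a) * indicator {a..1} \<tau>"
        using assms by (auto intro!: ennreal_leI divide_left_mono split: split_indicator)
    qed
    also have "\<dots> = ennreal (sqrt (real n) / a * (1 - a))"
      using assms by (subst nn_integral_cmult_indicator) (auto simp: ennreal_mult'[symmetric])
    also have "\<dots> \<le> ennreal (sqrt (real n) / a)"
      using assms by (intro ennreal_leI mult_left_le) auto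
    finally show ?thesis .
  qed
  show "measure (noise_law n) Bad \<le> sqrt (real n) / a / c"
    unfolding Bad_def using assms
    by (intro noise_integral_Markov(1)[OF J zero _ _ v B]) auto
  show "Bad \<in> sets (noise_law n)"
    unfolding Bad_def using assms
    by (intro noise_integral_Markov(2)[OF J zero _ _ v B]) auto
qed

end

section \<open>The sparse regime\<close>

lemma measure_gauss_two_sided_shift:
  assumes "y > 0"
  shows "measure gauss {z. y \<le> \<bar>c + z\<bar>} = normal_tail (y - \<bar>c\<bar>) + normal_tail (y + \<bar>c\<bar>)"
proof -
  have "{z. y \<le> \<bar>c + z\<bar>} = {y - c..} \<union> ({..<- y - c} \<union> {- y - c})" using assms by auto
  moreover have "measure gauss ({y - c..} \<union> ({..<- y - c} \<union> {- y - c})) = measure gauss {y - c..} + measure gauss ({..<- y - c} \<union> {- y - c})"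
    using assms by (intro gauss.finite_measure_Union) auto
  moreover have "measure gauss ({..<- y - c} \<union> {- y - c}) = measure gauss {..<- y - c} + measure gauss {- y - c}"
    by (intro gauss.finite_measure_Union) auto
  ultimately have "measure gauss {z. y \<le> \<bar>c + z\<bar>} = normal_tail (y - c) + normal_tail (y + c)"
    by (simp add: measure_gauss_atLeast measure_gauss_lessThan add.commute[of y c])
  then show ?thesis by (cases "c \<ge> 0") simp_all
qed

locale sparse_regime =
  fixes b :: real and s :: "nat \<Rightarrow> nat"
  assumes s_range: "\<And>n. n \<ge> 1 \<Longrightarrow> 1 \<le> s n \<and> s n \<le> n"
    and s_infinity: "filterlim s at_top sequentially"
    and s_sparse: "(\<lambda>n. real (s n) / real n) \<longlonglongrightarrow> 0"
begin

text \<open>This is sqrt (2 log (n / s)), so the signals of \<open>sparse_class_eq\<close> have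
  modulus \<open>thr n + b\<close>.\<close>

definition thr :: "nat \<Rightarrow> real" where
  "thr n = zeta (real (s n) / real n)"

lemma ratio_pos: "n \<ge> 1 \<Longrightarrow> 0 < real (s n) / real n" and ratio_le_1: "n \<ge> 1 \<Longrightarrow> real (s n) / real n \<le> 1"
  using s_range[of n] by (auto simp: Suc_le_eq)

lemma thr_at_top: "filterlim thr at_top sequentially"
proof -
  have "filterlim (\<lambda>n. real (s n) / real n) (at_right 0) sequentially"
    unfolding filterlim_at
  proof (intro conjI s_sparse)
    show "\<forall>\<^sub>F n in sequentially. real (s n) / real n \<in> {0<..} \<and> real (s n) / real n \<noteq> 0"
      using eventually_ge_at_top[of 1]
    proof eventually_elim
      case (elim n)
      then have "0 < real (s n) / real n" by (rule ratio_pos)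
      then show ?case by (metis greaterThan_iff less_irrefl)
    qed
  qed
  from filterlim_compose[OF zeta_at_top this] show ?thesis by (simp add: thr_def[abs_def])
qed

lemma exp_thr: "n \<ge> 1 \<Longrightarrow> exp (- (thr n)\<^sup>2 / 2) = real (s n) / real n"
  unfolding thr_def by (intro exp_zeta ratio_pos ratio_le_1)

lemma eventually_thr: "eventually P at_top \<Longrightarrow> \<forall>\<^sub>F n in sequentially. P (thr n)"
  using eventually_compose_filterlim[OF _ thr_at_top] .

lemma real_s_at_top: "filterlim (\<lambda>n. real (s n)) at_top sequentially"
  by (rule filterlim_compose[OF filterlim_real_sequentially s_infinity])

lemma eventually_s: "eventually P at_top \<Longrightarrow> \<forall>\<^sub>F n in sequentially. P (real (s n))"
  using eventually_compose_filterlim[OF _ real_s_at_top] .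

lemma sparse_class_eqD:
  assumes "n \<ge> 1" "\<theta> \<in> sparse_class_eq n (s n) b"
  shows "card (support_set n \<theta>) = s n" "support_set n \<theta> \<subseteq> {..<n}"
    "i \<in> support_set n \<theta> \<Longrightarrow> \<bar>\<theta> i\<bar> = thr n + b" "i \<in> {..<n} - support_set n \<theta> \<Longrightarrow> \<theta> i = 0"
  using assms by (auto simp: sparse_class_eq_def support_set_def thr_def zeta_def)

text \<open>A signal exceeds y in modulus with probability
  \<open>normal_tail (y - (thr n + b))\<close> plus a vanishing wrong-sign term; by the Lipschitz
  bound this is within \<mu> / 2 of \<open>normal_tail (- b)\<close>, and Chebyshev's inequality
  does the rest. Admitting every y near \<open>thr n\<close> serves both the localization of the
  estimator and the rejection thresholds.\<close>

lemma signal_counts: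
  assumes "\<mu> > 0" "e > 0"
  shows "\<forall>\<^sub>F n in sequentially. \<forall>\<theta>\<in>sparse_class_eq n (s n) b. \<forall>y. \<bar>y - thr n\<bar> \<le> \<mu> / 4 \<longrightarrow>
    (\<exists>Bad\<in>sets (noise_law n). measure (noise_law n) Bad \<le> e \<and> (\<forall>\<omega>\<in>Rn n - Bad.
      \<bar>real (card {i\<in>support_set n \<theta>. y \<le> \<bar>\<theta> i + \<omega> i\<bar>}) - normal_tail (- b) * real (s n)\<bar> \<le> \<mu> * real (s n)))"
proof -
  have "filterlim (\<lambda>z. 2 * z + (b - \<mu> / 4)) at_top at_top" by real_asymp
  from filterlim_compose[OF normal_tail_tendsto_0 this]
  have "\<forall>\<^sub>F z in at_top. normal_tail (2 * z + (b - \<mu> / 4)) < \<mu> / 4"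
    using assms by (intro order_tendstoD(2)) auto
  from eventually_thr[OF this] have e1: "\<forall>\<^sub>F n in sequentially. normal_tail (2 * thr n + (b - \<mu> / 4)) < \<mu> / 4" .
  have e2: "\<forall>\<^sub>F n in sequentially. thr n > \<mu> + \<bar>b\<bar>" by (rule eventually_thr[OF eventually_gt_at_top])
  have e3: "\<forall>\<^sub>F n in sequentially. real (s n) \<ge> 4 / (\<mu>\<^sup>2 * e)" by (rule eventually_s[OF eventually_ge_at_top])
  show ?thesis
    using e1 e2 e3 eventually_ge_at_top[of 1]
  proof eventually_elim
    case (elim n)
    show ?case
    proof (intro ballI allI impI)
      fix \<theta> y assume \<theta>: "\<theta> \<in> sparse_class_eq n (s n) b" and y: "\<bar>y - thr n\<bar> \<le> \<mu> / 4"
      define J where "J = support_set n \<theta>"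
      define \<pi> where "\<pi> = normal_tail (y - (thr n + b)) + normal_tail (y + (thr n + b))"
      note D = sparse_class_eqD[OF elim(4) \<theta>]
      have sn: "real (s n) > 0" using s_range[OF elim(4)] by simp
      have y0: "y > 0" using y elim(2) assms unfolding abs_le_iff by linarith
      have m: "measure gauss {z. y \<le> \<bar>\<theta> i + z\<bar>} = \<pi>" if "i \<in> J" for i
        using that D(3)[of i] by (simp add: measure_gauss_two_sided_shift[OF y0] \<pi>_def J_def)
      then have sum: "(\<Sum>i\<in>J. measure gauss {z. y \<le> \<bar>\<theta> i + z\<bar>}) = real (s n) * \<pi>"
        using D(1) by (simp add: J_def)
      have "\<pi> \<le> 1"
      proof -
        have "J \<noteq> {}" using D(1) sn by (auto simp: J_def)
        then obtain i where "i \<in> J" by auto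
        from m[OF this] show ?thesis using gauss.prob_le_1 by metis
      qed
      have "normal_tail (y + (thr n + b)) \<le> normal_tail (2 * thr n + (b - \<mu> / 4))"
        using y unfolding abs_le_iff by (intro normal_tail_antimono) linarith
      then have t2: "normal_tail (y + (thr n + b)) \<le> \<mu> / 4" using elim by simp
      have "\<bar>normal_tail (y - (thr n + b)) - normal_tail (- b)\<bar> \<le> \<bar>y - thr n\<bar>"
        using normal_tail_lipschitz[of "y - (thr n + b)" "- b"] by simp
      then have \<pi>: "\<bar>\<pi> - normal_tail (- b)\<bar> \<le> \<mu> / 2"
        using y t2 normal_tail_nonneg[of "y + (thr n + b)"] unfolding \<pi>_def by linarith
      define Bad where "Bad = {\<omega>\<in>Rn n. \<mu> / 2 * real (s n) \<le> \<bar>real (card {i\<in>J. y \<le> \<bar>\<theta> i + \<omega> i\<bar>}) - (\<Sum>i\<in>J. measure gauss {z. y \<le> \<bar>\<theta> i + z\<bar>})\<bar>}"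
      have a: "\<mu> / 2 * real (s n) > 0" using assms sn by simp
      have J: "J \<subseteq> {..<n}" using D(2) by (simp add: J_def)
      have "measure (noise_law n) Bad \<le> (\<Sum>i\<in>J. measure gauss {z. y \<le> \<bar>\<theta> i + z\<bar>}) / (\<mu> / 2 * real (s n))\<^sup>2"
        unfolding Bad_def by (rule count_concentration(1)[OF J a])
      also have "\<dots> \<le> real (s n) * 1 / (\<mu> / 2 * real (s n))\<^sup>2"
        unfolding sum using \<open>\<pi> \<le> 1\<close> by (intro divide_right_mono mult_left_mono) auto
      also have "\<dots> = 4 / (\<mu>\<^sup>2 * real (s n))"
        using sn assms by (simp add: power2_eq_square field_simps)
      also have "\<dots> \<le> e"
        using elim(3) sn assms by (simp add: field_simps)
      finally have P: "measure (noise_law n) Bad \<le> e" .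
      have S: "Bad \<in> sets (noise_law n)" unfolding Bad_def by (rule count_concentration(2)[OF J a])
      show "\<exists>Bad\<in>sets (noise_law n). measure (noise_law n) Bad \<le> e \<and> (\<forall>\<omega>\<in>Rn n - Bad.
          \<bar>real (card {i\<in>support_set n \<theta>. y \<le> \<bar>\<theta> i + \<omega> i\<bar>}) - normal_tail (- b) * real (s n)\<bar> \<le> \<mu> * real (s n))"
      proof (intro bexI[OF _ S] conjI P ballI)
        fix \<omega> assume "\<omega> \<in> Rn n - Bad"
        then have "\<bar>real (card {i\<in>J. y \<le> \<bar>\<theta> i + \<omega> i\<bar>}) - real (s n) * \<pi>\<bar> \<le> \<mu> / 2 * real (s n)"
          unfolding Bad_def sum by (simp add: not_le less_imp_le)
        moreover have "\<bar>real (s n) * (\<pi> - normal_tail (- b))\<bar> \<le> real (s n) * (\<mu> / 2)"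
          unfolding abs_mult using \<pi> by (intro mult_mono) auto
        moreover have "real (card {i\<in>J. y \<le> \<bar>\<theta> i + \<omega> i\<bar>}) - normal_tail (- b) * real (s n)
            = real (card {i\<in>J. y \<le> \<bar>\<theta> i + \<omega> i\<bar>}) - real (s n) * \<pi> + real (s n) * (\<pi> - normal_tail (- b))"
          by (simp add: right_diff_distrib)
        moreover have "real (s n) * (\<mu> / 2) + real (s n) * (\<mu> / 2) = \<mu> * real (s n)" "\<mu> / 2 * real (s n) = real (s n) * (\<mu> / 2)"
          by simp_all
        ultimately show "\<bar>real (card {i\<in>support_set n \<theta>. y \<le> \<bar>\<theta> i + \<omega> i\<bar>}) - normal_tail (- b) * real (s n)\<bar> \<le> \<mu> * real (s n)"
          unfolding J_def[symmetric] by linarith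
      qed
    qed
  qed
qed

text \<open>The level means 2 \<open>normal_tail y\<close> = \<kappa> p s / n. The n - s nulls then
  have \<kappa> p s (1 - s / n) expected exceedances, and sparsity removes the last factor.\<close>

lemma null_counts:
  assumes "\<kappa> > 0" "\<mu> > 0" "e > 0"
  shows "\<forall>\<^sub>F n in sequentially. \<forall>\<theta>\<in>sparse_class_eq n (s n) b. \<forall>y.
    normal_tail y = \<kappa> * (normal_tail (- b) * exp (- (thr n)\<^sup>2 / 2) / 2) \<longrightarrow>
    (\<exists>Bad\<in>sets (noise_law n). measure (noise_law n) Bad \<le> e \<and> (\<forall>\<omega>\<in>Rn n - Bad.
      \<bar>real (card {i\<in>{..<n} - support_set n \<theta>. y \<le> \<bar>\<theta> i + \<omega> i\<bar>}) - \<kappa> * normal_tail (- b) * real (s n)\<bar> \<le> \<mu> * real (s n)))"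
proof -
  define p where "p = normal_tail (- b)"
  have p: "0 < p" "p \<le> 1" using normal_tail_pos by (auto simp: p_def)
  have e1: "\<forall>\<^sub>F n in sequentially. \<forall>y. normal_tail y = \<kappa> * (p * exp (- (thr n)\<^sup>2 / 2) / 2) \<longrightarrow> thr n - 1 \<le> y \<and> y \<le> thr n + 1"
    unfolding p_def by (rule eventually_thr[OF quantile_near_threshold[OF assms(1) zero_less_one]])
  have e2: "\<forall>\<^sub>F n in sequentially. thr n > 1" by (rule eventually_thr[OF eventually_gt_at_top])
  have e3: "\<forall>\<^sub>F n in sequentially. real (s n) \<ge> 4 * \<kappa> / (\<mu>\<^sup>2 * e)" by (rule eventually_s[OF eventually_ge_at_top])
  have e4: "\<forall>\<^sub>F n in sequentially. real (s n) / real n < \<mu> / (2 * \<kappa>)"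
    using assms by (intro order_tendstoD(2)[OF s_sparse]) auto
  show ?thesis
    using e1 e2 e3 e4 eventually_ge_at_top[of 1]
  proof eventually_elim
    case (elim n)
    show ?case unfolding p_def[symmetric]
    proof (intro ballI allI impI)
      fix \<theta> y assume \<theta>: "\<theta> \<in> sparse_class_eq n (s n) b" and y: "normal_tail y = \<kappa> * (p * exp (- (thr n)\<^sup>2 / 2) / 2)"
      define J where "J = {..<n} - support_set n \<theta>"
      note D = sparse_class_eqD[OF elim(5) \<theta>]
      have sn: "real (s n) > 0" "real n > 0" "s n \<le> n" using s_range[OF elim(5)] elim(5) by auto
      have y0: "y > 0" using elim(1,2) y by fastforce
      have cJ: "real (card J) = real n - real (s n)"
      proof -
        have "card J = n - s n" using D(1,2) by (simp add: J_def card_Diff_subset finite_subset[OF D(2)])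
        then show ?thesis using sn by (simp add: of_nat_diff)
      qed
      have nt: "2 * normal_tail y = \<kappa> * p * (real (s n) / real n)"
        using y exp_thr[OF elim(5)] by simp
      have "measure gauss {z. y \<le> \<bar>\<theta> i + z\<bar>} = 2 * normal_tail y" if "i \<in> J" for i
        using that D(4)[of i] y0 by (simp add: measure_gauss_two_sided J_def)
      then have "(\<Sum>i\<in>J. measure gauss {z. y \<le> \<bar>\<theta> i + z\<bar>}) = real (card J) * (2 * normal_tail y)" by simp
      also have "\<dots> = \<kappa> * p * real (s n) * (1 - real (s n) / real n)"
        unfolding cJ nt using sn by (simp add: field_simps)
      finally have sum: "(\<Sum>i\<in>J. measure gauss {z. y \<le> \<bar>\<theta> i + z\<bar>}) = \<kappa> * p * real (s n) * (1 - real (s n) / real n)" .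
      define S where "S = (\<Sum>i\<in>J. measure gauss {z. y \<le> \<bar>\<theta> i + z\<bar>})"
      have kp: "0 < \<kappa> * p" "\<kappa> * p \<le> \<kappa>" using assms p by (auto simp: mult_left_le)
      have S1: "S \<le> \<kappa> * real (s n)"
      proof -
        have "\<kappa> * p * real (s n) * (1 - real (s n) / real n) \<le> \<kappa> * p * real (s n) * 1"
          using kp sn by (intro mult_left_mono) auto
        also have "\<dots> \<le> \<kappa> * real (s n)" using mult_right_mono[OF kp(2), of "real (s n)"] by simp
        finally show ?thesis by (simp add: S_def sum)
      qed
      have S2: "\<bar>S - \<kappa> * p * real (s n)\<bar> \<le> \<mu> / 2 * real (s n)"
      proof -
        have "\<kappa> * p * (real (s n) / real n) \<le> \<kappa> * (\<mu> / (2 * \<kappa>))"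
          using kp elim(4) assms sn by (intro mult_mono) auto
        then have "\<kappa> * p * (real (s n) / real n) \<le> \<mu> / 2" using assms by simp
        then have "\<kappa> * p * (real (s n) / real n) * real (s n) \<le> \<mu> / 2 * real (s n)" using sn by (intro mult_right_mono) auto
        moreover have "S - \<kappa> * p * real (s n) = - (\<kappa> * p * (real (s n) / real n) * real (s n))"
          unfolding S_def sum by (simp only: right_diff_distrib mult_1_right mult.assoc mult.commute mult.left_commute)
        moreover have "0 \<le> \<kappa> * p * (real (s n) / real n) * real (s n)" using kp p assms sn by (intro mult_nonneg_nonneg) auto
        ultimately show ?thesis by linarith
      qed
      define Bad where "Bad = {\<omega>\<in>Rn n. \<mu> / 2 * real (s n) \<le> \<bar>real (card {i\<in>J. y \<le> \<bar>\<theta> i + \<omega> i\<bar>}) - S\<bar>}"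
      have a: "\<mu> / 2 * real (s n) > 0" using assms sn by simp
      have J: "J \<subseteq> {..<n}" by (auto simp: J_def)
      have "measure (noise_law n) Bad \<le> S / (\<mu> / 2 * real (s n))\<^sup>2"
        unfolding Bad_def S_def by (rule count_concentration(1)[OF J a])
      also have "\<dots> \<le> \<kappa> * real (s n) / (\<mu> / 2 * real (s n))\<^sup>2"
        using S1 by (intro divide_right_mono) auto
      also have "\<dots> = 4 * \<kappa> / (\<mu>\<^sup>2 * real (s n))"
        using sn assms by (simp add: power2_eq_square field_simps)
      also have "\<dots> \<le> e"
        using elim(3) sn assms by (simp add: field_simps)
      finally have P: "measure (noise_law n) Bad \<le> e" .
      have Sm: "Bad \<in> sets (noise_law n)" unfolding Bad_def S_def by (rule count_concentration(2)[OF J a])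
      show "\<exists>Bad\<in>sets (noise_law n). measure (noise_law n) Bad \<le> e \<and> (\<forall>\<omega>\<in>Rn n - Bad.
          \<bar>real (card {i\<in>{..<n} - support_set n \<theta>. y \<le> \<bar>\<theta> i + \<omega> i\<bar>}) - \<kappa> * p * real (s n)\<bar> \<le> \<mu> * real (s n))"
      proof (intro bexI[OF _ Sm] conjI P ballI)
        fix \<omega> assume "\<omega> \<in> Rn n - Bad"
        then have "\<bar>real (card {i\<in>J. y \<le> \<bar>\<theta> i + \<omega> i\<bar>}) - S\<bar> \<le> \<mu> / 2 * real (s n)"
          unfolding Bad_def by (simp add: not_le less_imp_le)
        with S2 show "\<bar>real (card {i\<in>{..<n} - support_set n \<theta>. y \<le> \<bar>\<theta> i + \<omega> i\<bar>}) - \<kappa> * p * real (s n)\<bar> \<le> \<mu> * real (s n)"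
          unfolding J_def[symmetric] by linarith
      qed
    qed
  qed
qed

end

section \<open>Consistency of the estimator relative to the target\<close>

context sparse_regime
begin

lemma target_thr: "n \<ge> 1 \<Longrightarrow> target b (thr n) = normal_tail (- b) / (2 * c0) * thr n * (real (s n) / real n)"
  using exp_thr[of n] by (simp add: target_def)

text \<open>The constants of \<open>good_event\<close> are fixed before n grows, in the order
  \<gamma>, K, \<mu>, u, \<delta>, \<eta>, t0, \<mu>'. Five exceptional sets of probability at most
  e / 5 are excluded: three for the noise, two for the signal counts just above and just below the
  threshold.\<close>

lemma mmle_near_target:
  assumes "\<forall>n\<ge>1. is_mmle n (T n)" and \<epsilon>: "0 < \<epsilon>" "\<epsilon> < 1" and e: "e > 0"
  shows "\<forall>\<^sub>F n in sequentially. \<forall>\<theta>\<in>sparse_class_eq n (s n) b.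
    \<exists>Bad\<in>sets (noise_law n). measure (noise_law n) Bad \<le> e \<and> (\<forall>\<omega>\<in>Rn n - Bad.
      T n (shift n \<theta> \<omega>) \<in> {(1 - \<epsilon>) * target b (thr n)..(1 + \<epsilon>) * target b (thr n)})"
proof -
  have T: "is_mmle n (T n)" if "n \<ge> 1" for n using assms that by blast
  define p where "p = normal_tail (- b)"
  have p: "0 < p" "p \<le> 1" using normal_tail_pos by (auto simp: p_def)
  define \<gamma> where "\<gamma> = min (min (- ln (1 - \<epsilon>) - \<epsilon>) (\<epsilon> - ln (1 + \<epsilon>))) 1"
  have \<gamma>: "\<gamma> > 0"
  proof -
    have "ln (1 + - \<epsilon>) < - \<epsilon>" using ln_diff_less[of "1 - \<epsilon>" 1] \<epsilon> by simp
    moreover have "ln (1 + \<epsilon>) < \<epsilon>" using \<epsilon> by (intro ln_add_one_self_less_self) auto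
    ultimately show ?thesis by (simp add: \<gamma>_def)
  qed
  have "((\<lambda>x::real. ln x / (x - 1)) \<longlongrightarrow> 0) at_top" by real_asymp
  then have "\<forall>\<^sub>F x::real in at_top. ln x / (x - 1) < p / 4" using p by (intro order_tendstoD(2)) auto
  then obtain X0 where X0: "\<And>x. x \<ge> X0 \<Longrightarrow> ln x / (x - 1) < p / 4" by (auto simp: eventually_at_top_linorder)
  \<comment> \<open>Beyond X0 the logarithm is below p / 4 * (x - 1); the term exp 2 ensures ln K -
    1 \<ge> 1 \<ge> \<gamma>.\<close>
  define K where "K = max (max 2 X0) (exp 2)"
  have K: "K \<ge> 2" "K \<ge> X0" "K \<ge> exp 2" by (auto simp: K_def)
  have lnK: "ln K \<ge> 2" using K by (simp add: ln_ge_iff)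
  have K_ln: "ln x \<le> p / 4 * (x - 1)" if "x \<ge> K" for x
    using X0[of x] that K by (simp add: pos_divide_less_eq)
  define D1 D2 where "D1 = (p + 1) * ln K + 3" and "D2 = 2 * ln K + K"
  have D: "D1 > 0" "D2 > 0" using p lnK K by (auto simp: D1_def D2_def intro!: add_nonneg_pos mult_nonneg_nonneg)
  \<comment> \<open>D1 and D2 are the coefficients of \<mu> in the two margin conditions of
    \<open>good_event\<close>; at most half of the margin p \<gamma> is spent on each.\<close>
  define \<mu> where "\<mu> = min (min (p / 4) 1) (min (p * \<gamma> / (2 * D1)) (p * \<gamma> / (2 * D2)))"
  have \<mu>: "0 < \<mu>" "\<mu> \<le> p / 4" "\<mu> \<le> 1" "\<mu> * D1 < p * \<gamma>" "\<mu> * D2 < p * \<gamma>"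
  proof -
    have pg: "0 < p * \<gamma>" using p \<gamma> by simp
    show "0 < \<mu>" "\<mu> \<le> p / 4" "\<mu> \<le> 1" using p pg D by (auto simp: \<mu>_def)
    have "\<mu> * D1 \<le> p * \<gamma> / (2 * D1) * D1" using D by (intro mult_right_mono) (auto simp: \<mu>_def)
    then show "\<mu> * D1 < p * \<gamma>" using D pg by simp
    have "\<mu> * D2 \<le> p * \<gamma> / (2 * D2) * D2" using D by (intro mult_right_mono) (auto simp: \<mu>_def)
    then show "\<mu> * D2 < p * \<gamma>" using D pg by simp
  qed
  \<comment> \<open>A common relative error: \<delta>, the noise and the sparsity each cost a share
    u, and the total 3 u p = 3 \<mu> / 4 stays below \<mu>.\<close>
  define u where "u = \<mu> / (4 * p)"
  have u: "0 < u" "u \<le> 1/16" "u * p = \<mu> / 4" using \<mu> p by (auto simp: u_def field_simps)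
  define \<delta> where "\<delta> = 2 * c0 * u"
  define d where "d = 2 * c0 - \<delta>"
  have d_eq: "d = 2 * c0 * (1 - u)" by (simp add: d_def \<delta>_def algebra_simps)
  have d: "d > 0" "\<delta> > 0" "\<delta> < 2 * c0" using u c0_pos by (auto simp: d_eq \<delta>_def)
  \<comment> \<open>Makes the noise fraction in \<open>null_change\<close> equal to u.\<close>
  define \<eta> where "\<eta> = \<epsilon> * d * u / 4"
  have \<eta>: "\<eta> > 0" "4 * \<eta> / (\<epsilon> * (2 * c0 - \<delta>)) = u"
    using \<epsilon> d u by (auto simp: \<eta>_def d_def[symmetric])
  obtain t1 where t1: "t1 > 0" "\<And>\<tau>. 0 < \<tau> \<Longrightarrow> \<tau> < t1 \<Longrightarrow> null_drift \<tau> \<le> (2 * c0 + \<delta>) * (\<tau> / zeta \<tau>) \<and> null_drift \<tau> \<ge> (2 * c0 - \<delta>) * (\<tau> / zeta \<tau>)"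
    using eventually_conj[OF null_drift_upper[OF d(2)] null_drift_lower[OF d(2)]]
    unfolding eventually_at_right_field by auto
  define t0 where "t0 = min (t1 / 2) (1 / 8)"
  have t0: "0 < t0" "t0 < t1" "t0 \<le> 1/8" using t1 by (auto simp: t0_def)
  \<comment> \<open>Multiplied by ts, the condition \<open>top\<close> becomes \<mu>' < p / 2 * t0
    in the limit; half of the right side is taken.\<close>
  define \<mu>' where "\<mu>' = p * t0 / 4"
  have \<mu>': "\<mu>' > 0" using p t0 by (simp add: \<mu>'_def)
  \<comment> \<open>With z = \<open>thr n\<close>, the quantity n ts / \<zeta>(ts) is s times g z.
    The limit p / (2 c0) expresses the balance between null drift and detectable signals.\<close>
  define g where "g z = p / (2 * c0) * (z / zeta (target b z))" for z
  have lg: "(g \<longlongrightarrow> p / (2 * c0)) at_top"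
  proof -
    have "((\<lambda>z. p / (2 * c0) * inverse (zeta (target b z) / z)) \<longlongrightarrow> p / (2 * c0) * inverse 1) at_top"
      by (intro tendsto_intros zeta_target) auto
    then show ?thesis by (simp add: g_def[abs_def])
  qed
  have p2: "0 < p / (2 * c0)" using p c0_pos by simp
  have E1: "\<forall>\<^sub>F n in sequentially. \<forall>\<tau>\<in>{target b (thr n) / K..target b (thr n)}. \<forall>x. \<bar>x\<bar> \<ge> thr n + \<mu> / 4 \<longrightarrow> 1 - \<mu> \<le> score \<tau> x"
    using K \<mu> by (intro eventually_thr[OF score_above_threshold]) auto
  have E2: "\<forall>\<^sub>F n in sequentially. \<forall>\<tau>\<in>{0<..K * target b (thr n)}. \<forall>x. \<bar>x\<bar> \<le> thr n - \<mu> / 4 \<longrightarrow> score \<tau> x \<le> \<mu>"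
    using K \<mu> by (intro eventually_thr[OF score_below_threshold]) auto
  have tgt: "filterlim (\<lambda>n. target b (thr n)) (at_right 0) sequentially"
    by (rule filterlim_compose[OF target_at_right thr_at_top])
  then have tgt0: "(\<lambda>n. target b (thr n)) \<longlonglongrightarrow> 0" by (simp add: filterlim_at)
  have E3: "\<forall>\<^sub>F n in sequentially. target b (thr n) < min (t0 / K) (\<mu> / 8)"
    using t0 K \<mu> by (intro order_tendstoD(2)[OF tgt0]) auto
  have E4: "\<forall>\<^sub>F n in sequentially. (2 * c0 + \<delta>) * g (thr n) < p + \<mu>"
  proof (rule eventually_thr, rule order_tendstoD(2))
    show "((\<lambda>z. (2 * c0 + \<delta>) * g z) \<longlongrightarrow> (2 * c0 + \<delta>) * (p / (2 * c0))) at_top" by (intro tendsto_intros lg)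
    have "(2 * c0 + \<delta>) * (p / (2 * c0)) = p + u * p" using c0_pos by (simp add: \<delta>_def field_simps)
    then show "(2 * c0 + \<delta>) * (p / (2 * c0)) < p + \<mu>" using u \<mu> by simp
  qed
  have E5: "\<forall>\<^sub>F n in sequentially. (1 - 2 * u) * (d * g (thr n)) > p - \<mu>"
  proof (rule eventually_thr, rule order_tendstoD(1))
    show "((\<lambda>z. (1 - 2 * u) * (d * g z)) \<longlongrightarrow> (1 - 2 * u) * (d * (p / (2 * c0)))) at_top" by (intro tendsto_intros lg)
    have "d * (p / (2 * c0)) = (1 - u) * p" using c0_pos by (simp add: d_eq)
    then have "(1 - 2 * u) * (d * (p / (2 * c0))) = p - 3 * (u * p) + 2 * u * (u * p)" by (simp only:) (simp add: algebra_simps)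
    moreover have "0 < 2 * u * (u * p)" using u p by simp
    ultimately show "(1 - 2 * u) * (d * (p / (2 * c0))) > p - \<mu>" using u(3) \<mu>(1) by linarith
  qed
  have E6: "\<forall>\<^sub>F n in sequentially. g (thr n) < p / c0"
    using p2 p c0_pos by (intro eventually_thr[OF order_tendstoD(2)[OF lg]]) (auto simp: field_simps)
  have E7: "\<forall>\<^sub>F n in sequentially. g (thr n) > p / (4 * c0)"
    using p2 p c0_pos by (intro eventually_thr[OF order_tendstoD(1)[OF lg]]) (auto simp: field_simps)
  have E8: "\<forall>\<^sub>F n in sequentially. \<mu>' + target b (thr n) * ln (1 / target b (thr n)) < p / 2 * (t0 - target b (thr n))"
  proof -
    have "((\<lambda>x::real. x * ln (1 / x)) \<longlongrightarrow> 0) (at_right 0)" by real_asymp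
    from filterlim_compose[OF this tgt]
    have "(\<lambda>n. p / 2 * (t0 - target b (thr n)) - target b (thr n) * ln (1 / target b (thr n))) \<longlonglongrightarrow> p / 2 * (t0 - 0) - 0"
      by (intro tendsto_intros tgt0)
    then have "\<forall>\<^sub>F n in sequentially. p / 2 * (t0 - target b (thr n)) - target b (thr n) * ln (1 / target b (thr n)) > \<mu>'"
      using p t0 by (intro order_tendstoD(1)) (auto simp: \<mu>'_def)
    then show ?thesis by eventually_elim simp
  qed
  have E9: "\<forall>\<^sub>F n in sequentially. thr n \<ge> 1" by (rule eventually_thr[OF eventually_ge_at_top])
  have E10: "\<forall>\<^sub>F n in sequentially. real (s n) / real n < u" using u by (intro order_tendstoD(2)[OF s_sparse])
  \<comment> \<open>Puts the target above 1 / n, so that it is an admissible competitor of the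
    estimator.\<close>
  have E11: "\<forall>\<^sub>F n in sequentially. real (s n) \<ge> 1 / (p / (2 * c0))" by (rule eventually_s[OF eventually_ge_at_top])
  have E12: "\<forall>\<^sub>F n in sequentially. 2 * sqrt (258 * (real (s n) * (p / c0))) / (\<mu> * real (s n)) < e / 5"
  proof (rule eventually_s, rule order_tendstoD(2))
    show "((\<lambda>x. 2 * sqrt (258 * (x * (p / c0))) / (\<mu> * x)) \<longlongrightarrow> 0) at_top"
      using p c0_pos \<mu> by real_asymp
  qed (use e in simp)
  have E13: "\<forall>\<^sub>F n in sequentially. 2 * sqrt (258 * (4 * c0 / p / real (s n))) / \<eta> < e / 5"
  proof (rule eventually_s, rule order_tendstoD(2))
    show "((\<lambda>x. 2 * sqrt (258 * (4 * c0 / p / x)) / \<eta>) \<longlongrightarrow> 0) at_top"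
      using p c0_pos \<eta> by real_asymp
  qed (use e in simp)
  have E14: "\<forall>\<^sub>F n in sequentially. p / (2 * c0) * sqrt (2 / real (s n)) / (t0 * \<mu>') < e / 5"
  proof (rule eventually_s, rule order_tendstoD(2))
    show "((\<lambda>x. p / (2 * c0) * sqrt (2 / x) / (t0 * \<mu>')) \<longlongrightarrow> 0) at_top"
      using p c0_pos t0 \<mu>' by real_asymp
  qed (use e in simp)
  have e5: "e / 5 > 0" using e by simp
  show ?thesis
    using E1 E2 E3 E4 E5 E6 E7 E8 E9 E10 E11 E12 E13 E14 signal_counts[OF \<mu>(1) e5] eventually_ge_at_top[of 1]
  proof eventually_elim
    case (elim n)
    note n1 = elim(16)
    show ?case
    proof
      fix \<theta> assume \<theta>: "\<theta> \<in> sparse_class_eq n (s n) b"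
      note CD = sparse_class_eqD[OF n1 \<theta>]
      define sr nr ts z where "sr = real (s n)" and "nr = real n" and "ts = target b (thr n)" and "z = thr n"
      define I1 I0 where "I1 = support_set n \<theta>" and "I0 = {..<n} - I1"
      have sr: "sr > 0" "nr > 0" "sr \<le> nr" using s_range[OF n1] n1 by (auto simp: sr_def nr_def)
      have z1: "z \<ge> 1" using elim(9) by (simp add: z_def)
      have ts: "ts > 0" unfolding ts_def using z1 by (intro target_pos) (simp add: z_def)
      have ts_eq: "nr * ts = sr * (p / (2 * c0) * z)"
        using sr by (simp add: ts_def target_thr[OF n1] p_def sr_def nr_def z_def)
      have tsK: "ts < t0 / K" "ts < \<mu> / 8" using elim(3) by (auto simp: ts_def)
      have tsK': "K * ts \<le> t0" using tsK(1) K by (simp add: pos_less_divide_eq mult.commute)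
      have tst0: "ts \<le> t0"
      proof -
        have "1 * ts \<le> K * ts" using K ts by (intro mult_right_mono) auto
        with tsK' show ?thesis by linarith
      qed
      have zs: "zeta ts > 0" using ts tst0 t0 by (intro zeta_pos) auto
      define G where "G = g z"
      have G: "nr * (ts / zeta ts) = sr * G" "G > 0"
      proof -
        have "nr * (ts / zeta ts) = (nr * ts) / zeta ts" by simp
        also have "\<dots> = sr * G" unfolding ts_eq by (simp add: G_def g_def ts_def z_def)
        finally show "nr * (ts / zeta ts) = sr * G" .
        show "G > 0" using z1 zs p2 by (simp add: G_def g_def z_def[symmetric] ts_def[symmetric] zero_less_mult_iff)
             (use p c0_pos in \<open>auto simp: ts_def z_def\<close>)
      qed
      have cI0: "real (card I0) = nr - sr"
      proof -
        have "card I0 = n - s n" using CD(1,2) by (simp add: I0_def I1_def card_Diff_subset finite_subset[OF CD(2)])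
        then show ?thesis using s_range[OF n1] by (simp add: nr_def sr_def of_nat_diff)
      qed
      have J: "I0 \<subseteq> {..<n}" by (auto simp: I0_def)
      have zero: "\<theta> i = 0" if "i \<in> I0" for i using CD(4) that by (simp add: I0_def I1_def)
      have lo: "1 / nr \<le> ts"
      proof -
        have "1 \<le> sr * (p / (2 * c0))" using elim(11)[unfolded pos_divide_le_eq[OF p2]] by (simp only: sr_def)
        also have "\<dots> \<le> sr * (p / (2 * c0) * z)"
          using z1 p2 sr by (intro mult_left_mono) (simp_all only: mult_le_cancel_left1, auto)
        finally have "1 \<le> nr * ts" by (simp add: ts_eq)
        then show ?thesis using sr by (simp add: divide_le_eq mult.commute)
      qed
      define c0' c1' c2' where "c0' = \<mu> * sr" and "c1' = \<eta> * nr" and "c2' = \<mu>' * sr / ts"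
      have c': "c0' > 0" "c1' > 0" "c2' > 0" using \<mu> \<eta> \<mu>' sr ts by (auto simp: c0'_def c1'_def c2'_def)
      define B0 where "B0 = {\<omega>\<in>Rn n. ennreal c0' \<le> (\<integral>\<^sup>+\<tau>. ennreal (\<bar>null_noise I0 (shift n \<theta> \<omega>) \<tau>\<bar> * (1 / \<tau>)) * indicator {1 / nr..ts} \<tau> \<partial>lborel)}"
      define B1 where "B1 = {\<omega>\<in>Rn n. ennreal c1' \<le> (\<integral>\<^sup>+\<tau>. ennreal (\<bar>null_noise I0 (shift n \<theta> \<omega>) \<tau>\<bar> * (zeta \<tau> / \<tau>\<^sup>2)) * indicator {ts..t0} \<tau> \<partial>lborel)}"
      define B2 where "B2 = {\<omega>\<in>Rn n. ennreal c2' \<le> (\<integral>\<^sup>+\<tau>. ennreal (\<bar>null_noise I0 (shift n \<theta> \<omega>) \<tau>\<bar> * (1 / \<tau>)) * indicator {t0..1} \<tau> \<partial>lborel)}"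
      have P0: "measure (noise_law n) B0 \<le> e / 5" "B0 \<in> sets (noise_law n)"
      proof -
        have "measure (noise_law n) B0 \<le> 2 * sqrt (258 * (real n * (ts / zeta ts))) / c0'"
          unfolding B0_def using sr lo tst0 t0 c' by (intro noise_low(1)[OF J zero]) auto
        also have "\<dots> = 2 * sqrt (258 * (sr * G)) / (\<mu> * sr)" using G by (simp add: nr_def c0'_def)
        also have "\<dots> \<le> 2 * sqrt (258 * (sr * (p / c0))) / (\<mu> * sr)"
          using elim(6) sr \<mu> by (intro divide_right_mono mult_left_mono real_sqrt_le_mono) (auto simp: G_def z_def)
        also have "\<dots> \<le> e / 5" using elim(12) by (simp add: sr_def)
        finally show "measure (noise_law n) B0 \<le> e / 5" .
        show "B0 \<in> sets (noise_law n)"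
          unfolding B0_def using sr lo tst0 t0 c' by (intro noise_low(2)[OF J zero]) auto
      qed
      have P1: "measure (noise_law n) B1 \<le> e / 5" "B1 \<in> sets (noise_law n)"
      proof -
        have "measure (noise_law n) B1 \<le> 2 * sqrt (258 * (real n * (zeta ts / ts))) / c1'"
          unfolding B1_def using ts tst0 t0 c' by (intro noise_high(1)[OF J zero]) auto
        also have "real n * (zeta ts / ts) = nr\<^sup>2 / (sr * G)"
          unfolding G(1)[symmetric] using zs ts sr by (simp add: nr_def power2_eq_square)
        also have "2 * sqrt (258 * (nr\<^sup>2 / (sr * G))) / c1' = 2 * sqrt (258 * (1 / (sr * G))) / \<eta>"
          using sr \<eta> by (simp add: c1'_def real_sqrt_mult real_sqrt_divide)
        also have "\<dots> \<le> 2 * sqrt (258 * (4 * c0 / p / sr)) / \<eta>"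
        proof -
          have "sr * (p / (4 * c0)) \<le> sr * G" using elim(7) sr by (intro mult_left_mono) (auto simp: G_def z_def)
          then have "1 / (sr * G) \<le> 1 / (sr * (p / (4 * c0)))"
            using sr p c0_pos G by (intro divide_left_mono) auto
          also have "\<dots> = 4 * c0 / p / sr" by simp
          finally show ?thesis using \<eta> by (intro divide_right_mono mult_left_mono real_sqrt_le_mono) auto
        qed
        also have "\<dots> \<le> e / 5" using elim(13) by (simp add: sr_def)
        finally show "measure (noise_law n) B1 \<le> e / 5" .
        show "B1 \<in> sets (noise_law n)"
          unfolding B1_def using ts tst0 t0 c' by (intro noise_high(2)[OF J zero]) auto
      qed
      have P2: "measure (noise_law n) B2 \<le> e / 5" "B2 \<in> sets (noise_law n)"
      proof -
        have "measure (noise_law n) B2 \<le> sqrt (real n) / t0 / c2'"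
          unfolding B2_def using t0 c' by (intro noise_top(1)[OF J zero]) auto
        also have "\<dots> = sqrt nr * ts / (sr * (t0 * \<mu>'))"
          using ts by (simp add: c2'_def nr_def)
        also have "sqrt nr * ts = sr * (p / (2 * c0)) * (z / sqrt nr)"
        proof -
          have "nr = sqrt nr * sqrt nr" using sr by simp
          then have h: "sqrt nr * (sqrt nr * ts) = sr * (p / (2 * c0) * z)" using ts_eq by (metis mult.assoc)
          have "sqrt nr * ts = sr * (p / (2 * c0) * z) / sqrt nr" unfolding h[symmetric] using sr by simp
          then show ?thesis by simp
        qed
        also have "sr * (p / (2 * c0)) * (z / sqrt nr) / (sr * (t0 * \<mu>')) = p / (2 * c0) * (z / sqrt nr) / (t0 * \<mu>')"
          using sr by simp
        also have "\<dots> \<le> p / (2 * c0) * sqrt (2 / sr) / (t0 * \<mu>')"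
        proof -
          \<comment> \<open>The crude bound of the logarithm is enough: it yields z / sqrt n \<le>
            sqrt (2 / s), which tends to 0.\<close>
          have "ln (nr / sr) \<le> nr / sr" using sr ln_le_minus_one[of "nr / sr"] by simp
          then have "z \<le> sqrt (2 * (nr / sr))"
            by (simp add: z_def thr_def zeta_def sr_def nr_def)
          then have "z / sqrt nr \<le> sqrt (2 * (nr / sr)) / sqrt nr" by (intro divide_right_mono) (use sr in auto)
          also have "\<dots> = sqrt (2 / sr)" using sr by (simp add: real_sqrt_divide[symmetric])
          finally show ?thesis using p2 t0 \<mu>' by (intro divide_right_mono mult_left_mono) auto
        qed
        also have "\<dots> \<le> e / 5" using elim(14) by (simp add: sr_def)
        finally show "measure (noise_law n) B2 \<le> e / 5" .
        show "B2 \<in> sets (noise_law n)"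
          unfolding B2_def using t0 c' by (intro noise_top(2)[OF J zero]) auto
      qed
      have "\<bar>(z + \<mu> / 4) - thr n\<bar> \<le> \<mu> / 4" "\<bar>(z - \<mu> / 4) - thr n\<bar> \<le> \<mu> / 4" using \<mu> by (auto simp: z_def)
      from elim(15)[rule_format, OF \<theta> this(1)] elim(15)[rule_format, OF \<theta> this(2)]
      obtain B3 B4 where
        P3: "B3 \<in> sets (noise_law n)" "measure (noise_law n) B3 \<le> e / 5"
          "\<And>\<omega>. \<omega> \<in> Rn n - B3 \<Longrightarrow> \<bar>real (card {i\<in>I1. z + \<mu> / 4 \<le> \<bar>\<theta> i + \<omega> i\<bar>}) - p * sr\<bar> \<le> \<mu> * sr" and
        P4: "B4 \<in> sets (noise_law n)" "measure (noise_law n) B4 \<le> e / 5"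
          "\<And>\<omega>. \<omega> \<in> Rn n - B4 \<Longrightarrow> \<bar>real (card {i\<in>I1. z - \<mu> / 4 \<le> \<bar>\<theta> i + \<omega> i\<bar>}) - p * sr\<bar> \<le> \<mu> * sr"
        unfolding p_def[symmetric] sr_def[symmetric] I1_def[symmetric] by blast
      interpret P: prob_space "noise_law n" by (rule prob_space_noise_law)
      define Bad where "Bad = B0 \<union> (B1 \<union> (B2 \<union> (B3 \<union> B4)))"
      have Bs: "Bad \<in> sets (noise_law n)" unfolding Bad_def using P0 P1 P2 P3 P4 by (intro sets.Un) auto
      have "P.prob Bad \<le> P.prob B0 + (P.prob B1 + (P.prob B2 + (P.prob B3 + P.prob B4)))"
        unfolding Bad_def using P0(2) P1(2) P2(2) P3(1) P4(1)
        by (intro order_trans[OF measure_Un_le] add_left_mono sets.Un order_refl)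
      then have Bp: "P.prob Bad \<le> e" using P0(1) P1(1) P2(1) P3(2) P4(2) by linarith
      have "T n (shift n \<theta> \<omega>) \<in> {(1 - \<epsilon>) * ts..(1 + \<epsilon>) * ts}" if \<omega>: "\<omega> \<in> Rn n - Bad" for \<omega>
      proof -
        define X where "X = shift n \<theta> \<omega>"
        have XR: "X \<in> Rn n" by (simp add: X_def)
        have Xi: "X i = \<theta> i + \<omega> i" if "i < n" for i using that by (simp add: X_def)
        have sub1: "i < n" if "i \<in> I1" for i using that CD(2) by (auto simp: I1_def)
        have cnt: "{i\<in>I1. y \<le> \<bar>X i\<bar>} = {i\<in>I1. y \<le> \<bar>\<theta> i + \<omega> i\<bar>}" for y
          using Xi sub1 by auto
        have notin: "\<omega> \<in> Rn n" "\<omega> \<notin> B0" "\<omega> \<notin> B1" "\<omega> \<notin> B2" "\<omega> \<in> Rn n - B3" "\<omega> \<in> Rn n - B4"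
          using \<omega> by (auto simp: Bad_def)
        have ge: "good_event I0 I1 X nr sr ts t0 p \<epsilon> \<mu> \<mu>' \<eta> \<delta> \<gamma> K (z - \<mu> / 4) (z + \<mu> / 4) (1 / nr)"
        proof
          show "finite I0" "finite I1" using J CD(2) by (auto simp: I1_def intro: finite_subset)
          show "real (card I0) \<le> nr" using cI0 sr by simp
          show "real (card I1) = sr" using CD(1) by (simp add: I1_def sr_def)
          show "0 < sr" "0 < 1 / nr" using sr by auto
          show "1 / nr \<le> ts" "K * ts \<le> t0" "t0 \<le> 1 / 8" by fact+
          show "0 < \<epsilon>" "\<epsilon> < 1" "2 \<le> K" "0 < \<mu>" "0 < \<mu>'" "0 < \<eta>" "0 < \<delta>" "\<delta> < 2 * c0" "0 < \<gamma>" "0 < p" by fact+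
          show "null_drift \<tau> \<le> (2 * c0 + \<delta>) * (\<tau> / zeta \<tau>)" if "0 < \<tau>" "\<tau> \<le> t0" for \<tau>
            using t1(2)[of \<tau>] that t0 by simp
          show "(2 * c0 - \<delta>) * (\<tau> / zeta \<tau>) \<le> null_drift \<tau>" if "0 < \<tau>" "\<tau> \<le> t0" for \<tau>
            using t1(2)[of \<tau>] that t0 by simp
          have "nr * ((2 * c0 + \<delta>) * (ts / zeta ts)) = (2 * c0 + \<delta>) * (nr * (ts / zeta ts))" by (simp only: mult_ac)
          also have "\<dots> = ((2 * c0 + \<delta>) * G) * sr" unfolding G(1) by (simp only: mult_ac)
          also have "\<dots> \<le> (p + \<mu>) * sr" using elim(4) sr by (intro mult_right_mono) (auto simp: G_def z_def)
          finally show "nr * ((2 * c0 + \<delta>) * (ts / zeta ts)) \<le> (p + \<mu>) * sr" .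
          have su: "sr \<le> u * nr" using elim(10) sr by (simp add: sr_def nr_def divide_less_eq)
          have "(p - \<mu>) * sr \<le> ((1 - 2 * u) * (d * G)) * sr"
            using elim(5) sr by (intro mult_right_mono) (auto simp: G_def z_def)
          also have "\<dots> = ((1 - 2 * u) * nr) * (d * (ts / zeta ts))"
          proof -
            have "((1 - 2 * u) * nr) * (d * (ts / zeta ts)) = (1 - 2 * u) * d * (nr * (ts / zeta ts))" by (simp only: mult_ac)
            then show ?thesis unfolding G(1) by (simp only: mult_ac)
          qed
          also have "\<dots> \<le> (real (card I0) - u * nr) * (d * (ts / zeta ts))"
            using su d ts zs by (intro mult_right_mono) (auto simp: cI0 algebra_simps)
          finally show "(p - \<mu>) * sr \<le> (real (card I0) - 4 * \<eta> / (\<epsilon> * (2 * c0 - \<delta>)) * nr) * ((2 * c0 - \<delta>) * (ts / zeta ts))"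
            by (subst \<eta>(2)) (simp only: d_def[symmetric])
          have "u * nr \<le> 1/16 * nr" using u sr by (intro mult_right_mono) auto
          then show "4 * \<eta> / (\<epsilon> * (2 * c0 - \<delta>)) * nr \<le> real (card I0)"
            unfolding \<eta>(2) cI0 using su sr by linarith
          show "1 - \<mu> \<le> score \<tau> x" if "ts / K \<le> \<tau>" "\<tau> \<le> ts" "z + \<mu> / 4 \<le> \<bar>x\<bar>" for \<tau> x
            using elim(1) that by (auto simp: ts_def z_def)
          show "score \<tau> x \<le> \<mu>" if "0 < \<tau>" "\<tau> \<le> K * ts" "\<bar>x\<bar> \<le> z - \<mu> / 4" for \<tau> x
            using elim(2) that by (auto simp: ts_def z_def)
          show "(p - \<mu>) * sr \<le> real (card {i\<in>I1. z + \<mu> / 4 \<le> \<bar>X i\<bar>})"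
            unfolding cnt using P3(3)[OF notin(5)] by (simp add: abs_le_iff algebra_simps)
          show "real (card {i\<in>I1. z - \<mu> / 4 \<le> \<bar>X i\<bar>}) \<le> (p + \<mu>) * sr"
            unfolding cnt using P4(3)[OF notin(6)] by (simp add: abs_le_iff algebra_simps)
          show "(\<integral>\<^sup>+\<tau>. ennreal (\<bar>null_noise I0 X \<tau>\<bar> / \<tau>) * indicator {1 / nr..ts} \<tau> \<partial>lborel) \<le> ennreal (\<mu> * sr)"
            using notin by (simp add: B0_def X_def c0'_def)
          show "(\<integral>\<^sup>+\<tau>. ennreal (\<bar>null_noise I0 X \<tau>\<bar> * zeta \<tau> / \<tau>\<^sup>2) * indicator {ts..t0} \<tau> \<partial>lborel) \<le> ennreal (\<eta> * nr)"
            using notin by (simp add: B1_def X_def c1'_def)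
          show "(\<integral>\<^sup>+\<tau>. ennreal (\<bar>null_noise I0 X \<tau>\<bar> / \<tau>) * indicator {t0..1} \<tau> \<partial>lborel) \<le> ennreal (\<mu>' * sr / ts)"
            using notin by (simp add: B2_def X_def c2'_def)
          show "8 * ts \<le> \<mu>" using tsK by simp
          show "\<mu> \<le> p / 4" "\<mu> \<le> 1" by fact+
          show "\<mu> * ((p + 1) * ln K + 3) < p * \<gamma>" "\<mu> * (2 * ln K + K) < p * \<gamma>"
            using \<mu> by (auto simp: D1_def D2_def)
          show "\<gamma> \<le> - ln (1 - \<epsilon>) - \<epsilon>" "\<gamma> \<le> \<epsilon> - ln (1 + \<epsilon>)" by (auto simp: \<gamma>_def)
          have "\<gamma> \<le> 1" by (simp add: \<gamma>_def)
          then show "\<gamma> \<le> ln K - 1" using lnK by simp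
          show "ln x \<le> p / 4 * (x - 1)" if "K \<le> x" for x using that by (rule K_ln)
          have "(\<mu>' + ts * ln (1 / ts)) / ts < (p / 2 * (t0 - ts)) / ts"
            using elim(8) ts by (intro divide_strict_right_mono) (auto simp: ts_def)
          then show "\<mu>' / ts + ln (1 / ts) < p / 2 * (t0 / ts - 1)"
            using ts by (simp add: add_divide_distrib diff_divide_distrib right_diff_distrib)
        qed
        interpret good_event I0 I1 X nr sr ts t0 p \<epsilon> \<mu> \<mu>' \<eta> \<delta> \<gamma> K "z - \<mu> / 4" "z + \<mu> / 4" "1 / nr" by (rule ge)
        have split: "(\<Sum>i<n. ln (lik_ratio \<tau> (X i))) = L0 \<tau> + L1 \<tau>" for \<tau>
        proof -
          have "{..<n} = I0 \<union> I1" "I0 \<inter> I1 = {}" using CD(2) by (auto simp: I0_def I1_def)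
          then show ?thesis unfolding L0_def L1_def using fin by (simp add: sum.union_disjoint)
        qed
        have "ts \<in> {1 / real n..1}" using lo tst0 t0 by (simp add: nr_def)
        from is_mmle_maximal[OF T[OF n1] n1 XR this]
        have "L0 ts + L1 ts \<le> L0 (T n X) + L1 (T n X)" by (simp add: split)
        moreover have "T n X \<in> {1 / nr..1}" using is_mmle_range[OF T[OF n1] XR] by (simp add: nr_def)
        ultimately show ?thesis using maximiser_near_target[of "T n X"] by (simp add: X_def)
      qed
      then show "\<exists>Bad\<in>sets (noise_law n). measure (noise_law n) Bad \<le> e \<and> (\<forall>\<omega>\<in>Rn n - Bad.
          T n (shift n \<theta> \<omega>) \<in> {(1 - \<epsilon>) * target b (thr n)..(1 + \<epsilon>) * target b (thr n)})"
        using Bs Bp by (intro bexI[of _ Bad]) (auto simp: ts_def)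
    qed
  qed
qed

end

section \<open>Quantiles, measurability, and the error rates as integrals over the noise\<close>

lemma normal_tail_eq_solution:
  assumes "0 < c" "c \<le> 1 / 2"
  obtains y where "normal_tail y = c"
proof -
  have "\<forall>\<^sub>F y in at_top. normal_tail y < c"
    using assms by (intro order_tendstoD(2)[OF normal_tail_tendsto_0])
  then have "\<forall>\<^sub>F y in at_top. normal_tail y < c \<and> y \<ge> 0"
    using eventually_ge_at_top[of 0] by eventually_elim simp
  then obtain M where M: "normal_tail M < c" "M \<ge> 0"
    using eventually_happens'[OF trivial_limit_at_top_linorder] by blast
  have "\<exists>y\<ge>0. y \<le> M \<and> normal_tail y = c"
  proof (rule IVT2)
    show "\<forall>x. 0 \<le> x \<and> x \<le> M \<longrightarrow> isCont normal_tail x"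
      using DERIV_isCont[OF normal_tail_has_derivative] by blast
  qed (use M assms in auto)
  then show ?thesis using that by blast
qed

text \<open>Off the exceptional set the deviation is at most d; on it, two numbers in [0, 1] differ
  by at most 1.\<close>

lemma (in prob_space) expectation_near:
  assumes F [measurable]: "F \<in> borel_measurable M" and F01: "\<And>x. x \<in> space M \<Longrightarrow> 0 \<le> F x \<and> F x \<le> 1"
    and c: "0 \<le> c" "c \<le> 1" and Bad: "Bad \<in> events" "prob Bad \<le> e"
    and d: "d \<ge> 0" "\<And>x. x \<in> space M - Bad \<Longrightarrow> \<bar>F x - c\<bar> \<le> d"
  shows "\<bar>expectation F - c\<bar> \<le> d + (e :: real)"
proof -
  have iF: "integrable M F" using F01 by (intro integrable_const_bound[of _ 1] AE_I2) auto
  have iI: "integrable M (indicator Bad :: _ \<Rightarrow> real)"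
    using Bad by (intro integrable_const_bound[of _ 1] AE_I2) (auto simp: indicator_def)
  have iB: "integrable M (\<lambda>x. d + indicator Bad x :: real)"
    by (intro Bochner_Integration.integrable_add iI) simp
  have "\<bar>expectation F - c\<bar> = \<bar>expectation (\<lambda>x. F x - c)\<bar>"
    using iF by (simp add: prob_space)
  also have "\<dots> \<le> expectation (\<lambda>x. \<bar>F x - c\<bar>)" by (rule integral_abs_bound)
  also have "\<dots> \<le> expectation (\<lambda>x. d + indicator Bad x)"
  proof (rule integral_mono)
    show "integrable M (\<lambda>x. \<bar>F x - c\<bar>)" using iF by (intro integrable_abs Bochner_Integration.integrable_diff) auto
    show "\<bar>F x - c\<bar> \<le> d + indicator Bad x" if x: "x \<in> space M" for x
    proof (cases "x \<in> Bad")
      case True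
      then show ?thesis using F01[OF x] c d(1) by (simp add: abs_le_iff)
    next
      case False
      then show ?thesis using d(2)[of x] x by simp
    qed
  qed (rule iB)
  also have "\<dots> = d + prob Bad" using Bad by (subst Bochner_Integration.integral_add[OF _ iI]) (auto simp: prob_space)
  finally show ?thesis using Bad(2) by simp
qed

lemma S_value_mmle_measurable:
  assumes "is_mmle n T" "n \<ge> 1" "i < n"
  shows "(\<lambda>X. S_value (X i) (T X)) \<in> borel_measurable (borel_Rn n)"
proof -
  have [measurable]: "T \<in> borel_measurable (borel_Rn n)" using assms by (simp add: is_mmle_def)
  have [measurable]: "(\<lambda>X. X i) \<in> borel_measurable (borel_Rn n)" using assms by measurable
  have "(\<lambda>X. (X i, T X)) \<in> borel_Rn n \<rightarrow>\<^sub>M restrict_space (borel \<Otimes>\<^sub>M borel) {z. snd z > 0}"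
  proof (rule measurable_restrict_space2)
    have "T X > 0" if "X \<in> Rn n" for X
    proof -
      have "0 < 1 / real n" using assms by simp
      also have "\<dots> \<le> T X" using is_mmle_range[OF assms(1) that] by simp
      finally show ?thesis .
    qed
    then show "(\<lambda>X. (X i, T X)) \<in> space (borel_Rn n) \<rightarrow> {z. snd z > 0}"
      by (auto simp: space_PiM)
  qed measurable
  from measurable_compose[OF this S_value_measurable] show ?thesis by simp
qed

lemma integral_data_law:
  assumes "F \<in> borel_measurable (borel_Rn n)"
  shows "(\<integral>X. (F X :: real) \<partial>data_law n \<theta>) = (\<integral>\<omega>. F (shift n \<theta> \<omega>) \<partial>noise_law n)"
  unfolding data_law_def using assms by (intro integral_distr shift_measurable)

definition null_rejections :: "nat \<Rightarrow> (nat \<Rightarrow> real) \<Rightarrow> ((nat \<Rightarrow> real) \<Rightarrow> real) \<Rightarrow> real \<Rightarrow> (nat \<Rightarrow> real) \<Rightarrow> real" where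
  "null_rejections n \<theta> T t X = real (card {i\<in>{..<n} - support_set n \<theta>. S_value (X i) (T X) < t})"

definition signal_rejections :: "nat \<Rightarrow> (nat \<Rightarrow> real) \<Rightarrow> ((nat \<Rightarrow> real) \<Rightarrow> real) \<Rightarrow> real \<Rightarrow> (nat \<Rightarrow> real) \<Rightarrow> real" where
  "signal_rejections n \<theta> T t X = real (card {i\<in>support_set n \<theta>. S_value (X i) (T X) < t})"

lemma finite_support_set: "finite (support_set n \<theta>)"
  by (simp add: support_set_def)

lemma signal_rejections_le: "signal_rejections n \<theta> T t X \<le> real (card (support_set n \<theta>))"
  unfolding signal_rejections_def by (intro of_nat_mono card_mono finite_support_set) auto

lemma rejections_measurable:
  assumes "is_mmle n T" "n \<ge> 1"
  shows "null_rejections n \<theta> T t \<in> borel_measurable (borel_Rn n)"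
    "signal_rejections n \<theta> T t \<in> borel_measurable (borel_Rn n)"
proof -
  have *: "(\<lambda>X. real (card {i\<in>J. S_value (X i) (T X) < t})) \<in> borel_measurable (borel_Rn n)" if J: "J \<subseteq> {..<n}" for J
  proof -
    have "(\<lambda>X. \<Sum>i\<in>J. if S_value (X i) (T X) < t then 1 else 0 :: real) \<in> borel_measurable (borel_Rn n)"
    proof (rule borel_measurable_sum)
      fix i assume "i \<in> J"
      with J have [measurable]: "(\<lambda>X. S_value (X i) (T X)) \<in> borel_measurable (borel_Rn n)"
        by (intro S_value_mmle_measurable assms) auto
      show "(\<lambda>X. if S_value (X i) (T X) < t then 1 else 0 :: real) \<in> borel_measurable (borel_Rn n)"
        by measurable
    qed
    moreover have "finite J" using J finite_subset by blast
    then have "(\<lambda>X. \<Sum>i\<in>J. if S_value (X i) (T X) < t then 1 else 0 :: real) = (\<lambda>X. real (card {i\<in>J. S_value (X i) (T X) < t}))"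
      by (simp add: sum.If_cases Int_def fun_eq_iff)
    ultimately show ?thesis by simp
  qed
  show "null_rejections n \<theta> T t \<in> borel_measurable (borel_Rn n)"
    unfolding null_rejections_def[abs_def] by (rule *) auto
  show "signal_rejections n \<theta> T t \<in> borel_measurable (borel_Rn n)"
    unfolding signal_rejections_def[abs_def] by (rule *) (auto simp: support_set_def)
qed

lemma sum_of_bool_card: "finite A \<Longrightarrow> (\<Sum>i\<in>A. of_bool (P i) :: real) = real (card {i\<in>A. P i})"
  by (simp add: Int_def)

lemma S_procedure_eq_1_iff: "S_procedure T t X i = 1 \<longleftrightarrow> S_value (X i) (T X) < t"
  by (simp add: S_procedure_def)

lemma FDR_eq:
  assumes "is_mmle n T" "n \<ge> 1"
  shows "FDR n \<theta> (S_procedure T t) = (\<integral>\<omega>. null_rejections n \<theta> T t (shift n \<theta> \<omega>) /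
    max 1 (null_rejections n \<theta> T t (shift n \<theta> \<omega>) + signal_rejections n \<theta> T t (shift n \<theta> \<omega>)) \<partial>noise_law n)"
proof -
  note [measurable] = rejections_measurable[OF assms]
  have 1: "(\<Sum>i<n. of_bool (\<theta> i = 0 \<and> S_procedure T t X i = 1)) = null_rejections n \<theta> T t X" for X
  proof -
    have "{i\<in>{..<n}. \<theta> i = 0 \<and> S_value (X i) (T X) < t} = {i\<in>{..<n} - support_set n \<theta>. S_value (X i) (T X) < t}"
      by (auto simp: support_set_def)
    then show ?thesis
      unfolding S_procedure_eq_1_iff sum_of_bool_card[OF finite_lessThan] null_rejections_def by (simp only:)
  qed
  have 2: "(\<Sum>i<n. of_bool (S_procedure T t X i = 1)) = null_rejections n \<theta> T t X + signal_rejections n \<theta> T t X" for X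
  proof -
    have "{i\<in>{..<n}. S_value (X i) (T X) < t} = {i\<in>{..<n} - support_set n \<theta>. S_value (X i) (T X) < t} \<union> {i\<in>support_set n \<theta>. S_value (X i) (T X) < t}"
      by (auto simp: support_set_def)
    then have "card {i\<in>{..<n}. S_value (X i) (T X) < t} = card {i\<in>{..<n} - support_set n \<theta>. S_value (X i) (T X) < t} + card {i\<in>support_set n \<theta>. S_value (X i) (T X) < t}"
      using finite_support_set[of n \<theta>] by (simp only:) (rule card_Un_disjoint, auto)
    then show ?thesis
      unfolding S_procedure_eq_1_iff sum_of_bool_card[OF finite_lessThan] null_rejections_def signal_rejections_def by (simp only: of_nat_add)
  qed
  show ?thesis unfolding FDR_def 1 2 by (rule integral_data_law) measurable
qed

lemma FNR_eq:
  assumes "is_mmle n T" "n \<ge> 1" "card (support_set n \<theta>) \<ge> 1"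
  shows "FNR n \<theta> (S_procedure T t) = (\<integral>\<omega>. 1 - signal_rejections n \<theta> T t (shift n \<theta> \<omega>) / real (card (support_set n \<theta>)) \<partial>noise_law n)"
proof -
  note [measurable] = rejections_measurable[OF assms(1,2)]
  define c where "c = real (card (support_set n \<theta>))"
  have c: "c \<ge> 1" using assms(3) by (simp add: c_def)
  have 1: "(\<Sum>i<n. of_bool (\<theta> i \<noteq> 0)) = c"
    unfolding sum_of_bool_card[OF finite_lessThan] c_def support_set_def ..
  have 2: "(\<Sum>i<n. of_bool (\<theta> i \<noteq> 0) * (1 - real (S_procedure T t X i))) = c - signal_rejections n \<theta> T t X" for X
  proof -
    have "(\<Sum>i<n. of_bool (\<theta> i \<noteq> 0) * (1 - real (S_procedure T t X i)))
        = (\<Sum>i<n. of_bool (\<theta> i \<noteq> 0)) - (\<Sum>i<n. of_bool (\<theta> i \<noteq> 0 \<and> S_value (X i) (T X) < t))"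
      unfolding sum_subtractf[symmetric] by (intro sum.cong) (auto simp: S_procedure_def)
    also have "(\<Sum>i<n. of_bool (\<theta> i \<noteq> 0 \<and> S_value (X i) (T X) < t)) = signal_rejections n \<theta> T t X"
      unfolding sum_of_bool_card[OF finite_lessThan] signal_rejections_def support_set_def by (simp add: conj_assoc)
    finally show ?thesis unfolding 1 .
  qed
  have "FNR n \<theta> (S_procedure T t) = (\<integral>X. 1 - signal_rejections n \<theta> T t X / c \<partial>data_law n \<theta>)"
    unfolding FNR_def 1 2 using c by (simp add: diff_divide_distrib max_def)
  also have "\<dots> = (\<integral>\<omega>. 1 - signal_rejections n \<theta> T t (shift n \<theta> \<omega>) / c \<partial>noise_law n)"
    by (rule integral_data_law) measurable
  finally show ?thesis by (simp add: c_def)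
qed

section \<open>Rejection counts and the limits of the two rates\<close>

context sparse_regime
begin

text \<open>Let y1 and y2 be the quantiles for \<kappa> = t / (1 - t) times 1 - u and 1 + u. Once
  the estimator is near the target, |x| \<ge> y1 forces rejection and |x| \<le> y2 forces acceptance
  for all coordinates simultaneously. The counts are thus sandwiched between exceedance counts of
  deterministic thresholds, and the dependence between estimator and coordinates does no
  harm.\<close>

lemma rejection_counts:
  assumes T: "\<forall>n\<ge>1. is_mmle n (T n)" and t: "0 < t" "t < 1" and \<mu>: "\<mu> > 0" and e: "e > 0"
  shows "\<forall>\<^sub>F n in sequentially. \<forall>\<theta>\<in>sparse_class_eq n (s n) b.
    \<exists>Bad\<in>sets (noise_law n). measure (noise_law n) Bad \<le> e \<and> (\<forall>\<omega>\<in>Rn n - Bad.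
      \<bar>signal_rejections n \<theta> (T n) t (shift n \<theta> \<omega>) - normal_tail (- b) * real (s n)\<bar> \<le> \<mu> * real (s n) \<and>
      \<bar>null_rejections n \<theta> (T n) t (shift n \<theta> \<omega>) - t / (1 - t) * normal_tail (- b) * real (s n)\<bar> \<le> \<mu> * real (s n))"
proof -
  define p where "p = normal_tail (- b)"
  have p: "0 < p" "p \<le> 1" using normal_tail_pos by (auto simp: p_def)
  define k where "k = t / (1 - t)"
  have k: "k > 0" "k * (1 - t) = t" using t by (auto simp: k_def)
  \<comment> \<open>The cap 1 / 2 keeps k1 positive; the other term makes the induced error k u at
    most \<mu> / 2.\<close>
  define u where "u = min (1 / 2) (\<mu> / (2 * k))"
  have u: "0 < u" "u \<le> 1 / 2" "k * u \<le> \<mu> / 2"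
  proof -
    show "0 < u" "u \<le> 1 / 2" using \<mu> k by (auto simp: u_def)
    have "k * u \<le> k * (\<mu> / (2 * k))" using k by (intro mult_left_mono) (auto simp: u_def)
    then show "k * u \<le> \<mu> / 2" using k by simp
  qed
  define k1 k2 where "k1 = k * (1 - u)" and "k2 = k * (1 + u)"
  have k12: "k1 > 0" "k2 > 0" using k u by (auto simp: k1_def k2_def)
  have "k1 * (1 - t) = (k * (1 - t)) * (1 - u)" "k2 * (1 - t) = (k * (1 - t)) * (1 + u)" by (simp_all add: k1_def k2_def)
  \<comment> \<open>The estimator is localized with relative error u / 2, half of the margin u in
    \<kappa>, so both S-value criteria hold strictly.\<close>
  then have lt: "k1 * (1 - t) < t * (1 - u / 2)" "k2 * (1 - t) > t * (1 + u / 2)"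
    using t u unfolding k(2) by (auto intro!: mult_strict_left_mono)
  have u2: "0 < u / 2" "u / 2 < 1" "\<mu> / 2 > 0" "\<mu> / 4 > 0" "e / 5 > 0" using u \<mu> e by auto
  define c where "c \<kappa> n = \<kappa> * (p * exp (- (thr n)\<^sup>2 / 2) / 2)" for \<kappa> n
  note R = eventually_thr[OF S_value_reject[OF t u2(1,2) k12(1) lt(1), of b]]
  note A = eventually_thr[OF S_value_accept[OF t u2(1,2) k12(2) lt(2), of b]]
  note Q1 = eventually_thr[OF quantile_near_threshold[OF k12(1) u2(4), of b]]
  note Q2 = eventually_thr[OF quantile_near_threshold[OF k12(2) u2(4), of b]]
  have small: "\<forall>\<^sub>F n in sequentially. c \<kappa> n < 1 / 2" for \<kappa>
  proof -
    have "((\<lambda>z. \<kappa> * (p * exp (- z\<^sup>2 / 2) / 2)) \<longlongrightarrow> 0) at_top" by real_asymp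
    then have "\<forall>\<^sub>F z in at_top. \<kappa> * (p * exp (- z\<^sup>2 / 2) / 2) < 1 / 2" by (rule order_tendstoD(2)) simp
    from eventually_thr[OF this] show ?thesis by (simp add: c_def)
  qed
  note N1 = null_counts[OF k12(1) u2(3,5)]
  note N2 = null_counts[OF k12(2) u2(3,5)]
  note M = mmle_near_target[OF T u2(1,2,5)]
  show ?thesis
    using R A Q1 Q2 small[of k1] small[of k2] N1 N2 M signal_counts[OF \<mu> u2(5)] eventually_ge_at_top[of 1]
  proof eventually_elim
    case (elim n)
    note n1 = elim(11)
    have cp: "c k1 n > 0" "c k2 n > 0" using k12 p by (auto simp: c_def)
    obtain y1 where y1: "normal_tail y1 = c k1 n" using normal_tail_eq_solution[OF cp(1)] elim(5) by auto
    obtain y2 where y2: "normal_tail y2 = c k2 n" using normal_tail_eq_solution[OF cp(2)] elim(6) by auto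
    note y1' = y1[unfolded c_def p_def] and y2' = y2[unfolded c_def p_def]
    have near: "\<bar>y1 - thr n\<bar> \<le> \<mu> / 4" "\<bar>y2 - thr n\<bar> \<le> \<mu> / 4"
      using elim(3)[rule_format, OF y1'] elim(4)[rule_format, OF y2'] unfolding abs_le_iff by linarith+
    show ?case
    proof
      fix \<theta> assume \<theta>: "\<theta> \<in> sparse_class_eq n (s n) b"
      define S N where "S = support_set n \<theta>" and "N = {..<n} - S"
      have fin: "finite S" "finite N" and S: "S \<subseteq> {..<n}" and Nn: "N \<subseteq> {..<n}" by (auto simp: S_def N_def support_set_def)
      define cnt where "cnt J y \<omega> = real (card {i\<in>J. y \<le> \<bar>\<theta> i + \<omega> i\<bar>})" for J y and \<omega> :: "nat \<Rightarrow> real"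
      obtain B0 where B0: "B0 \<in> sets (noise_law n)" "measure (noise_law n) B0 \<le> e / 5"
        "\<And>\<omega>. \<omega> \<in> Rn n - B0 \<Longrightarrow> T n (shift n \<theta> \<omega>) \<in> {(1 - u / 2) * target b (thr n)..(1 + u / 2) * target b (thr n)}"
        using elim(9)[rule_format, OF \<theta>] by blast
      obtain B1 where B1: "B1 \<in> sets (noise_law n)" "measure (noise_law n) B1 \<le> e / 5"
        "\<And>\<omega>. \<omega> \<in> Rn n - B1 \<Longrightarrow> \<bar>cnt N y1 \<omega> - k1 * p * real (s n)\<bar> \<le> \<mu> / 2 * real (s n)"
        using elim(7)[rule_format, OF \<theta> y1'] unfolding cnt_def N_def S_def p_def by blast
      obtain B2 where B2: "B2 \<in> sets (noise_law n)" "measure (noise_law n) B2 \<le> e / 5"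
        "\<And>\<omega>. \<omega> \<in> Rn n - B2 \<Longrightarrow> \<bar>cnt N y2 \<omega> - k2 * p * real (s n)\<bar> \<le> \<mu> / 2 * real (s n)"
        using elim(8)[rule_format, OF \<theta> y2'] unfolding cnt_def N_def S_def p_def by blast
      obtain B3 where B3: "B3 \<in> sets (noise_law n)" "measure (noise_law n) B3 \<le> e / 5"
        "\<And>\<omega>. \<omega> \<in> Rn n - B3 \<Longrightarrow> \<bar>cnt S y1 \<omega> - p * real (s n)\<bar> \<le> \<mu> * real (s n)"
        using elim(10)[rule_format, OF \<theta> near(1)] unfolding cnt_def S_def p_def by blast
      obtain B4 where B4: "B4 \<in> sets (noise_law n)" "measure (noise_law n) B4 \<le> e / 5"
        "\<And>\<omega>. \<omega> \<in> Rn n - B4 \<Longrightarrow> \<bar>cnt S y2 \<omega> - p * real (s n)\<bar> \<le> \<mu> * real (s n)"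
        using elim(10)[rule_format, OF \<theta> near(2)] unfolding cnt_def S_def p_def by blast
      define Bad where "Bad = B0 \<union> (B1 \<union> (B2 \<union> (B3 \<union> B4)))"
      have Bs: "Bad \<in> sets (noise_law n)" unfolding Bad_def using B0 B1 B2 B3 B4 by (intro sets.Un) auto
      interpret P: prob_space "noise_law n" by (rule prob_space_noise_law)
      have "P.prob Bad \<le> P.prob B0 + (P.prob B1 + (P.prob B2 + (P.prob B3 + P.prob B4)))"
        unfolding Bad_def using B0(1) B1(1) B2(1) B3(1) B4(1)
        by (intro order_trans[OF measure_Un_le] add_left_mono sets.Un order_refl)
      then have Bp: "P.prob Bad \<le> e" using B0(2) B1(2) B2(2) B3(2) B4(2) by linarith
      have "\<bar>signal_rejections n \<theta> (T n) t (shift n \<theta> \<omega>) - p * real (s n)\<bar> \<le> \<mu> * real (s n) \<and>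
          \<bar>null_rejections n \<theta> (T n) t (shift n \<theta> \<omega>) - k * p * real (s n)\<bar> \<le> \<mu> * real (s n)" if \<omega>: "\<omega> \<in> Rn n - Bad" for \<omega>
      proof -
        define X where "X = shift n \<theta> \<omega>"
        have B: "\<omega> \<in> Rn n - B0" "\<omega> \<in> Rn n - B1" "\<omega> \<in> Rn n - B2" "\<omega> \<in> Rn n - B3" "\<omega> \<in> Rn n - B4"
          using \<omega> by (auto simp: Bad_def)
        have \<tau>: "T n X \<in> {(1 - u / 2) * target b (thr n)..(1 + u / 2) * target b (thr n)}"
          unfolding X_def by (rule B0(3)[OF B(1)])
        have rej: "S_value x (T n X) < t" if "y1 \<le> \<bar>x\<bar>" for x
          using elim(1)[rule_format, OF y1' \<tau> that] .
        have acc: "S_value x (T n X) \<ge> t" if "\<bar>x\<bar> \<le> y2" for x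
          using elim(2)[rule_format, OF y2' \<tau> that] .
        have sandwich: "cnt J y1 \<omega> \<le> real (card {i\<in>J. S_value (X i) (T n X) < t})"
          "real (card {i\<in>J. S_value (X i) (T n X) < t}) \<le> cnt J y2 \<omega>" if J: "J \<subseteq> {..<n}" for J
        proof -
          have fJ: "finite J" using J finite_subset by blast
          have Xi: "X i = \<theta> i + \<omega> i" if "i \<in> J" for i using that J by (auto simp: X_def)
          show "cnt J y1 \<omega> \<le> real (card {i\<in>J. S_value (X i) (T n X) < t})"
            unfolding cnt_def using fJ rej by (intro of_nat_mono card_mono) (auto simp: Xi)
          have "y2 \<le> \<bar>x\<bar>" if "S_value x (T n X) < t" for x
            using acc[of x] that by linarith
          then show "real (card {i\<in>J. S_value (X i) (T n X) < t}) \<le> cnt J y2 \<omega>"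
            unfolding cnt_def using fJ by (intro of_nat_mono card_mono) (auto simp: Xi)
        qed
        have s0: "real (s n) \<ge> 0" by simp
        have "k * u * p \<le> \<mu> / 2 * 1" using u p \<mu> by (intro mult_mono) auto
        then have kup: "k * u * p * real (s n) \<le> \<mu> / 2 * real (s n)" using s0 by (intro mult_right_mono) auto
        have k1s: "k1 * p * real (s n) = k * p * real (s n) - k * u * p * real (s n)"
          and k2s: "k2 * p * real (s n) = k * p * real (s n) + k * u * p * real (s n)"
          by (simp_all add: k1_def k2_def algebra_simps)
        have "\<mu> / 2 * real (s n) + \<mu> / 2 * real (s n) = \<mu> * real (s n)" by simp
        moreover have "signal_rejections n \<theta> (T n) t X = real (card {i\<in>S. S_value (X i) (T n X) < t})"
          by (simp add: signal_rejections_def S_def)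
        moreover have "null_rejections n \<theta> (T n) t X = real (card {i\<in>N. S_value (X i) (T n X) < t})"
          by (simp add: null_rejections_def N_def S_def)
        ultimately show ?thesis
          using sandwich[OF S] sandwich[OF Nn] B1(3)[OF B(2)] B2(3)[OF B(3)] B3(3)[OF B(4)] B4(3)[OF B(5)] kup
          unfolding k1s k2s X_def[symmetric] abs_le_iff by linarith
      qed
      then show "\<exists>Bad\<in>sets (noise_law n). measure (noise_law n) Bad \<le> e \<and> (\<forall>\<omega>\<in>Rn n - Bad.
          \<bar>signal_rejections n \<theta> (T n) t (shift n \<theta> \<omega>) - normal_tail (- b) * real (s n)\<bar> \<le> \<mu> * real (s n) \<and>
          \<bar>null_rejections n \<theta> (T n) t (shift n \<theta> \<omega>) - t / (1 - t) * normal_tail (- b) * real (s n)\<bar> \<le> \<mu> * real (s n))"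
        using Bs Bp unfolding p_def k_def by blast
    qed
  qed
qed

text \<open>With V false and W true rejections, V - t (V + W) is a combination of the two count
  errors with weights 1 - t and t, hence at most \<mu> s in modulus, while the denominator is at
  least W \<ge> p s / 2. The FNR depends on W alone, and 1 - \<open>normal_tail (- b)\<close> is
  \<open>normal_tail b\<close>.\<close>

lemma FDR_FNR_limits:
  assumes T: "\<forall>n\<ge>1. is_mmle n (T n)" and t: "0 < t" "t < 1" and \<epsilon>: "\<epsilon> > 0"
  shows "\<forall>\<^sub>F n in sequentially. \<forall>\<theta>\<in>sparse_class_eq n (s n) b.
    \<bar>FDR n \<theta> (S_procedure (T n) t) - t\<bar> < \<epsilon> \<and> \<bar>FNR n \<theta> (S_procedure (T n) t) - normal_tail b\<bar> < \<epsilon>"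
proof -
  define p where "p = normal_tail (- b)"
  have p: "0 < p" "p \<le> 1" using normal_tail_pos by (auto simp: p_def)
  define \<mu> where "\<mu> = min (p / 2) (\<epsilon> * p / 8)"
  have \<mu>: "0 < \<mu>" "\<mu> \<le> p / 2" "\<mu> \<le> \<epsilon> * p / 8" using p \<epsilon> by (auto simp: \<mu>_def)
  have e: "\<epsilon> / 4 > 0" using \<epsilon> by simp
  \<comment> \<open>Ensures at least one rejection off the exceptional set, so that the maximum with
    1 in the FDR is attained by the rejection count.\<close>
  have s_large: "\<forall>\<^sub>F n in sequentially. real (s n) \<ge> 2 / p" by (rule eventually_s[OF eventually_ge_at_top])
  show ?thesis
    using rejection_counts[OF T t \<mu>(1) e] s_large eventually_ge_at_top[of 1]
  proof eventually_elim
    case (elim n)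
    have mm: "is_mmle n (T n)" using T elim by simp
    show ?case
    proof
      fix \<theta> assume \<theta>: "\<theta> \<in> sparse_class_eq n (s n) b"
      interpret P: prob_space "noise_law n" by (rule prob_space_noise_law)
      define V W where "V \<omega> = null_rejections n \<theta> (T n) t (shift n \<theta> \<omega>)" and "W \<omega> = signal_rejections n \<theta> (T n) t (shift n \<theta> \<omega>)" for \<omega>
      note [measurable] = rejections_measurable[OF mm elim(3), THEN measurable_compose[OF shift_measurable]]
      have [measurable]: "V \<in> borel_measurable (noise_law n)" "W \<in> borel_measurable (noise_law n)"
        unfolding V_def[abs_def] W_def[abs_def] by measurable
      define r where "r = real (s n)"
      have r: "r > 0" "r * p \<ge> 2" using s_range[OF elim(3)] elim(2) p by (auto simp: r_def pos_divide_le_eq)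
      have card: "card (support_set n \<theta>) = s n" using sparse_class_eqD(1)[OF elim(3) \<theta>] .
      have VW: "0 \<le> V \<omega>" "0 \<le> W \<omega>" "W \<omega> \<le> r" for \<omega>
        using signal_rejections_le[of n \<theta> "T n" t "shift n \<theta> \<omega>"] card
        by (auto simp: V_def W_def r_def null_rejections_def signal_rejections_def)
      obtain Bad where Bad: "Bad \<in> sets (noise_law n)" "measure (noise_law n) Bad \<le> \<epsilon> / 4"
        and cnt: "\<And>\<omega>. \<omega> \<in> Rn n - Bad \<Longrightarrow> \<bar>W \<omega> - p * r\<bar> \<le> \<mu> * r \<and> \<bar>V \<omega> - t / (1 - t) * p * r\<bar> \<le> \<mu> * r"
        using elim(1)[rule_format, OF \<theta>] unfolding V_def W_def p_def r_def by blast
      have "\<bar>P.expectation (\<lambda>\<omega>. V \<omega> / max 1 (V \<omega> + W \<omega>)) - t\<bar> \<le> \<epsilon> / 4 + \<epsilon> / 4"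
      proof (rule P.expectation_near[OF _ _ _ _ Bad])
        show "0 \<le> V \<omega> / max 1 (V \<omega> + W \<omega>) \<and> V \<omega> / max 1 (V \<omega> + W \<omega>) \<le> 1" for \<omega>
          using VW[of \<omega>] by (auto simp: divide_le_eq_1 max_def)
        fix \<omega> assume "\<omega> \<in> space (noise_law n) - Bad"
        then have *: "\<bar>W \<omega> - p * r\<bar> \<le> \<mu> * r" "\<bar>V \<omega> - t / (1 - t) * p * r\<bar> \<le> \<mu> * r" using cnt by auto
        have "\<mu> * r \<le> p / 2 * r" using \<mu>(2) r(1) by (intro mult_right_mono) auto
        then have W: "W \<omega> \<ge> p * r / 2" using *(1) unfolding abs_le_iff by linarith
        then have D: "V \<omega> + W \<omega> \<ge> p * r / 2" "V \<omega> + W \<omega> \<ge> 1" using VW(1)[of \<omega>] r(2) by (auto simp: mult.commute)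
        have "V \<omega> - t * (V \<omega> + W \<omega>) = (1 - t) * (V \<omega> - t / (1 - t) * p * r) - t * (W \<omega> - p * r)"
        proof -
          have "(1 - t) * (t / (1 - t) * p * r) = t * (p * r)" using t by simp
          then show ?thesis by (simp only: right_diff_distrib) (simp add: algebra_simps)
        qed
        moreover have "\<bar>(1 - t) * (V \<omega> - t / (1 - t) * p * r)\<bar> \<le> (1 - t) * (\<mu> * r)"
          using *(2) t unfolding abs_mult by (intro mult_mono) auto
        moreover have "\<bar>t * (W \<omega> - p * r)\<bar> \<le> t * (\<mu> * r)"
          using *(1) t unfolding abs_mult by (intro mult_mono) auto
        moreover have "(1 - t) * (\<mu> * r) + t * (\<mu> * r) = \<mu> * r" by (simp add: algebra_simps)
        ultimately have "\<bar>V \<omega> - t * (V \<omega> + W \<omega>)\<bar> \<le> \<mu> * r" by linarith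
        also have "\<dots> \<le> \<epsilon> * p / 8 * r" using \<mu>(3) r(1) by (intro mult_right_mono) auto
        also have "\<dots> = \<epsilon> / 4 * (p * r / 2)" by simp
        also have "\<dots> \<le> \<epsilon> / 4 * (V \<omega> + W \<omega>)" using D(1) \<epsilon> by (intro mult_left_mono) auto
        finally have "\<bar>V \<omega> - t * (V \<omega> + W \<omega>)\<bar> / (V \<omega> + W \<omega>) \<le> \<epsilon> / 4"
          using D(2) by (simp add: pos_divide_le_eq)
        moreover have "V \<omega> / max 1 (V \<omega> + W \<omega>) - t = (V \<omega> - t * (V \<omega> + W \<omega>)) / (V \<omega> + W \<omega>)"
          using D(2) by (simp add: max_def diff_divide_distrib)
        ultimately show "\<bar>V \<omega> / max 1 (V \<omega> + W \<omega>) - t\<bar> \<le> \<epsilon> / 4"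
          using D(2) by (simp add: abs_divide)
      qed (use t \<epsilon> in auto)
      then have "\<bar>FDR n \<theta> (S_procedure (T n) t) - t\<bar> < \<epsilon>"
        using \<epsilon> by (simp add: FDR_eq[OF mm elim(3)] V_def W_def)
      moreover have "\<bar>P.expectation (\<lambda>\<omega>. 1 - W \<omega> / r) - normal_tail b\<bar> \<le> \<epsilon> / 4 + \<epsilon> / 4"
      proof (rule P.expectation_near[OF _ _ _ _ Bad])
        show "0 \<le> 1 - W \<omega> / r \<and> 1 - W \<omega> / r \<le> 1" for \<omega>
          using VW[of \<omega>] r by (simp add: pos_divide_le_eq)
        fix \<omega> assume "\<omega> \<in> space (noise_law n) - Bad"
        then have "\<bar>W \<omega> - p * r\<bar> \<le> \<mu> * r" using cnt by auto
        then have "\<bar>(W \<omega> - p * r) / r\<bar> \<le> \<mu>" using r by (simp add: pos_divide_le_eq)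
        moreover have "1 - W \<omega> / r - normal_tail b = - ((W \<omega> - p * r) / r)"
          using r by (simp add: p_def normal_tail_uminus diff_divide_distrib)
        moreover have "\<mu> \<le> \<epsilon> / 4"
        proof -
          have "\<epsilon> * p \<le> \<epsilon> * 1" using p \<epsilon> by (intro mult_left_mono) auto
          then show ?thesis using \<mu>(3) \<epsilon> by linarith
        qed
        ultimately show "\<bar>1 - W \<omega> / r - normal_tail b\<bar> \<le> \<epsilon> / 4" by (simp only: abs_minus_cancel)
      qed (use \<epsilon> in auto)
      then have "\<bar>FNR n \<theta> (S_procedure (T n) t) - normal_tail b\<bar> < \<epsilon>"
        using \<epsilon> s_range[OF elim(3)] by (simp add: FNR_eq[OF mm elim(3)] card W_def r_def)
      ultimately show "\<bar>FDR n \<theta> (S_procedure (T n) t) - t\<bar> < \<epsilon> \<and> \<bar>FNR n \<theta> (S_procedure (T n) t) - normal_tail b\<bar> < \<epsilon>" ..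
    qed
  qed
qed

end

theorem theorem2:
  fixes b t :: real and s :: "nat \<Rightarrow> nat" and T :: "nat \<Rightarrow> (nat \<Rightarrow> real) \<Rightarrow> real"
  assumes t: "t \<in> {0<..1/2}"
    and s_range: "\<And>n. n \<ge> 1 \<Longrightarrow> 1 \<le> s n \<and> s n \<le> n"
    and s_infinity: "filterlim s at_top sequentially"
    and s_sparse: "(\<lambda>n. real (s n) / real n) \<longlonglongrightarrow> 0"
    and T: "\<And>n. n \<ge> 1 \<Longrightarrow> is_mmle n (T n)"
  shows "(\<forall>\<epsilon>>0. \<forall>\<^sub>F n in sequentially. \<forall>\<theta>\<^sub>0\<in>sparse_class_eq n (s n) b.
            \<bar>FDR n \<theta>\<^sub>0 (S_procedure (T n) t) - t\<bar> < \<epsilon>) \<and>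
         (\<forall>\<epsilon>>0. \<forall>\<^sub>F n in sequentially. \<forall>\<theta>\<^sub>0\<in>sparse_class_eq n (s n) b.
            \<bar>FNR n \<theta>\<^sub>0 (S_procedure (T n) t) - normal_tail b\<bar> < \<epsilon>)"
proof -
  interpret sparse_regime b s by unfold_locales (fact s_range s_infinity s_sparse)+
  have t': "0 < t" "t < 1" using t by auto
  have "\<forall>n\<ge>1. is_mmle n (T n)" using T by blast
  note lim = FDR_FNR_limits[OF this t']
  show ?thesis
  proof (intro conjI allI impI)
    fix \<epsilon> :: real assume "\<epsilon> > 0"
    note lim[OF this]
    then show "\<forall>\<^sub>F n in sequentially. \<forall>\<theta>\<^sub>0\<in>sparse_class_eq n (s n) b. \<bar>FDR n \<theta>\<^sub>0 (S_procedure (T n) t) - t\<bar> < \<epsilon>"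
      and "\<forall>\<^sub>F n in sequentially. \<forall>\<theta>\<^sub>0\<in>sparse_class_eq n (s n) b. \<bar>FNR n \<theta>\<^sub>0 (S_procedure (T n) t) - normal_tail b\<bar> < \<epsilon>"
      by (auto elim: eventually_mono)
  qed
qed

end
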